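(* Let $q,r\ge2$ and $\alpha\in(0,1)$. If $\alpha\ne1/2$, then the Martin compactification of $\mathrm{DL}(q,r)$ with respect to $P=P_\alpha$ is the horocyclic compactification $\widetilde{\mathrm{DL}}(q,r)$. With $\beta=(1-\alpha)/\alpha$, the extension of the Martin kernel to the boundary $$\bigl(\partial^*\mathbb T_q\times\{\omega_2^{-\infty}\}\bigr)\cup\bigl(\{\omega_1^{-\infty}\}\times\partial^*\mathbb T_r\bigr)\cup\{\omega_1^k\omega_2^{-k}:k\in\overline{\mathbb Z}\}\cup\{y_1\omega_2^{-\mathfrak h(y_1)}:y_1\in\mathbb T_q\}\cup\{\omega_1^{-\mathfrak h(y_2)}y_2:y_2\in\mathbb T_r\}$$ is given, for $x_1x_2\in\mathrm{DL}(q,r)$, by (i) $K(x_1x_2,\xi_1\omega_2^{-\infty})=K_1(x_1,\xi_1)$ for $\xi_1\in\partial^*\mathbb T_q$; (ii) $K(x_1x_2,\omega_1^{-\infty}\xi_2)=K_2(x_2,\xi_2)$ for $\xi_2\in\partial^*\mathbb T_r$; (iii) $K(x_1x_2,\omega_1^k\omega_2^{-k})=\dfrac{\beta^k+\beta^{\mathfrak h(x_1)}}{\beta^k+1}$ for $k\in\overline{\mathbb Z}$, where for $k=\pm\infty$ the right-hand side is understood as the respective limit; (iv) $K(x_1x_2,y_1\omega_2^{-\mathfrak h(y_1)})=\dfrac{\phi_{\alpha,q}(x_1,y_1)}{\phi_{\alpha,q}(o_1,y_1)}$ for $y_1\in\mathbb T_q$; (v) $K(x_1x_2,\omega_1^{-\mathfrak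 h(y_2)}y_2)=\dfrac{\phi_{1-\alpha,r}(x_2,y_2)}{\phi_{1-\alpha,r}(o_2,y_2)}$ for $y_2\in\mathbb T_r$. Each of the kernels in (i) and (ii) is a minimal harmonic function for $P$, while the ones in (iii), (iv) and (v) are non-minimal harmonic functions.
   Context: Trees. For an integer $p\ge2$, $\mathbb T_p$ is the homogeneous tree in which every vertex has $p+1$ neighbours. An end is an equivalence class of one-sided infinite geodesic rays, two rays being equivalent if their symmetric difference is finite; $\partial\mathbb T_p$ is the set of ends and $\widehat{\mathbb T}_p=\mathbb T_p\cup\partial\mathbb T_p$. For distinct $w,z\in\widehat{\mathbb T}_p$, $\overline{w\,z}$ is the geodesic connecting them. Fix a root $o$ and a reference end $\omega$; put $\partial^*\mathbb T_p=\partial\mathbb T_p\setminus\{\omega\}$. The confluent $c=w\wedge z$ with respect to $o$ is defined by $\overline{o\,w}\cap\overline{o\,z}=\overline{o\,c}$. The end topology on $\widehat{\mathbb T}_p$ is induced by the metric $\theta(z,w)=p^{-d(z\wedge w,o)}$ for $z\neq w$, $\theta(z,z)=0$. For vertices $x,y$, $x\curlywedge y$ is the vertex $b$ with $\overline{x\,\omega}\cap\overline{y\,\omega}=\overline{b\,\omega}$. Put $\mathfrak u(x,y)=d(x,x\curlywedge y)$, $\mathfrak d(x,y)=d(y,x\curlywedge y)$, and $\mathfrak h(x)=\mathfrak d(o,x)-\mathfrak u(o,x)$. Each vertex $x$ has exactly one neighbour $x^-$ with $\mathfrak h(x^-)=\mathfrak h(x)-1$; its $p$ other neighbours (successors) $y$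 satisfy $y^-=x$. Horocyclic compactification of a tree. Let $\overline{\mathbb Z}=\mathbb Z\cup\{\pm\infty\}$. Replace the end $\omega$ by new points $\omega^k$, $k\in\overline{\mathbb Z}$: $\widetilde{\mathbb T}_p=\mathbb T_p\cup\partial^*\mathbb T_p\cup\{\omega^k:k\in\overline{\mathbb Z}\}$. Set $\mathfrak h(\omega^k)=k$ and $\mathfrak h(\xi)=+\infty$ for $\xi\in\partial^*\mathbb T_p$. The topology is induced by the metric $\theta_h(z,w)=\theta(z,w)+\left|\frac{\mathfrak h(z)}{1+|\mathfrak h(z)|}-\frac{\mathfrak h(w)}{1+|\mathfrak h(w)|}\right|$, where in $\theta$ each $\omega^k$ is treated as the end $\omega$, and $\frac{\pm\infty}{1+\infty}=\pm1$. Thus a sequence of vertices $y^{(n)}$ converges to $\xi\in\partial^*\mathbb T_p$ iff it does so in the end topology, and to $\omega^k$ iff $\mathfrak h(y^{(n)})\to k$ and $y^{(n)}\to\omega$ in the end topology. Diestel-Leader graph. Let $\mathbb T_q,\mathbb T_r$ have roots $o_1,o_2$ and reference ends $\omega_1,\omega_2$. The vertex set is $\mathrm{DL}(q,r)=\{x_1x_2\in\mathbb T_q\times\mathbb T_r:\mathfrak h(x_1)+\mathfrak h(x_2)=0\}$, with $x_1x_2\sim y_1y_2$ iff $x_1\sim y_1$ and $x_2\sim y_2$; reference point $o=o_1o_2$. The horocyclic compactification $\widetilde{\mathrm{DL}}(q,r)$ is the closure of $\mathrm{DL}(q,r)$ in $\widetilde{\mathbb T}_q\times\widetilde{\mathbb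 T}_r$. Random walks. $P_\alpha$ on $\mathrm{DL}(q,r)$ has transition probabilities $p_\alpha(x,y)=\alpha/q$ if $y_1^-=x_1$ and $y_2=x_2^-$; $(1-\alpha)/r$ if $y_1=x_1^-$ and $y_2^-=x_2$; and $0$ otherwise. For $a\in(0,1)$, $P_{a,p}$ on $\mathbb T_p$ moves from $v$ to each of its $p$ successors with probability $a/p$ and to $v^-$ with probability $1-a$. The projections of $P_\alpha$ on the two trees are $P_1=P_{\alpha,q}$ on $\mathbb T_q$ and $P_2=P_{1-\alpha,r}$ on $\mathbb T_r$. Martin theory. For a transient irreducible transition matrix $P$ with reference point $o$, $G(x,y)=\sum_{n\ge0}p^{(n)}(x,y)$ and $K(x,y)=G(x,y)/G(o,y)$. The Martin compactification is the smallest metrizable compactification of the state space $X$ containing $X$ as a discrete dense subset to which all functions $K(x,\cdot)$, $x\in X$, extend continuously; the extension is again denoted $K$. Compactifications of $X$ are identified when the identity on $X$ extends to a homeomorphism. A function $h$ is harmonic if $Ph=h$; a positive harmonic $h$ is minimal if $h(o)=1$ and every positive harmonic $h_1\le h$ is a constant multiple of $h$. $K_1,K_2$ are the extended Martin kernels of $P_1,P_2$: with $F_i(v,w)$ the probability that the $P_i$-walk started at $v$ ever hits $w$, one has for an end $\xi_i$ of the $i$-th tree $K_i(x_i,\xi_i)=F_i(x_i,c_i)/F_i(o_i,c_i)$, where $c_i=x_i\wedge\xi_i$. Spherical functions. For $a\in(0,1)$, $a\ne1/2$, $p\ge2$ and vertices $x,y$ of $\mathbb T_p$, put $\mathfrak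 u=\mathfrak u(x,y)$, $\mathfrak d=\mathfrak d(x,y)$ and $b=(1-a)/a$. Then $$\phi_{a,p}(x,y)=\frac{1}{(p\,b^2)^{\mathfrak d}}\left(\frac{p\,b+1}{p\,b^2-1}+\frac{b^{\mathfrak u}-1}{b-1}+\frac{b^{\mathfrak d}-1}{b-1}\right)\quad\text{if }a<\tfrac12,$$ $$\phi_{a,p}(x,y)=\frac{b^{\mathfrak u+\mathfrak d}}{p^{\mathfrak d}}\left(\frac{p\,b^{-1}+1}{p\,b^{-2}-1}+\frac{b^{-\mathfrak u}-1}{b^{-1}-1}+\frac{b^{-\mathfrak d}-1}{b^{-1}-1}\right)\quad\text{if }a>\tfrac12.$$ *)

theory Defs
  imports "HOL-Analysis.Analysis" "HOL-Library.Extended"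
begin

section \<open>Trees with a root and a reference end\<close>

text \<open>The vertex set is the whole type \<open>'v\<close>. An end is represented by its equivalence class of
  geodesic rays.\<close>

record 'v tree =
  adj :: "'v \<Rightarrow> 'v \<Rightarrow> bool"
  root :: 'v
  ref_end :: "(nat \<Rightarrow> 'v) set"

definition homogeneous_tree :: "nat \<Rightarrow> 'v tree \<Rightarrow> bool" where
  "homogeneous_tree p T \<longleftrightarrow>
     symp (adj T) \<and> irreflp (adj T) \<and>
     (\<forall>x y. (adj T)\<^sup>*\<^sup>* x y) \<and>
     \<not> (\<exists>xs. 3 \<le> length xs \<and> distinct xs \<and> successively (adj T) xs \<and> adj T (last xs) (hd xs)) \<and>
     (\<forall>x. card {y. adj T x y} = p + 1)"

definition gdist :: "'v tree \<Rightarrow> 'v \<Rightarrow> 'v \<Rightarrow> nat" where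
  "gdist T x y = (LEAST n. (adj T ^^ n) x y)"

definition geodesic_ray :: "'v tree \<Rightarrow> (nat \<Rightarrow> 'v) \<Rightarrow> bool" where
  "geodesic_ray T r \<longleftrightarrow> (\<forall>i j. i \<le> j \<longrightarrow> gdist T (r i) (r j) = j - i)"

definition ends :: "'v tree \<Rightarrow> (nat \<Rightarrow> 'v) set set" where
  "ends T = {r. geodesic_ray T r} //
     {(r, s). geodesic_ray T r \<and> geodesic_ray T s \<and> finite (sym_diff (range r) (range s))}"

definition proper_ends :: "'v tree \<Rightarrow> (nat \<Rightarrow> 'v) set set" where
  "proper_ends T = ends T - {ref_end T}"

datatype 'v end_pt = Vertex 'v | End "(nat \<Rightarrow> 'v) set"

definition end_compactification :: "'v tree \<Rightarrow> 'v end_pt set" where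
  "end_compactification T = range Vertex \<union> End ` ends T"

text \<open>The vertex set of the geodesic from the vertex \<open>x\<close> to a vertex or an end.\<close>

fun geodesic :: "'v tree \<Rightarrow> 'v \<Rightarrow> 'v end_pt \<Rightarrow> 'v set" where
  "geodesic T x (Vertex y) = {v. gdist T x v + gdist T v y = gdist T x y}"
| "geodesic T x (End \<xi>) = \<Union> {range r | r. r \<in> \<xi> \<and> r 0 = x}"

text \<open>The confluent \<open>w \<and> z\<close> with respect to the root. It is only used when \<open>w\<close> and \<open>z\<close> are not
  the same end, in which case it is a vertex.\<close>

definition confluent :: "'v tree \<Rightarrow> 'v end_pt \<Rightarrow> 'v end_pt \<Rightarrow> 'v" where
  "confluent T w z =
     (THE c. geodesic T (root T) w \<inter> geodesic T (root T) z = geodesic T (root T) (Vertex c))"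

definition theta :: "nat \<Rightarrow> 'v tree \<Rightarrow> 'v end_pt \<Rightarrow> 'v end_pt \<Rightarrow> real" where
  "theta p T z w =
     (if z = w then 0 else 1 / real p ^ gdist T (confluent T z w) (root T))"

definition end_topology :: "nat \<Rightarrow> 'v tree \<Rightarrow> 'v end_pt topology" where
  "end_topology p T = Metric_space.mtopology (end_compactification T) (theta p T)"

text \<open>The confluent with respect to the reference end.\<close>

definition end_confluent :: "'v tree \<Rightarrow> 'v \<Rightarrow> 'v \<Rightarrow> 'v" where
  "end_confluent T x y =
     (THE b. geodesic T x (End (ref_end T)) \<inter> geodesic T y (End (ref_end T))
             = geodesic T b (End (ref_end T)))"

definition up :: "'v tree \<Rightarrow> 'v \<Rightarrow> 'v \<Rightarrow> nat" where
  "up T x y = gdist T x (end_confluent T x y)"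

definition down :: "'v tree \<Rightarrow> 'v \<Rightarrow> 'v \<Rightarrow> nat" where
  "down T x y = gdist T y (end_confluent T x y)"

definition hor :: "'v tree \<Rightarrow> 'v \<Rightarrow> int" where
  "hor T x = int (down T (root T) x) - int (up T (root T) x)"

definition pred_vertex :: "'v tree \<Rightarrow> 'v \<Rightarrow> 'v" where
  "pred_vertex T x = (THE y. adj T x y \<and> hor T y = hor T x - 1)"


section \<open>Horocyclic compactification of a tree\<close>

text \<open>\<open>HEnd \<xi>\<close> is an end other than the reference end, and \<open>Omega k\<close> is the point \<open>\<omega>\<close> with
  superscript \<open>k\<close>.\<close>

datatype 'v hor_pt = HVertex 'v | HEnd "(nat \<Rightarrow> 'v) set" | Omega "int extended"

definition hor_compactification :: "'v tree \<Rightarrow> 'v hor_pt set" where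
  "hor_compactification T = range HVertex \<union> HEnd ` proper_ends T \<union> range Omega"

fun to_end_pt :: "'v tree \<Rightarrow> 'v hor_pt \<Rightarrow> 'v end_pt" where
  "to_end_pt T (HVertex x) = Vertex x"
| "to_end_pt T (HEnd \<xi>) = End \<xi>"
| "to_end_pt T (Omega k) = End (ref_end T)"

fun hor_ext :: "'v tree \<Rightarrow> 'v hor_pt \<Rightarrow> int extended" where
  "hor_ext T (HVertex x) = Fin (hor T x)"
| "hor_ext T (HEnd \<xi>) = Pinf"
| "hor_ext T (Omega k) = k"

text \<open>The map \<open>k \<mapsto> k / (1 + \<bar>k\<bar>)\<close>.\<close>

fun squash :: "int extended \<Rightarrow> real" where
  "squash (Fin k) = real_of_int k / (1 + \<bar>real_of_int k\<bar>)"
| "squash Pinf = 1"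
| "squash Minf = - 1"

definition theta_h :: "nat \<Rightarrow> 'v tree \<Rightarrow> 'v hor_pt \<Rightarrow> 'v hor_pt \<Rightarrow> real" where
  "theta_h p T z w =
     theta p T (to_end_pt T z) (to_end_pt T w) + \<bar>squash (hor_ext T z) - squash (hor_ext T w)\<bar>"

definition hor_topology :: "nat \<Rightarrow> 'v tree \<Rightarrow> 'v hor_pt topology" where
  "hor_topology p T = Metric_space.mtopology (hor_compactification T) (theta_h p T)"


section \<open>Diestel-Leader graphs\<close>

definition DL :: "'a tree \<Rightarrow> 'b tree \<Rightarrow> ('a \<times> 'b) set" where
  "DL T1 T2 = {(x1, x2). hor T1 x1 + hor T2 x2 = 0}"

definition DL_origin :: "'a tree \<Rightarrow> 'b tree \<Rightarrow> 'a \<times> 'b" where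
  "DL_origin T1 T2 = (root T1, root T2)"

definition DL_embed :: "'a \<times> 'b \<Rightarrow> 'a hor_pt \<times> 'b hor_pt" where
  "DL_embed = map_prod HVertex HVertex"

definition DL_hor_topology ::
    "nat \<Rightarrow> nat \<Rightarrow> 'a tree \<Rightarrow> 'b tree \<Rightarrow> ('a hor_pt \<times> 'b hor_pt) topology" where
  "DL_hor_topology q r T1 T2 =
     (let W = prod_topology (hor_topology q T1) (hor_topology r T2)
      in subtopology W (W closure_of (DL_embed ` DL T1 T2)))"


section \<open>Martin theory of a transition matrix \<open>P\<close> on a state space \<open>X\<close>\<close>

primrec nstep :: "'s set \<Rightarrow> ('s \<Rightarrow> 's \<Rightarrow> real) \<Rightarrow> nat \<Rightarrow> 's \<Rightarrow> 's \<Rightarrow> real" where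
  "nstep X P 0 x y = (if x = y then 1 else 0)"
| "nstep X P (Suc n) x y = infsum (\<lambda>z. P x z * nstep X P n z y) X"

definition irreducible_chain :: "'s set \<Rightarrow> ('s \<Rightarrow> 's \<Rightarrow> real) \<Rightarrow> bool" where
  "irreducible_chain X P \<longleftrightarrow> (\<forall>x\<in>X. \<forall>y\<in>X. \<exists>n. nstep X P n x y > 0)"

definition transient_chain :: "'s set \<Rightarrow> ('s \<Rightarrow> 's \<Rightarrow> real) \<Rightarrow> bool" where
  "transient_chain X P \<longleftrightarrow> (\<forall>x\<in>X. \<forall>y\<in>X. summable (\<lambda>n. nstep X P n x y))"

definition green :: "'s set \<Rightarrow> ('s \<Rightarrow> 's \<Rightarrow> real) \<Rightarrow> 's \<Rightarrow> 's \<Rightarrow> real" where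
  "green X P x y = (\<Sum>n. nstep X P n x y)"

definition martin_kernel :: "'s set \<Rightarrow> ('s \<Rightarrow> 's \<Rightarrow> real) \<Rightarrow> 's \<Rightarrow> 's \<Rightarrow> 's \<Rightarrow> real" where
  "martin_kernel X P o\<^sub>0 x y = green X P x y / green X P o\<^sub>0 y"

text \<open>\<open>first_passage X P n v w\<close> is the probability that the walk started at \<open>v\<close> visits \<open>w\<close> for the
  first time at time \<open>n\<close>; summing over \<open>n\<close> gives the probability \<open>F(v, w)\<close> of ever hitting \<open>w\<close>.\<close>

primrec first_passage :: "'s set \<Rightarrow> ('s \<Rightarrow> 's \<Rightarrow> real) \<Rightarrow> nat \<Rightarrow> 's \<Rightarrow> 's \<Rightarrow> real" where
  "first_passage X P 0 v w = (if v = w then 1 else 0)"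
| "first_passage X P (Suc n) v w =
     (if v = w then 0 else infsum (\<lambda>z. P v z * first_passage X P n z w) X)"

definition hit_prob :: "'s set \<Rightarrow> ('s \<Rightarrow> 's \<Rightarrow> real) \<Rightarrow> 's \<Rightarrow> 's \<Rightarrow> real" where
  "hit_prob X P v w = (\<Sum>n. first_passage X P n v w)"

definition harmonic :: "'s set \<Rightarrow> ('s \<Rightarrow> 's \<Rightarrow> real) \<Rightarrow> ('s \<Rightarrow> real) \<Rightarrow> bool" where
  "harmonic X P h \<longleftrightarrow>
     (\<forall>x\<in>X. (\<lambda>y. P x y * h y) summable_on X \<and> infsum (\<lambda>y. P x y * h y) X = h x)"

definition positive_harmonic :: "'s set \<Rightarrow> ('s \<Rightarrow> 's \<Rightarrow> real) \<Rightarrow> ('s \<Rightarrow> real) \<Rightarrow> bool" where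
  "positive_harmonic X P h \<longleftrightarrow> harmonic X P h \<and> (\<forall>x\<in>X. h x > 0)"

definition minimal_harmonic :: "'s set \<Rightarrow> ('s \<Rightarrow> 's \<Rightarrow> real) \<Rightarrow> 's \<Rightarrow> ('s \<Rightarrow> real) \<Rightarrow> bool" where
  "minimal_harmonic X P o\<^sub>0 h \<longleftrightarrow>
     positive_harmonic X P h \<and> h o\<^sub>0 = 1 \<and>
     (\<forall>h1. positive_harmonic X P h1 \<and> (\<forall>x\<in>X. h1 x \<le> h x)
        \<longrightarrow> (\<exists>c. \<forall>x\<in>X. h1 x = c * h x))"

text \<open>A compactification of \<open>X\<close> is a topology \<open>C\<close> together with the embedding \<open>\<iota>\<close> of \<open>X\<close>.\<close>

definition metrizable_compactification :: "'s set \<Rightarrow> 'c topology \<Rightarrow> ('s \<Rightarrow> 'c) \<Rightarrow> bool" where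
  "metrizable_compactification X C \<iota> \<longleftrightarrow>
     compact_space C \<and> metrizable_space C \<and>
     inj_on \<iota> X \<and> \<iota> ` X \<subseteq> topspace C \<and>
     subtopology C (\<iota> ` X) = discrete_topology (\<iota> ` X) \<and>
     C closure_of (\<iota> ` X) = topspace C"

definition kernel_extension ::
    "'s set \<Rightarrow> ('s \<Rightarrow> 's \<Rightarrow> real) \<Rightarrow> 's \<Rightarrow> 'c topology \<Rightarrow> ('s \<Rightarrow> 'c) \<Rightarrow> ('s \<Rightarrow> 'c \<Rightarrow> real) \<Rightarrow> bool" where
  "kernel_extension X P o\<^sub>0 C \<iota> K \<longleftrightarrow>
     (\<forall>x\<in>X. continuous_map C euclideanreal (K x) \<and>
             (\<forall>y\<in>X. K x (\<iota> y) = martin_kernel X P o\<^sub>0 x y))"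

text \<open>HOL cannot quantify over all types inside a formula, so the competing compactifications in the
  minimality clause live on a type \<open>'d\<close>, an extra argument that theorems leave arbitrary.\<close>

definition martin_compactification ::
    "'d itself \<Rightarrow> 's set \<Rightarrow> ('s \<Rightarrow> 's \<Rightarrow> real) \<Rightarrow> 's \<Rightarrow> 'c topology \<Rightarrow> ('s \<Rightarrow> 'c) \<Rightarrow> bool" where
  "martin_compactification TYPE('d) X P o\<^sub>0 C \<iota> \<longleftrightarrow>
     irreducible_chain X P \<and> transient_chain X P \<and>
     metrizable_compactification X C \<iota> \<and> (\<exists>K. kernel_extension X P o\<^sub>0 C \<iota> K) \<and>
     (\<forall>(D :: 'd topology) \<kappa>.
        metrizable_compactification X D \<kappa> \<and> (\<exists>K. kernel_extension X P o\<^sub>0 D \<kappa> K)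
        \<longrightarrow> (\<exists>g. continuous_map D C g \<and> (\<forall>x\<in>X. g (\<kappa> x) = \<iota> x)))"


section \<open>The random walks\<close>

definition tree_walk :: "real \<Rightarrow> nat \<Rightarrow> 'v tree \<Rightarrow> 'v \<Rightarrow> 'v \<Rightarrow> real" where
  "tree_walk a p T v w =
     (if pred_vertex T w = v then a / real p
      else if w = pred_vertex T v then 1 - a
      else 0)"

definition DL_walk ::
    "real \<Rightarrow> nat \<Rightarrow> nat \<Rightarrow> 'a tree \<Rightarrow> 'b tree \<Rightarrow> 'a \<times> 'b \<Rightarrow> 'a \<times> 'b \<Rightarrow> real" where
  "DL_walk \<alpha> q r T1 T2 x y =
     (if pred_vertex T1 (fst y) = fst x \<and> snd y = pred_vertex T2 (snd x) then \<alpha> / real q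
      else if fst y = pred_vertex T1 (fst x) \<and> pred_vertex T2 (snd y) = snd x
        then (1 - \<alpha>) / real r
      else 0)"

definition spherical :: "real \<Rightarrow> nat \<Rightarrow> 'v tree \<Rightarrow> 'v \<Rightarrow> 'v \<Rightarrow> real" where
  "spherical a p T x y =
     (let u = up T x y; d = down T x y; b = (1 - a) / a; c = 1 / b in
      if a < 1/2 then
        1 / (real p * b^2) ^ d *
          ((real p * b + 1) / (real p * b^2 - 1) + (b^u - 1) / (b - 1) + (b^d - 1) / (b - 1))
      else
        b ^ (u + d) / real p ^ d *
          ((real p * c + 1) / (real p * c^2 - 1) + (c^u - 1) / (c - 1) + (c^d - 1) / (c - 1)))"

end

theory Submission
  imports Defs
begin

text \<open>The Green function of \<open>P\<close> is computed by separation of variables. On a product of two functions that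
  each live on the subtree below a vertex and have mean zero over its successors, \<open>P\<close> acts as the walk on the levels killed
  outside a finite interval, whose Green function is elementary. A point mass on a level is a double series of
  such products, so the Green function becomes a double series whose asymptotics give the limits of the
  Martin kernels for \<open>\<alpha> > 1/2\<close>. The case \<open>\<alpha> < 1/2\<close> follows by the \<open>h\<close>-transform with \<open>\<beta>\<close> to the level, and
  limits in the second tree follow by exchanging the trees.

  The limit kernels separate the boundary points: a kernel attached to a vertex or end of one tree decreases
  strictly when the confluent moves up while the level stays fixed. The closure of the graph of the
  correspondence between an arbitrary competing compactification and the horocyclic one is then the graph of a
  continuous map.

  A kernel at an end is minimal because a harmonic function below it is a limit of potentials of charges
  that move to that end. The other kernels are comparable to a different boundary kernel: a neighbouring
  one for vertices and finite \<open>k\<close>, and for \<open>k = \<plusminus>\<infinity>\<close> a spherical one, which is bounded after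
  an \<open>h\<close>-transform if necessary.\<close>

section \<open>Geodesics and rays in a homogeneous tree\<close>

text \<open>On a tree, hitting probabilities multiply along geodesics, which gives the Green
  function at once (\<open>\<phi>\<close>); the walk on the product has no such formula at hand. Its
  coordinates are coupled only through the level: a factor from the first tree vanishes at levels
  below \<open>i - 1\<close>, one from the second at levels above \<open>j + 1\<close>, and the zero
  means make these two levels absorbing. This is the origin of the killed interval. The weight
  \<open>\<beta>\<close> to half the level is contracted by the walk with factor
  \<open>2 * sqrt (\<alpha> * (1 - \<alpha>))\<close>, which is below 1 because
  \<open>\<alpha> \<noteq> 1/2\<close>. Functions bounded by the weight carry no hidden harmonic
  part: a solution of the Green equation is the Green function, with transience as a by-product, and
  superharmonic functions below the weight are potentials. In the double series the coefficients in
  each index sum to zero. The leading terms depend on one index only and cancel, so each limit is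
  decided by a term of next order; hence the remainders are estimated explicitly.\<close>

locale homtree =
  fixes T :: "'v tree" and p :: nat
  assumes hom: "homogeneous_tree p T" and p2: "p \<ge> 2" and ref: "ref_end T \<in> ends T"
begin

abbreviation A where "A \<equiv> adj T"
abbreviation D where "D \<equiv> gdist T"

lemma adj_sym: "A x y \<Longrightarrow> A y x"
  using hom by (auto simp: homogeneous_tree_def dest: sympD)

lemma adj_irrefl: "\<not> A x x"
  using hom by (auto simp: homogeneous_tree_def dest: irreflpD)

lemma conn: "A\<^sup>*\<^sup>* x y"
  using hom by (auto simp: homogeneous_tree_def)

lemma nocycle:
  "\<lbrakk>3 \<le> length xs; distinct xs; successively A xs; A (last xs) (hd xs)\<rbrakk> \<Longrightarrow> False"
  using hom unfolding homogeneous_tree_def by blast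

lemma card_nb: "card {y. A x y} = p + 1"
  using hom by (auto simp: homogeneous_tree_def)

lemma finite_nb: "finite {y. A x y}"
  using card_nb[of x] by (metis add_eq_0_iff_both_eq_0 card.infinite one_neq_zero)

section \<open>Distances in a tree\<close>

lemma relpow_sym: "(A ^^ n) x y \<Longrightarrow> (A ^^ n) y x"
proof (induction n arbitrary: x y)
  case (Suc n)
  then obtain z where "(A ^^ n) x z" "A z y" by (auto elim: relpowp_Suc_E)
  then show ?case using Suc.IH adj_sym by (metis relpowp_Suc_I2)
qed auto

lemma gdist_relpow: "(A ^^ D x y) x y"
  unfolding gdist_def using conn[of x y] by (metis LeastI_ex rtranclp_imp_relpowp)

lemma gdist_le: "(A ^^ n) x y \<Longrightarrow> D x y \<le> n"
  unfolding gdist_def by (rule Least_le)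

lemma gdist_self [simp]: "D x x = 0"
  using gdist_le[of 0 x x] by simp

lemma gdist_eq0 [simp]: "D x y = 0 \<longleftrightarrow> x = y"
  using gdist_relpow[of x y] by auto

lemma gdist_sym: "D x y = D y x"
  by (meson gdist_le gdist_relpow le_antisym relpow_sym)

lemma gdist_triangle: "D x z \<le> D x y + D y z"
  by (rule gdist_le) (rule relpowp_trans[OF gdist_relpow gdist_relpow])

lemma gdist_1_iff: "D x y = 1 \<longleftrightarrow> A x y"
proof
  assume "D x y = 1" then show "A x y" using gdist_relpow[of x y] by auto
next
  assume a: "A x y"
  then have "D x y \<le> 1" by (intro gdist_le) (simp only: relpowp_1)
  moreover have "D x y \<noteq> 0" using a adj_irrefl by auto
  ultimately show "D x y = 1" by linarith
qed

lemma ex_closer: "x \<noteq> z \<Longrightarrow> \<exists>y. A x y \<and> D z x = Suc (D z y)"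
proof -
  assume "x \<noteq> z"
  then obtain n where n: "D z x = Suc n" by (metis gdist_eq0 not0_implies_Suc)
  then obtain y where y: "(A ^^ n) z y" "A y x" using gdist_relpow[of z x] by (auto elim: relpowp_Suc_E)
  have "D z y \<le> n" using y gdist_le by blast
  moreover have "D z x \<le> D z y + D y x" by (rule gdist_triangle)
  moreover have "D y x = 1" using y gdist_1_iff by blast
  ultimately show ?thesis using n y adj_sym by (intro exI[of _ y]) auto
qed

text \<open>Such a path closes a cycle through any vertex that is adjacent to both ends and at least as far from
  \<open>z\<close> as they are.\<close>

lemma low_path:
  assumes "y \<noteq> y'"
  shows "\<exists>xs. distinct xs \<and> successively A xs \<and> xs \<noteq> [] \<and> hd xs = y \<and> last xs = y' \<and>
     (\<forall>w\<in>set xs. w = y \<or> w = y' \<or> D z w < max (D z y) (D z y'))"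
  using assms
proof (induction "D z y + D z y'" arbitrary: y y' rule: less_induct)
  case less
  \<comment> \<open>It suffices to shorten from the endpoint that is farther from \<open>z\<close>;
    if that endpoint is \<open>y'\<close>, the claim is applied to the pair in the other order and
    the path is reversed.\<close>
  have main: "\<exists>xs. distinct xs \<and> successively A xs \<and> xs \<noteq> [] \<and> hd xs = y \<and> last xs = y' \<and>
     (\<forall>w\<in>set xs. w = y \<or> w = y' \<or> D z w < max (D z y) (D z y'))"
    if ne: "y \<noteq> y'" and ge: "D z y' \<le> D z y"
      and IH: "\<And>w. D z w < D z y \<Longrightarrow> w \<noteq> y' \<Longrightarrow> \<exists>xs. distinct xs \<and> successively A xs \<and> xs \<noteq> [] \<and> hd xs = w \<and> last xs = y' \<and>
     (\<forall>v\<in>set xs. v = w \<or> v = y' \<or> D z v < max (D z w) (D z y'))" for y y'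
  proof -
    have "y \<noteq> z" using ne ge by (metis gdist_eq0 gdist_self le_zero_eq)
    then obtain w where w: "A y w" "D z y = Suc (D z w)" using ex_closer by blast
    show ?thesis
    proof (cases "w = y'")
      case True
      then show ?thesis using w ne by (intro exI[of _ "[y, y']"]) auto
    next
      case False
      then obtain xs where xs: "distinct xs" "successively A xs" "xs \<noteq> []" "hd xs = w" "last xs = y'"
        "\<forall>v\<in>set xs. v = w \<or> v = y' \<or> D z v < max (D z w) (D z y')" using IH[of w] w by auto
      have "y \<notin> set xs" using xs(6) w ne ge adj_irrefl by fastforce
      moreover have "\<forall>v\<in>set xs. v = y' \<or> D z v < max (D z y) (D z y')" using xs(6) w ge by fastforce
      ultimately show ?thesis using xs w
        by (intro exI[of _ "y # xs"]) (auto simp: successively_Cons)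
    qed
  qed
  show ?case
  proof (cases "D z y' \<le> D z y")
    case True
    then show ?thesis using main[OF less.prems True] less.hyps by auto
  next
    case False
    then have "D z y \<le> D z y'" by simp
    moreover have "\<exists>xs. distinct xs \<and> successively A xs \<and> xs \<noteq> [] \<and> hd xs = w \<and> last xs = y \<and>
     (\<forall>v\<in>set xs. v = w \<or> v = y \<or> D z v < max (D z w) (D z y))" if "D z w < D z y'" "w \<noteq> y" for w
      using less.hyps[of w y] that by auto
    ultimately obtain xs where xs: "distinct xs" "successively A xs" "xs \<noteq> []" "hd xs = y'" "last xs = y"
      "\<forall>v\<in>set xs. v = y' \<or> v = y \<or> D z v < max (D z y') (D z y)"
      using main[of y' y] less.prems by blast
    have "successively (\<lambda>x y. A y x) xs"
      using xs(2) adj_sym unfolding successively_conv_nth by blast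
    then have "successively A (rev xs)" by (simp only: successively_rev)
    then show ?thesis using xs by (intro exI[of _ "rev xs"]) (auto simp: hd_rev last_rev max.commute)
  qed
qed

text \<open>Two such neighbours are joined by a path as in \<open>low_path\<close>, which avoids
  \<open>x\<close> and is closed up by \<open>x\<close> to a cycle. Acyclicity is used only here;
  the rest of the tree geometry rests on this lemma.\<close>

lemma closer_unique:
  assumes "A x y" "A x y'" "D z y \<le> D z x" "D z y' \<le> D z x"
  shows "y = y'"
proof (rule ccontr)
  assume ne: "y \<noteq> y'"
  obtain xs where xs: "distinct xs" "successively A xs" "xs \<noteq> []" "hd xs = y" "last xs = y'"
    "\<forall>w\<in>set xs. w = y \<or> w = y' \<or> D z w < max (D z y) (D z y')" using low_path[OF ne, of z] by blast
  have x: "x \<notin> set xs" using xs(6) assms adj_irrefl by fastforce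
  have "length xs \<ge> 2" using xs ne by (cases xs) (auto simp: Suc_le_eq)
  then show False using nocycle[of "x # xs"] xs x assms adj_sym by (auto simp: successively_Cons)
qed

text \<open>Equal distances are impossible, since \<open>y\<close> and the neighbour of
  \<open>x\<close> that is closer to \<open>z\<close> would then coincide by
  \<open>closer_unique\<close>.\<close>

lemma gdist_adj:
  assumes "A x y" shows "D z y = Suc (D z x) \<or> D z x = Suc (D z y)"
proof -
  have "D z y \<le> D z x + 1" "D z x \<le> D z y + 1"
    using gdist_triangle[of z x y] gdist_triangle[of z y x] assms gdist_1_iff adj_sym by metis+
  moreover have "D z x \<noteq> D z y"
  proof
    assume e: "D z x = D z y"
    have "x \<noteq> z" using e assms adj_irrefl by auto
    then obtain w where w: "A x w" "D z x = Suc (D z w)" using ex_closer by blast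
    have "w = y" by (rule closer_unique[OF w(1) assms, of z]) (use w(2) e in linarith)+
    then show False using e w(2) by (metis n_not_Suc_n)
  qed
  ultimately show ?thesis by linarith
qed

section \<open>Rays as non-backtracking paths\<close>

definition nb_ray :: "(nat \<Rightarrow> 'v) \<Rightarrow> bool" where
  "nb_ray r \<longleftrightarrow> (\<forall>n. A (r n) (r (Suc n)) \<and> r (Suc (Suc n)) \<noteq> r n)"

lemma nb_ray_dist: assumes "nb_ray r" shows "D (r i) (r (i + n)) = n"
proof -
  \<comment> \<open>Two consecutive distances are carried through the induction: a step leads away
    from \<open>r i\<close> because the previous one did and at most one neighbour is not farther
    away.\<close>
  have "D (r i) (r (i + n)) = n \<and> D (r i) (r (i + Suc n)) = Suc n"
  proof (induction n)
    case 0
    then show ?case using assms gdist_1_iff by (simp add: nb_ray_def)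
  next
    case (Suc n)
    let ?m = "i + n"
    have a: "A (r (Suc ?m)) (r (Suc (Suc ?m)))" "A (r (Suc ?m)) (r ?m)" "r (Suc (Suc ?m)) \<noteq> r ?m"
      using assms adj_sym by (auto simp: nb_ray_def)
    have "\<not> D (r i) (r (Suc (Suc ?m))) \<le> D (r i) (r (Suc ?m))"
      using closer_unique[OF a(1,2), of "r i"] Suc a(3) by auto
    then show ?case using gdist_adj[OF a(1), of "r i"] Suc by auto
  qed
  then show ?thesis by simp
qed

text \<open>The right-hand side is a local condition, so shifting a ray or adding a vertex in front
  of it can be checked on single steps.\<close>

lemma geodesic_ray_iff: "geodesic_ray T r \<longleftrightarrow> nb_ray r"
proof
  assume g: "geodesic_ray T r"
  have 1: "D (r n) (r (Suc n)) = 1" for n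
    using g[unfolded geodesic_ray_def, rule_format, of n "Suc n"] by simp
  have "D (r n) (r (Suc (Suc n))) = 2" for n
    using g[unfolded geodesic_ray_def, rule_format, of n "Suc (Suc n)"] by simp
  then have "r (Suc (Suc n)) \<noteq> r n" for n by (metis gdist_self zero_neq_numeral)
  then show "nb_ray r" using 1 gdist_1_iff by (simp add: nb_ray_def)
next
  assume "nb_ray r"
  then show "geodesic_ray T r" unfolding geodesic_ray_def
    using nb_ray_dist by (metis le_add_diff_inverse)
qed

lemma nb_ray_shift: "nb_ray r \<Longrightarrow> nb_ray (\<lambda>n. r (n + k))"
  by (auto simp: nb_ray_def)

lemma nb_ray_Cons:
  assumes "nb_ray s" "A z (s 0)" "s 1 \<noteq> z"
  shows "nb_ray (\<lambda>n. case n of 0 \<Rightarrow> z | Suc m \<Rightarrow> s m)"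
  using assms by (auto simp: nb_ray_def split: nat.split)

text \<open>Coincidence of tails up to a shift. For rays it is the same relation as
  \<open>eqv\<close> (\<open>tail_eq_imp_eqv\<close>, \<open>eqv_imp_tail_eq\<close>), and it is
  easier to maintain when the starting point moves.\<close>

definition tail_eq :: "(nat \<Rightarrow> 'v) \<Rightarrow> (nat \<Rightarrow> 'v) \<Rightarrow> bool" where
  "tail_eq s r \<longleftrightarrow> (\<exists>i j. \<forall>n. s (n + i) = r (n + j))"

definition eqv :: "(nat \<Rightarrow> 'v) \<Rightarrow> (nat \<Rightarrow> 'v) \<Rightarrow> bool" where
  "eqv r s \<longleftrightarrow> finite (sym_diff (range r) (range s))"

lemma tail_eq_imp_eqv: "tail_eq s r \<Longrightarrow> eqv s r"
proof -
  assume "tail_eq s r"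
  then obtain i j where ij: "\<forall>n. s (n + i) = r (n + j)" by (auto simp: tail_eq_def)
  have "sym_diff (range s) (range r) \<subseteq> s ` {..<i} \<union> r ` {..<j}"
  proof -
    have "s n \<in> range r" if "n \<ge> i" for n using ij[rule_format, of "n - i"] that by simp
    moreover have "r n \<in> range s" if "n \<ge> j" for n
      using ij[rule_format, of "n - j"] that by (metis le_add_diff_inverse2 rangeI)
    ultimately show ?thesis by (force simp: not_le)
  qed
  then show "eqv s r" unfolding eqv_def by (rule finite_subset) auto
qed

lemma eqv_refl: "eqv r r" by (simp add: eqv_def)
lemma eqv_sym: "eqv r s \<Longrightarrow> eqv s r" by (simp add: eqv_def Un_commute)
lemma eqv_trans: "eqv r s \<Longrightarrow> eqv s t \<Longrightarrow> eqv r t"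
  unfolding eqv_def by (rule finite_subset[of _ "sym_diff (range r) (range s) \<union> sym_diff (range s) (range t)"]) auto

text \<open>Along a path from \<open>r 0\<close> to \<open>z\<close> the starting point moves by one
  edge at a time: if the ray already uses this edge, its first vertex is dropped, otherwise the new
  start is put in front.\<close>

lemma ray_from_ex:
  assumes "nb_ray r" shows "\<exists>s. nb_ray s \<and> s 0 = z \<and> tail_eq s r"
  using conn[of "r 0" z]
proof (induction rule: rtranclp_induct)
  case base
  show ?case using assms by (intro exI[of _ r]) (auto simp: tail_eq_def)
next
  case (step z z')
  then obtain s where s: "nb_ray s" "s 0 = z" "tail_eq s r" by blast
  then obtain i j where ij: "\<forall>n. s (n + i) = r (n + j)" by (auto simp: tail_eq_def)
  show ?case
  proof (cases "s 1 = z'")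
    case True
    have "tail_eq (\<lambda>n. s (n + 1)) r" unfolding tail_eq_def
      by (intro exI[of _ i] exI[of _ "Suc j"] allI) (use ij[rule_format, of "Suc _"] in simp)
    then show ?thesis using True nb_ray_shift[OF s(1), of 1] by (intro exI[of _ "\<lambda>n. s (n + 1)"]) auto
  next
    case False
    have "tail_eq (\<lambda>n. case n of 0 \<Rightarrow> z' | Suc m \<Rightarrow> s m) r" unfolding tail_eq_def
      by (intro exI[of _ "Suc i"] exI[of _ j] allI) (use ij in simp)
    then show ?thesis using False nb_ray_Cons[OF s(1), of z'] step(2) s(2) adj_sym
      by (intro exI[of _ "\<lambda>n. case n of 0 \<Rightarrow> z' | Suc m \<Rightarrow> s m"]) auto
  qed
qed

lemma common_start_back:
  assumes "nb_ray s" "nb_ray t" "s 0 = t 0" "s k = t k" "j \<le> k"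
  shows "s j = t j"
  using assms(4,5)
proof (induction k)
  case (Suc k)
  have d: "D (s 0) (s n) = n" "D (s 0) (t n) = n" for n
    using nb_ray_dist[OF assms(1), of 0 n] nb_ray_dist[OF assms(2), of 0 n] assms(3) by auto
  have "A (s (Suc k)) (s k)" "A (s (Suc k)) (t k)"
    using assms(1,2) Suc.prems adj_sym by (metis nb_ray_def)+
  then have "s k = t k" using closer_unique[of "s (Suc k)" "s k" "t k" "s 0"] d by simp
  then show ?case using Suc by (cases "j = Suc k") auto
qed auto

text \<open>Rays are injective, so a finite symmetric difference leaves common vertices arbitrarily
  far out. The common start forces equal indices there, and agreement propagates back towards the
  start.\<close>

lemma ray_unique:
  assumes "nb_ray s" "nb_ray t" "s 0 = t 0" "eqv s t" shows "s = t"
proof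
  fix j
  have "D (s 0) (s n) = n" for n using nb_ray_dist[OF assms(1), of 0 n] by simp
  then have inj: "inj s" by (metis injI)
  have "finite {n. s n \<notin> range t}"
  proof -
    have "s ` {n. s n \<notin> range t} \<subseteq> sym_diff (range s) (range t)" by auto
    then show ?thesis using assms(4) inj unfolding eqv_def by (meson finite_imageD finite_subset inj_on_subset subset_UNIV)
  qed
  then have "\<not> {n. s n \<notin> range t} \<supseteq> {j..}" using finite_subset infinite_Ici by blast
  then obtain k where k: "k \<ge> j" "s k \<in> range t" by auto
  then obtain k' where "s k = t k'" by auto
  moreover have "D (s 0) (s k) = k" "D (s 0) (t k') = k'"
    using nb_ray_dist[OF assms(1), of 0 k] nb_ray_dist[OF assms(2), of 0 k'] assms(3) by auto
  ultimately have "s k = t k" by metis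
  then show "s j = t j" using common_start_back assms k by blast
qed

lemma eqv_imp_tail_eq:
  assumes "nb_ray s" "nb_ray r" "eqv s r" shows "tail_eq s r"
proof -
  obtain t where t: "nb_ray t" "t 0 = s 0" "tail_eq t r" using ray_from_ex[OF assms(2)] by blast
  then have "eqv t s" using eqv_trans[OF tail_eq_imp_eqv[OF t(3)] eqv_sym[OF assms(3)]] by blast
  then show ?thesis using ray_unique[OF t(1) assms(1) t(2)] t by simp
qed

section \<open>Ends as classes of rays\<close>

lemma ends_iff: "\<xi> \<in> ends T \<longleftrightarrow> (\<exists>r. nb_ray r \<and> \<xi> = {s. nb_ray s \<and> eqv r s})"
  unfolding ends_def quotient_def by (auto simp: geodesic_ray_iff eqv_def)

lemma end_nb: "\<xi> \<in> ends T \<Longrightarrow> r \<in> \<xi> \<Longrightarrow> nb_ray r"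
  by (auto simp: ends_iff)

lemma end_closed:
  assumes "\<xi> \<in> ends T" "r \<in> \<xi>" "nb_ray s" shows "s \<in> \<xi> \<longleftrightarrow> eqv r s"
proof -
  obtain t where t: "\<xi> = {s. nb_ray s \<and> eqv t s}" using assms(1) unfolding ends_iff by blast
  then have "eqv t r" using assms by blast
  then show ?thesis using t assms(3) eqv_trans[of t r s] eqv_trans[OF eqv_sym, of t r s] by auto
qed

lemma end_eqI:
  assumes "\<xi> \<in> ends T" "\<eta> \<in> ends T" "r \<in> \<xi>" "r \<in> \<eta>" shows "\<xi> = \<eta>"
proof -
  have "s \<in> \<xi> \<longleftrightarrow> s \<in> \<eta>" for s
    using end_closed[OF assms(1,3), of s] end_closed[OF assms(2,4), of s] end_nb assms by blast
  then show ?thesis by blast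
qed

definition class_of :: "(nat \<Rightarrow> 'v) \<Rightarrow> (nat \<Rightarrow> 'v) set" where
  "class_of r = {s. nb_ray s \<and> eqv r s}"

lemma class_of_end: "nb_ray r \<Longrightarrow> class_of r \<in> ends T" "nb_ray r \<Longrightarrow> r \<in> class_of r"
  by (auto simp: class_of_def ends_iff eqv_refl)

lemma ex1_ray: assumes "\<xi> \<in> ends T" shows "\<exists>!r. r \<in> \<xi> \<and> r 0 = z"
proof -
  obtain r where r: "nb_ray r" "\<xi> = {s. nb_ray s \<and> eqv r s}" using assms unfolding ends_iff by blast
  obtain s where s: "nb_ray s" "s 0 = z" "tail_eq s r" using ray_from_ex[OF r(1)] by blast
  then have "s \<in> \<xi>" using r tail_eq_imp_eqv eqv_sym by blast
  moreover have "s = t" if "t \<in> \<xi>" "t 0 = z" for t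
    using ray_unique[OF s(1), of t] that s end_nb[OF assms] end_closed[OF assms \<open>s \<in> \<xi>\<close>] by auto
  ultimately show ?thesis using s by blast
qed

definition ray :: "'v \<Rightarrow> (nat \<Rightarrow> 'v) set \<Rightarrow> nat \<Rightarrow> 'v" where
  "ray z \<xi> = (THE r. r \<in> \<xi> \<and> r 0 = z)"

lemma ray_in: "\<xi> \<in> ends T \<Longrightarrow> ray z \<xi> \<in> \<xi>" and ray_0: "\<xi> \<in> ends T \<Longrightarrow> ray z \<xi> 0 = z"
  unfolding ray_def using theI'[OF ex1_ray] by auto

lemma ray_eqI: "\<xi> \<in> ends T \<Longrightarrow> r \<in> \<xi> \<Longrightarrow> r 0 = z \<Longrightarrow> ray z \<xi> = r"
  unfolding ray_def by (rule the1_equality[OF ex1_ray]) simp_all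

lemma ray_nb: "\<xi> \<in> ends T \<Longrightarrow> nb_ray (ray z \<xi>)"
  using ray_in end_nb by blast

lemma ray_dist: "\<xi> \<in> ends T \<Longrightarrow> D z (ray z \<xi> n) = n"
  using nb_ray_dist[OF ray_nb, of \<xi> z 0 n] ray_0 by simp

lemma geodesic_End: "\<xi> \<in> ends T \<Longrightarrow> geodesic T z (End \<xi>) = range (ray z \<xi>)"
proof -
  assume x: "\<xi> \<in> ends T"
  have "r \<in> \<xi> \<and> r 0 = z \<longleftrightarrow> r = ray z \<xi>" for r
    using ray_in[OF x, of z] ray_0[OF x, of z] ray_eqI[OF x, of r z] by auto
  then show ?thesis by simp
qed

section \<open>The parent map towards the reference end\<close>

definition par :: "'v \<Rightarrow> 'v" where "par x = ray x (ref_end T) 1"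

lemma ray_par_Suc: "ray x (ref_end T) (Suc n) = ray (par x) (ref_end T) n"
proof -
  let ?r = "ray x (ref_end T)"
  have "tail_eq (\<lambda>n. ?r (n + 1)) ?r" unfolding tail_eq_def
    by (intro exI[of _ 0] exI[of _ 1]) simp
  then have "(\<lambda>n. ?r (n + 1)) \<in> ref_end T"
    using end_closed[OF ref ray_in[OF ref]] nb_ray_shift[OF ray_nb[OF ref]] tail_eq_imp_eqv eqv_sym by blast
  then have "ray (par x) (ref_end T) = (\<lambda>n. ?r (n + 1))" by (intro ray_eqI[OF ref]) (auto simp: par_def)
  then show ?thesis by simp
qed

lemma ray_par: "ray x (ref_end T) n = (par ^^ n) x"
  by (induction n arbitrary: x) (auto simp: ray_0[OF ref] ray_par_Suc funpow_swap1)

lemma par_adj: "A x (par x)"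
  using ray_nb[OF ref, of x] ray_par[of x 0] ray_par[of x 1] by (metis One_nat_def funpow_0 nb_ray_def par_def)

text \<open>When \<open>par y \<noteq> x\<close>, putting \<open>x\<close> in front of the ray from
  \<open>y\<close> to the reference end does not backtrack, so this is the ray from \<open>x\<close>
  and its first step is \<open>y\<close>.\<close>

lemma adj_par: "A x y \<longleftrightarrow> par x = y \<or> par y = x"
proof
  assume a: "A x y"
  show "par x = y \<or> par y = x"
  proof (rule disjCI)
    assume n: "par y \<noteq> x"
    have "tail_eq (\<lambda>n. case n of 0 \<Rightarrow> x | Suc m \<Rightarrow> ray y (ref_end T) m) (ray y (ref_end T))"
      unfolding tail_eq_def by (intro exI[of _ 1] exI[of _ 0]) simp
    moreover have "nb_ray (\<lambda>n. case n of 0 \<Rightarrow> x | Suc m \<Rightarrow> ray y (ref_end T) m)"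
      by (rule nb_ray_Cons[OF ray_nb[OF ref]]) (use a n in \<open>auto simp: par_def ray_0[OF ref]\<close>)
    ultimately have "(\<lambda>n. case n of 0 \<Rightarrow> x | Suc m \<Rightarrow> ray y (ref_end T) m) \<in> ref_end T"
      using end_closed[OF ref ray_in[OF ref]] tail_eq_imp_eqv eqv_sym by blast
    then have "ray x (ref_end T) = (\<lambda>n. case n of 0 \<Rightarrow> x | Suc m \<Rightarrow> ray y (ref_end T) m)"
      by (intro ray_eqI[OF ref]) auto
    then show "par x = y" by (simp add: par_def ray_0[OF ref])
  qed
next
  assume "par x = y \<or> par y = x" then show "A x y" using par_adj adj_sym by blast
qed

lemma par_dist: "D x ((par ^^ n) x) = n"
  using ray_dist[OF ref, of x n] ray_par by simp

lemma par_funpow_inj: "(par ^^ m) x = (par ^^ n) x \<Longrightarrow> m = n"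
  using par_dist by metis

lemma par_merge: "\<exists>m n. (par ^^ m) x = (par ^^ n) y"
proof -
  have "tail_eq (ray x (ref_end T)) (ray y (ref_end T))"
    using eqv_imp_tail_eq[OF ray_nb[OF ref] ray_nb[OF ref]] end_closed[OF ref ray_in[OF ref] ray_nb[OF ref]] ray_in[OF ref] by blast
  then show ?thesis unfolding tail_eq_def ray_par by (metis add_0)
qed

lemma par_children: "card {y. par y = x} = p" "finite {y. par y = x}"
proof -
  have "par (par x) \<noteq> x" using par_dist[of x 2] by (auto simp: numeral_2_eq_2)
  then have n: "par x \<notin> {y. par y = x}" by auto
  have e: "{y. A x y} = insert (par x) {y. par y = x}" using adj_par by auto
  then show f: "finite {y. par y = x}" using finite_nb[of x] by simp
  show "card {y. par y = x} = p" using card_nb[of x] e n f by simp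
qed

end

section \<open>Ancestors and confluents with respect to the reference end\<close>

text \<open>Only the parent map and an integer grading remain; adjacency, root and ends are
  forgotten. The algebra of confluents and the functions \<open>fk\<close> need no more.\<close>

locale htree =
  fixes par :: "'v \<Rightarrow> 'v" and lv :: "'v \<Rightarrow> int" and p :: nat
  assumes lv_par [simp]: "lv (par x) = lv x - 1"
    and card_children: "card {y. par y = x} = p"
    and p_ge2: "p \<ge> 2"
    and merge: "\<exists>m n. (par ^^ m) x = (par ^^ n) y"
begin

lemma finite_children: "finite {y. par y = x}"
  using card_children[of x] p_ge2 by (intro card_ge_0_finite) linarith

text \<open>Truncation in \<open>nat\<close> makes \<open>anc x k = x\<close> for
  \<open>k > lv x\<close>, so that \<open>anc_anc\<close> needs no upper bound on
  \<open>k\<close>.\<close>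

definition anc :: "'v \<Rightarrow> int \<Rightarrow> 'v" where
  "anc x k = (par ^^ nat (lv x - k)) x"

lemma lv_funpow: "lv ((par ^^ n) x) = lv x - int n"
  by (induction n) auto

lemma lv_anc: "k \<le> lv x \<Longrightarrow> lv (anc x k) = k"
  by (simp add: anc_def lv_funpow)

lemma anc_self [simp]: "anc x (lv x) = x"
  by (simp add: anc_def)

lemma anc_anc: "j \<le> k \<Longrightarrow> anc (anc x k) j = anc x j"
proof (cases "k \<le> lv x")
  case True
  assume "j \<le> k"
  with True have "nat (lv x - j) = nat (k - j) + nat (lv x - k)" by simp
  then show ?thesis using True by (simp add: anc_def lv_funpow funpow_add)
qed (simp add: anc_def)

lemma par_anc: "k \<le> lv x \<Longrightarrow> par (anc x k) = anc x (k - 1)"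
proof -
  assume "k \<le> lv x"
  then have "nat (lv x - (k - 1)) = Suc (nat (lv x - k))" by simp
  then show ?thesis by (simp add: anc_def)
qed

lemma anc_pred: "anc x (lv x - 1) = par x"
  by (simp add: anc_def)

lemma anc_par: "k < lv x \<Longrightarrow> anc (par x) k = anc x k"
  using anc_anc[of k "lv x - 1" x] by (simp add: anc_pred)

lemma funpow_anc: "(par ^^ n) x = anc x (lv x - int n)"
  by (simp add: anc_def)

text \<open>The level of the confluent of \<open>x\<close> and \<open>y\<close> with respect to the reference end.\<close>

definition cl :: "'v \<Rightarrow> 'v \<Rightarrow> int" where
  "cl x y = lv x - int (LEAST n. lv x - int n \<le> lv y \<and> anc x (lv x - int n) = anc y (lv x - int n))"

text \<open>Common ancestors stay common further up, so their levels form a down-set whose maximum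
  is \<open>cl\<close>. In this form facts on confluents reduce to integer arithmetic.\<close>

lemma cl_iff: "k \<le> cl x y \<longleftrightarrow> k \<le> lv x \<and> k \<le> lv y \<and> anc x k = anc y k"
proof -
  define P where "P n \<longleftrightarrow> lv x - int n \<le> lv y \<and> anc x (lv x - int n) = anc y (lv x - int n)" for n
  obtain m n where mn: "(par ^^ m) x = (par ^^ n) y" using merge by blast
  then have "lv x - int m = lv y - int n" using lv_funpow by metis
  then have "P m" using mn by (simp add: P_def funpow_anc)
  then have N: "P (LEAST n. P n)" by (rule LeastI)
  have c: "cl x y = lv x - int (LEAST n. P n)" by (simp add: cl_def P_def)
  show ?thesis
  proof
    assume k: "k \<le> cl x y"
    then have "anc x k = anc (anc x (cl x y)) k" by (simp add: anc_anc)
    also have "\<dots> = anc y k" using N k by (simp add: P_def c anc_anc)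
    finally show "k \<le> lv x \<and> k \<le> lv y \<and> anc x k = anc y k" using N k c by (simp add: P_def)
  next
    assume k: "k \<le> lv x \<and> k \<le> lv y \<and> anc x k = anc y k"
    then have "P (nat (lv x - k))" by (simp add: P_def)
    then have "(LEAST n. P n) \<le> nat (lv x - k)" by (rule Least_le)
    then have "int (LEAST n. P n) \<le> lv x - k" using k by (simp add: le_nat_iff)
    then show "k \<le> cl x y" using c by simp
  qed
qed

lemma cl_eqI: "(\<And>k. k \<le> c \<longleftrightarrow> k \<le> lv x \<and> k \<le> lv y \<and> anc x k = anc y k) \<Longrightarrow> cl x y = c"
  using cl_iff[of _ x y] by (meson order_antisym order_refl)

lemma cl_le1: "cl x y \<le> lv x" and cl_le2: "cl x y \<le> lv y" and anc_cl: "anc x (cl x y) = anc y (cl x y)"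
  using cl_iff[of "cl x y" x y] by auto

lemma cl_commute: "cl x y = cl y x"
  by (rule cl_eqI) (auto simp: cl_iff)

lemma cl_self [simp]: "cl x x = lv x"
  by (rule cl_eqI) auto

lemma cl_ultra: "k \<le> cl x y \<Longrightarrow> k \<le> cl y z \<Longrightarrow> k \<le> cl x z"
  by (auto simp: cl_iff)

text \<open>Of the three confluent levels of a triple the two smallest agree, as in an ultrametric
  space.\<close>

lemma cl_strict: "cl y z < cl x y \<Longrightarrow> cl x z = cl y z"
  using cl_ultra[of "cl y z" x y z] cl_ultra[of "cl y z + 1" y x z] cl_commute[of x y]
    cl_ultra[of "min (cl x y) (cl x z)" y x z] by linarith

lemma cl_anc: "k \<le> lv x \<Longrightarrow> cl (anc x k) y = min (cl x y) k"
proof (rule cl_eqI)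
  fix j assume "k \<le> lv x"
  then show "(j \<le> min (cl x y) k) = (j \<le> lv (anc x k) \<and> j \<le> lv y \<and> anc (anc x k) j = anc y j)"
    by (cases "j \<le> k") (auto simp: cl_iff lv_anc anc_anc)
qed

lemma cl_par: "cl (par x) y = min (cl x y) (lv x - 1)"
  using cl_anc[of "lv x - 1" x y] by (simp add: anc_pred)

lemma cl_eq_lv_iff: "cl x y = lv x \<longleftrightarrow> lv x \<le> lv y \<and> anc y (lv x) = x"
  using cl_iff[of "lv x" x y] cl_le1[of x y] anc_self[of x] by (metis order_refl order_antisym)

lemma cl_eq_lv_same: "lv x = lv y \<Longrightarrow> cl x y = lv x \<longleftrightarrow> x = y"
  by (metis anc_self cl_eq_lv_iff order_refl)

lemma ex_child_not: "\<exists>y. par y = x \<and> y \<noteq> z"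
proof (rule ccontr)
  assume "\<not> ?thesis"
  then have "{y. par y = x} \<subseteq> {z}" by auto
  then have "card {y. par y = x} \<le> 1" using card_mono[of "{z}"] by fastforce
  then show False using card_children[of x] p_ge2 by simp
qed

lemma ex_desc: "lv x \<le> l \<Longrightarrow> \<exists>y. lv y = l \<and> anc y (lv x) = x"
proof (induction l rule: int_ge_induct)
  case base
  show ?case by (intro exI[of _ x]) simp
next
  case (step l)
  then obtain y where y: "lv y = l" "anc y (lv x) = x" by blast
  obtain z where z: "par z = y" using ex_child_not by blast
  then have "lv z = l + 1" using lv_par[of z] y by simp
  then show ?case using y z step anc_par[of "lv x" z] by (intro exI[of _ z]) auto
qed

lemma ex_far: "\<exists>v. lv v = l \<and> cl x v \<le> c"
proof (cases "l \<le> c")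
  case True
  define k where "k = min l (lv x)"
  obtain v where v: "lv v = l" using ex_desc[of "anc x k" l] lv_anc[of k x] by (auto simp: k_def)
  then show ?thesis using True cl_le2[of x v] by (intro exI[of _ v]) auto
next
  case False
  define k where "k = min c (lv x)"
  define a where "a = anc x k"
  have a: "lv a = k" by (simp add: a_def lv_anc k_def)
  obtain b where b: "par b = a" "b \<noteq> anc x (k + 1)" using ex_child_not by blast
  have lb: "lv b = k + 1" using lv_par[of b] a b by simp
  have "lv b \<le> l" using lb False by (simp add: k_def)
  then obtain v where v: "lv v = l" "anc v (lv b) = b" using ex_desc by blast
  have "\<not> k + 1 \<le> cl x v" using v b lb by (auto simp: cl_iff)
  then show ?thesis using v by (intro exI[of _ v]) (auto simp: k_def)
qed

end

context homtree
begin

text \<open>By \<open>merge\<close> the pair under \<open>SOME\<close> exists; its difference does not depend on the choice and is the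
  horocyclic level.\<close>

definition lv :: "'v \<Rightarrow> int" where
  "lv x = (let mn = SOME mn. (par ^^ fst mn) x = (par ^^ snd mn) (root T) in int (fst mn) - int (snd mn))"

lemma funpow_par_diff:
  assumes "(par ^^ m) x = (par ^^ n) y" "(par ^^ m') x = (par ^^ n') y"
  shows "int m - int n = int m' - int n'"
proof -
  have *: "int m - int n = int m' - int n'"
    if "(par ^^ m) x = (par ^^ n) y" "(par ^^ m') x = (par ^^ n') y" "m \<le> m'" for m n m' n'
  proof -
    have "(par ^^ n') y = (par ^^ (m' - m + m)) x" using that by simp
    also have "\<dots> = (par ^^ (m' - m + n)) y" using that(1) by (simp only: funpow_add o_apply)
    finally have "n' = m' - m + n" by (rule par_funpow_inj)
    then show ?thesis using that(3) by simp
  qed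
  show ?thesis using *[OF assms] *[OF assms(2,1)] by (cases "m \<le> m'") auto
qed

lemma lv_eq: assumes "(par ^^ m) x = (par ^^ n) (root T)" shows "lv x = int m - int n"
proof -
  define P where "P mn \<longleftrightarrow> (par ^^ fst mn) x = (par ^^ snd mn) (root T)" for mn :: "nat \<times> nat"
  have "P (m, n)" using assms by (simp add: P_def)
  then have "P (SOME mn. P mn)" by (rule someI)
  then show ?thesis using funpow_par_diff[OF assms] unfolding lv_def P_def by (simp add: Let_def)
qed

lemma lv_root [simp]: "lv (root T) = 0"
  using lv_eq[of 0 "root T" 0] by simp

sublocale htree par lv p
proof
  fix x y
  obtain m n where mn: "(par ^^ m) x = (par ^^ n) (root T)" using par_merge by blast
  then have "(par ^^ m) (par x) = (par ^^ Suc n) (root T)" by (metis funpow.simps(2) funpow_swap1 o_apply)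
  from lv_eq[OF this] lv_eq[OF mn] show "lv (par x) = lv x - 1" by simp
  show "card {y. par y = x} = p" by (rule par_children)
  show "\<exists>m n. (par ^^ m) x = (par ^^ n) y" by (rule par_merge)
qed (rule p2)

text \<open>The path over the confluent gives one inequality; for the other, the right-hand side
  drops by at most 1 along each edge and is 0 for \<open>x = y\<close>.\<close>

lemma gdist_cl: "int (D x y) = lv x + lv y - 2 * cl x y"
proof -
  have "D x y \<le> D x (anc x (cl x y)) + D (anc x (cl x y)) y" by (rule gdist_triangle)
  also have "D (anc x (cl x y)) y = D y (anc y (cl x y))" by (subst anc_cl) (rule gdist_sym)
  finally have "D x y \<le> nat (lv x - cl x y) + nat (lv y - cl x y)" by (simp add: anc_def par_dist)
  then have up: "int (D x y) \<le> lv x + lv y - 2 * cl x y" using cl_le1[of x y] cl_le2[of x y] by linarith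
  have st: "lv x + lv y - 2 * cl x y \<le> lv z + lv y - 2 * cl z y + 1" if "A x z" for x z
    using that[unfolded adj_par] cl_par[of x y] cl_par[of z y] lv_par[of x] lv_par[of z] cl_le1[of x y] cl_le1[of z y]
    by (auto simp: min_def split: if_splits)
  have "lv x + lv y - 2 * cl x y \<le> int n" if "(A ^^ n) x y" for n
    using that
  proof (induction n arbitrary: x)
    case (Suc n)
    then obtain z where "A x z" "(A ^^ n) z y" by (meson relpowp_Suc_E2)
    then show ?case using Suc.IH[of z] st[of x z] by simp
  qed simp
  from this[OF gdist_relpow] up show ?thesis by simp
qed

lemma geodesic_ref: "geodesic T x (End (ref_end T)) = {anc x k | k. k \<le> lv x}"
proof -
  have "range (ray x (ref_end T)) = {anc x k | k. k \<le> lv x}"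
  proof (intro set_eqI iffI)
    fix y assume "y \<in> {anc x k | k. k \<le> lv x}"
    then show "y \<in> range (ray x (ref_end T))" by (auto simp: ray_par anc_def)
  next
    fix y assume "y \<in> range (ray x (ref_end T))"
    then obtain n where "y = anc x (lv x - int n)" by (auto simp: ray_par funpow_anc)
    then show "y \<in> {anc x k | k. k \<le> lv x}" by auto
  qed
  then show ?thesis using geodesic_End[OF ref] by simp
qed

lemma end_confluent_eq: "end_confluent T x y = anc x (cl x y)"
proof -
  let ?b = "anc x (cl x y)"
  have b: "lv ?b = cl x y" by (simp add: lv_anc cl_le1)
  have i: "{anc x k | k. k \<le> lv x} \<inter> {anc y k | k. k \<le> lv y} = {anc ?b k | k. k \<le> lv ?b}"
  proof (intro set_eqI iffI)
    fix v assume "v \<in> {anc x k | k. k \<le> lv x} \<inter> {anc y k | k. k \<le> lv y}"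
    then obtain k j where kj: "v = anc x k" "k \<le> lv x" "v = anc y j" "j \<le> lv y" by blast
    then have "lv v = k" "lv v = j" using lv_anc by metis+
    then have v: "lv v \<le> lv x" "lv v \<le> lv y" "v = anc x (lv v)" "v = anc y (lv v)" using kj by simp_all
    then have "lv v \<le> cl x y" unfolding cl_iff by metis
    moreover from this have "v = anc ?b (lv v)" using v(3) by (simp add: anc_anc)
    ultimately show "v \<in> {anc ?b k | k. k \<le> lv ?b}" using b by auto
  next
    fix v assume "v \<in> {anc ?b k | k. k \<le> lv ?b}"
    then obtain k where k: "k \<le> cl x y" "v = anc ?b k" using b by auto
    then have "v = anc x k" by (simp add: anc_anc)
    moreover have kk: "k \<le> lv x" "k \<le> lv y" "anc x k = anc y k" using k(1) cl_iff by auto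
    ultimately have "v = anc y k" by simp
    with kk \<open>v = anc x k\<close> show "v \<in> {anc x k | k. k \<le> lv x} \<inter> {anc y k | k. k \<le> lv y}" by blast
  qed
  show ?thesis unfolding end_confluent_def geodesic_ref
  proof (rule the_equality)
    show "{anc x k | k. k \<le> lv x} \<inter> {anc y k | k. k \<le> lv y} = {anc ?b k | k. k \<le> lv ?b}" by (rule i)
    fix c assume "{anc x k | k. k \<le> lv x} \<inter> {anc y k | k. k \<le> lv y} = {anc c k | k. k \<le> lv c}"
    then have e: "{anc c k | k. k \<le> lv c} = {anc ?b k | k. k \<le> lv ?b}" using i by simp
    have "c \<in> {anc c k | k. k \<le> lv c}" "?b \<in> {anc ?b k | k. k \<le> lv ?b}" using anc_self by (metis (mono_tags, lifting) mem_Collect_eq order_refl)+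
    with e obtain k j where "c = anc ?b k" "k \<le> lv ?b" "?b = anc c j" "j \<le> lv c" by blast
    then show "c = ?b" by (metis anc_self lv_anc order_antisym)
  qed
qed

lemma up_eq: "int (up T x y) = lv x - cl x y"
  unfolding up_def end_confluent_eq by (simp add: anc_def par_dist cl_le1)

lemma down_eq: "int (down T x y) = lv y - cl x y"
  unfolding down_def end_confluent_eq by (subst anc_cl) (simp add: anc_def par_dist cl_le2)

lemma hor_eq: "hor T x = lv x"
  unfolding hor_def by (simp add: up_eq down_eq)

lemma pred_vertex_eq: "pred_vertex T x = par x"
  unfolding pred_vertex_def hor_eq
proof (rule the_equality)
  show "A x (par x) \<and> lv (par x) = lv x - 1" by (simp add: par_adj)
  fix y assume "A x y \<and> lv y = lv x - 1"
  then show "y = par x" using lv_par[of y] by (auto simp: adj_par)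
qed

end

section \<open>The metrics of the two compactifications of a tree\<close>

lemma abs_frac: "1 - \<bar>x / (1 + \<bar>x\<bar>)\<bar> = 1 / (1 + \<bar>x\<bar>)" for x :: real
proof -
  have y: "1 + \<bar>x\<bar> > 0" by linarith
  have "\<bar>x / (1 + \<bar>x\<bar>)\<bar> = \<bar>x\<bar> / (1 + \<bar>x\<bar>)" using y by simp
  also have "1 - \<dots> = (1 + \<bar>x\<bar> - \<bar>x\<bar>) / (1 + \<bar>x\<bar>)" using y by (simp only: diff_divide_distrib divide_self_if) simp
  finally show ?thesis by simp
qed

lemma squash_inj: "squash k = squash l \<longleftrightarrow> k = l"
proof
  \<comment> \<open>On finite levels \<open>squash\<close> is inverted by
    \<open>t / (1 - |t|)\<close>.\<close>
  have inv: "squash k / (1 - \<bar>squash k\<bar>) = real_of_int i" and lt: "\<bar>squash k\<bar> < 1" if "k = Fin i" for k i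
  proof -
    have y: "1 + \<bar>real_of_int i\<bar> > 0" by linarith
    have e: "1 - \<bar>squash k\<bar> = 1 / (1 + \<bar>real_of_int i\<bar>)" using that abs_frac[of "real_of_int i"] by simp
    show "squash k / (1 - \<bar>squash k\<bar>) = real_of_int i" unfolding e using that y by simp
    have "1 / (1 + \<bar>real_of_int i\<bar>) > 0" using y by simp
    then show "\<bar>squash k\<bar> < 1" using e by linarith
  qed
  assume e: "squash k = squash l"
  have n: "squash (Fin i) \<noteq> 1" "squash (Fin i) \<noteq> -1" for i using lt[of "Fin i" i, OF refl] by (metis abs_one abs_minus_cancel less_irrefl)+
  show "k = l"
  proof (cases k)
    case (Fin i)
    show ?thesis
    proof (cases l)
      case F: (Fin j)
      have "real_of_int i = real_of_int j" using inv[OF Fin] inv[OF F] e by metis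
      then show ?thesis using Fin F by simp
    qed (use Fin e n in auto)
  next
    case Pinf
    then show ?thesis using e n by (cases l) auto
  next
    case Minf
    then show ?thesis using e n by (cases l) auto
  qed
qed simp

context homtree
begin

text \<open>The counterpart of \<open>par\<close> with the root in the role of the reference end;
  the root is its own image, so iterates stop there.\<close>

definition sg :: "'v \<Rightarrow> 'v" where
  "sg v = (if v = root T then v else SOME y. A v y \<and> D (root T) v = Suc (D (root T) y))"

lemma sg_root [simp]: "sg (root T) = root T" by (simp add: sg_def)

lemma sg_adj: assumes "v \<noteq> root T" shows "A v (sg v)" "D (root T) v = Suc (D (root T) (sg v))"
  using someI_ex[OF ex_closer[OF assms]] assms by (auto simp: sg_def)

lemma sg_eqI: "A u v \<Longrightarrow> D (root T) v = Suc (D (root T) u) \<Longrightarrow> sg v = u"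
proof -
  assume a: "A u v" "D (root T) v = Suc (D (root T) u)"
  then have v: "v \<noteq> root T" by auto
  show ?thesis
    by (rule closer_unique[of v _ _ "root T"]) (use a sg_adj[OF v] adj_sym in simp_all)
qed

lemma D_sg: "D (root T) (sg v) = D (root T) v - 1"
  using sg_adj(2)[of v] by (cases "v = root T") auto

lemma D_sgpow: "D (root T) ((sg ^^ k) v) = D (root T) v - k"
  by (induction k) (auto simp: D_sg)

lemma D_sgpow_le: "D ((sg ^^ k) v) v \<le> k"
proof (induction k)
  case (Suc k)
  have "D (sg ((sg ^^ k) v)) ((sg ^^ k) v) \<le> 1"
    using sg_adj(1)[of "(sg ^^ k) v"] gdist_1_iff[of "sg ((sg ^^ k) v)" "(sg ^^ k) v"] adj_sym
    by (cases "(sg ^^ k) v = root T") auto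
  then show ?case using Suc gdist_triangle[of "(sg ^^ Suc k) v" v "(sg ^^ k) v"] by simp
qed simp

text \<open>The \<open>n\<close>-th vertex of the geodesic from the root; for a vertex \<open>v\<close> the path stays at \<open>v\<close> after reaching it.\<close>

fun pt :: "'v end_pt \<Rightarrow> nat \<Rightarrow> 'v" where
  "pt (Vertex v) n = (sg ^^ (D (root T) v - n)) v"
| "pt (End \<xi>) n = ray (root T) \<xi> n"

abbreviation M where "M \<equiv> end_compactification T"

lemma M_cases: assumes "w \<in> M" obtains v where "w = Vertex v" | \<xi> where "w = End \<xi>" "\<xi> \<in> ends T"
  using assms by (auto simp: end_compactification_def)

lemma Vertex_M [simp]: "Vertex v \<in> M" and End_M [simp]: "End \<xi> \<in> M \<longleftrightarrow> \<xi> \<in> ends T"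
  by (auto simp: end_compactification_def)

lemma pt_vertex_D: "D (root T) (pt (Vertex v) n) = min n (D (root T) v)"
  by (simp add: D_sgpow)

lemma pt_vertex_ge: "D (root T) v \<le> n \<Longrightarrow> pt (Vertex v) n = v"
  by simp

lemma sg_ray: assumes "\<xi> \<in> ends T" shows "sg (ray (root T) \<xi> (Suc n)) = ray (root T) \<xi> n"
  using ray_nb[OF assms, of "root T"] ray_dist[OF assms] by (intro sg_eqI) (auto simp: nb_ray_def)

text \<open>Either the path still advances, or it has stopped, and then it has stopped at the point
  itself. This alternative often replaces the distinction between vertices and ends.\<close>

lemma pt_D: assumes "w \<in> M" shows "D (root T) (pt w n) = n \<or> (D (root T) (pt w n) < n \<and> w = Vertex (pt w n))"
  using assms
proof (cases rule: M_cases)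
  case (1 v)
  then show ?thesis using pt_vertex_D[of v n] pt_vertex_ge[of v n] by (cases "D (root T) v < n") (auto simp del: pt.simps)
next
  case (2 \<xi>)
  then show ?thesis using ray_dist by simp
qed

lemma pt_0: "w \<in> M \<Longrightarrow> pt w 0 = root T"
  using pt_D[of w 0] gdist_eq0[of "root T"] by auto

lemma pt_back: assumes "w \<in> M" "m \<le> n" "D (root T) (pt w n) = n"
  shows "pt w m = (sg ^^ (n - m)) (pt w n)"
  using assms(1)
proof (cases rule: M_cases)
  case (1 v)
  then have "n \<le> D (root T) v" using assms(3) pt_vertex_D[of v n] by simp
  then have "D (root T) v - m = (n - m) + (D (root T) v - n)" using assms(2) by simp
  then show ?thesis using 1 by (simp add: funpow_add)
next
  case (2 \<xi>)
  have "(sg ^^ k) (ray (root T) \<xi> (m + k)) = ray (root T) \<xi> m" for k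
    by (induction k) (auto simp: funpow_swap1 sg_ray[OF 2(2)] simp del: funpow.simps(2) simp: funpow_Suc_right)
  from this[of "n - m"] show ?thesis using 2 assms(2) by simp
qed

lemma pt_agree_mono:
  assumes "w \<in> M" "z \<in> M" "pt w n = pt z n" "m \<le> n" shows "pt w m = pt z m"
proof (cases "D (root T) (pt w n) = n")
  case True
  then show ?thesis using pt_back[OF assms(1,4)] pt_back[OF assms(2,4)] assms(3) by simp
next
  case False
  then have "w = Vertex (pt w n)" "z = Vertex (pt z n)" using pt_D[OF assms(1), of n] pt_D[OF assms(2), of n] assms(3) by auto
  then show ?thesis using assms(3) by metis
qed

lemma pt_differ: assumes "w \<in> M" "z \<in> M" "w \<noteq> z" shows "\<exists>n. pt w n \<noteq> pt z n"
proof (rule ccontr)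
  assume "\<nexists>n. pt w n \<noteq> pt z n"
  then have eq: "pt w n = pt z n" for n by blast
  show False
  proof (cases "\<exists>n. D (root T) (pt w n) < n")
    case True
    then obtain n where "D (root T) (pt w n) < n" by blast
    then have "w = Vertex (pt w n)" "z = Vertex (pt z n)"
      using pt_D[OF assms(1), of n] pt_D[OF assms(2), of n] eq[of n] by auto
    then show False using eq[of n] assms(3) by metis
  next
    case False
    have ne: "u \<noteq> Vertex v" if "\<And>n. \<not> D (root T) (pt u n) < n" for u v
      using that[of "Suc (D (root T) v)"] by auto
    have "w \<noteq> Vertex v" "z \<noteq> Vertex v" for v using ne[of w v] ne[of z v] False eq by auto
    then obtain \<xi> \<eta> where x: "w = End \<xi>" "\<xi> \<in> ends T" "z = End \<eta>" "\<eta> \<in> ends T"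
      using assms M_cases by metis
    then have "ray (root T) \<xi> = ray (root T) \<eta>" using eq by auto
    then have "\<xi> = \<eta>" using end_eqI[OF x(2,4)] ray_in x by metis
    then show False using x assms by simp
  qed
qed

lemma pt_range: assumes "w \<in> M" "u \<in> range (pt w)" shows "u = pt w (D (root T) u)"
proof -
  obtain n where n: "u = pt w n" using assms by auto
  show ?thesis
  proof (cases "D (root T) u = n")
    case False
    then have "w = Vertex u" using pt_D[OF assms(1), of n] n by auto
    then show ?thesis using pt_vertex_ge[of u "D (root T) u"] by simp
  qed (use n in simp)
qed

lemma geodesic_vertex: "geodesic T (root T) (Vertex v) = range (pt (Vertex v))"
proof (intro set_eqI iffI)
  fix u assume "u \<in> range (pt (Vertex v))"
  then obtain n where n: "u = (sg ^^ (D (root T) v - n)) v" by auto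
  have "D (root T) u + D u v = D (root T) v"
    using D_sgpow[of "D (root T) v - n" v] D_sgpow_le[of "D (root T) v - n" v] gdist_triangle[of "root T" v u]
    unfolding n[symmetric] by linarith
  then show "u \<in> geodesic T (root T) (Vertex v)" by simp
next
  fix u assume "u \<in> geodesic T (root T) (Vertex v)"
  then have "D (root T) u + D u v = D (root T) v" by simp
  then have "u = pt (Vertex v) (D (root T) u)"
  proof (induction "D u v" arbitrary: u)
    case 0
    then show ?case by auto
  next
    case (Suc k)
    then have "u \<noteq> v" by auto
    then obtain w where w: "A u w" "D v u = Suc (D v w)" using ex_closer by blast
    have e: "D w v = k" using Suc(2) w(2) gdist_sym by (metis Suc_inject)
    have "D (root T) v \<le> D (root T) w + D w v" by (rule gdist_triangle)
    then have dw: "D (root T) w = Suc (D (root T) u)"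
      using gdist_adj[OF w(1), of "root T"] Suc(2,3) e by linarith
    then have "w = pt (Vertex v) (D (root T) w)" using Suc(1)[of w] e Suc(2,3) by linarith
    then have "pt (Vertex v) (D (root T) u) = sg w"
      using pt_back[of "Vertex v" "D (root T) u" "D (root T) w"] dw by simp
    moreover have "sg w = u" using sg_eqI w dw by blast
    ultimately show ?case by simp
  qed
  then show "u \<in> range (pt (Vertex v))" by blast
qed

lemma geodesic_pt: "w \<in> M \<Longrightarrow> geodesic T (root T) w = range (pt w)"
  by (cases rule: M_cases[of w]) (auto simp: geodesic_vertex geodesic_End simp del: geodesic.simps pt.simps, auto)

text \<open>Paths from the root that have separated never meet again (\<open>pt_agree_mono\<close>),
  so the common part is an initial piece, and its last vertex is the confluent.\<close>

lemma confluent_theta: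
  assumes "w \<in> M" "z \<in> M" "w \<noteq> z"
  obtains N where "confluent T w z = pt w N" "theta p T w z = 1 / real p ^ N"
    "\<And>n. pt w n = pt z n \<longleftrightarrow> n \<le> N"
    "geodesic T (root T) w \<inter> geodesic T (root T) z = geodesic T (root T) (Vertex (confluent T w z))"
    "D (root T) (confluent T w z) = N"
proof -
  define N where "N = (LEAST n. pt w (Suc n) \<noteq> pt z (Suc n))"
  have "\<exists>n. pt w (Suc n) \<noteq> pt z (Suc n)"
    using pt_differ[OF assms] pt_0 assms by (metis not0_implies_Suc)
  then have N: "pt w (Suc N) \<noteq> pt z (Suc N)" unfolding N_def by (rule LeastI_ex)
  have ag: "pt w n = pt z n \<longleftrightarrow> n \<le> N" for n
  proof
    assume "pt w n = pt z n"
    then show "n \<le> N" using pt_agree_mono[OF assms(1,2), of n "Suc N"] N by (meson not_less_eq_eq)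
  next
    assume "n \<le> N"
    then show "pt w n = pt z n"
      using not_less_Least[of "n - 1" "\<lambda>n. pt w (Suc n) \<noteq> pt z (Suc n)"] pt_0 assms unfolding N_def
      by (cases n) auto
  qed
  \<comment> \<open>Neither path has stopped before \<open>N\<close>, since otherwise
    \<open>w\<close> and \<open>z\<close> would be the same vertex.\<close>
  have DN: "D (root T) (pt w N) = N"
  proof (rule ccontr)
    assume "D (root T) (pt w N) \<noteq> N"
    then have "w = Vertex (pt w N)" "z = Vertex (pt z N)"
      using pt_D[OF assms(1), of N] pt_D[OF assms(2), of N] ag[of N] by auto
    then show False using ag[of N] assms(3) by (metis order_refl)
  qed
  have gN: "geodesic T (root T) (Vertex (pt w N)) = pt w ` {..N}"
  proof -
    have "pt (Vertex (pt w N)) n = pt w (min n N)" for n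
      using pt_back[OF assms(1), of "min n N" N] DN by (auto simp: min_def)
    then show ?thesis unfolding geodesic_vertex by (force simp: image_iff min_def)
  qed
  have i: "geodesic T (root T) w \<inter> geodesic T (root T) z = geodesic T (root T) (Vertex (pt w N))"
    unfolding gN geodesic_pt[OF assms(1)] geodesic_pt[OF assms(2)]
  proof (intro set_eqI iffI)
    fix u assume "u \<in> range (pt w) \<inter> range (pt z)"
    then have "u = pt w (D (root T) u)" "u = pt z (D (root T) u)" using pt_range assms by auto
    then show "u \<in> pt w ` {..N}" using ag[of "D (root T) u"] by auto
  next
    fix u assume "u \<in> pt w ` {..N}"
    then obtain n where "n \<le> N" "u = pt w n" by auto
    then show "u \<in> range (pt w) \<inter> range (pt z)" using ag[of n] by (metis IntI rangeI)
  qed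
  have c: "confluent T w z = pt w N"
    unfolding confluent_def
  proof (rule the_equality)
    show "geodesic T (root T) w \<inter> geodesic T (root T) z = geodesic T (root T) (Vertex (pt w N))" by (rule i)
    fix c assume "geodesic T (root T) w \<inter> geodesic T (root T) z = geodesic T (root T) (Vertex c)"
    then have e: "geodesic T (root T) (Vertex c) = geodesic T (root T) (Vertex (pt w N))" using i by simp
    have "c \<in> geodesic T (root T) (Vertex c)" "pt w N \<in> geodesic T (root T) (Vertex (pt w N))" by auto
    with e have "c \<in> geodesic T (root T) (Vertex (pt w N))" "pt w N \<in> geodesic T (root T) (Vertex c)" by blast+
    then have "D (root T) c + D c (pt w N) = D (root T) (pt w N)" "D (root T) (pt w N) + D (pt w N) c = D (root T) c" by simp_all
    then have "D c (pt w N) = 0" by linarith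
    then show "c = pt w N" by simp
  qed
  have "theta p T w z = 1 / real p ^ N" unfolding theta_def c using DN assms(3) gdist_sym[of "pt w N" "root T"] by simp
  then show ?thesis using that[of N] c ag i DN by simp
qed

lemma p_pos: "real p > 1" using p2 by simp

text \<open>The closed ball of radius \<open>1 / p ^ n\<close> consists of the points whose paths
  from the root share the first \<open>n\<close> steps; the topology is accessed through this
  fact.\<close>

lemma theta_le_iff:
  assumes "w \<in> M" "z \<in> M" shows "theta p T w z \<le> 1 / real p ^ n \<longleftrightarrow> pt w n = pt z n"
proof (cases "w = z")
  case True then show ?thesis by (simp add: theta_def)
next
  case False
  then obtain N where N: "theta p T w z = 1 / real p ^ N" "\<And>n. pt w n = pt z n \<longleftrightarrow> n \<le> N"
    using confluent_theta[OF assms] by metis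
  have "1 / real p ^ N \<le> 1 / real p ^ n \<longleftrightarrow> real p ^ n \<le> real p ^ N"
    using p_pos by (auto simp: field_simps)
  also have "\<dots> \<longleftrightarrow> n \<le> N" using p_pos by simp
  finally show ?thesis using N by simp
qed

lemma theta_cases:
  assumes "w \<in> M" "z \<in> M" shows "theta p T w z = 0 \<and> w = z \<or> (\<exists>N. theta p T w z = 1 / real p ^ N \<and> w \<noteq> z)"
  using confluent_theta[OF assms] by (metis theta_def)

text \<open>The positive values of \<open>theta\<close> are powers of \<open>1 / p\<close>, so a
  strict inequality gains one step of agreement.\<close>

lemma theta_less:
  assumes "w \<in> M" "z \<in> M" "theta p T w z < 1 / real p ^ n" shows "pt w (Suc n) = pt z (Suc n)"
  using theta_cases[OF assms(1,2)]
proof (elim disjE exE conjE)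
  fix N assume N: "theta p T w z = 1 / real p ^ N"
  then have "1 / real p ^ N < 1 / real p ^ n" using assms(3) by simp
  then have "real p ^ n < real p ^ N" using p_pos by (simp add: field_simps)
  then have "Suc n \<le> N" using p_pos by simp
  then have "real p ^ Suc n \<le> real p ^ N" using p_pos by (intro power_increasing) auto
  then have "theta p T w z \<le> 1 / real p ^ Suc n" unfolding N using p_pos by (intro divide_left_mono) auto
  then show ?thesis using theta_le_iff assms by blast
qed auto

lemma theta_nonneg: "0 \<le> theta p T w z" by (simp add: theta_def)

lemma theta_ultra:
  assumes "w \<in> M" "z \<in> M" "u \<in> M" shows "theta p T w u \<le> max (theta p T w z) (theta p T z u)"
proof (cases "w = u")
  case True
  then have "theta p T w u = 0" by (simp add: theta_def)
  then show ?thesis using theta_nonneg[of w z] by simp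
next
  case False
  then obtain N where N: "theta p T w u = 1 / real p ^ N" "\<And>n. pt w n = pt u n \<longleftrightarrow> n \<le> N"
    using confluent_theta[OF assms(1,3)] by metis
  show ?thesis
  proof (rule ccontr)
    assume "\<not> ?thesis"
    then have "theta p T w z < 1 / real p ^ N" "theta p T z u < 1 / real p ^ N" using N by auto
    then have "pt w (Suc N) = pt u (Suc N)" using theta_less assms by metis
    then show False using N(2) by simp
  qed
qed

lemma theta_0_iff: "w \<in> M \<Longrightarrow> z \<in> M \<Longrightarrow> theta p T w z = 0 \<longleftrightarrow> w = z"
  using theta_cases[of w z] p_pos by auto

lemma theta_metric: "Metric_space M (theta p T)"
proof
  fix w z u
  show "0 \<le> theta p T w z" by (rule theta_nonneg)
  show "theta p T w z = theta p T z w" unfolding theta_def confluent_def by (simp add: Int_commute)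
  assume a: "w \<in> M" "z \<in> M"
  show "theta p T w z = 0 \<longleftrightarrow> w = z" using theta_0_iff a .
  assume "u \<in> M"
  then have "theta p T w u \<le> max (theta p T w z) (theta p T z u)" using a theta_ultra by blast
  then show "theta p T w u \<le> theta p T w z + theta p T z u" using theta_nonneg[of w z] theta_nonneg[of z u] by linarith
qed

section \<open>The metric of the horocyclic compactification\<close>

abbreviation HM where "HM \<equiv> hor_compactification T"

lemma to_end_pt_M: "z \<in> HM \<Longrightarrow> to_end_pt T z \<in> M"
  using ref by (auto simp: hor_compactification_def proper_ends_def)

lemma to_end_hor_inj:
  assumes "z \<in> HM" "w \<in> HM" "to_end_pt T z = to_end_pt T w" "hor_ext T z = hor_ext T w" shows "z = w"
  using assms by (cases z; cases w) (auto simp: hor_compactification_def proper_ends_def)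

lemma theta_h_metric: "Metric_space HM (theta_h p T)"
proof
  interpret E: Metric_space M "theta p T" by (rule theta_metric)
  fix w z u
  show "0 \<le> theta_h p T w z" by (simp add: theta_h_def theta_nonneg)
  show "theta_h p T w z = theta_h p T z w" unfolding theta_h_def using E.commute by (simp add: abs_minus_commute)
  assume a: "w \<in> HM" "z \<in> HM"
  show "theta_h p T w z = 0 \<longleftrightarrow> w = z"
  proof
    assume "theta_h p T w z = 0"
    then have "theta p T (to_end_pt T w) (to_end_pt T z) = 0" "squash (hor_ext T w) = squash (hor_ext T z)"
      unfolding theta_h_def using theta_nonneg[of "to_end_pt T w" "to_end_pt T z"] by linarith+
    then show "w = z" using to_end_hor_inj[OF a] E.zero[OF to_end_pt_M to_end_pt_M, OF a] squash_inj by blast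
  qed (simp add: theta_h_def E.mdist_zero to_end_pt_M a)
  assume b: "u \<in> HM"
  show "theta_h p T w u \<le> theta_h p T w z + theta_h p T z u"
    unfolding theta_h_def using E.triangle[OF to_end_pt_M[OF a(1)] to_end_pt_M[OF a(2)] to_end_pt_M[OF b]] by linarith
qed

end

section \<open>Convergence to boundary points\<close>

lemma squash_abs_less: "\<bar>squash (Fin k)\<bar> < 1"
proof -
  have "1 - \<bar>squash (Fin k)\<bar> = 1 / (1 + \<bar>real_of_int k\<bar>)" using abs_frac[of "real_of_int k"] by simp
  moreover have "1 / (1 + \<bar>real_of_int k\<bar>) > 0" by simp
  ultimately show ?thesis by linarith
qed

lemma squash_strict: assumes "k < l" shows "squash (Fin k) < squash (Fin l)"
proof -
  have p: "x / (1 + \<bar>x\<bar>) < y / (1 + \<bar>y\<bar>)" if "x < y" for x y :: real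
  proof -
    have "x * (1 + \<bar>y\<bar>) < y * (1 + \<bar>x\<bar>)"
    proof (cases "0 \<le> x")
      case True then show ?thesis using that by (simp add: algebra_simps)
    next
      case False
      then show ?thesis
      proof (cases "0 \<le> y")
        case True
        have "x * y \<le> 0" using True False by (simp add: mult_nonpos_nonneg)
        then show ?thesis using that False True by (simp add: algebra_simps)
      qed (use that False in \<open>simp add: algebra_simps\<close>)
    qed
    moreover have "1 + \<bar>x\<bar> > 0" "1 + \<bar>y\<bar> > 0" by linarith+
    ultimately show ?thesis by (simp add: divide_less_eq less_divide_eq mult.commute)
  qed
  show ?thesis using p[of "real_of_int k" "real_of_int l"] assms by simp
qed

lemma squash_less_iff: "squash (Fin k) < squash (Fin l) \<longleftrightarrow> k < l"
  using squash_strict by (metis not_less_iff_gr_or_eq)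

lemma squash_uminus: "squash (- k) = - squash k"
  by (cases k) auto

lemma squash_tendsto_Pinf:
  "((\<lambda>i. squash (Fin (f i))) \<longlongrightarrow> 1) F \<longleftrightarrow> (\<forall>l. \<forall>\<^sub>F i in F. l \<le> f i)"
proof
  assume t: "((\<lambda>i. squash (Fin (f i))) \<longlongrightarrow> 1) F"
  show "\<forall>l. \<forall>\<^sub>F i in F. l \<le> f i"
  proof
    fix l
    have "squash (Fin l) < 1" using squash_abs_less[of l] by linarith
    then have "\<forall>\<^sub>F i in F. squash (Fin l) < squash (Fin (f i))" using t by (rule order_tendstoD(1)[rotated])
    then show "\<forall>\<^sub>F i in F. l \<le> f i" by eventually_elim (simp only: squash_less_iff)
  qed
next
  assume a: "\<forall>l. \<forall>\<^sub>F i in F. l \<le> f i"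
  show "((\<lambda>i. squash (Fin (f i))) \<longlongrightarrow> 1) F"
  proof (rule order_tendstoI)
    fix y :: real assume "y < 1"
    then obtain n :: nat where n: "1 / (1 - y) < real n" using reals_Archimedean2 by blast
    have "\<forall>\<^sub>F i in F. int n \<le> f i" using a by blast
    then show "\<forall>\<^sub>F i in F. y < squash (Fin (f i))"
    proof eventually_elim
      case (elim i)
      then have g: "real n \<le> real_of_int (f i)" "0 \<le> real_of_int (f i)" by linarith+
      then have "1 < (1 - y) * (1 + real_of_int (f i))"
      proof -
        have "1 < real n * (1 - y)" using n \<open>y < 1\<close> by (simp add: field_simps)
        also have "\<dots> \<le> (1 + real_of_int (f i)) * (1 - y)" using g \<open>y < 1\<close> by (intro mult_right_mono) auto
        finally show ?thesis by (simp add: mult.commute)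
      qed
      then show ?case using g by (simp add: less_divide_eq algebra_simps)
    qed
  next
    fix y :: real assume y: "1 < y"
    have "squash (Fin (f i)) < y" for i using squash_abs_less[of "f i"] y by linarith
    then show "\<forall>\<^sub>F i in F. squash (Fin (f i)) < y" by simp
  qed
qed

lemma squash_tendsto_Minf:
  "((\<lambda>i. squash (Fin (f i))) \<longlongrightarrow> -1) F \<longleftrightarrow> (\<forall>l. \<forall>\<^sub>F i in F. f i \<le> l)"
proof -
  have "((\<lambda>i. squash (Fin (f i))) \<longlongrightarrow> -1) F \<longleftrightarrow> ((\<lambda>i. squash (Fin (- f i))) \<longlongrightarrow> 1) F"
    using tendsto_minus_cancel_left[of "\<lambda>i. squash (Fin (f i))" 1 F] squash_uminus[of "Fin (f _)"] by simp
  also have "\<dots> \<longleftrightarrow> (\<forall>l. \<forall>\<^sub>F i in F. l \<le> - f i)" by (rule squash_tendsto_Pinf)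
  also have "\<dots> \<longleftrightarrow> (\<forall>l. \<forall>\<^sub>F i in F. f i \<le> l)" by (metis (no_types, lifting) eventually_mono le_minus_iff minus_minus neg_le_iff_le)
  finally show ?thesis .
qed

text \<open>The neighbouring values at \<open>k - 1\<close> and \<open>k + 1\<close> isolate the
  value at \<open>k\<close>.\<close>

lemma squash_tendsto_Fin:
  "((\<lambda>i. squash (Fin (f i))) \<longlongrightarrow> squash (Fin k)) F \<longleftrightarrow> (\<forall>\<^sub>F i in F. f i = k)"
proof
  assume t: "((\<lambda>i. squash (Fin (f i))) \<longlongrightarrow> squash (Fin k)) F"
  have "squash (Fin (k - 1)) < squash (Fin k)" "squash (Fin k) < squash (Fin (k + 1))" by (rule squash_strict, simp)+
  then have "\<forall>\<^sub>F i in F. squash (Fin (k - 1)) < squash (Fin (f i))" "\<forall>\<^sub>F i in F. squash (Fin (f i)) < squash (Fin (k + 1))"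
    using t order_tendstoD by blast+
  then show "\<forall>\<^sub>F i in F. f i = k" by eventually_elim (unfold squash_less_iff, linarith)
next
  assume "\<forall>\<^sub>F i in F. f i = k"
  then have "\<forall>\<^sub>F i in F. squash (Fin (f i)) = squash (Fin k)" by eventually_elim simp
  then show "((\<lambda>i. squash (Fin (f i))) \<longlongrightarrow> squash (Fin k)) F" by (rule tendsto_eventually)
qed

text \<open>A limit of modulus 1 is the value at an infinite level. Otherwise the inverse map
  \<open>t / (1 - |t|)\<close> is continuous at the limit and turns the sequence into integers,
  whose limits are integers.\<close>

lemma squash_closed: assumes "(\<lambda>n. squash (k n)) \<longlonglongrightarrow> t" shows "\<exists>l. t = squash l"
proof -
  have le: "\<bar>squash k\<bar> \<le> 1" for k using squash_abs_less by (cases k) (auto simp: less_imp_le simp del: squash.simps(1))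
  have "\<bar>t\<bar> \<le> 1" by (rule tendsto_le[OF _ tendsto_const tendsto_rabs[OF assms]]) (use le in auto)
  show ?thesis
  proof (cases "\<bar>t\<bar> = 1")
    case True
    then have "t = squash Pinf \<or> t = squash Minf" by auto
    then show ?thesis by blast
  next
    case False
    define u where "u n = squash (k n) / (1 - \<bar>squash (k n)\<bar>)" for n
    have "u \<longlonglongrightarrow> t / (1 - \<bar>t\<bar>)" unfolding u_def
      by (intro tendsto_intros assms) (use False in auto)
    moreover have "\<forall>\<^sub>F n in sequentially. u n \<in> \<int>"
    proof -
      have "\<bar>t\<bar> < 1" using False \<open>\<bar>t\<bar> \<le> 1\<close> by simp
      then have "\<forall>\<^sub>F n in sequentially. \<bar>squash (k n)\<bar> < 1"
        using tendsto_rabs[OF assms] order_tendstoD(2) by blast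
      then show ?thesis
      proof eventually_elim
        case (elim n)
        then obtain i where i: "k n = Fin i" by (cases "k n") auto
        have "1 - \<bar>squash (k n)\<bar> = 1 / (1 + \<bar>real_of_int i\<bar>)" using abs_frac[of "real_of_int i"] i by simp
        then have "u n = real_of_int i" unfolding u_def using i by (simp add: field_simps)
        then show ?case by simp
      qed
    qed
    ultimately have "t / (1 - \<bar>t\<bar>) \<in> \<int>" using closed_Ints by (metis Lim_in_closed_set sequentially_bot)
    then obtain i where i: "t / (1 - \<bar>t\<bar>) = real_of_int i" by (auto elim: Ints_cases)
    have lt: "\<bar>t\<bar> < 1" using False \<open>\<bar>t\<bar> \<le> 1\<close> by simp
    have "t = squash (Fin i)"
    proof -
      have "\<bar>real_of_int i\<bar> = \<bar>t\<bar> / (1 - \<bar>t\<bar>)" using i lt by (metis abs_divide abs_of_pos diff_gt_0_iff_gt)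
      then have "1 + \<bar>real_of_int i\<bar> = 1 / (1 - \<bar>t\<bar>)" using lt by (simp add: field_simps)
      then have "squash (Fin i) = real_of_int i * (1 - \<bar>t\<bar>)" by simp
      also have "\<dots> = t / (1 - \<bar>t\<bar>) * (1 - \<bar>t\<bar>)" by (simp only: i)
      also have "\<dots> = t" using lt by simp
      finally show ?thesis by simp
    qed
    then show ?thesis by blast
  qed
qed

context homtree
begin

lemma finite_ball: "finite {u. D (root T) u \<le> n}"
proof (induction n)
  case (Suc n)
  have "{u. D (root T) u \<le> Suc n} \<subseteq> {u. D (root T) u \<le> n} \<union> (\<Union>w\<in>{u. D (root T) u \<le> n}. {u. A w u})"
  proof
    fix u assume u: "u \<in> {u. D (root T) u \<le> Suc n}"
    show "u \<in> {u. D (root T) u \<le> n} \<union> (\<Union>w\<in>{u. D (root T) u \<le> n}. {u. A w u})"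
    proof (cases "u = root T")
      case False
      then have "D (root T) (sg u) \<le> n" "A (sg u) u" using sg_adj[OF False] u adj_sym by auto
      then show ?thesis by blast
    qed simp
  qed
  moreover have "finite ({u. D (root T) u \<le> n} \<union> (\<Union>w\<in>{u. D (root T) u \<le> n}. {u. A w u}))"
    using Suc finite_nb by simp
  ultimately show ?case by (rule finite_subset)
qed simp

lemma ex_small: assumes "e > 0" shows "\<exists>n. 1 / real p ^ n < e"
proof -
  have "(1 / real p) < 1" using p_pos by simp
  then obtain n where "(1 / real p) ^ n < e" using real_arch_pow_inv[OF assms] by blast
  then show ?thesis by (auto simp: power_one_over)
qed

text \<open>The two summands of \<open>theta_h\<close> can be controlled separately, and
  \<open>theta_le_iff\<close> expresses the first one by paths from the root.\<close>

lemma hor_limit_iff: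
  "limitin (hor_topology p T) f z F \<longleftrightarrow>
    z \<in> HM \<and> (\<forall>\<^sub>F i in F. f i \<in> HM) \<and>
    (\<forall>n. \<forall>\<^sub>F i in F. f i \<in> HM \<and> pt (to_end_pt T (f i)) n = pt (to_end_pt T z) n) \<and>
    ((\<lambda>i. squash (hor_ext T (f i))) \<longlongrightarrow> squash (hor_ext T z)) F"
proof -
  interpret H: Metric_space HM "theta_h p T" by (rule theta_h_metric)
  have lim: "limitin (hor_topology p T) f z F \<longleftrightarrow> z \<in> HM \<and> (\<forall>e>0. \<forall>\<^sub>F i in F. f i \<in> HM \<and> theta_h p T (f i) z < e)"
    unfolding hor_topology_def H.limitin_metric ..
  show ?thesis
  proof
    assume "limitin (hor_topology p T) f z F"
    then have z: "z \<in> HM" and e: "\<And>e. e > 0 \<Longrightarrow> \<forall>\<^sub>F i in F. f i \<in> HM \<and> theta_h p T (f i) z < e" using lim by auto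
    have "\<forall>\<^sub>F i in F. f i \<in> HM \<and> pt (to_end_pt T (f i)) n = pt (to_end_pt T z) n" for n
      using e[of "1 / real p ^ n"] p_pos
    proof (simp, elim eventually_mono conjE, intro conjI)
      fix i assume i: "f i \<in> HM" "theta_h p T (f i) z < 1 / real p ^ n"
      then have "theta p T (to_end_pt T (f i)) (to_end_pt T z) \<le> 1 / real p ^ n" by (simp add: theta_h_def)
      then show "pt (to_end_pt T (f i)) n = pt (to_end_pt T z) n" using theta_le_iff to_end_pt_M i z by blast
    qed
    moreover have "((\<lambda>i. squash (hor_ext T (f i))) \<longlongrightarrow> squash (hor_ext T z)) F"
    proof (rule tendstoI)
      fix r :: real assume "r > 0"
      show "\<forall>\<^sub>F i in F. dist (squash (hor_ext T (f i))) (squash (hor_ext T z)) < r"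
        using e[OF \<open>r > 0\<close>]
      proof eventually_elim
        case (elim i)
        then show ?case using theta_nonneg[of "to_end_pt T (f i)" "to_end_pt T z"]
          unfolding theta_h_def dist_real_def by linarith
      qed
    qed
    moreover have "\<forall>\<^sub>F i in F. f i \<in> HM" using e[of 1] by (simp add: eventually_conj_iff)
    ultimately show "z \<in> HM \<and> (\<forall>\<^sub>F i in F. f i \<in> HM) \<and>
    (\<forall>n. \<forall>\<^sub>F i in F. f i \<in> HM \<and> pt (to_end_pt T (f i)) n = pt (to_end_pt T z) n) \<and>
    ((\<lambda>i. squash (hor_ext T (f i))) \<longlongrightarrow> squash (hor_ext T z)) F" using z by blast
  next
    assume a: "z \<in> HM \<and> (\<forall>\<^sub>F i in F. f i \<in> HM) \<and>
    (\<forall>n. \<forall>\<^sub>F i in F. f i \<in> HM \<and> pt (to_end_pt T (f i)) n = pt (to_end_pt T z) n) \<and>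
    ((\<lambda>i. squash (hor_ext T (f i))) \<longlongrightarrow> squash (hor_ext T z)) F"
    have "\<forall>\<^sub>F i in F. f i \<in> HM \<and> theta_h p T (f i) z < e" if "e > 0" for e
    proof -
      have "e / 2 > 0" using that by simp
      then obtain n where n: "1 / real p ^ n < e / 2" using ex_small by blast
      have "\<forall>\<^sub>F i in F. f i \<in> HM \<and> pt (to_end_pt T (f i)) n = pt (to_end_pt T z) n" using a by blast
      moreover have "\<forall>\<^sub>F i in F. dist (squash (hor_ext T (f i))) (squash (hor_ext T z)) < e / 2"
        using a that by (intro tendstoD) auto
      ultimately show ?thesis
      proof eventually_elim
        case (elim i)
        then have "theta p T (to_end_pt T (f i)) (to_end_pt T z) \<le> 1 / real p ^ n"
          using theta_le_iff to_end_pt_M a by blast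
        then show ?case using elim n unfolding theta_h_def dist_real_def by linarith
      qed
    qed
    then show "limitin (hor_topology p T) f z F" using lim a by blast
  qed
qed

lemma HVertex_HM [simp]: "HVertex v \<in> HM" and Omega_HM [simp]: "Omega k \<in> HM"
  and HEnd_HM [simp]: "HEnd \<xi> \<in> HM \<longleftrightarrow> \<xi> \<in> proper_ends T"
  by (auto simp: hor_compactification_def)

lemma topspace_hor: "topspace (hor_topology p T) = HM"
proof -
  interpret H: Metric_space HM "theta_h p T" by (rule theta_h_metric)
  show ?thesis by (simp add: hor_topology_def)
qed

text \<open>One step beyond the distance of \<open>v\<close> its path has come to rest, and by
  \<open>pt_D\<close> only \<open>v\<close> itself can rest there.\<close>

lemma vertex_eqI:
  assumes "w \<in> M" "pt w (Suc (D (root T) v)) = pt (Vertex v) (Suc (D (root T) v))" shows "w = Vertex v"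
  using pt_D[OF assms(1), of "Suc (D (root T) v)"] assms(2) pt_vertex_ge[of v "Suc (D (root T) v)"] by auto

lemma open_HVertex: "openin (hor_topology p T) {HVertex v}"
proof -
  interpret H: Metric_space HM "theta_h p T" by (rule theta_h_metric)
  have "H.mball (HVertex v) (1 / real p ^ Suc (D (root T) v)) \<subseteq> {HVertex v}"
  proof
    fix z assume "z \<in> H.mball (HVertex v) (1 / real p ^ Suc (D (root T) v))"
    then have z: "z \<in> HM" "theta_h p T (HVertex v) z < 1 / real p ^ Suc (D (root T) v)" by auto
    then have "theta p T (Vertex v) (to_end_pt T z) \<le> 1 / real p ^ Suc (D (root T) v)" by (simp add: theta_h_def)
    then have "pt (Vertex v) (Suc (D (root T) v)) = pt (to_end_pt T z) (Suc (D (root T) v))"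
      using theta_le_iff to_end_pt_M z by (metis Vertex_M)
    then have "to_end_pt T z = Vertex v" using vertex_eqI to_end_pt_M z by metis
    then show "z \<in> {HVertex v}" by (cases z) auto
  qed
  then show ?thesis unfolding hor_topology_def H.openin_mtopology using p_pos
    by (auto intro!: exI[of _ "1 / real p ^ Suc (D (root T) v)"])
qed

lemma lim_HVertex:
  "limitin (hor_topology p T) f (HVertex v) F \<Longrightarrow> \<forall>\<^sub>F i in F. f i = HVertex v"
  using open_HVertex[of v] by (auto simp: limitin_def)

lemma pt_vertex_iff:
  assumes "D (root T) u = n" shows "pt (Vertex v) n = u \<longleftrightarrow> D (root T) u + D u v = D (root T) v"
proof -
  have "u \<in> range (pt (Vertex v)) \<longleftrightarrow> D (root T) u + D u v = D (root T) v"
    using geodesic_vertex[of v] by auto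
  moreover have "u \<in> range (pt (Vertex v)) \<longleftrightarrow> pt (Vertex v) n = u"
    using pt_range[of "Vertex v" u] assms by (metis Vertex_M rangeI)
  ultimately show ?thesis by blast
qed

text \<open>The ray from the root to \<open>\<omega>\<close> reaches level \<open>- n\<close> after
  \<open>n\<close> steps, and the geodesic to \<open>v\<close> follows it exactly up to the
  confluent. Hence convergence to \<open>\<omega>\<close> means that \<open>cl (root T)\<close>
  tends to minus infinity.\<close>

lemma ref_agree: "pt (Vertex v) n = pt (End (ref_end T)) n \<longleftrightarrow> cl (root T) v \<le> - int n"
proof -
  let ?u = "anc (root T) (- int n)"
  have u: "pt (End (ref_end T)) n = ?u" by (simp add: ray_par funpow_anc)
  have lu: "lv ?u = - int n" by (simp add: lv_anc)
  have du: "D (root T) ?u = n" using par_dist[of "root T" n] funpow_anc[of n "root T"] by simp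
  have "int (D (root T) ?u) + int (D ?u v) = int (D (root T) v) \<longleftrightarrow> cl (root T) v \<le> - int n"
    unfolding gdist_cl[of ?u v] gdist_cl[of "root T" v] du using cl_anc[of "- int n" "root T" v] lu
    by (auto simp: min_def)
  then have "D (root T) ?u + D ?u v = D (root T) v \<longleftrightarrow> cl (root T) v \<le> - int n"
    unfolding of_nat_add[symmetric] of_nat_eq_iff .
  then show ?thesis using pt_vertex_iff[OF du, of v] u by simp
qed

lemma lim_Omega_iff:
  "limitin (hor_topology p T) (\<lambda>i. HVertex (v i)) (Omega k) F \<longleftrightarrow>
    (\<forall>c. \<forall>\<^sub>F i in F. cl (root T) (v i) \<le> c) \<and> ((\<lambda>i. squash (Fin (lv (v i)))) \<longlongrightarrow> squash k) F"
proof -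
  have "(\<forall>n. \<forall>\<^sub>F i in F. cl (root T) (v i) \<le> - int n) \<longleftrightarrow> (\<forall>c. \<forall>\<^sub>F i in F. cl (root T) (v i) \<le> c)"
  proof safe
    fix c assume "\<forall>n. \<forall>\<^sub>F i in F. cl (root T) (v i) \<le> - int n"
    then have "\<forall>\<^sub>F i in F. cl (root T) (v i) \<le> - int (nat (- c))" by blast
    then show "\<forall>\<^sub>F i in F. cl (root T) (v i) \<le> c" by (elim eventually_mono) linarith
  qed blast
  then show ?thesis unfolding hor_limit_iff to_end_pt.simps ref_agree by (simp add: hor_eq)
qed

end

section \<open>Compactness and confluents with ends\<close>

context homtree
begin

lemma proper_end_ends: "\<xi> \<in> proper_ends T \<Longrightarrow> \<xi> \<in> ends T"
  by (simp add: proper_ends_def)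

text \<open>A path that never steps to a child is the ray to the reference end. After a step to a
  child the next step cannot lead to the parent, which would be backtracking.\<close>

lemma proper_descends:
  assumes "\<xi> \<in> proper_ends T"
  shows "\<exists>m. \<forall>n\<ge>m. par (ray (root T) \<xi> (Suc n)) = ray (root T) \<xi> n"
proof -
  let ?s = "ray (root T) \<xi>"
  have e: "\<xi> \<in> ends T" "\<xi> \<noteq> ref_end T" using assms by (auto simp: proper_ends_def)
  have nb: "nb_ray ?s" using ray_nb e by blast
  have "\<exists>m. ?s (Suc m) \<noteq> par (?s m)"
  proof (rule ccontr)
    assume "\<not> ?thesis"
    then have "?s n = (par ^^ n) (root T)" for n by (induction n) (auto simp: ray_0[OF e(1)])
    then have "?s = ray (root T) (ref_end T)" using ray_par by auto
    then show False using end_eqI[OF e(1) ref] ray_in[OF e(1)] ray_in[OF ref] e(2) by metis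
  qed
  then obtain m where m: "?s (Suc m) \<noteq> par (?s m)" by blast
  have ad: "par (?s n) = ?s (Suc n) \<or> par (?s (Suc n)) = ?s n" for n using nb adj_par by (auto simp: nb_ray_def)
  have "par (?s (Suc n)) = ?s n" if "m \<le> n" for n
    using that
  proof (induction n rule: dec_induct)
    case base
    then show ?case using ad[of m] m by auto
  next
    case (step n)
    then show ?case using ad[of "Suc n"] nb by (metis nb_ray_def)
  qed
  then show ?thesis by blast
qed

definition dstart :: "(nat \<Rightarrow> 'v) set \<Rightarrow> nat" where
  "dstart \<xi> = (SOME m. \<forall>n\<ge>m. par (ray (root T) \<xi> (Suc n)) = ray (root T) \<xi> n)"

lemma dstart: "\<xi> \<in> proper_ends T \<Longrightarrow> dstart \<xi> \<le> n \<Longrightarrow> par (ray (root T) \<xi> (Suc n)) = ray (root T) \<xi> n"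
  unfolding dstart_def using someI_ex[OF proper_descends] by blast

lemma lv_ray:
  assumes "\<xi> \<in> proper_ends T"
  shows "lv (ray (root T) \<xi> (dstart \<xi> + j)) = lv (ray (root T) \<xi> (dstart \<xi>)) + int j"
proof (induction j)
  case (Suc j)
  then show ?case using dstart[OF assms, of "dstart \<xi> + j"] lv_par[of "ray (root T) \<xi> (Suc (dstart \<xi> + j))"] by simp
qed simp

lemma ray_lv_large:
  assumes "\<xi> \<in> proper_ends T"
  shows "\<forall>\<^sub>F n in sequentially. l \<le> lv (ray (root T) \<xi> n)"
proof (rule eventually_sequentiallyI)
  fix n assume n: "dstart \<xi> + nat (l - lv (ray (root T) \<xi> (dstart \<xi>))) \<le> n"
  then show "l \<le> lv (ray (root T) \<xi> n)" using lv_ray[OF assms, of "n - dstart \<xi>"] by simp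
qed

lemma ray_anc:
  assumes "\<xi> \<in> proper_ends T" "dstart \<xi> \<le> m" "m \<le> n"
  shows "anc (ray (root T) \<xi> n) (lv (ray (root T) \<xi> m)) = ray (root T) \<xi> m \<and> lv (ray (root T) \<xi> m) \<le> lv (ray (root T) \<xi> n)"
  using assms(3)
proof (induction n rule: dec_induct)
  case (step n)
  let ?r = "ray (root T) \<xi>"
  have pr: "par (?r (Suc n)) = ?r n" using dstart[OF assms(1), of n] assms(2) step by simp
  then have l: "lv (?r n) = lv (?r (Suc n)) - 1" using lv_par[of "?r (Suc n)"] by simp
  then have "anc (?r (Suc n)) (lv (?r m)) = anc (?r n) (lv (?r m))"
    using step anc_par[of "lv (?r m)" "?r (Suc n)"] pr by simp
  then show ?case using step l by simp
qed simp

text \<open>Vertices and proper ends are treated alike: a target is approached by a sequence of vertices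
  whose confluents with any fixed vertex are eventually constant.\<close>

definition clE :: "'v \<Rightarrow> (nat \<Rightarrow> 'v) set \<Rightarrow> int" where
  "clE x \<xi> = (THE c. \<forall>\<^sub>F n in sequentially. cl x (ray (root T) \<xi> n) = c)"

text \<open>Once the ray descends and has reached the level of \<open>x\<close>, a further step to a
  child cannot move the confluent.\<close>

lemma cl_ray_eventually:
  assumes "\<xi> \<in> proper_ends T" shows "\<forall>\<^sub>F n in sequentially. cl x (ray (root T) \<xi> n) = clE x \<xi>"
proof -
  let ?r = "ray (root T) \<xi>"
  obtain N where N: "\<And>n. n \<ge> N \<Longrightarrow> lv x \<le> lv (?r n)"
    using ray_lv_large[OF assms] by (auto simp: eventually_sequentially)
  define K where "K = max N (dstart \<xi>)"
  have "cl x (?r n) = cl x (?r K)" if "K \<le> n" for n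
    using that
  proof (induction n rule: dec_induct)
    case (step n)
    have pr: "par (?r (Suc n)) = ?r n" using dstart[OF assms, of n] step by (simp add: K_def)
    have "cl (?r (Suc n)) x \<le> lv (?r (Suc n)) - 1"
      using cl_le2[of "?r (Suc n)" x] N[of n] lv_par[of "?r (Suc n)"] pr step by (simp add: K_def)
    then show ?case using cl_par[of "?r (Suc n)" x] pr step cl_commute by simp
  qed simp
  then have ev: "\<forall>\<^sub>F n in sequentially. cl x (?r n) = cl x (?r K)"
    by (rule eventually_sequentiallyI)
  have "clE x \<xi> = cl x (?r K)" unfolding clE_def
  proof (rule the_equality)
    show "\<forall>\<^sub>F n in sequentially. cl x (?r n) = cl x (?r K)" by (rule ev)
    fix c assume "\<forall>\<^sub>F n in sequentially. cl x (?r n) = c"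
    with ev have "\<forall>\<^sub>F n in sequentially. c = cl x (?r K)" by eventually_elim simp
    then show "c = cl x (?r K)" by simp
  qed
  then show ?thesis using ev by simp
qed

text \<open>The geodesic from the root to \<open>v\<close> uses an edge from a vertex to its child.
  Moving to the child brings \<open>v\<close> closer, which happens only if \<open>v\<close> is the
  child or a descendant of it.\<close>

lemma passes_ray:
  assumes "\<xi> \<in> proper_ends T" "dstart \<xi> \<le> n" "pt (Vertex v) (Suc n) = ray (root T) \<xi> (Suc n)"
  shows "lv (ray (root T) \<xi> (Suc n)) \<le> lv v" "anc v (lv (ray (root T) \<xi> (Suc n))) = ray (root T) \<xi> (Suc n)"
proof -
  let ?r = "ray (root T) \<xi>"
  have e: "\<xi> \<in> ends T" using assms proper_end_ends by blast
  have pn: "pt (Vertex v) n = ?r n"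
    using pt_agree_mono[of "Vertex v" "End \<xi>" "Suc n" n] assms(3) e by (metis End_M Vertex_M le_SucI order_refl pt.simps(2))
  have "D (root T) (?r (Suc n)) + D (?r (Suc n)) v = D (root T) v" "D (root T) (?r n) + D (?r n) v = D (root T) v"
    using pt_vertex_iff[OF ray_dist[OF e]] pn assms(3) by blast+
  then have "int (D (?r n) v) = int (D (?r (Suc n)) v) + 1" using ray_dist[OF e, of "root T"] by simp
  then have "cl (?r (Suc n)) v = lv (?r (Suc n))"
    unfolding gdist_cl using cl_par[of "?r (Suc n)" v] dstart[OF assms(1,2)] lv_par[of "?r (Suc n)"] cl_le1[of "?r (Suc n)" v]
    by (auto simp: min_def split: if_splits)
  then show "lv (?r (Suc n)) \<le> lv v" "anc v (lv (?r (Suc n))) = ?r (Suc n)" using cl_eq_lv_iff by blast+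
qed

text \<open>The geodesics to \<open>v i\<close> eventually pass a vertex of the ray whose level is
  at least \<open>l\<close> and the level of \<open>x\<close>. Its descendants all have the same
  confluent with \<open>x\<close>.\<close>

lemma lim_HEnd:
  assumes "limitin (hor_topology p T) (\<lambda>i. HVertex (v i)) (HEnd \<xi>) F"
  shows "\<forall>\<^sub>F i in F. cl x (v i) = clE x \<xi>" "\<forall>\<^sub>F i in F. l \<le> lv (v i)"
proof -
  let ?r = "ray (root T) \<xi>"
  have x: "\<xi> \<in> proper_ends T" and
    ag: "\<And>n. \<forall>\<^sub>F i in F. pt (Vertex (v i)) n = ?r n"
    using assms unfolding hor_limit_iff by (simp_all del: pt.simps(1))
  have "\<forall>\<^sub>F n in sequentially. max l (lv x) \<le> lv (?r n) \<and> cl x (?r n) = clE x \<xi>"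
    using ray_lv_large[OF x] cl_ray_eventually[OF x] by (rule eventually_conj)
  then obtain N where N: "\<And>n. n \<ge> N \<Longrightarrow> max l (lv x) \<le> lv (?r n) \<and> cl x (?r n) = clE x \<xi>"
    by (auto simp: eventually_sequentially)
  define n where "n = max N (dstart \<xi>)"
  have both: "cl x (v i) = clE x \<xi> \<and> l \<le> lv (v i)" if "pt (Vertex (v i)) (Suc n) = ?r (Suc n)" for i
  proof -
    have 1: "lv (?r (Suc n)) \<le> lv (v i)" "anc (v i) (lv (?r (Suc n))) = ?r (Suc n)"
      using passes_ray[OF x _ that] by (auto simp: n_def)
    have 2: "max l (lv x) \<le> lv (?r (Suc n))" "cl x (?r (Suc n)) = clE x \<xi>" using N[of "Suc n"] by (auto simp: n_def)
    have "cl (?r (Suc n)) x = min (cl (v i) x) (lv (?r (Suc n)))" using cl_anc[OF 1(1), of x] 1(2) by simp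
    then have "cl (?r (Suc n)) x = cl (v i) x" using cl_le2[of "v i" x] 2(1) by simp
    then show ?thesis using 1 2 cl_commute by simp
  qed
  show "\<forall>\<^sub>F i in F. cl x (v i) = clE x \<xi>" "\<forall>\<^sub>F i in F. l \<le> lv (v i)"
    using ag[of "Suc n"] both by (auto elim!: eventually_mono simp del: pt.simps)
qed

lemma ray_tendsto_HEnd:
  assumes "\<xi> \<in> proper_ends T"
  shows "limitin (hor_topology p T) (\<lambda>n. HVertex (ray (root T) \<xi> n)) (HEnd \<xi>) sequentially"
proof -
  have e: "\<xi> \<in> ends T" using assms proper_end_ends by blast
  have "pt (Vertex (ray (root T) \<xi> n)) m = ray (root T) \<xi> m" if "m \<le> n" for m n
    using pt_back[of "End \<xi>" m n] that e ray_dist[OF e] by simp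
  then have "\<forall>\<^sub>F n in sequentially. pt (Vertex (ray (root T) \<xi> n)) m = ray (root T) \<xi> m" for m
    by (intro eventually_sequentiallyI)
  moreover have "(\<lambda>n. squash (Fin (lv (ray (root T) \<xi> n)))) \<longlonglongrightarrow> 1"
    unfolding squash_tendsto_Pinf using ray_lv_large[OF assms] by blast
  ultimately show ?thesis unfolding hor_limit_iff using assms by (simp add: hor_eq del: pt.simps(1))
qed

text \<open>Needed for completeness: a point whose path follows a descending edge of the ray of
  \<open>\<xi>\<close> has at least the level reached there. The points over \<open>\<omega>\<close>
  are excluded because the path has left the ray of the reference end.\<close>

lemma squash_hor_cases:
  assumes "z \<in> HM" "\<xi> \<in> proper_ends T" "dstart \<xi> \<le> n" "pt (to_end_pt T z) (Suc n) = ray (root T) \<xi> (Suc n)"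
    "ray (root T) \<xi> (Suc n) \<noteq> ray (root T) (ref_end T) (Suc n)" "l \<le> lv (ray (root T) \<xi> (Suc n))"
  shows "squash (Fin l) \<le> squash (hor_ext T z)"
proof (cases z)
  case (HVertex v)
  then have "lv (ray (root T) \<xi> (Suc n)) \<le> lv v" using passes_ray(1)[OF assms(2,3)] assms(4) by simp
  then show ?thesis using HVertex assms(6) squash_less_iff[of "lv v" l] by (simp add: hor_eq del: squash.simps)
next
  case (HEnd \<eta>)
  then show ?thesis using squash_abs_less[of l] by (simp del: squash.simps(1))
next
  case (Omega k)
  then show ?thesis using assms by simp
qed

lemma hor_mcomplete: "Metric_space.mcomplete HM (theta_h p T)"
proof -
  interpret H: Metric_space HM "theta_h p T" by (rule theta_h_metric)
  have ht: "hor_topology p T = H.mtopology" by (simp add: hor_topology_def)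
  show ?thesis unfolding H.mcomplete_def ht[symmetric]
  proof (intro allI impI)
    fix \<sigma> :: "nat \<Rightarrow> 'v hor_pt" assume c: "H.MCauchy \<sigma>"
    define w where "w n = to_end_pt T (\<sigma> n)" for n
    define t where "t n = squash (hor_ext T (\<sigma> n))" for n
    have sM: "\<sigma> n \<in> HM" for n using c by (auto simp: H.MCauchy_def)
    have wM: "w n \<in> M" for n using sM to_end_pt_M by (simp add: w_def)
    have ca: "\<exists>N. \<forall>n n'. N \<le> n \<longrightarrow> N \<le> n' \<longrightarrow> theta_h p T (\<sigma> n) (\<sigma> n') < e" if "e > 0" for e
      using c that by (simp add: H.MCauchy_def)
    have "\<exists>u. \<forall>\<^sub>F n in sequentially. pt (w n) j = u" for j
    proof -
      obtain N where N: "\<And>n n'. N \<le> n \<Longrightarrow> N \<le> n' \<Longrightarrow> theta_h p T (\<sigma> n) (\<sigma> n') < 1 / real p ^ j"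
        using ca[of "1 / real p ^ j"] p_pos by auto
      have "pt (w n) j = pt (w N) j" if "N \<le> n" for n
      proof -
        have "theta p T (w n) (w N) \<le> 1 / real p ^ j" using N[OF that order_refl] unfolding theta_h_def w_def by linarith
        then show ?thesis using theta_le_iff wM by blast
      qed
      then show ?thesis by (intro exI[of _ "pt (w N) j"] eventually_sequentiallyI[of N]) blast
    qed
    then obtain r where r: "\<And>j. \<forall>\<^sub>F n in sequentially. pt (w n) j = r j" by metis
    have "Cauchy t"
    proof (rule metric_CauchyI)
      fix e :: real assume "0 < e"
      then obtain N where N: "\<And>n n'. N \<le> n \<Longrightarrow> N \<le> n' \<Longrightarrow> theta_h p T (\<sigma> n) (\<sigma> n') < e" using ca by blast
      have "dist (t m) (t n) < e" if "N \<le> m" "N \<le> n" for m n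
        using N[OF that] theta_nonneg[of "w m" "w n"] unfolding theta_h_def t_def w_def dist_real_def by linarith
      then show "\<exists>N. \<forall>m\<ge>N. \<forall>n\<ge>N. dist (t m) (t n) < e" by blast
    qed
    then obtain s where s: "t \<longlonglongrightarrow> s" using Cauchy_convergent convergent_def by blast
    show "\<exists>z. limitin (hor_topology p T) \<sigma> z sequentially"
    \<comment> \<open>The limiting path \<open>r\<close> either stops, and then the sequence is
      eventually one vertex, or it is a ray and determines the end of the limit.\<close>
    proof (cases "\<exists>j. D (root T) (r j) \<noteq> j")
      case True
      then obtain j where j: "D (root T) (r j) \<noteq> j" by blast
      have "\<forall>\<^sub>F n in sequentially. \<sigma> n = HVertex (r j)"
        using r[of j]
      proof eventually_elim
        case (elim n)
        then have "to_end_pt T (\<sigma> n) = Vertex (r j)" using pt_D[OF wM, of n j] j by (auto simp: w_def)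
        then show ?case by (cases "\<sigma> n") auto
      qed
      then show ?thesis
        by (intro exI[of _ "HVertex (r j)"] limitin_eventually) (auto simp: topspace_hor)
    next
      case False
      then have Dr: "D (root T) (r j) = j" for j by simp
      have bk: "sg (r (Suc j)) = r j" for j
      proof -
        have "\<forall>\<^sub>F n in sequentially. pt (w n) j = r j \<and> pt (w n) (Suc j) = r (Suc j)"
          using r[of j] r[of "Suc j"] by (rule eventually_conj)
        then obtain n where "pt (w n) j = r j" "pt (w n) (Suc j) = r (Suc j)" by (auto simp: eventually_sequentially)
        then show ?thesis using pt_back[OF wM, of j "Suc j" n] Dr by simp
      qed
      have r0: "r 0 = root T" using Dr[of 0] by simp
      have nb: "nb_ray r" unfolding nb_ray_def
      proof (intro allI conjI)
        fix n
        have "r (Suc n) \<noteq> root T" using Dr[of "Suc n"] by auto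
        then show "A (r n) (r (Suc n))" using sg_adj(1)[of "r (Suc n)"] bk adj_sym by simp
        show "r (Suc (Suc n)) \<noteq> r n" using Dr[of n] Dr[of "Suc (Suc n)"] by auto
      qed
      define \<xi> where "\<xi> = class_of r"
      have e: "\<xi> \<in> ends T" "r \<in> \<xi>" using class_of_end[OF nb] by (auto simp: \<xi>_def)
      have ry: "ray (root T) \<xi> = r" using ray_eqI[OF e r0] .
      show ?thesis
      proof (cases "\<xi> = ref_end T")
        case True
        obtain k where k: "s = squash k" using squash_closed[OF s[unfolded t_def]] by blast
        have "limitin (hor_topology p T) \<sigma> (Omega k) sequentially"
          unfolding hor_limit_iff using sM r s[unfolded t_def] k True ry by (simp add: w_def)
        then show ?thesis by blast
      next
        case False
        then have px: "\<xi> \<in> proper_ends T" using e by (simp add: proper_ends_def)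
        obtain i where i: "pt (End \<xi>) i \<noteq> pt (End (ref_end T)) i"
          using pt_differ[of "End \<xi>" "End (ref_end T)"] e ref False by auto
        \<comment> \<open>At a proper end the limit of the levels is not free: following the ray
          pushes the squashed levels above every finite value, which forces
          \<open>s = 1\<close>.\<close>
        have lo: "\<forall>\<^sub>F n in sequentially. squash (Fin l) \<le> t n" for l
        proof -
          obtain N where N: "\<And>n. n \<ge> N \<Longrightarrow> l \<le> lv (r n)"
            using ray_lv_large[OF px] ry by (auto simp: eventually_sequentially)
          define m where "m = max N (max i (dstart \<xi>))"
          have "i \<le> Suc m" by (simp add: m_def)
          then have ne: "ray (root T) \<xi> (Suc m) \<noteq> ray (root T) (ref_end T) (Suc m)"
            using pt_agree_mono[of "End \<xi>" "End (ref_end T)" "Suc m" i] e ref i by auto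
          show ?thesis using r[of "Suc m"]
          proof eventually_elim
            case (elim n)
            then show ?case unfolding t_def using squash_hor_cases[OF sM px, of m n l] ry ne N[of "Suc m"]
              by (simp add: w_def m_def)
          qed
        qed
        have "squash (Fin l) \<le> s" for l
          by (rule tendsto_lowerbound[OF s lo]) simp
        moreover have "\<forall>\<^sub>F n in sequentially. l \<le> int n" for l
          by (rule eventually_sequentiallyI[of "nat l"]) linarith
        then have "(\<lambda>n. squash (Fin (int n))) \<longlonglongrightarrow> 1" unfolding squash_tendsto_Pinf by blast
        ultimately have "1 \<le> s" by (meson LIMSEQ_le_const2)
        moreover have "s \<le> 1"
        proof (rule tendsto_upperbound[OF s])
          have "squash k \<le> 1" for k using squash_abs_less by (cases k) (auto simp: abs_less_iff less_imp_le simp del: squash.simps(1))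
          then show "\<forall>\<^sub>F n in sequentially. t n \<le> 1" by (simp add: t_def)
        qed simp
        ultimately have "s = 1" by simp
        then have "limitin (hor_topology p T) \<sigma> (HEnd \<xi>) sequentially"
          unfolding hor_limit_iff using sM r s[unfolded t_def] px ry by (simp add: w_def)
        then show ?thesis by blast
      qed
    qed
  qed
qed

lemma hor_totally_bounded: "Metric_space.mtotally_bounded HM (theta_h p T) HM"
proof -
  interpret H: Metric_space HM "theta_h p T" by (rule theta_h_metric)
  show ?thesis unfolding H.mtotally_bounded_def
  proof (intro allI impI)
    fix e :: real assume e: "0 < e"
    then have "0 < e / 2" by simp
    then obtain n where n: "1 / real p ^ n < e / 2" using ex_small by blast
    \<comment> \<open>There are finitely many keys: the \<open>n\<close>-th path vertex lies in a
      finite ball, and \<open>squash\<close> falls into one of finitely many cells of width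
      \<open>e / 2\<close>. Points with equal keys are closer than \<open>e\<close>.\<close>
    define key where "key z = (pt (to_end_pt T z) n, \<lfloor>squash (hor_ext T z) / (e / 2)\<rfloor>)" for z
    have sq: "\<bar>squash k\<bar> \<le> 1" for k using squash_abs_less by (cases k) (auto simp: less_imp_le simp del: squash.simps(1))
    have "key ` HM \<subseteq> {u. D (root T) u \<le> n} \<times> {\<lfloor>-1 / (e / 2)\<rfloor> .. \<lfloor>1 / (e / 2)\<rfloor>}"
    proof
      fix y assume "y \<in> key ` HM"
      then obtain z where z: "z \<in> HM" "y = key z" by blast
      have "D (root T) (pt (to_end_pt T z) n) \<le> n" using pt_D[OF to_end_pt_M[OF z(1)], of n] by auto
      moreover have "-1 \<le> squash (hor_ext T z)" "squash (hor_ext T z) \<le> 1" using sq[of "hor_ext T z"] by linarith+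
      then have "-1 / (e / 2) \<le> squash (hor_ext T z) / (e / 2)" "squash (hor_ext T z) / (e / 2) \<le> 1 / (e / 2)"
        using e by (intro divide_right_mono; simp)+
      ultimately show "y \<in> {u. D (root T) u \<le> n} \<times> {\<lfloor>-1 / (e / 2)\<rfloor> .. \<lfloor>1 / (e / 2)\<rfloor>}"
        unfolding z key_def by (auto intro: floor_mono simp del: minus_divide_left)
    qed
    then have fin: "finite (key ` HM)" by (rule finite_subset) (simp add: finite_ball)
    define K where "K = inv_into HM key ` (key ` HM)"
    have "HM \<subseteq> (\<Union>x\<in>K. H.mball x e)"
    proof
      fix z assume z: "z \<in> HM"
      let ?x = "inv_into HM key (key z)"
      have x: "?x \<in> HM" "key ?x = key z" using z by (auto intro: inv_into_into f_inv_into_f)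
      have 1: "pt (to_end_pt T ?x) n = pt (to_end_pt T z) n" using x(2) by (simp add: key_def)
      have 2: "\<lfloor>squash (hor_ext T ?x) / (e / 2)\<rfloor> = \<lfloor>squash (hor_ext T z) / (e / 2)\<rfloor>" using x(2) by (simp add: key_def)
      have "theta p T (to_end_pt T ?x) (to_end_pt T z) \<le> 1 / real p ^ n"
        using theta_le_iff[OF to_end_pt_M[OF x(1)] to_end_pt_M[OF z]] 1 by blast
      moreover have "\<bar>squash (hor_ext T ?x) / (e / 2) - squash (hor_ext T z) / (e / 2)\<bar> < 1"
        using 2 by linarith
      then have "\<bar>squash (hor_ext T ?x) - squash (hor_ext T z)\<bar> < e / 2"
        unfolding diff_divide_distrib[symmetric] abs_divide using e by (simp add: divide_less_eq)
      ultimately have "theta_h p T ?x z < e" using n unfolding theta_h_def by linarith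
      then have "z \<in> H.mball ?x e" using x z by simp
      then show "z \<in> (\<Union>x\<in>K. H.mball x e)" using z by (auto simp: K_def)
    qed
    moreover have "finite K" "K \<subseteq> HM" using fin by (auto simp: K_def intro: inv_into_into)
    ultimately show "\<exists>K. finite K \<and> K \<subseteq> HM \<and> HM \<subseteq> (\<Union>x\<in>K. H.mball x e)" by blast
  qed
qed

lemma hor_compact: "compact_space (hor_topology p T)"
proof -
  interpret H: Metric_space HM "theta_h p T" by (rule theta_h_metric)
  show ?thesis unfolding hor_topology_def H.compact_space_eq_mcomplete_mtotally_bounded
    using hor_mcomplete hor_totally_bounded by blast
qed

lemma hor_metrizable: "metrizable_space (hor_topology p T)"
proof -
  interpret H: Metric_space HM "theta_h p T" by (rule theta_h_metric)
  show ?thesis unfolding hor_topology_def by (rule H.metrizable_space_mtopology)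
qed

section \<open>Confluents with respect to the root and to the reference end compared\<close>

lemma confluent_facts:
  assumes "w \<in> M" "z \<in> M" "w \<noteq> z"
  shows "pt w (D (root T) (confluent T w z)) = confluent T w z"
    "pt z (D (root T) (confluent T w z)) = confluent T w z"
    "pt w n = pt z n \<longleftrightarrow> n \<le> D (root T) (confluent T w z)"
proof -
  obtain N where N: "confluent T w z = pt w N" "\<And>n. pt w n = pt z n \<longleftrightarrow> n \<le> N"
    "D (root T) (confluent T w z) = N" by (rule confluent_theta[OF assms]) blast
  moreover have "pt w N = pt z N" using N(2) by simp
  ultimately show "pt w (D (root T) (confluent T w z)) = confluent T w z"
    "pt z (D (root T) (confluent T w z)) = confluent T w z"
    "pt w n = pt z n \<longleftrightarrow> n \<le> D (root T) (confluent T w z)" by auto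
qed

lemma D_path_incr:
  assumes "w \<in> M" "D x (pt w (Suc m)) = Suc (D x (pt w m))" "D (root T) (pt w (Suc (Suc m))) = Suc (Suc m)"
  shows "D x (pt w (Suc (Suc m))) = Suc (D x (pt w (Suc m)))"
proof -
  let ?a = "pt w m" and ?b = "pt w (Suc m)" and ?c = "pt w (Suc (Suc m))"
  have bc: "?b = sg ?c" "?a = sg (sg ?c)"
    using pt_back[OF assms(1) _ assms(3), of "Suc m"] pt_back[OF assms(1) _ assms(3), of m] by (simp_all add: numeral_2_eq_2 del: pt.simps)
  have db: "D (root T) ?b = Suc m" and da: "D (root T) ?a = m" using bc D_sg assms(3) by simp_all
  have ad: "A ?b ?c" "A ?b ?a"
    using sg_adj(1)[of ?c] sg_adj(1)[of ?b] bc db assms(3) adj_sym gdist_self by (metis nat.distinct(1))+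
  have "?a \<noteq> ?c" using da assms(3) by (metis n_not_Suc_n Suc_n_not_n less_not_refl lessI less_SucI)
  then have "\<not> D x ?c \<le> D x ?b" using closer_unique[OF ad, of x] assms(2) by auto
  then show ?thesis using gdist_adj[OF ad(1), of x] by auto
qed

text \<open>A difference of Busemann type: beyond the confluent of \<open>x\<close> and
  \<open>w\<close> the path runs away from both \<open>x\<close> and the root, so both distances
  grow by 1 per step.\<close>

lemma bus_confluent:
  assumes "w \<in> M" "w \<noteq> Vertex x" "c = confluent T (Vertex x) w" "D (root T) c \<le> m" "D (root T) (pt w m) = m"
  shows "int (D x (pt w m)) - int m = int (D x c) - int (D (root T) c)"
proof -
  define N where "N = D (root T) c"
  have N: "c = pt w N" "D (root T) c = N" "\<And>n. pt (Vertex x) n = pt w n \<longleftrightarrow> n \<le> N"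
    using confluent_facts[of "Vertex x" w] assms(1,2) unfolding assms(3) N_def by (simp_all del: pt.simps)
  have on: "D (root T) c + D c x = D (root T) x"
    using pt_vertex_iff[OF N(2), of x] N(1) N(3)[of N] by simp
  have Dk: "D (root T) (pt w k) = k" if "k \<le> m" for k
    using pt_back[OF assms(1) that assms(5)] D_sgpow[of "m - k" "pt w m"] assms(5) that by (simp del: pt.simps)
  have first: "D x (pt w (Suc N)) = Suc (D x (pt w N))" if "Suc N \<le> m"
  proof -
    have "pt w N = sg (pt w (Suc N))" using pt_back[OF assms(1), of N "Suc N"] Dk[OF that] by (simp del: pt.simps)
    then have "A (pt w N) (pt w (Suc N))" using sg_adj(1)[of "pt w (Suc N)"] Dk[OF that] adj_sym gdist_self by (metis nat.distinct(1))
    moreover have "D x (pt w N) \<noteq> Suc (D x (pt w (Suc N)))"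
    proof
      assume "D x (pt w N) = Suc (D x (pt w (Suc N)))"
      then have "D (root T) (pt w (Suc N)) + D (pt w (Suc N)) x = D (root T) x"
        using on N(1,2) Dk[OF that] gdist_sym by simp
      then have "pt (Vertex x) (Suc N) = pt w (Suc N)" using pt_vertex_iff[OF Dk[OF that]] by blast
      then show False using N(3) by simp
    qed
    ultimately show ?thesis using gdist_adj[of "pt w N" "pt w (Suc N)" x] by auto
  qed
  have "D x (pt w (N + j)) = D x c + j \<and> (N + Suc j \<le> m \<longrightarrow> D x (pt w (N + Suc j)) = D x c + Suc j)" if "N + j \<le> m" for j
    using that
  proof (induction j)
    case 0
    then show ?case using first N(1) by (auto simp del: pt.simps)
  next
    case (Suc j)
    then show ?case using D_path_incr[OF assms(1), of x "N + j"] Dk[of "Suc (Suc (N + j))"] by (auto simp del: pt.simps)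
  qed
  from this[of "m - N"] show ?thesis using assms(4) N(2) by (simp del: pt.simps)
qed

text \<open>Converts between two kinds of confluents: the kernels of the tree walks are stated with
  those relative to the root, while the computations use those relative to
  \<open>\<omega>\<close>.\<close>

lemma cl_confluent:
  assumes "w \<in> M" "w \<noteq> Vertex x" "c = confluent T (Vertex x) w" "D (root T) c \<le> m" "D (root T) (pt w m) = m"
  shows "cl x (pt w m) - cl (root T) (pt w m) = cl x c - cl (root T) c"
  using bus_confluent[OF assms] gdist_cl[of x "pt w m"] gdist_cl[of "root T" "pt w m"]
    gdist_cl[of x c] gdist_cl[of "root T" c] assms(5) by linarith

lemma D_confluent_le:
  assumes "w \<in> M" "w \<noteq> Vertex x" shows "D (root T) (confluent T (Vertex x) w) \<le> D (root T) x"
proof -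
  have "confluent T (Vertex x) w = pt (Vertex x) (D (root T) (confluent T (Vertex x) w))"
    using confluent_facts(1)[of "Vertex x" w] assms by simp
  then show ?thesis using pt_vertex_D[of x] by (metis min.cobounded2)
qed

lemma cl_confluent_vertex:
  assumes "y \<noteq> x" shows "cl x y - cl (root T) y = cl x (confluent T (Vertex x) (Vertex y)) - cl (root T) (confluent T (Vertex x) (Vertex y))"
proof -
  have "confluent T (Vertex x) (Vertex y) = pt (Vertex y) (D (root T) (confluent T (Vertex x) (Vertex y)))"
    using confluent_facts(2)[of "Vertex x" "Vertex y"] assms by simp
  then have "D (root T) (confluent T (Vertex x) (Vertex y)) \<le> D (root T) y"
    using pt_vertex_D[of y] by (metis min.cobounded2)
  then show ?thesis using cl_confluent[of "Vertex y" x _ "D (root T) y"] assms by simp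
qed

lemma cl_confluent_end:
  assumes "\<xi> \<in> proper_ends T"
  shows "clE x \<xi> - clE (root T) \<xi> = cl x (confluent T (Vertex x) (End \<xi>)) - cl (root T) (confluent T (Vertex x) (End \<xi>))"
proof -
  have e: "\<xi> \<in> ends T" using assms proper_end_ends by blast
  have "\<forall>\<^sub>F n in sequentially. cl x (ray (root T) \<xi> n) = clE x \<xi> \<and> cl (root T) (ray (root T) \<xi> n) = clE (root T) \<xi> \<and> D (root T) x \<le> n"
    using cl_ray_eventually[OF assms] eventually_ge_at_top by (intro eventually_conj) auto
  then obtain n where n: "cl x (ray (root T) \<xi> n) = clE x \<xi>" "cl (root T) (ray (root T) \<xi> n) = clE (root T) \<xi>" "D (root T) x \<le> n"
    by (auto simp: eventually_sequentially)
  have "D (root T) (confluent T (Vertex x) (End \<xi>)) \<le> n"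
    using D_confluent_le[of "End \<xi>" x] e n(3) by simp
  then show ?thesis using cl_confluent[of "End \<xi>" x _ n] e ray_dist[OF e] n by simp
qed

text \<open>The confluent with \<open>x\<close> is no farther from the root than \<open>x\<close>,
  so agreement of the paths one step beyond that distance fixes it. This makes the tree kernels
  locally constant near ends.\<close>

lemma confluent_near_end:
  assumes "\<xi> \<in> ends T" "w \<in> M" "pt w (Suc (D (root T) x)) = pt (End \<xi>) (Suc (D (root T) x))"
  shows "w \<noteq> Vertex x" "confluent T (Vertex x) w = confluent T (Vertex x) (End \<xi>)"
proof -
  show ne: "w \<noteq> Vertex x"
    using assms(3) ray_dist[OF assms(1), of "root T" "Suc (D (root T) x)"] by auto
  define N where "N = D (root T) (confluent T (Vertex x) w)"
  have N: "confluent T (Vertex x) w = pt w N" "\<And>n. pt (Vertex x) n = pt w n \<longleftrightarrow> n \<le> N"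
    using confluent_facts[of "Vertex x" w] assms(2) ne unfolding N_def by (simp_all del: pt.simps)
  define K where "K = D (root T) (confluent T (Vertex x) (End \<xi>))"
  have K: "confluent T (Vertex x) (End \<xi>) = pt (End \<xi>) K" "\<And>n. pt (Vertex x) n = pt (End \<xi>) n \<longleftrightarrow> n \<le> K"
    "D (root T) (confluent T (Vertex x) (End \<xi>)) = K"
    using confluent_facts[of "Vertex x" "End \<xi>"] assms(1) unfolding K_def by (simp_all del: pt.simps)
  have Kle: "K \<le> D (root T) x" using D_confluent_le[of "End \<xi>" x] assms(1) K(3) by simp
  have ag: "pt w n = pt (End \<xi>) n" if "n \<le> Suc (D (root T) x)" for n
    using pt_agree_mono[of w "End \<xi>" "Suc (D (root T) x)" n] assms that by simp
  have "K \<le> N" using N(2)[of K] K(2)[of K] ag[of K] Kle by simp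
  moreover have "\<not> Suc K \<le> N" using N(2)[of "Suc K"] K(2)[of "Suc K"] ag[of "Suc K"] Kle by simp
  ultimately have "N = K" by simp
  then show "confluent T (Vertex x) w = confluent T (Vertex x) (End \<xi>)" using N(1) K(1) ag[of K] Kle by simp
qed

lemma continuous_map_end_topology:
  assumes "\<And>\<xi>. \<xi> \<in> ends T \<Longrightarrow> \<exists>n. \<forall>w\<in>M. pt w n = pt (End \<xi>) n \<longrightarrow> f w = f (End \<xi>)"
  shows "continuous_map (end_topology p T) euclideanreal f"
proof -
  interpret E: Metric_space M "theta p T" by (rule theta_metric)
  have loc: "\<exists>n. \<forall>w\<in>M. pt w n = pt z n \<longrightarrow> f w = f z" if "z \<in> M" for z
    using that
  proof (cases rule: M_cases)
    case (1 v)
    then show ?thesis using vertex_eqI by metis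
  qed (use assms in blast)
  have "openin E.mtopology {w \<in> M. f w \<in> U}" for U
    unfolding E.openin_mtopology
  proof (intro conjI allI impI)
    fix z assume "z \<in> {w \<in> M. f w \<in> U}"
    then have z: "z \<in> M" "f z \<in> U" by auto
    then obtain n where n: "\<forall>w\<in>M. pt w n = pt z n \<longrightarrow> f w = f z" using loc by blast
    have "E.mball z (1 / real p ^ n) \<subseteq> {w \<in> M. f w \<in> U}"
    proof
      fix w assume "w \<in> E.mball z (1 / real p ^ n)"
      then have w: "w \<in> M" "theta p T z w \<le> 1 / real p ^ n" by auto
      then have "pt z n = pt w n" using theta_le_iff z by blast
      then have "f w = f z" using n w by simp
      then show "w \<in> {w \<in> M. f w \<in> U}" using w z by simp
    qed
    then show "\<exists>r>0. E.mball z r \<subseteq> {w \<in> M. f w \<in> U}" using p_pos by (intro exI[of _ "1 / real p ^ n"]) simp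
  next
    show "{w \<in> M. f w \<in> U} \<subseteq> M" by blast
  qed
  then show ?thesis by (simp add: end_topology_def continuous_map_def Pi_def)
qed

end

section \<open>Transition matrices of finite range\<close>

locale finite_range_chain =
  fixes X :: "'s set" and P :: "'s \<Rightarrow> 's \<Rightarrow> real"
  assumes P_nonneg: "x \<in> X \<Longrightarrow> z \<in> X \<Longrightarrow> 0 \<le> P x z"
    and finite_range: "x \<in> X \<Longrightarrow> finite {z \<in> X. P x z \<noteq> 0}"
begin

definition nb :: "'s \<Rightarrow> 's set" where "nb x = {z \<in> X. P x z \<noteq> 0}"

lemma finite_nb: "x \<in> X \<Longrightarrow> finite (nb x)" and nb_X: "z \<in> nb x \<Longrightarrow> z \<in> X"
  using finite_range by (auto simp: nb_def)

lemma P_nb_pos: "x \<in> X \<Longrightarrow> z \<in> nb x \<Longrightarrow> 0 < P x z"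
  using P_nonneg[of x z] by (auto simp: nb_def)

lemma has_sum_nb:
  assumes "x \<in> X" shows "((\<lambda>z. P x z * f z) has_sum (\<Sum>z\<in>nb x. P x z * f z)) X"
  by (rule has_sum_finite_neutralI[of "nb x"]) (use assms finite_nb in \<open>auto simp: nb_def\<close>)

lemma infsum_nb: "x \<in> X \<Longrightarrow> infsum (\<lambda>z. P x z * f z) X = (\<Sum>z\<in>nb x. P x z * f z)"
  using has_sum_nb infsumI by blast

lemma harmonic_iff: "harmonic X P h \<longleftrightarrow> (\<forall>x\<in>X. (\<Sum>z\<in>nb x. P x z * h z) = h x)"
  unfolding harmonic_def using has_sum_nb[THEN has_sum_imp_summable] infsum_nb by simp

lemma nstep_Suc: "x \<in> X \<Longrightarrow> nstep X P (Suc n) x y = (\<Sum>z\<in>nb x. P x z * nstep X P n z y)"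
  using infsum_nb by simp

lemma first_passage_Suc:
  "x \<in> X \<Longrightarrow> x \<noteq> y \<Longrightarrow> first_passage X P (Suc n) x y = (\<Sum>z\<in>nb x. P x z * first_passage X P n z y)"
  using infsum_nb by simp

declare nstep.simps(2) [simp del] first_passage.simps(2) [simp del]

lemma nstep_nonneg: "x \<in> X \<Longrightarrow> 0 \<le> nstep X P n x y"
proof (induction n arbitrary: x)
  case (Suc n)
  then show ?case unfolding nstep_Suc[OF Suc.prems]
    by (intro sum_nonneg mult_nonneg_nonneg P_nonneg) (auto dest: nb_X)
qed simp

lemma first_passage_nonneg: "x \<in> X \<Longrightarrow> 0 \<le> first_passage X P n x y"
proof (induction n arbitrary: x)
  case (Suc n)
  show ?case
  proof (cases "x = y")
    case False
    then show ?thesis unfolding first_passage_Suc[OF Suc.prems False]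
      using Suc by (intro sum_nonneg mult_nonneg_nonneg P_nonneg) (auto dest: nb_X)
  qed (simp add: first_passage.simps(2))
qed simp

lemma sum_nstep_Suc:
  assumes "x \<in> X"
  shows "(\<Sum>n<Suc N. nstep X P n x y) = (if x = y then 1 else 0) + (\<Sum>z\<in>nb x. P x z * (\<Sum>n<N. nstep X P n z y))"
proof -
  have "(\<Sum>n<Suc N. nstep X P n x y) = (if x = y then 1 else 0) + (\<Sum>n<N. nstep X P (Suc n) x y)"
    by (subst sum.lessThan_Suc_shift) simp
  also have "(\<Sum>n<N. nstep X P (Suc n) x y) = (\<Sum>z\<in>nb x. P x z * (\<Sum>n<N. nstep X P n z y))"
    unfolding nstep_Suc[OF assms] sum_distrib_left by (rule sum.swap)
  finally show ?thesis .
qed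

text \<open>The Green equation alone does not determine its solution. Under domination by a weight
  that \<open>P\<close> contracts, the error of the \<open>N\<close>-th partial sum is at most
  \<open>C * \<rho> ^ N * w x\<close>, by induction on \<open>N\<close>; summability is part of the
  conclusion.\<close>

lemma nstep_sums_green:
  assumes w: "\<And>x. x \<in> X \<Longrightarrow> (\<Sum>z\<in>nb x. P x z * w z) \<le> \<rho> * w x" and rho: "0 \<le> \<rho>" "\<rho> < 1" and C: "0 \<le> C"
    and eq: "\<And>x. x \<in> X \<Longrightarrow> G x = (if x = y then 1 else 0) + (\<Sum>z\<in>nb x. P x z * G z)"
    and boundary: "\<And>x. x \<in> X \<Longrightarrow> \<bar>G x\<bar> \<le> C * w x"
    and x: "x \<in> X"
  shows "(\<lambda>n. nstep X P n x y) sums G x"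
proof -
  have bound: "\<bar>G x - (\<Sum>n<N. nstep X P n x y)\<bar> \<le> C * \<rho> ^ N * w x" if "x \<in> X" for N x
    using that
  proof (induction N arbitrary: x)
    case 0 then show ?case using boundary by simp
  next
    case (Suc N)
    have "G x - (\<Sum>n<Suc N. nstep X P n x y) = (\<Sum>z\<in>nb x. P x z * (G z - (\<Sum>n<N. nstep X P n z y)))"
      unfolding sum_nstep_Suc[OF Suc.prems] by (subst eq[OF Suc.prems]) (simp add: right_diff_distrib sum_subtractf)
    also have "\<bar>\<dots>\<bar> \<le> (\<Sum>z\<in>nb x. \<bar>P x z * (G z - (\<Sum>n<N. nstep X P n z y))\<bar>)" by (rule sum_abs)
    also have "\<dots> \<le> (\<Sum>z\<in>nb x. P x z * (C * \<rho> ^ N * w z))"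
    proof (rule sum_mono)
      fix z assume z: "z \<in> nb x"
      show "\<bar>P x z * (G z - (\<Sum>n<N. nstep X P n z y))\<bar> \<le> P x z * (C * \<rho> ^ N * w z)"
        using P_nb_pos[OF Suc.prems z] Suc.IH[OF nb_X[OF z]] by (simp add: abs_mult)
    qed
    also have "\<dots> = C * \<rho> ^ N * (\<Sum>z\<in>nb x. P x z * w z)" by (simp add: sum_distrib_left mult_ac)
    also have "\<dots> \<le> C * \<rho> ^ N * (\<rho> * w x)" using w[OF Suc.prems] C rho by (intro mult_left_mono) auto
    finally show ?case by (simp add: mult_ac)
  qed
  have "(\<lambda>N. C * \<rho> ^ N * w x) \<longlonglongrightarrow> C * 0 * w x" by (intro tendsto_intros LIMSEQ_realpow_zero rho)
  then have z: "(\<lambda>N. C * \<rho> ^ N * w x) \<longlonglongrightarrow> 0" by simp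
  have "(\<lambda>N. G x - (\<Sum>n<N. nstep X P n x y)) \<longlonglongrightarrow> 0"
    by (rule Lim_null_comparison[OF _ z]) (use bound[OF x] in auto)
  then have "(\<lambda>N. G x - (G x - (\<Sum>n<N. nstep X P n x y))) \<longlonglongrightarrow> G x - 0"
    by (intro tendsto_intros)
  then show ?thesis by (simp add: sums_def)
qed

lemma nstep_add_ge:
  assumes "x \<in> X" "z \<in> X"
  shows "nstep X P n x z * nstep X P m z y \<le> nstep X P (n + m) x y"
  using assms(1)
proof (induction n arbitrary: x)
  case 0
  then show ?case using nstep_nonneg[of x m y] by auto
next
  case (Suc n)
  have "nstep X P (Suc n) x z * nstep X P m z y = (\<Sum>v\<in>nb x. P x v * (nstep X P n v z * nstep X P m z y))"
    unfolding nstep_Suc[OF Suc.prems] sum_distrib_right by (simp add: mult_ac)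
  also have "\<dots> \<le> (\<Sum>v\<in>nb x. P x v * nstep X P (n + m) v y)"
    using Suc nb_X P_nonneg by (intro sum_mono mult_left_mono) auto
  finally show ?case using nstep_Suc[OF Suc.prems] by simp
qed

lemma nstep_1: assumes "x \<in> X" "y \<in> X" shows "nstep X P (Suc 0) x y = P x y"
proof -
  have "nstep X P (Suc 0) x y = (\<Sum>z\<in>nb x. if z = y then P x z else 0)"
    unfolding nstep_Suc[OF assms(1)] by (rule sum.cong) auto
  then show ?thesis using finite_nb[OF assms(1)] assms by (simp add: nb_def)
qed

lemma irreducibleI:
  assumes "\<And>x y. x \<in> X \<Longrightarrow> y \<in> X \<Longrightarrow> (\<lambda>u v. u \<in> X \<and> v \<in> X \<and> P u v > 0)\<^sup>*\<^sup>* x y"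
  shows "irreducible_chain X P"
  unfolding irreducible_chain_def
proof (intro ballI)
  fix x y assume "x \<in> X" "y \<in> X"
  from assms[OF this] have "\<exists>n. nstep X P n x y > 0"
  proof (induction rule: rtranclp_induct)
    case base show ?case by (intro exI[of _ 0]) simp
  next
    case (step y z)
    then obtain n where "nstep X P n x y > 0" by blast
    then have "0 < nstep X P n x y * nstep X P (Suc 0) y z" using step nstep_1 by simp
    also have "\<dots> \<le> nstep X P (n + Suc 0) x z" using step \<open>x \<in> X\<close> by (intro nstep_add_ge) auto
    finally show ?case by blast
  qed
  then show "\<exists>n. nstep X P n x y > 0" .
qed

section \<open>Transient chains: Green function, hitting probabilities, potentials\<close>

context
  assumes transient: "transient_chain X P"
begin

lemma summable_nstep: "x \<in> X \<Longrightarrow> y \<in> X \<Longrightarrow> summable (\<lambda>n. nstep X P n x y)"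
  using transient by (simp add: transient_chain_def)

lemma green_nonneg: "x \<in> X \<Longrightarrow> y \<in> X \<Longrightarrow> 0 \<le> green X P x y"
  unfolding green_def by (intro suminf_nonneg summable_nstep nstep_nonneg)

lemma green_pos: assumes "irreducible_chain X P" "x \<in> X" "y \<in> X" shows "0 < green X P x y"
proof -
  obtain n where "nstep X P n x y > 0" using assms by (auto simp: irreducible_chain_def)
  then show ?thesis unfolding green_def using suminf_pos_iff summable_nstep nstep_nonneg assms by metis
qed

lemma green_mult_le:
  assumes "x \<in> X" "z \<in> X" "y \<in> X" shows "green X P x z * P z y \<le> green X P x y"
proof -
  have "green X P x z * P z y = (\<Sum>n. nstep X P n x z * P z y)"
    unfolding green_def by (rule suminf_mult2[OF summable_nstep]) (use assms in auto)
  also have "\<dots> \<le> (\<Sum>n. nstep X P (Suc n) x y)"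
  proof (rule suminf_le)
    show "nstep X P n x z * P z y \<le> nstep X P (Suc n) x y" for n
      using nstep_add_ge[OF assms(1,2), of n "Suc 0" y] nstep_1[OF assms(2,3)] by simp
    show "summable (\<lambda>n. nstep X P n x z * P z y)" using summable_nstep assms by (intro summable_mult2) auto
    show "summable (\<lambda>n. nstep X P (Suc n) x y)" using summable_Suc_iff[of "\<lambda>n. nstep X P n x y"] summable_nstep[OF assms(1,3)] by blast
  qed
  also have "\<dots> \<le> green X P x y"
    unfolding green_def using suminf_split_head[OF summable_nstep[OF assms(1,3)]] nstep_nonneg[OF assms(1), of 0 y] by linarith
  finally show ?thesis .
qed

lemma nstep_first_passage:
  assumes "x \<in> X" "y \<in> X"
  shows "nstep X P n x y = (\<Sum>k\<le>n. first_passage X P k x y * nstep X P (n - k) y y)"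
  using assms(1)
proof (induction n arbitrary: x)
  case (Suc n)
  show ?case
  proof (cases "x = y")
    case True
    have "first_passage X P k x y = (if k = 0 then 1 else 0)" for k
      using True by (cases k) (auto simp: first_passage.simps(2))
    then have "(\<Sum>k\<le>Suc n. first_passage X P k x y * nstep X P (Suc n - k) y y)
        = (\<Sum>k\<in>{0}. first_passage X P k x y * nstep X P (Suc n - k) y y)"
      by (intro sum.mono_neutral_right) (auto simp: True)
    then show ?thesis using True by simp
  next
    case False
    have "(\<Sum>k\<le>Suc n. first_passage X P k x y * nstep X P (Suc n - k) y y)
       = (\<Sum>k\<le>n. first_passage X P (Suc k) x y * nstep X P (n - k) y y)"
      using False by (subst sum.atMost_Suc_shift) simp
    also have "\<dots> = (\<Sum>k\<le>n. \<Sum>z\<in>nb x. P x z * (first_passage X P k z y * nstep X P (n - k) y y))"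
      unfolding first_passage_Suc[OF Suc.prems False] sum_distrib_right by (simp add: mult_ac)
    also have "\<dots> = (\<Sum>z\<in>nb x. P x z * nstep X P n z y)"
      by (subst sum.swap) (use Suc.IH nb_X in \<open>simp add: sum_distrib_left\<close>)
    finally show ?thesis using nstep_Suc[OF Suc.prems] by simp
  qed
qed simp

text \<open>The first-passage decomposition is a convolution in time, so summing over time is a
  Cauchy product.\<close>

lemma green_hit_prob:
  assumes "x \<in> X" "y \<in> X" shows "green X P x y = hit_prob X P x y * green X P y y"
proof -
  have le: "first_passage X P n x y \<le> nstep X P n x y" for n
  proof -
    have "first_passage X P n x y = (\<Sum>k\<in>{n}. first_passage X P k x y * nstep X P (n - k) y y)" by simp
    also have "\<dots> \<le> nstep X P n x y" unfolding nstep_first_passage[OF assms]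
      using first_passage_nonneg nstep_nonneg assms by (intro sum_mono2) (auto simp del: nstep.simps)
    finally show ?thesis .
  qed
  have s1: "summable (\<lambda>n. norm (first_passage X P n x y))"
    by (rule summable_comparison_test[OF _ summable_nstep[OF assms]])
      (use le first_passage_nonneg assms in auto)
  have s2: "summable (\<lambda>n. norm (nstep X P n y y))" using summable_nstep[OF assms(2,2)] nstep_nonneg assms by simp
  show ?thesis unfolding green_def hit_prob_def
    using Cauchy_product_sums[OF s1 s2] unfolding nstep_first_passage[OF assms, symmetric] by (simp add: sums_iff)
qed

text \<open>Riesz decomposition: the bound by a function contracted by \<open>P\<close> leaves no harmonic part.\<close>

lemma superharmonic_has_sum:
  assumes w: "\<And>x. x \<in> X \<Longrightarrow> (\<Sum>z\<in>nb x. P x z * w z) \<le> \<rho> * w x" and rho: "0 \<le> \<rho>" "\<rho> < 1" and C: "0 \<le> C"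
    and u: "\<And>x. x \<in> X \<Longrightarrow> 0 \<le> u x" "\<And>x. x \<in> X \<Longrightarrow> u x \<le> C * w x"
    and nu: "\<And>x. x \<in> X \<Longrightarrow> \<nu> x = u x - (\<Sum>z\<in>nb x. P x z * u z)" "\<And>x. x \<in> X \<Longrightarrow> 0 \<le> \<nu> x"
    and x: "x \<in> X"
  shows "((\<lambda>z. \<nu> z * green X P x z) has_sum u x) X"
proof -
  have rec: "(\<Sum>z\<in>B. \<nu> z * (\<Sum>n<Suc N. nstep X P n x z)) =
      (if x \<in> B then \<nu> x else 0) + (\<Sum>v\<in>nb x. P x v * (\<Sum>z\<in>B. \<nu> z * (\<Sum>n<N. nstep X P n v z)))"
    if "x \<in> X" "finite B" for x B N
  proof -
    have "(\<Sum>z\<in>B. \<nu> z * (\<Sum>n<Suc N. nstep X P n x z)) =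
       (\<Sum>z\<in>B. (if x = z then \<nu> z else 0) + (\<Sum>v\<in>nb x. P x v * (\<nu> z * (\<Sum>n<N. nstep X P n v z))))"
      unfolding sum_nstep_Suc[OF that(1)] by (rule sum.cong) (auto simp: distrib_left sum_distrib_left mult_ac)
    also have "\<dots> = (if x \<in> B then \<nu> x else 0) + (\<Sum>z\<in>B. \<Sum>v\<in>nb x. P x v * (\<nu> z * (\<Sum>n<N. nstep X P n v z)))"
      using that(2) by (simp add: sum.distrib)
    also have "(\<Sum>z\<in>B. \<Sum>v\<in>nb x. P x v * (\<nu> z * (\<Sum>n<N. nstep X P n v z))) =
       (\<Sum>v\<in>nb x. P x v * (\<Sum>z\<in>B. \<nu> z * (\<Sum>n<N. nstep X P n v z)))"
      by (subst sum.swap) (simp add: sum_distrib_left)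
    finally show ?thesis .
  qed
  \<comment> \<open>Truncated potentials of finitely many charges stay below \<open>u\<close>, by
    induction on the time horizon.\<close>
  have upper: "(\<Sum>z\<in>B. \<nu> z * (\<Sum>n<N. nstep X P n x z)) \<le> u x" if "x \<in> X" "finite B" "B \<subseteq> X" for x B N
    using that(1)
  proof (induction N arbitrary: x)
    case 0 then show ?case using u by simp
  next
    case (Suc N)
    have "(\<Sum>v\<in>nb x. P x v * (\<Sum>z\<in>B. \<nu> z * (\<Sum>n<N. nstep X P n v z))) \<le> (\<Sum>v\<in>nb x. P x v * u v)"
      using Suc nb_X P_nonneg by (intro sum_mono mult_left_mono) auto
    moreover have "(if x \<in> B then \<nu> x else 0) \<le> \<nu> x" using nu(2)[OF Suc.prems] by simp
    ultimately show ?case using rec[OF Suc.prems that(2)] nu(1)[OF Suc.prems] by simp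
  qed
  \<comment> \<open>Conversely, a finite set of charges depending on the horizon \<open>N\<close>
    recovers \<open>u\<close> up to \<open>C * \<rho> ^ N * w x\<close>; the induction step collects
    \<open>x\<close> and the sets found for its neighbours.\<close>
  have lower: "\<exists>B0. finite B0 \<and> B0 \<subseteq> X \<and> (\<forall>B. finite B \<longrightarrow> B0 \<subseteq> B \<longrightarrow>
      u x - C * \<rho> ^ N * w x \<le> (\<Sum>z\<in>B. \<nu> z * (\<Sum>n<N. nstep X P n x z)))" if "x \<in> X" for x N
    using that
  proof (induction N arbitrary: x)
    case 0 then show ?case using u by (intro exI[of _ "{}"]) auto
  next
    case (Suc N)
    define Q where "Q v B0 \<longleftrightarrow> finite B0 \<and> B0 \<subseteq> X \<and> (\<forall>B. finite B \<longrightarrow> B0 \<subseteq> B \<longrightarrow>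
      u v - C * \<rho> ^ N * w v \<le> (\<Sum>z\<in>B. \<nu> z * (\<Sum>n<N. nstep X P n v z)))" for v B0
    have "\<forall>v\<in>X. \<exists>B0. Q v B0" using Suc.IH unfolding Q_def by blast
    then obtain B0 where "\<forall>v\<in>X. Q v (B0 v)" by (auto dest: bchoice)
    then have B0: "\<And>v. v \<in> X \<Longrightarrow> finite (B0 v) \<and> B0 v \<subseteq> X \<and> (\<forall>B. finite B \<longrightarrow> B0 v \<subseteq> B \<longrightarrow>
      u v - C * \<rho> ^ N * w v \<le> (\<Sum>z\<in>B. \<nu> z * (\<Sum>n<N. nstep X P n v z)))"
      by (simp add: Q_def)
    define B1 where "B1 = insert x (\<Union>v\<in>nb x. B0 v)"
    have "finite B1" "B1 \<subseteq> X" using B0 nb_X finite_nb Suc.prems by (auto simp: B1_def)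
    moreover have "u x - C * \<rho> ^ Suc N * w x \<le> (\<Sum>z\<in>B. \<nu> z * (\<Sum>n<Suc N. nstep X P n x z))"
      if B: "finite B" "B1 \<subseteq> B" for B
    proof -
      have "(\<Sum>v\<in>nb x. P x v * (u v - C * \<rho> ^ N * w v)) \<le> (\<Sum>v\<in>nb x. P x v * (\<Sum>z\<in>B. \<nu> z * (\<Sum>n<N. nstep X P n v z)))"
      proof (rule sum_mono)
        fix v assume v: "v \<in> nb x"
        have "B0 v \<subseteq> B" using B v by (auto simp: B1_def)
        then show "P x v * (u v - C * \<rho> ^ N * w v) \<le> P x v * (\<Sum>z\<in>B. \<nu> z * (\<Sum>n<N. nstep X P n v z))"
          using B0[OF nb_X[OF v]] B(1) P_nonneg[OF Suc.prems nb_X[OF v]] by (intro mult_left_mono) auto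
      qed
      moreover have "(\<Sum>v\<in>nb x. P x v * (u v - C * \<rho> ^ N * w v)) = (\<Sum>v\<in>nb x. P x v * u v) - C * \<rho> ^ N * (\<Sum>v\<in>nb x. P x v * w v)"
        by (simp add: right_diff_distrib sum_subtractf sum_distrib_left mult_ac)
      moreover have "C * \<rho> ^ N * (\<Sum>v\<in>nb x. P x v * w v) \<le> C * \<rho> ^ N * (\<rho> * w x)"
        using w[OF Suc.prems] C rho by (intro mult_left_mono) auto
      moreover have "x \<in> B" using B by (auto simp: B1_def)
      ultimately show ?thesis using rec[OF Suc.prems B(1), of N] nu(1)[OF Suc.prems] by (simp add: mult_ac)
    qed
    ultimately show ?case by blast
  qed
  let ?f = "\<lambda>z. \<nu> z * green X P x z"
  have lim: "(\<lambda>N. \<Sum>z\<in>B. \<nu> z * (\<Sum>n<N. nstep X P n x z)) \<longlonglongrightarrow> sum ?f B" if "B \<subseteq> X" for B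
    unfolding green_def using that summable_nstep[OF x] by (intro tendsto_intros summable_LIMSEQ) auto
  have ub: "sum ?f B \<le> u x" if "finite B" "B \<subseteq> X" for B
    by (rule LIMSEQ_le_const2[OF lim]) (use upper[OF x] that in auto)
  have f0: "0 \<le> ?f z" if "z \<in> X" for z using nu(2) green_nonneg x that by simp
  have hs: "(?f has_sum (SUP B\<in>{B. finite B \<and> B \<subseteq> X}. sum ?f B)) X"
    by (rule nonneg_bdd_above_has_sum) (use f0 ub in \<open>auto intro!: bdd_aboveI[of _ "u x"]\<close>)
  moreover have "(SUP B\<in>{B. finite B \<and> B \<subseteq> X}. sum ?f B) = u x" (is "?S = _")
  proof (rule antisym)
    show "?S \<le> u x" by (rule cSUP_least) (use ub in auto)
    have le: "u x - C * \<rho> ^ N * w x \<le> ?S" for N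
    proof -
      obtain B where B: "finite B" "B \<subseteq> X" "u x - C * \<rho> ^ N * w x \<le> (\<Sum>z\<in>B. \<nu> z * (\<Sum>n<N. nstep X P n x z))"
        using lower[OF x, of N] by blast
      have "(\<Sum>z\<in>B. \<nu> z * (\<Sum>n<N. nstep X P n x z)) \<le> sum ?f B"
        unfolding green_def using nu(2) B x summable_nstep nstep_nonneg
        by (intro sum_mono mult_left_mono sum_le_suminf) auto
      also have "\<dots> \<le> ?S" by (rule cSUP_upper) (use B ub in \<open>auto intro!: bdd_aboveI[of _ "u x"]\<close>)
      finally show ?thesis using B by linarith
    qed
    have "(\<lambda>N. u x - C * \<rho> ^ N * w x) \<longlonglongrightarrow> u x - C * 0 * w x" by (intro tendsto_intros LIMSEQ_realpow_zero rho)
    then show "u x \<le> ?S" using le by (intro LIMSEQ_le_const2[of "\<lambda>N. u x - C * \<rho> ^ N * w x"]) auto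
  qed
  ultimately show ?thesis by simp
qed

text \<open>By the Riesz decomposition \<open>u a\<close> and \<open>u b\<close> are sums of
  \<open>green X P a\<close> and \<open>green X P b\<close> against the same charge, so a comparison
  of the Green functions on the support of the charge carries over to \<open>u\<close>.\<close>

lemma potential_ratio:
  assumes w: "\<And>x. x \<in> X \<Longrightarrow> (\<Sum>z\<in>nb x. P x z * w z) \<le> \<rho> * w x" and rho: "0 \<le> \<rho>" "\<rho> < 1" and C: "0 \<le> C"
    and u: "\<And>x. x \<in> X \<Longrightarrow> 0 \<le> u x" "\<And>x. x \<in> X \<Longrightarrow> u x \<le> C * w x"
    and super: "\<And>x. x \<in> X \<Longrightarrow> (\<Sum>z\<in>nb x. P x z * u z) \<le> u x"
    and ab: "a \<in> X" "b \<in> X"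
    and near: "\<And>y. y \<in> X \<Longrightarrow> (\<Sum>z\<in>nb y. P y z * u z) \<noteq> u y \<Longrightarrow> \<bar>green X P a y - \<kappa> * green X P b y\<bar> \<le> \<epsilon> * green X P b y"
  shows "\<bar>u a - \<kappa> * u b\<bar> \<le> \<epsilon> * u b"
proof -
  define \<nu> where "\<nu> x = u x - (\<Sum>z\<in>nb x. P x z * u z)" for x
  have hs: "((\<lambda>z. \<nu> z * green X P x z) has_sum u x) X" if "x \<in> X" for x
    by (rule superharmonic_has_sum[OF w rho C u]) (use super that in \<open>auto simp: \<nu>_def\<close>)
  have d: "((\<lambda>z. \<nu> z * green X P a z + (- \<kappa>) * (\<nu> z * green X P b z)) has_sum (u a + (- \<kappa>) * u b)) X"
    by (intro has_sum_add has_sum_cmult_right hs ab)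
  have e: "((\<lambda>z. \<epsilon> * (\<nu> z * green X P b z)) has_sum (\<epsilon> * u b)) X" "((\<lambda>z. (- \<epsilon>) * (\<nu> z * green X P b z)) has_sum ((- \<epsilon>) * u b)) X"
    by (intro has_sum_cmult_right hs ab)+
  have pw: "\<bar>\<nu> z * green X P a z + (- \<kappa>) * (\<nu> z * green X P b z)\<bar> \<le> \<epsilon> * (\<nu> z * green X P b z)" if "z \<in> X" for z
  proof (cases "\<nu> z = 0")
    case False
    then have "\<bar>green X P a z - \<kappa> * green X P b z\<bar> \<le> \<epsilon> * green X P b z" using near[OF that] by (auto simp: \<nu>_def)
    moreover have "0 \<le> \<nu> z" using super that by (simp add: \<nu>_def)
    ultimately have "\<nu> z * \<bar>green X P a z - \<kappa> * green X P b z\<bar> \<le> \<nu> z * (\<epsilon> * green X P b z)" by (intro mult_left_mono)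
    moreover have "\<nu> z * \<bar>green X P a z - \<kappa> * green X P b z\<bar> = \<bar>\<nu> z * green X P a z + (- \<kappa>) * (\<nu> z * green X P b z)\<bar>"
      using \<open>0 \<le> \<nu> z\<close> by (simp add: abs_mult_pos' algebra_simps flip: abs_mult_pos)
    ultimately show ?thesis by (simp add: mult_ac)
  qed simp
  have "u a + (- \<kappa>) * u b \<le> \<epsilon> * u b" by (rule has_sum_mono[OF d e(1)]) (use pw in \<open>auto simp: abs_le_iff\<close>)
  moreover have "(- \<epsilon>) * u b \<le> u a + (- \<kappa>) * u b"
  proof (rule has_sum_mono[OF e(2) d])
    fix z assume "z \<in> X"
    from pw[OF this] show "(- \<epsilon>) * (\<nu> z * green X P b z) \<le> \<nu> z * green X P a z + (- \<kappa>) * (\<nu> z * green X P b z)" by linarith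
  qed
  ultimately show ?thesis by linarith
qed

end
end

section \<open>The walk on a tree\<close>

lemma powi_nat_diff: "x \<noteq> 0 \<Longrightarrow> x powi (int m - int n) = x ^ m / x ^ n" for x :: real
  by (simp add: power_int_diff)

context htree
begin

lemma lv_child: "par z = x \<Longrightarrow> lv z = lv x + 1"
  using lv_par[of z] by simp

lemma cl_child:
  assumes "par z = x"
  shows "cl z y = (if cl x y < lv x then cl x y else if lv x < lv y \<and> z = anc y (lv x + 1) then lv x + 1 else lv x)"
proof -
  have m: "cl x y = min (cl z y) (lv x)" using cl_par[of z y] assms lv_child[OF assms] by simp
  have "lv x + 1 \<le> cl z y \<longleftrightarrow> lv x < lv y \<and> z = anc y (lv x + 1)"
    unfolding cl_iff using lv_child[OF assms] anc_self[of z] by auto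
  then show ?thesis using m cl_le1[of z y] lv_child[OF assms] by (auto simp: min_def split: if_splits)
qed

lemma anc_child: "cl x y = lv x \<Longrightarrow> lv x < lv y \<Longrightarrow> par (anc y (lv x + 1)) = x"
  using par_anc[of "lv x + 1" y] cl_eq_lv_iff[of x y] by simp

text \<open>The function \<open>fk y i\<close> lives on the descendants of the ancestor of \<open>y\<close> at level \<open>i - 1\<close> and has mean
  zero over the children of that vertex.\<close>

definition fk :: "'v \<Rightarrow> int \<Rightarrow> 'v \<Rightarrow> real" where
  "fk y i x = (if i \<le> cl x y then real p powi (i - lv y) else 0) - (if i - 1 \<le> cl x y then real p powi (i - 1 - lv y) else 0)"

lemma real_p: "real p \<noteq> 0" "real p > 0" "real p \<ge> 2" "real p > 1" using p_ge2 by auto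

lemma fk_child: "par z = x \<Longrightarrow> i \<le> lv x \<Longrightarrow> fk y i z = fk y i x"
  using cl_par[of z y] lv_child[of z x] by (simp add: fk_def)

text \<open>If \<open>x\<close> is an ancestor of \<open>y\<close>, one of its \<open>p\<close>
  children receives the positive indicator, while all of them receive the negative one, whose weight
  is smaller by the factor \<open>p\<close>. Otherwise every term is zero.\<close>

lemma fk_sum:
  assumes "lv x = i - 1" "i \<le> lv y" shows "(\<Sum>z | par z = x. fk y i z) = 0"
proof (cases "cl x y = lv x")
  case True
  let ?c = "anc y i"
  have c: "par ?c = x" using anc_child[OF True] assms by simp
  have v: "fk y i z = (if z = ?c then real p powi (i - lv y) else 0) - real p powi (i - 1 - lv y)" if "par z = x" for z
    using cl_child[OF that, of y] True assms by (auto simp: fk_def)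
  have "(\<Sum>z | par z = x. fk y i z) = (\<Sum>z | par z = x. (if z = ?c then real p powi (i - lv y) else 0) - real p powi (i - 1 - lv y))"
    by (rule sum.cong) (auto simp: v)
  also have "\<dots> = real p powi (i - lv y) - real p * real p powi (i - 1 - lv y)"
    using finite_children[of x] c card_children[of x] by (simp add: sum_subtractf)
  also have "\<dots> = 0" using real_p power_int_add_1'[of "real p" "i - 1 - lv y"] by simp
  finally show ?thesis .
next
  case False
  then have "cl x y < lv x" using cl_le1[of x y] by simp
  then have "fk y i z = 0" if "par z = x" for z
    using cl_child[OF that, of y] assms by (simp add: fk_def)
  then show ?thesis by simp
qed

lemma fk_zero: "cl x y < i - 1 \<Longrightarrow> fk y i x = 0"
  by (simp add: fk_def)

lemma fk_zero_lv: "lv x < i - 1 \<Longrightarrow> fk y i x = 0"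
  using cl_le1[of x y] by (intro fk_zero) simp

lemma fk_bound: "\<bar>fk y (lv y - int m) x\<bar> \<le> 2 / real p ^ m"
proof -
  have 1: "real p powi (lv y - int m - lv y) = 1 / real p ^ m"
    by (simp add: power_int_minus divide_simps)
  have "real p powi (lv y - int m - 1 - lv y) = 1 / real p ^ Suc m"
    by (simp add: power_int_minus power_int_def nat_add_distrib divide_simps)
  also have "\<dots> \<le> 1 / real p ^ m" using real_p by (intro divide_left_mono power_increasing mult_pos_pos) auto
  finally have 2: "real p powi (lv y - int m - 1 - lv y) \<le> 1 / real p ^ m" .
  define t s where "t = real p powi (lv y - int m - 1 - lv y)" and "s = 1 / real p ^ m"
  have "0 \<le> t" "t \<le> s" "2 / real p ^ m = 2 * s" using 2 by (simp_all add: t_def s_def)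
  then show ?thesis unfolding fk_def 1 t_def[symmetric] s_def[symmetric] by auto
qed

text \<open>On the level of \<open>y\<close> these are the martingale differences of the point mass
  at \<open>y\<close> for the partitions by common ancestors; the series telescopes and the
  remainder decays like a power of \<open>1 / p\<close>.\<close>

lemma fk_sums:
  assumes "lv x = lv y" shows "(\<lambda>m. fk y (lv y - int m) x) sums (if x = y then 1 else 0)"
proof -
  define h where "h m = (if lv y - int m \<le> cl x y then real p powi (- int m) else 0)" for m
  have f: "fk y (lv y - int m) x = h m - h (Suc m)" for m
    unfolding fk_def h_def by (simp add: algebra_simps)
  have "h \<longlonglongrightarrow> 0"
  proof (rule Lim_null_comparison)
    show "\<forall>\<^sub>F m in sequentially. norm (h m) \<le> (1 / real p) ^ m"
      by (simp add: h_def power_int_minus power_one_over inverse_eq_divide)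
    show "(\<lambda>m. (1 / real p) ^ m) \<longlonglongrightarrow> 0" by (intro LIMSEQ_realpow_zero) (use real_p in auto)
  qed
  then have "(\<lambda>m. h m - h (Suc m)) sums (h 0 - 0)" by (rule telescope_sums')
  moreover have "h 0 = (if x = y then 1 else 0)"
    using cl_le1[of x y] cl_eq_lv_same[OF assms] assms by (auto simp: h_def)
  ultimately show ?thesis using f by simp
qed

end

text \<open>\<open>sqrt ((1 - a) / a)\<close> minimizes \<open>a * t + (1 - a) / t\<close> over
  positive \<open>t\<close>, so among geometric weights its powers are contracted most by the level
  process.\<close>

lemma drift_sqrt:
  fixes a :: real assumes "0 < a" "a < 1"
  defines "t \<equiv> sqrt ((1 - a) / a)"
  shows "a * t + (1 - a) / t = 2 * sqrt (a * (1 - a))" "0 < t"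
proof -
  show t: "0 < t" using assms by simp
  have 1: "a * t = sqrt (a * (1 - a))"
  proof -
    have "a * t = sqrt (a ^ 2) * t" using assms(1) by simp
    also have "\<dots> = sqrt (a ^ 2 * ((1 - a) / a))" unfolding t_def by (simp only: real_sqrt_mult)
    also have "a ^ 2 * ((1 - a) / a) = a * (1 - a)" using assms by (simp add: power2_eq_square)
    finally show ?thesis .
  qed
  have "(1 - a) / t = a * t ^ 2 / t" unfolding t_def using assms by simp
  also have "\<dots> = a * t" using t by (simp add: power2_eq_square)
  finally show "a * t + (1 - a) / t = 2 * sqrt (a * (1 - a))" using 1 by simp
qed

lemma sqrt_drift_less: fixes a :: real assumes "0 < a" "a < 1" "a \<noteq> 1 / 2" shows "2 * sqrt (a * (1 - a)) < 1"
proof -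
  have "(2 * a - 1) ^ 2 > 0" using assms by simp
  then have "a * (1 - a) < (1 / 2) ^ 2" by (simp add: power2_eq_square algebra_simps)
  then have "sqrt (a * (1 - a)) < 1 / 2" using real_sqrt_less_mono by fastforce
  then show ?thesis by simp
qed

locale tree_rw = homtree T p for T :: "'v tree" and p +
  fixes a :: real assumes a: "0 < a" "a < 1" "a \<noteq> 1 / 2"
begin

abbreviation P where "P \<equiv> tree_walk a p T"

lemma P_eq: "P v w = (if par w = v then a / real p else if w = par v then 1 - a else 0)"
  by (simp add: tree_walk_def pred_vertex_eq)

lemma par_not_child: "par (par x) \<noteq> x"
  using lv_par[of x] lv_par[of "par x"] by force

lemma supp: "{z \<in> UNIV. P x z \<noteq> 0} = insert (par x) {z. par z = x}"
  using a real_p by (auto simp: P_eq)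

sublocale C: finite_range_chain UNIV P
proof
  show "0 \<le> P x z" for x z using a by (simp add: P_eq)
  show "finite {z \<in> UNIV. P x z \<noteq> 0}" for x unfolding supp using finite_children by simp
qed

lemma sum_nb: "(\<Sum>z\<in>C.nb x. P x z * f z) = a / real p * (\<Sum>z | par z = x. f z) + (1 - a) * f (par x)"
proof -
  have "(\<Sum>z\<in>C.nb x. P x z * f z) = P x (par x) * f (par x) + (\<Sum>z | par z = x. P x z * f z)"
    unfolding C.nb_def supp using finite_children par_not_child[of x] by (subst sum.insert) auto
  also have "P x (par x) = 1 - a" using par_not_child by (simp add: P_eq)
  also have "(\<Sum>z | par z = x. P x z * f z) = (\<Sum>z | par z = x. a / real p * f z)"
    by (rule sum.cong) (auto simp: P_eq)
  finally show ?thesis by (simp add: sum_distrib_left)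
qed

definition b where "b = (1 - a) / a"
text \<open>\<open>Fm\<close> and \<open>Fp\<close> turn out to be the probabilities of ever hitting
  the parent, and of ever hitting a given child from its parent (\<open>hit_prob_eq\<close>);
  \<open>1 / cG\<close> is the probability of never returning. They are introduced in closed form
  and checked against first-step equations.\<close>

definition Fm where "Fm = min 1 b"
definition Fp where "Fp = 1 / (real p * max 1 b)"
definition w where "w x = sqrt b powi lv x"
definition cG where "cG = 1 / (1 - (1 - a) * Fp - a * Fm)"
definition \<phi> where "\<phi> x y = Fm powi (lv x - cl x y) * Fp powi (lv y - cl x y)"

lemma b_pos: "b > 0" using a by (simp add: b_def)
lemma ab: "a * b = 1 - a" using a by (simp add: b_def)
lemma F_pos: "Fm > 0" "Fp > 0" using b_pos real_p by (auto simp: Fm_def Fp_def)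

lemma Fm_eq: "Fm = a * Fm ^ 2 + (1 - a)"
proof (cases "b \<le> 1")
  case True
  have "b = a * b * b + a * b" using a by (simp add: b_def field_simps)
  moreover have e: "a * b ^ 2 = a * b * b" by (simp add: power2_eq_square)
  moreover have "Fm = b" using True by (simp add: Fm_def)
  ultimately show ?thesis using ab by simp
qed (simp add: Fm_def)

text \<open>The first-step equation times \<open>p\<close>: from the parent the walk either moves up
  and has to make up two levels, or hits the child at once, or enters one of the
  \<open>p - 1\<close> siblings and has to come back first.\<close>

lemma Fp_eq: "real p * Fp = real p * (1 - a) * Fp ^ 2 + a * (1 + (real p - 1) * Fm * Fp)"
proof -
  have p: "real p > 0" by (rule real_p)
  show ?thesis
  proof (cases "b \<le> 1")
    case True
    then have F: "Fm = b" "Fp = 1 / real p" by (simp_all add: Fm_def Fp_def)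
    have "real p * (1 - a) * Fp ^ 2 + a * (1 + (real p - 1) * Fm * Fp) = (1 - a) / real p + a + (a * b) * (real p - 1) / real p"
      unfolding F using p by (simp add: power2_eq_square field_simps)
    also have "\<dots> = 1" unfolding ab using p by (simp add: field_simps)
    finally show ?thesis unfolding F using p by simp
  next
    case False
    then have F: "Fm = 1" "Fp = 1 / (real p * b)" by (simp_all add: Fm_def Fp_def max_def)
    have "real p * (1 - a) * Fp ^ 2 + a * (1 + (real p - 1) * Fm * Fp) = (a * b) / (real p * b * b) + a + a * (real p - 1) / (real p * b)"
      unfolding F ab using p b_pos by (simp add: power2_eq_square field_simps)
    also have "\<dots> = (a + a * b) / b" using p b_pos by (simp add: field_simps)
    also have "\<dots> = 1 / b" using ab by simp
    finally show ?thesis unfolding F using p b_pos by simp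
  qed
qed

lemma cG_pos: "cG > 0" and cG_eq: "cG = 1 + (1 - a) * (cG * Fp) + a * (cG * Fm)"
proof -
  have h: "1 / real p + 1 \<le> 3 / 2" using real_p by (simp add: field_simps)
  have "(1 - a) * Fp + a * Fm < 1"
  proof (cases "b \<le> 1")
    case True
    have "1 - a \<le> a" using True a by (simp add: b_def)
    then have "a > 1 / 2" using a by auto
    moreover have "(1 - a) * Fp + a * Fm = (1 - a) * (1 / real p + 1)" using True ab by (simp add: Fm_def Fp_def algebra_simps)
    moreover have "(1 - a) * (1 / real p + 1) \<le> (1 - a) * (3 / 2)" by (rule mult_left_mono[OF h]) (use a in simp)
    moreover have "(1 - a) * (3 / 2) < 1" using \<open>a > 1 / 2\<close> by simp
    ultimately show ?thesis by (metis le_less_trans)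
  next
    case False
    have "a \<le> 1 - a" using False a by (simp add: b_def)
    then have "a < 1 / 2" using a by auto
    moreover have "(1 - a) * Fp + a * Fm = a * (1 / real p + 1)"
    proof -
      have F: "Fp = 1 / (real p * b)" "Fm = 1" using False by (simp_all add: Fm_def Fp_def max_def)
      have "(1 - a) * Fp = a / real p" unfolding F ab[symmetric] using b_pos by simp
      then show ?thesis using F by (simp add: algebra_simps)
    qed
    moreover have "a * (1 / real p + 1) \<le> a * (3 / 2)" by (rule mult_left_mono[OF h]) (use a in simp)
    moreover have "a * (3 / 2) < 1" using \<open>a < 1 / 2\<close> by simp
    ultimately show ?thesis by (metis le_less_trans)
  qed
  then have *: "1 - (1 - a) * Fp - a * Fm > 0" by simp
  then show "cG > 0" by (simp add: cG_def)
  show "cG = 1 + (1 - a) * (cG * Fp) + a * (cG * Fm)"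
    using * unfolding cG_def by (simp add: field_simps)
qed

lemma w_sum: "(\<Sum>z\<in>C.nb x. P x z * w z) = 2 * sqrt (a * (1 - a)) * w x"
proof -
  have t: "sqrt b > 0" using b_pos by simp
  have "w z = sqrt b * w x" if "par z = x" for z
    using lv_child[OF that] t by (simp add: w_def power_int_add)
  then have "(\<Sum>z | par z = x. w z) = (\<Sum>z | par z = x. sqrt b * w x)"
    by (intro sum.cong) auto
  then have "(\<Sum>z | par z = x. w z) = real p * (sqrt b * w x)" using card_children[of x] by simp
  moreover have "w (par x) = w x / sqrt b" using t by (simp add: w_def power_int_diff)
  ultimately have "(\<Sum>z\<in>C.nb x. P x z * w z) = (a * sqrt b + (1 - a) / sqrt b) * w x"
    unfolding sum_nb using real_p by (simp add: algebra_simps)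
  then show ?thesis using drift_sqrt(1)[OF a(1,2)] by (simp add: b_def)
qed

text \<open>\<open>Fm \<le> sqrt b\<close> and \<open>Fp \<le> 1 / sqrt b\<close>, so the product
  along the path is at most \<open>sqrt b\<close> to the difference of the levels.\<close>

lemma \<phi>_bound: "\<bar>\<phi> x y\<bar> \<le> sqrt b powi (- lv y) * w x"
proof -
  obtain u d :: nat where ud: "lv x - cl x y = int u" "lv y - cl x y = int d"
    using cl_le1[of x y] cl_le2[of x y] by (metis diff_ge_0_iff_ge zero_le_imp_eq_int)
  have t: "sqrt b > 0" using b_pos by simp
  have "Fm \<le> sqrt b"
  proof (cases "b \<le> 1")
    case True
    then have "sqrt b \<le> 1" by simp
    then have "sqrt b * sqrt b \<le> 1 * sqrt b" using t by (intro mult_right_mono) auto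
    moreover have "sqrt b * sqrt b = b" using b_pos by simp
    ultimately have "b \<le> sqrt b" by linarith
    then show ?thesis by (simp add: Fm_def)
  qed (simp add: Fm_def)
  then have 1: "Fm ^ u \<le> sqrt b ^ u" using F_pos by (intro power_mono) auto
  have "sqrt b \<le> real p * max 1 b"
  proof -
    have "sqrt b \<le> max 1 b"
    proof (cases "b \<le> 1")
      case False
      then have "1 * sqrt b \<le> sqrt b * sqrt b" by (intro mult_right_mono) auto
      then show ?thesis using b_pos by simp
    qed (simp add: max_def)
    also have "\<dots> \<le> real p * max 1 b" using real_p b_pos by (simp add: mult_le_cancel_right1)
    finally show ?thesis .
  qed
  then have "Fp \<le> 1 / sqrt b" unfolding Fp_def using t real_p by (intro divide_left_mono mult_pos_pos) auto
  then have 2: "Fp ^ d \<le> (1 / sqrt b) ^ d" using F_pos by (intro power_mono) auto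
  have "\<bar>\<phi> x y\<bar> = Fm ^ u * Fp ^ d" unfolding \<phi>_def ud using F_pos by simp
  also have "\<dots> \<le> sqrt b ^ u * (1 / sqrt b) ^ d" using 1 2 F_pos t by (intro mult_mono) auto
  also have "\<dots> = sqrt b powi (int u - int d)" using t powi_nat_diff[of "sqrt b" u d] by (simp add: power_one_over)
  also have "int u - int d = - lv y + lv x" using ud by simp
  also have "sqrt b powi (- lv y + lv x) = sqrt b powi (- lv y) * w x" unfolding w_def by (rule power_int_add) (use t in auto)
  finally show ?thesis .
qed

lemma \<phi>_rec: "cG * \<phi> x y = (if x = y then 1 else 0) + (\<Sum>z\<in>C.nb x. P x z * (cG * \<phi> z y))"
proof -
  define u where "u = lv x - cl x y"
  define d where "d = lv y - cl x y"
  note nz = F_pos[THEN less_imp_neq, symmetric]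
  \<comment> \<open>The cases are: \<open>x\<close> off the line of ancestors of \<open>y\<close>, a
    proper ancestor of \<open>y\<close>, or \<open>y\<close> itself.\<close>
  consider "cl x y < lv x" | "cl x y = lv x" "lv x < lv y" | "cl x y = lv x" "lv x = lv y"
    using cl_le1[of x y] cl_le2[of x y] by linarith
  then show ?thesis
  proof cases
    case 1
    have c: "\<phi> z y = Fm * \<phi> x y" if "par z = x" for z
    proof -
      have e: "lv z - cl z y = (lv x - cl x y) + 1" "lv y - cl z y = lv y - cl x y"
        using 1 cl_child[OF that, of y] lv_child[OF that] by simp_all
      show ?thesis by (simp only: \<phi>_def e power_int_add_1[OF disjI1[OF nz(1)]] mult_ac)
    qed
    have pa: "\<phi> (par x) y = \<phi> x y / Fm" using 1 cl_par[of x y] nz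
      by (simp add: \<phi>_def power_int_diff min_def)
    have "(\<Sum>z\<in>C.nb x. P x z * (cG * \<phi> z y)) = cG * \<phi> x y * (a * Fm + (1 - a) / Fm)"
      unfolding sum_nb using c pa card_children[of x] real_p by (simp add: algebra_simps)
    also have "a * Fm + (1 - a) / Fm = (a * Fm ^ 2 + (1 - a)) / Fm" using nz by (simp add: power2_eq_square add_divide_distrib)
    also have "\<dots> = 1" using Fm_eq nz by simp
    finally show ?thesis using 1 by auto
  next
    case 2
    let ?c = "anc y (lv x + 1)"
    have pc: "par ?c = x" using anc_child 2 by blast
    have x: "\<phi> x y = Fp powi (lv y - lv x)" using 2 by (simp add: \<phi>_def)
    have v: "\<phi> z y = (if z = ?c then \<phi> x y / Fp - Fm * \<phi> x y else 0) + Fm * \<phi> x y" if "par z = x" for z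
      using cl_child[OF that, of y] lv_child[OF that] 2 nz by (simp add: \<phi>_def power_int_diff power_int_add)
    have "(\<Sum>z | par z = x. \<phi> z y) = (\<Sum>z | par z = x. (if z = ?c then \<phi> x y / Fp - Fm * \<phi> x y else 0) + Fm * \<phi> x y)"
      by (rule sum.cong) (auto simp: v)
    also have "\<dots> = \<phi> x y / Fp + (real p - 1) * Fm * \<phi> x y"
      using finite_children[of x] pc card_children[of x] by (simp add: sum.distrib algebra_simps)
    finally have s: "(\<Sum>z | par z = x. \<phi> z y) = \<phi> x y / Fp + (real p - 1) * Fm * \<phi> x y" .
    have pa: "\<phi> (par x) y = \<phi> x y * Fp" using 2 cl_par[of x y] nz
      by (simp add: \<phi>_def power_int_add power_int_diff min_def)
    have "(\<Sum>z\<in>C.nb x. P x z * (cG * \<phi> z y)) = cG * \<phi> x y * (a / real p * (1 / Fp + (real p - 1) * Fm) + (1 - a) * Fp)"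
      unfolding sum_nb pa sum_distrib_left[symmetric] s by (simp add: algebra_simps)
    also have "a / real p * (1 / Fp + (real p - 1) * Fm) + (1 - a) * Fp =
        (a * (1 + (real p - 1) * Fm * Fp) + real p * (1 - a) * Fp ^ 2) / (real p * Fp)"
      using nz real_p by (simp add: field_simps power2_eq_square)
    also have "a * (1 + (real p - 1) * Fm * Fp) + real p * (1 - a) * Fp ^ 2 = real p * Fp" using Fp_eq by linarith
    also have "real p * Fp / (real p * Fp) = 1" using nz real_p by simp
    finally show ?thesis using 2 by auto
  next
    case 3
    then have xy: "x = y" using cl_eq_lv_same by blast
    have c: "\<phi> z y = Fm" if "par z = x" for z
      using cl_child[OF that, of y] lv_child[OF that] xy by (simp add: \<phi>_def)
    have pa: "\<phi> (par x) y = Fp" using cl_par[of x y] xy by (simp add: \<phi>_def)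
    have "(\<Sum>z\<in>C.nb x. P x z * (cG * \<phi> z y)) = a * (cG * Fm) + (1 - a) * (cG * Fp)"
      unfolding sum_nb using c pa card_children[of x] real_p by simp
    moreover have "\<phi> x y = 1" using xy by (simp add: \<phi>_def)
    ultimately show ?thesis using cG_eq xy by simp
  qed
qed

lemma nstep_sums: "(\<lambda>n. nstep UNIV P n x y) sums (cG * \<phi> x y)"
proof (rule C.nstep_sums_green)
  show "(\<Sum>z\<in>C.nb x. P x z * w z) \<le> 2 * sqrt (a * (1 - a)) * w x" for x using w_sum by simp
  show "2 * sqrt (a * (1 - a)) < 1" by (rule sqrt_drift_less[OF a])
  show "0 \<le> 2 * sqrt (a * (1 - a))" "0 \<le> cG * sqrt b powi (- lv y)" using a cG_pos b_pos by auto
  show "\<bar>cG * \<phi> x y\<bar> \<le> cG * sqrt b powi (- lv y) * w x" for x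
    using \<phi>_bound[of x y] cG_pos by (simp add: abs_mult mult.assoc)
  show "cG * \<phi> x y = (if x = y then 1 else 0) + (\<Sum>z\<in>C.nb x. P x z * (cG * \<phi> z y))" for x
    by (rule \<phi>_rec)
qed simp

lemma transient: "transient_chain UNIV P"
  unfolding transient_chain_def using nstep_sums sums_summable by blast

lemma green_eq: "green UNIV P x y = cG * \<phi> x y"
  unfolding green_def using nstep_sums sums_unique by metis

lemma hit_prob_eq: "hit_prob UNIV P x y = \<phi> x y"
proof -
  have "\<phi> y y = 1" by (simp add: \<phi>_def)
  then show ?thesis using C.green_hit_prob[OF transient, of x y] cG_pos unfolding green_eq by simp
qed

text \<open>\<open>y\<close> enters only through the difference of two confluent levels, which is
  why the quotient extends to the ends.\<close>

lemma \<phi>_ratio: "\<phi> x y / \<phi> (root T) y = Fm powi lv x * (Fm * Fp) powi (cl (root T) y - cl x y)"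
proof -
  note nz = F_pos[THEN less_imp_neq, symmetric]
  have "\<phi> x y / \<phi> (root T) y = (Fm powi (lv x - cl x y) / Fm powi (- cl (root T) y)) *
      (Fp powi (lv y - cl x y) / Fp powi (lv y - cl (root T) y))"
    by (simp add: \<phi>_def)
  also have "\<dots> = Fm powi (lv x - cl x y - (- cl (root T) y)) * Fp powi (lv y - cl x y - (lv y - cl (root T) y))"
    using nz by (simp only: power_int_diff simp_thms)
  also have "\<dots> = Fm powi (lv x + (cl (root T) y - cl x y)) * Fp powi (cl (root T) y - cl x y)"
    by (simp add: algebra_simps)
  also have "\<dots> = Fm powi lv x * (Fm * Fp) powi (cl (root T) y - cl x y)"
    using nz by (simp only: power_int_add power_int_mult_distrib simp_thms mult.assoc)
  finally show ?thesis .
qed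

lemma hit_ratio_end:
  assumes "\<xi> \<in> proper_ends T"
  shows "hit_prob UNIV P x (confluent T (Vertex x) (End \<xi>)) / hit_prob UNIV P (root T) (confluent T (Vertex x) (End \<xi>))
    = Fm powi lv x * (Fm * Fp) powi (clE (root T) \<xi> - clE x \<xi>)"
proof -
  have e: "clE (root T) \<xi> - clE x \<xi> = cl (root T) (confluent T (Vertex x) (End \<xi>)) - cl x (confluent T (Vertex x) (End \<xi>))"
    using cl_confluent_end[OF assms, of x] by linarith
  show ?thesis unfolding hit_prob_eq \<phi>_ratio e ..
qed

lemma kernel_extension_tree:
  "\<exists>K. kernel_extension UNIV P (root T) (end_topology p T) Vertex K \<and>
    (\<forall>\<xi>\<in>ends T. \<forall>x. K x (End \<xi>) = hit_prob UNIV P x (confluent T (Vertex x) (End \<xi>)) / hit_prob UNIV P (root T) (confluent T (Vertex x) (End \<xi>)))"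
proof -
  define K where "K x z = (case z of Vertex y \<Rightarrow> martin_kernel UNIV P (root T) x y
     | End \<xi> \<Rightarrow> \<phi> x (confluent T (Vertex x) (End \<xi>)) / \<phi> (root T) (confluent T (Vertex x) (End \<xi>)))" for x z
  have mk: "martin_kernel UNIV P (root T) x y = \<phi> x y / \<phi> (root T) y" for x y
    unfolding martin_kernel_def green_eq using cG_pos by simp
  have "continuous_map (end_topology p T) euclideanreal (K x)" for x
  proof (rule continuous_map_end_topology)
    fix \<xi> assume \<xi>: "\<xi> \<in> ends T"
    have "K x z = K x (End \<xi>)" if z: "z \<in> M" "pt z (Suc (D (root T) x)) = pt (End \<xi>) (Suc (D (root T) x))" for z
    proof -
      note cn = confluent_near_end[OF \<xi> z]
      from z(1) show ?thesis
      proof (cases rule: M_cases)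
        case (1 y)
        then have "y \<noteq> x" using cn(1) by auto
        have "cl (root T) y - cl x y = cl (root T) (confluent T (Vertex x) (End \<xi>)) - cl x (confluent T (Vertex x) (End \<xi>))"
          using cl_confluent_vertex[OF \<open>y \<noteq> x\<close>] cn(2) 1 by simp
        then show ?thesis using 1 by (simp add: K_def mk \<phi>_ratio)
      next
        case (2 \<eta>)
        then show ?thesis using cn(2) by (simp add: K_def)
      qed
    qed
    then show "\<exists>n. \<forall>z\<in>M. pt z n = pt (End \<xi>) n \<longrightarrow> K x z = K x (End \<xi>)" by blast
  qed
  then show ?thesis by (intro exI[of _ K]) (auto simp: kernel_extension_def K_def hit_prob_eq)
qed

end

section \<open>Asymptotics of a double series\<close>

text \<open>The values of \<open>fk\<close> up to normalization, see \<open>fk_Fc\<close> below.\<close>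

definition Fc :: "real \<Rightarrow> nat \<Rightarrow> real" where
  "Fc q m = (q - 1) / q ^ m - (if m = 0 then q else 0)"

definition Wsum :: "real \<Rightarrow> real \<Rightarrow> (nat \<Rightarrow> nat \<Rightarrow> real) \<Rightarrow> real" where
  "Wsum q r t = infsum (\<lambda>(m, n). Fc q m * Fc r n * t m n) UNIV"

text \<open>The sum of the geometric majorants from \<open>Fc_bound\<close>, hence a bound for the
  total mass of the coefficients in \<open>Wsum\<close>.\<close>

definition Kc :: "real \<Rightarrow> real \<Rightarrow> real" where "Kc q r = q * r * (1 / (1 - 1 / q) * (1 / (1 - 1 / r)))"

lemma geometric_has_sum:
  fixes x :: real assumes "0 \<le> x" "x < 1" shows "((\<lambda>m. x ^ m) has_sum (1 / (1 - x))) UNIV"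
  by (rule sums_nonneg_imp_has_sum) (use assms geometric_sums[of x] in auto)

lemma geometric_has_sum2:
  fixes x y :: real assumes "0 \<le> x" "x < 1" "0 \<le> y" "y < 1"
  shows "((\<lambda>(m, n). x ^ m * y ^ n) has_sum (1 / (1 - x) * (1 / (1 - y)))) UNIV"
proof -
  have 1: "((\<lambda>n. (\<lambda>(m, n). x ^ m * y ^ n) (m, n)) has_sum (x ^ m * (1 / (1 - y)))) UNIV" for m
    using has_sum_cmult_right[OF geometric_has_sum[OF assms(3,4)], of "x ^ m"] by simp
  have 2: "((\<lambda>m. x ^ m * (1 / (1 - y))) has_sum (1 / (1 - x) * (1 / (1 - y)))) UNIV"
    by (rule has_sum_cmult_left[OF geometric_has_sum[OF assms(1,2)]])
  have "(\<lambda>(m, n). x ^ m * y ^ n) summable_on Sigma UNIV (\<lambda>_. UNIV)"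
    by (rule summable_on_SigmaI[OF 1]) (use has_sum_imp_summable[OF 2] assms in auto)
  then have "((\<lambda>(m, n). x ^ m * y ^ n) has_sum (1 / (1 - x) * (1 / (1 - y)))) (Sigma UNIV (\<lambda>_. UNIV))"
    by (intro has_sum_SigmaI[OF 1 2])
  then show ?thesis by simp
qed

lemma Fc_bound: assumes "q \<ge> 2" shows "\<bar>Fc q m\<bar> \<le> q * (1 / q) ^ m"
proof (cases m)
  case (Suc k)
  have "(q - 1) / q ^ m \<le> q / q ^ m" using assms by (intro divide_right_mono) auto
  then show ?thesis using Suc assms by (simp add: Fc_def power_one_over)
qed (use assms in \<open>simp add: Fc_def\<close>)

text \<open>At \<open>x = 1\<close> the value is 0. This is the cancellation that annihilates all
  terms of a double series depending on one index only (\<open>Wsum_fst\<close>,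
  \<open>Wsum_snd\<close>).\<close>

lemma Fc_sums: assumes "q \<ge> 2" "0 \<le> x" "x \<le> 1" shows "(\<lambda>m. Fc q m * x ^ m) sums (- q * (1 - x) / (q - x))"
proof -
  have 1: "(\<lambda>m. (q - 1) * (x / q) ^ m) sums ((q - 1) * (1 / (1 - x / q)))"
    using assms by (intro sums_mult geometric_sums) auto
  have 2: "(\<lambda>m. if m = 0 then q else 0) sums q" by (rule sums_single[of 0 "\<lambda>_. q"])
  have f: "Fc q m * x ^ m = (q - 1) * (x / q) ^ m - (if m = 0 then q else 0)" for m
    by (simp add: Fc_def power_divide algebra_simps)
  have "(q - 1) * (1 / (1 - x / q)) - q = - q * (1 - x) / (q - x)"
    using assms by (simp add: field_simps)
  then show ?thesis unfolding f using sums_diff[OF 1 2] by simp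
qed

lemma Fc_abs_summable: assumes "q \<ge> 2" "\<And>m. \<bar>u m\<bar> \<le> B" shows "summable (\<lambda>m. norm (Fc q m * u m))"
proof (rule summable_comparison_test)
  have "norm (norm (Fc q m * u m)) \<le> q * B * (1 / q) ^ m" for m
  proof -
    have "\<bar>Fc q m * u m\<bar> \<le> (q * (1 / q) ^ m) * B" unfolding abs_mult
      using Fc_bound[OF assms(1)] assms(2) assms(1) by (intro mult_mono) auto
    then show ?thesis by (simp add: mult_ac)
  qed
  then show "\<exists>N. \<forall>n\<ge>N. norm (norm (Fc q n * u n)) \<le> q * B * (1 / q) ^ n" by blast
  show "summable (\<lambda>n. q * B * (1 / q) ^ n)" using assms by (intro summable_mult summable_geometric) auto
qed

context
  fixes q r :: real assumes q: "q \<ge> 2" and r: "r \<ge> 2"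
begin

lemma Kc_has_sum: "((\<lambda>(m, n). q * (1 / q) ^ m * (r * (1 / r) ^ n)) has_sum Kc q r) UNIV"
proof -
  have "((\<lambda>mn. q * r * (case mn of (m, n) \<Rightarrow> (1 / q) ^ m * (1 / r) ^ n)) has_sum Kc q r) UNIV"
    unfolding Kc_def using q r by (intro has_sum_cmult_right geometric_has_sum2) auto
  then show ?thesis by (rule has_sum_cong[THEN iffD1, rotated]) (auto simp: mult_ac)
qed

lemma Wsum_has_sum:
  assumes B: "\<And>m n. \<bar>t m n\<bar> \<le> B"
  shows "((\<lambda>(m, n). Fc q m * Fc r n * t m n) has_sum Wsum q r t) UNIV" "\<bar>Wsum q r t\<bar> \<le> Kc q r * B"
proof -
  have boundary: "norm (Fc q m * Fc r n * t m n) \<le> (q * (1 / q) ^ m * (r * (1 / r) ^ n)) * B" for m n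
  proof -
    have "\<bar>Fc q m\<bar> * \<bar>Fc r n\<bar> \<le> q * (1 / q) ^ m * (r * (1 / r) ^ n)"
      using Fc_bound[OF q] Fc_bound[OF r] q r by (intro mult_mono) auto
    then show ?thesis unfolding real_norm_def abs_mult by (rule mult_mono[OF _ B]) (use q r in auto)
  qed
  have hs: "((\<lambda>mn. (case mn of (m, n) \<Rightarrow> q * (1 / q) ^ m * (r * (1 / r) ^ n)) * B) has_sum Kc q r * B) UNIV"
    by (rule has_sum_cmult_left[OF Kc_has_sum])
  have "(\<lambda>mn. norm (case mn of (m, n) \<Rightarrow> Fc q m * Fc r n * t m n)) summable_on UNIV"
  proof (rule Infinite_Sum.abs_summable_on_comparison_test)
    show "(\<lambda>mn. norm ((case mn of (m, n) \<Rightarrow> q * (1 / q) ^ m * (r * (1 / r) ^ n)) * B)) summable_on UNIV"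
      by (rule summable_on_iff_abs_summable_on_real[THEN iffD1, OF has_sum_imp_summable[OF hs]])
    fix x :: "nat \<times> nat"
    show "norm (case x of (m, n) \<Rightarrow> Fc q m * Fc r n * t m n) \<le> norm ((case x of (m, n) \<Rightarrow> q * (1 / q) ^ m * (r * (1 / r) ^ n)) * B)"
      using boundary by (cases x) (smt (verit, best) case_prod_conv real_norm_def)
  qed
  then show 1: "((\<lambda>(m, n). Fc q m * Fc r n * t m n) has_sum Wsum q r t) UNIV"
    unfolding Wsum_def using abs_summable_summable has_sum_infsum by blast
  show "\<bar>Wsum q r t\<bar> \<le> Kc q r * B"
    using norm_infsum_le[OF 1 hs] boundary by (auto split: prod.split)
qed

lemma Wsum_cmult: "Wsum q r (\<lambda>m n. c * t m n) = c * Wsum q r t"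
proof -
  have "Wsum q r (\<lambda>m n. c * t m n) = infsum (\<lambda>mn. c * (case mn of (m, n) \<Rightarrow> Fc q m * Fc r n * t m n)) UNIV"
    unfolding Wsum_def by (rule infsum_cong) (auto simp: mult_ac)
  then show ?thesis unfolding Wsum_def by (simp add: infsum_cmult_right')
qed

lemma Wsum_add:
  assumes "\<And>m n. \<bar>t m n\<bar> \<le> B" "\<And>m n. \<bar>t' m n\<bar> \<le> B'"
  shows "Wsum q r (\<lambda>m n. t m n + t' m n) = Wsum q r t + Wsum q r t'"
proof -
  have "((\<lambda>mn. (case mn of (m, n) \<Rightarrow> Fc q m * Fc r n * t m n) + (case mn of (m, n) \<Rightarrow> Fc q m * Fc r n * t' m n)) has_sum
     (Wsum q r t + Wsum q r t')) UNIV"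
    by (intro has_sum_add Wsum_has_sum[OF assms(1)] Wsum_has_sum[OF assms(2)])
  then have "((\<lambda>(m, n). Fc q m * Fc r n * (t m n + t' m n)) has_sum (Wsum q r t + Wsum q r t')) UNIV"
    by (rule has_sum_cong[THEN iffD1, rotated]) (auto simp: algebra_simps)
  then show ?thesis unfolding Wsum_def by (rule infsumI)
qed

lemma Wsum_diff_bound:
  assumes "\<And>m n. \<bar>t m n\<bar> \<le> B" "\<And>m n. \<bar>t' m n\<bar> \<le> B'" "\<And>m n. \<bar>t m n - t' m n\<bar> \<le> e"
  shows "\<bar>Wsum q r t - Wsum q r t'\<bar> \<le> Kc q r * e"
proof -
  have b: "\<bar>(-1) * t' m n\<bar> \<le> B'" for m n using assms(2) by simp
  have "Wsum q r (\<lambda>m n. t m n + (-1) * t' m n) = Wsum q r t - Wsum q r t'"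
    using Wsum_add[OF assms(1) b] Wsum_cmult[of "-1" t'] by simp
  moreover have "\<bar>Wsum q r (\<lambda>m n. t m n + (-1) * t' m n)\<bar> \<le> Kc q r * e"
    by (rule Wsum_has_sum(2)) (use assms(3) in simp)
  ultimately show ?thesis by simp
qed

lemma Wsum_prod:
  assumes u: "\<And>m. \<bar>u m\<bar> \<le> B" and v: "\<And>n. \<bar>v n\<bar> \<le> B'"
    and U: "(\<lambda>m. Fc q m * u m) sums U" and V: "(\<lambda>n. Fc r n * v n) sums V"
  shows "Wsum q r (\<lambda>m n. u m * v n) = U * V"
proof -
  have hu: "((\<lambda>m. Fc q m * u m) has_sum U) UNIV" by (rule norm_summable_imp_has_sum[OF Fc_abs_summable[OF q u] U])
  have hv: "((\<lambda>n. Fc r n * v n) has_sum V) UNIV" by (rule norm_summable_imp_has_sum[OF Fc_abs_summable[OF r v] V])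
  have boundary: "\<bar>u m * v n\<bar> \<le> B * B'" for m n unfolding abs_mult using u v by (intro mult_mono) (auto intro: order_trans[OF abs_ge_zero])
  then have W: "((\<lambda>(m, n). Fc q m * Fc r n * (u m * v n)) has_sum Wsum q r (\<lambda>m n. u m * v n)) (Sigma UNIV (\<lambda>_. UNIV))"
    using Wsum_has_sum(1)[OF boundary] by simp
  have 1: "((\<lambda>n. (\<lambda>(m, n). Fc q m * Fc r n * (u m * v n)) (m, n)) has_sum (Fc q m * u m * V)) UNIV" for m
    using has_sum_cmult_right[OF hv, of "Fc q m * u m"] by (simp add: mult_ac)
  have "((\<lambda>m. Fc q m * u m * V) has_sum Wsum q r (\<lambda>m n. u m * v n)) UNIV"
    by (rule has_sum_SigmaD[OF W]) (use 1 in auto)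
  moreover have "((\<lambda>m. Fc q m * u m * V) has_sum U * V) UNIV" by (rule has_sum_cmult_left[OF hu])
  ultimately show ?thesis by (rule has_sum_unique)
qed

lemma Wsum_fst: assumes "\<And>m. \<bar>u m\<bar> \<le> B" shows "Wsum q r (\<lambda>m n. u m) = 0"
proof -
  have "(\<lambda>m. Fc q m * u m) sums (\<Sum>m. Fc q m * u m)"
    using summable_norm_cancel[OF Fc_abs_summable[OF q assms]] by (rule summable_sums)
  from Wsum_prod[OF assms _ this, of "\<lambda>_. 1" 1 0] show ?thesis using Fc_sums[OF r, of 1] by simp
qed

lemma Wsum_snd: assumes "\<And>n. \<bar>v n\<bar> \<le> B" shows "Wsum q r (\<lambda>m n. v n) = 0"
proof -
  have "(\<lambda>n. Fc r n * v n) sums (\<Sum>n. Fc r n * v n)"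
    using summable_norm_cancel[OF Fc_abs_summable[OF r assms]] by (rule summable_sums)
  from Wsum_prod[OF _ assms _ this, of "\<lambda>_. 1" 1 0] show ?thesis using Fc_sums[OF q, of 1] by simp
qed

end

text \<open>A multiple of the spherical function as a function of \<open>\<beta>\<^sup>u\<close> and \<open>\<beta>\<^sup>d\<close>, see \<open>spherical_gt\<close>.\<close>

definition Hh :: "real \<Rightarrow> real \<Rightarrow> real \<Rightarrow> real \<Rightarrow> real" where
  "Hh q \<beta> x y = (x + y) * (q * (1 - \<beta>) / (q - \<beta>)) - x * y * (q * (1 - \<beta>\<^sup>2) / (q - \<beta>\<^sup>2))"

lemma Hh_factor:
  assumes "0 < \<beta>" "\<beta> < 1" "q \<ge> 2"
  shows "Hh q \<beta> x y = q * (1 - \<beta>) / (q - \<beta>) * (x + y - x * y * ((1 + \<beta>) * (q - \<beta>) / (q - \<beta>\<^sup>2)))"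
proof -
  have "\<beta>\<^sup>2 < 1" using assms by (simp add: power_less_one_iff)
  have "q - \<beta> \<noteq> 0" using assms by linarith
  moreover have "1 - \<beta>\<^sup>2 = (1 - \<beta>) * (1 + \<beta>)" by (simp add: power2_eq_square algebra_simps)
  ultimately have "q * (1 - \<beta>\<^sup>2) / (q - \<beta>\<^sup>2) = q * (1 - \<beta>) / (q - \<beta>) * ((1 + \<beta>) * (q - \<beta>) / (q - \<beta>\<^sup>2))"
    by simp
  then show ?thesis unfolding Hh_def by (simp only: right_diff_distrib mult_ac)
qed

lemma xy_le: assumes "0 \<le> x" "x \<le> 1" "0 \<le> y" "y \<le> (1::real)" shows "2 * (x * y) \<le> x + y"
  using mult_left_le[of y x] mult_left_le[of x y] assms by (simp add: mult.commute)

lemma Hh_pos: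
  assumes "0 < \<beta>" "\<beta> < 1" "q \<ge> 2" "0 < x" "x \<le> 1" "0 \<le> y" "y \<le> 1"
  shows "0 < Hh q \<beta> x y"
proof -
  have b2: "\<beta>\<^sup>2 < 1" using assms by (simp add: power_less_one_iff)
  \<comment> \<open>The constant is below 2, and \<open>x * y\<close> is at most half of
    \<open>x + y\<close> on the unit square.\<close>
  have c: "(1 + \<beta>) * (q - \<beta>) / (q - \<beta>\<^sup>2) < 2"
  proof -
    have "0 < (q + \<beta>) * (1 - \<beta>)" using assms by simp
    then have "(1 + \<beta>) * (q - \<beta>) < 2 * (q - \<beta>\<^sup>2)" by (simp add: power2_eq_square algebra_simps)
    then show ?thesis using b2 assms by (simp add: divide_less_eq)
  qed
  have "x * y * ((1 + \<beta>) * (q - \<beta>) / (q - \<beta>\<^sup>2)) < x + y"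
  proof (cases "y = 0")
    case False
    then have "x * y * ((1 + \<beta>) * (q - \<beta>) / (q - \<beta>\<^sup>2)) < x * y * 2" using c assms by (intro mult_strict_left_mono) auto
    then show ?thesis using xy_le[of x y] assms by linarith
  qed (use assms in simp)
  then have h: "0 < x + y - x * y * ((1 + \<beta>) * (q - \<beta>) / (q - \<beta>\<^sup>2))" by linarith
  have "q * (1 - \<beta>) / (q - \<beta>) > 0" using assms by simp
  then show ?thesis unfolding Hh_factor[OF assms(1-3)] using h by (rule mult_pos_pos)
qed

text \<open>Moving the confluent one level up at fixed levels multiplies both arguments by
  \<open>\<beta>\<close> and the denominator of the spherical function by \<open>q\<close>. The
  inequality is the strict decrease behind the separation of boundary points.\<close>

lemma Hh_strict:
  assumes "0 < \<beta>" "\<beta> < 1" "q \<ge> 2" "0 < x" "x \<le> 1" "0 \<le> y" "y \<le> 1"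
  shows "Hh q \<beta> (\<beta> * x) (\<beta> * y) < q * Hh q \<beta> x y"
proof -
  have b2: "\<beta>\<^sup>2 < 1" using assms by (simp add: power_less_one_iff)
  define th where "th = (1 + \<beta>) * (q - \<beta>) / (q - \<beta>\<^sup>2)"
  have th: "th * (q - \<beta>\<^sup>2) = (1 + \<beta>) * (q - \<beta>)" using b2 assms by (simp add: th_def)
  have "(1 + \<beta>) * (x * y) < x + y"
  proof (cases "y = 0")
    case False
    then have "(1 + \<beta>) * (x * y) < 2 * (x * y)" using assms by (intro mult_strict_right_mono) auto
    then show ?thesis using xy_le[of x y] assms by linarith
  qed (use assms in simp)
  then have "(q - \<beta>) * ((1 + \<beta>) * (x * y)) < (q - \<beta>) * (x + y)" using assms by (intro mult_strict_left_mono) auto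
  then have "(th * (q - \<beta>\<^sup>2)) * (x * y) < (q - \<beta>) * (x + y)" unfolding th by (simp add: mult_ac)
  then have "\<beta> * x + \<beta> * y - (\<beta> * x) * (\<beta> * y) * th < q * (x + y - x * y * th)"
    by (simp add: power2_eq_square algebra_simps)
  moreover have c: "q * (1 - \<beta>) / (q - \<beta>) > 0" using assms by simp
  ultimately have "q * (1 - \<beta>) / (q - \<beta>) * (\<beta> * x + \<beta> * y - (\<beta> * x) * (\<beta> * y) * th) < q * (1 - \<beta>) / (q - \<beta>) * (q * (x + y - x * y * th))"
    by (intro mult_strict_left_mono)
  then show ?thesis unfolding Hh_factor[OF assms(1-3)] th_def by (simp add: mult_ac)
qed

lemma Hh_le: assumes "0 < \<beta>" "\<beta> < 1" "q \<ge> 2" "0 \<le> x" "x \<le> 1" "0 \<le> y" "y \<le> 1" shows "Hh q \<beta> x y \<le> 2 * q"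
proof -
  have b2: "\<beta>\<^sup>2 < 1" using assms by (simp add: power_less_one_iff)
  have "q * (1 - \<beta>) / (q - \<beta>) \<le> q * 1 / 1" using assms by (intro frac_le mult_left_mono) auto
  then have "(x + y) * (q * (1 - \<beta>) / (q - \<beta>)) \<le> 2 * q" using assms by (intro mult_mono) auto
  moreover have "0 \<le> x * y * (q * (1 - \<beta>\<^sup>2) / (q - \<beta>\<^sup>2))" using assms b2 by simp
  ultimately show ?thesis unfolding Hh_def by linarith
qed

text \<open>With \<open>A0 = \<beta>\<^sup>a\<close>, \<open>B0 = \<beta>\<^sup>b\<close>, where \<open>a\<close> and \<open>-b\<close> are the levels of the confluents of the two coordinates, and
  \<open>s\<close>, \<open>t\<close> given in the same way by the levels of the two points, \<open>gg\<close> is \<open>gz\<close> at \<open>i = a + 1 - m\<close> and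
  \<open>j = b + n - 1\<close>.\<close>

locale gparam =
  fixes q r \<beta> A0 B0 s t :: real
  assumes q: "q \<ge> 2" and r: "r \<ge> 2" and \<beta>: "0 < \<beta>" "\<beta> < 1"
    and AB: "0 < B0" "B0 < A0" and s: "B0 \<le> s" "s \<le> A0" and t: "B0 \<le> t" "t \<le> A0"
begin

definition Am where "Am m = A0 / \<beta> ^ m"
definition Bn where "Bn n = B0 * \<beta> ^ n"
definition gg where "gg m n = (Am m - max s t) * (min s t - Bn n) / (Am m - Bn n)"

lemma bn: "0 < \<beta> ^ n" "\<beta> ^ n \<le> 1" using \<beta> by (auto intro: power_le_one)

lemma Am_ge: "A0 \<le> Am m" unfolding Am_def using bn[of m] AB by (simp add: le_divide_eq mult_left_le)
lemma Bn_le: "Bn n \<le> B0" "0 < Bn n" unfolding Bn_def using bn[of n] AB by (auto intro: mult_left_le)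
lemma ABd: "A0 - B0 \<le> Am m - Bn n" "0 < A0 - B0" "0 < Am m - Bn n" using Am_ge[of m] Bn_le[of n] AB by linarith+

lemma frac01: "0 \<le> a \<Longrightarrow> a \<le> b \<Longrightarrow> 0 < b \<Longrightarrow> 0 \<le> a / b \<and> a / b \<le> (1::real)" by simp

text \<open>Since \<open>s / A0 * \<beta> ^ m = s / Am m\<close>, this is
  \<open>(1 - s / Am m) * (1 - t / Am m)\<close>. Times \<open>- (\<beta> ^ n)\<close> it is the
  coefficient of \<open>B0\<close> in the expansion of \<open>gg m n\<close> at
  \<open>B0 = 0\<close>.\<close>

definition x1 where "x1 m = (1 - s / A0 * \<beta> ^ m) * (1 - t / A0 * \<beta> ^ m)"

lemma x1_01: "0 \<le> x1 m" "x1 m \<le> 1"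
proof -
  have "0 \<le> c / A0 * \<beta> ^ m \<and> c / A0 * \<beta> ^ m \<le> 1" if "B0 \<le> c" "c \<le> A0" for c
  proof -
    have "0 \<le> c / A0" "c / A0 \<le> 1" using that AB by auto
    then show ?thesis using mult_le_one[of "c / A0" "\<beta> ^ m"] mult_nonneg_nonneg[of "c / A0" "\<beta> ^ m"] bn[of m] by simp
  qed
  from this[OF s] this[OF t] show "0 \<le> x1 m" "x1 m \<le> 1" unfolding x1_def
    by (auto intro!: mult_nonneg_nonneg mult_le_one)
qed

lemma x1_sums: "(\<lambda>m. Fc q m * x1 m) sums Hh q \<beta> (s / A0) (t / A0)"
proof -
  define X where "X = s / A0 + t / A0"
  have b2: "0 \<le> \<beta>\<^sup>2" "\<beta>\<^sup>2 \<le> 1" using \<beta> by (auto intro: power_le_one)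
  have "(\<lambda>m. Fc q m * 1 ^ m + (- X) * (Fc q m * \<beta> ^ m) + (s / A0 * (t / A0)) * (Fc q m * (\<beta>\<^sup>2) ^ m)) sums
    (- q * (1 - 1) / (q - 1) + (- X) * (- q * (1 - \<beta>) / (q - \<beta>)) + (s / A0 * (t / A0)) * (- q * (1 - \<beta>\<^sup>2) / (q - \<beta>\<^sup>2)))"
    using q \<beta> b2 by (intro sums_add sums_mult Fc_sums) auto
  moreover have "Fc q m * 1 ^ m + (- X) * (Fc q m * \<beta> ^ m) + (s / A0 * (t / A0)) * (Fc q m * (\<beta>\<^sup>2) ^ m) = Fc q m * x1 m" for m
    unfolding x1_def X_def by (simp add: power_mult[symmetric] power2_eq_square algebra_simps power_mult_distrib)
  moreover have "- q * (1 - 1) / (q - 1) + (- X) * (- q * (1 - \<beta>) / (q - \<beta>)) + (s / A0 * (t / A0)) * (- q * (1 - \<beta>\<^sup>2) / (q - \<beta>\<^sup>2)) = Hh q \<beta> (s / A0) (t / A0)"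
  proof -
    have h: "(- a) * (- q * u / v) = a * (q * u / v)" "a * (- q * u / v) = - (a * (q * u / v))" for a u v by simp_all
    show ?thesis unfolding Hh_def X_def[symmetric] h by simp
  qed
  ultimately show ?thesis by simp
qed

text \<open>The value of \<open>gg m n\<close> at \<open>B0 = 0\<close> depends on \<open>m\<close>
  only and is removed by \<open>Wsum_fst\<close>; the rest carries an explicit factor
  \<open>B0\<close>.\<close>

lemma gg_first: "Wsum q r gg / B0 = Wsum q r (\<lambda>m n. - (\<beta> ^ n * x1 m * (Am m / (Am m - Bn n))))"
proof -
  define u where "u m = (Am m - max s t) * min s t / Am m" for m
  define v where "v m n = - (\<beta> ^ n * x1 m * (Am m / (Am m - Bn n)))" for m n
  have eq: "gg m n = u m + B0 * v m n" for m n
  proof -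
    have A: "Am m > 0" using Am_ge[of m] AB by linarith
    have x: "x1 m = (Am m - s) * (Am m - t) / (Am m)\<^sup>2"
    proof -
      have e: "c / A0 * \<beta> ^ m = c / Am m" for c unfolding Am_def using bn[of m] AB by simp
      have "x1 m = (1 - s / Am m) * (1 - t / Am m)" unfolding x1_def e ..
      then show ?thesis using A by (simp add: field_simps power2_eq_square)
    qed
    have st: "(Am m - s) * (Am m - t) = (Am m - max s t) * (Am m - min s t)" by (auto simp: max_def min_def)
    have "B0 * v m n = - (Bn n * x1 m * (Am m / (Am m - Bn n)))" by (simp add: v_def Bn_def)
    also have "\<dots> = - (Bn n * ((Am m - max s t) * (Am m - min s t)) / (Am m * (Am m - Bn n)))"
      unfolding x st using A by (simp add: power2_eq_square)
    finally have bv: "B0 * v m n = - (Bn n * ((Am m - max s t) * (Am m - min s t)) / (Am m * (Am m - Bn n)))" .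
    define a b S T where "a = Am m" and "b = Bn n" and "S = max s t" and "T = min s t"
    have ab: "a > 0" "a - b \<noteq> 0" using A ABd(3)[of m n] by (auto simp: a_def b_def)
    have "(a - S) * (T - b) / (a - b) = (a - S) * T / a + - (b * ((a - S) * (a - T)) / (a * (a - b)))"
      using ab by (simp add: divide_simps) (simp add: algebra_simps)
    then show ?thesis unfolding gg_def u_def bv by (simp add: a_def b_def S_def T_def)
  qed
  have ub: "\<bar>u m\<bar> \<le> A0" for m
  proof -
    have A: "A0 \<le> Am m" by (rule Am_ge)
    define f where "f = (Am m - max s t) / Am m"
    have "0 \<le> f \<and> f \<le> 1" unfolding f_def using A s t AB by (intro frac01) auto
    moreover have "0 \<le> min s t" "min s t \<le> A0" using s t AB by auto
    ultimately have "0 \<le> f * min s t \<and> f * min s t \<le> 1 * A0"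
      by (intro conjI mult_mono mult_nonneg_nonneg) auto
    moreover have "u m = f * min s t" by (simp add: u_def f_def)
    ultimately show ?thesis by simp
  qed
  have vb: "\<bar>v m n\<bar> \<le> 1 + B0 / (A0 - B0)" for m n
  proof -
    have "Am m / (Am m - Bn n) = 1 + Bn n / (Am m - Bn n)" using ABd(3)[of m n] by (simp add: field_simps)
    also have "\<dots> \<le> 1 + B0 / (A0 - B0)" using ABd Bn_le AB by (intro add_left_mono frac_le) auto
    finally have h: "Am m / (Am m - Bn n) \<le> 1 + B0 / (A0 - B0)" .
    have h0: "0 \<le> Am m / (Am m - Bn n)" using ABd(3)[of m n] Am_ge[of m] AB by simp
    have "\<beta> ^ n * x1 m \<le> 1" using bn x1_01 by (intro mult_le_one) auto
    then have "\<beta> ^ n * x1 m * (Am m / (Am m - Bn n)) \<le> 1 * (1 + B0 / (A0 - B0))"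
      using h h0 bn x1_01 by (intro mult_mono) auto
    moreover have "0 \<le> \<beta> ^ n * x1 m * (Am m / (Am m - Bn n))"
      using h0 bn[of n] x1_01 by (intro mult_nonneg_nonneg) auto
    ultimately show ?thesis unfolding v_def abs_minus_cancel by (simp only: abs_of_nonneg mult_1)
  qed
  have vb': "\<bar>B0 * v m n\<bar> \<le> B0 * (1 + B0 / (A0 - B0))" for m n
    using vb[of m n] AB by (simp add: abs_mult)
  have "Wsum q r gg = Wsum q r (\<lambda>m n. u m + B0 * v m n)" using eq by (metis (no_types, lifting) ext)
  also have "\<dots> = Wsum q r (\<lambda>m n. u m) + Wsum q r (\<lambda>m n. B0 * v m n)" by (rule Wsum_add[OF q r ub vb'])
  also have "\<dots> = B0 * Wsum q r v" using Wsum_fst[OF q r ub] Wsum_cmult[OF q r] by simp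
  finally show ?thesis using AB unfolding v_def[abs_def] by simp
qed

text \<open>For the second coordinate escaping to its reference end while the first confluent stays
  put: \<open>B0\<close> tends to 0 with \<open>A0\<close> fixed. Replacing
  \<open>Am m / (Am m - Bn n)\<close> by 1 leaves a product of two single series.\<close>

lemma first_kind_bound:
  "\<bar>Wsum q r gg / B0 - r * (1 - \<beta>) / (r - \<beta>) * Hh q \<beta> (s / A0) (t / A0)\<bar> \<le> Kc q r * (B0 / (A0 - B0))"
proof -
  have v: "\<bar>- (\<beta> ^ n)\<bar> \<le> 1" and u: "\<bar>x1 m\<bar> \<le> 1" for m n using bn[of n] x1_01[of m] by auto
  have "(\<lambda>n. Fc r n * - (\<beta> ^ n)) sums (r * (1 - \<beta>) / (r - \<beta>))"
    using sums_minus[OF Fc_sums[OF r, of \<beta>]] \<beta> by simp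
  from Wsum_prod[OF q r u v x1_sums this]
  have W: "Wsum q r (\<lambda>m n. x1 m * - (\<beta> ^ n)) = r * (1 - \<beta>) / (r - \<beta>) * Hh q \<beta> (s / A0) (t / A0)" by simp
  have d: "\<bar>- (\<beta> ^ n * x1 m * (Am m / (Am m - Bn n))) - x1 m * - (\<beta> ^ n)\<bar> \<le> B0 / (A0 - B0)" for m n
  proof -
    have "Am m / (Am m - Bn n) = 1 + Bn n / (Am m - Bn n)" using ABd(3)[of m n] by (simp add: field_simps)
    then have "\<bar>- (\<beta> ^ n * x1 m * (Am m / (Am m - Bn n))) - x1 m * - (\<beta> ^ n)\<bar> = \<beta> ^ n * x1 m * (Bn n / (Am m - Bn n))"
      using bn[of n] x1_01[of m] Bn_le[of n] ABd(3)[of m n] by (simp add: algebra_simps abs_mult)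
    also have "\<dots> \<le> 1 * (B0 / (A0 - B0))"
      using ABd Bn_le AB bn x1_01 Bn_le(2)[THEN less_imp_le]
      by (intro mult_mono mult_le_one frac_le) (auto intro!: divide_nonneg_pos)
    finally show ?thesis by simp
  qed
  have b1: "\<bar>x1 m * - (\<beta> ^ n)\<bar> \<le> 1" for m n
    using mult_le_one[of "x1 m" "\<beta> ^ n"] bn[of n] x1_01[of m] by (simp add: abs_mult)
  have b2: "\<bar>- (\<beta> ^ n * x1 m * (Am m / (Am m - Bn n)))\<bar> \<le> 1 + B0 / (A0 - B0)" for m n
    using d[of n m] b1[of m n] by linarith
  show ?thesis unfolding gg_first W[symmetric] by (rule Wsum_diff_bound[OF q r b2 b1 d])
qed

text \<open>For both confluents escaping: \<open>A0\<close> tends to infinity and \<open>B0\<close>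
  to 0. The terms in one index cancel, and the normalized mixed term is
  \<open>\<beta> ^ m * \<beta> ^ n\<close> up to small errors. As the limit does not involve
  \<open>s\<close> and \<open>t\<close>, the factor \<open>s + t\<close> alone shapes the kernels at
  the points \<open>(Omega k, Omega (- k))\<close>.\<close>

lemma omega_bound:
  "\<bar>A0 * Wsum q r gg / (B0 * (s + t)) - q * (1 - \<beta>) / (q - \<beta>) * (r * (1 - \<beta>) / (r - \<beta>))\<bar>
    \<le> Kc q r * (B0 / (A0 - B0) + s / (A0 - B0) + B0 / s * (A0 / (A0 - B0)))"
proof -
  have st: "0 < s" "0 < t" "0 < s + t" using s t AB by linarith+
  define c where "c = A0 / (B0 * (s + t))"
  define y where "y m n = \<beta> ^ n * (A0 / (Am m - Bn n) * (1 - s * t / ((s + t) * Am m) - Bn n / (s + t)))" for m n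
  define u where "u m = - c * (s * t / Am m)" for m
  define v where "v n = c * (min s t - Bn n)" for n
  define e where "e = B0 / (A0 - B0) + s / (A0 - B0) + B0 / s * (A0 / (A0 - B0))"
  have c0: "0 < c" using AB st by (simp add: c_def)
  \<comment> \<open>An exact identity: \<open>v n\<close> and \<open>u m\<close> carry everything of
    larger order, and \<open>y m n\<close> is the remaining mixed term.\<close>
  have eq: "c * gg m n = (v n + u m) + y m n" for m n
  proof -
    define a b where "a = Am m" and "b = Bn n"
    have ab: "a > 0" "a - b \<noteq> 0" using Am_ge[of m] AB ABd(3)[of m n] by (auto simp: a_def b_def)
    have bb: "\<beta> ^ n = b / B0" unfolding b_def Bn_def using AB by simp
    have y: "y m n = c * b * ((s + t) / (a - b) * (1 - s * t / ((s + t) * a) - b / (s + t)))"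
    proof -
      have "b / B0 * (A0 / (a - b) * Z) = c * b * ((s + t) / (a - b) * Z)" for Z
        unfolding c_def using AB st by simp
      then show ?thesis unfolding y_def bb a_def[symmetric] b_def[symmetric] by simp
    qed
    have "(a - max s t) * (min s t - b) = (min s t - b) * (a - b) - (s - b) * (t - b)"
      by (auto simp: max_def min_def algebra_simps)
    then have "(a - max s t) * (min s t - b) / (a - b) = (min s t - b) - (s - b) * (t - b) / (a - b)"
      using ab by (simp add: diff_divide_distrib)
    also have "(s - b) * (t - b) / (a - b) = s * t / a - b * ((s + t) / (a - b) * (1 - s * t / ((s + t) * a) - b / (s + t)))"
      using ab st by (simp add: divide_simps) (simp add: algebra_simps)
    finally have g: "gg m n = (min s t - b) - (s * t / a - b * ((s + t) / (a - b) * (1 - s * t / ((s + t) * a) - b / (s + t))))"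
      unfolding gg_def a_def[symmetric] b_def[symmetric] .
    have "c * ((w - b) - (z - b * Q)) = c * (w - b) + - c * z + c * b * Q" for w z Q
      by (simp add: algebra_simps)
    then show ?thesis unfolding g y u_def v_def a_def[symmetric] b_def[symmetric] .
  qed
  have ub: "\<bar>u m\<bar> \<le> c * (s * t / A0)" for m
  proof -
    have "s * t / Am m \<le> s * t / A0" using Am_ge[of m] AB st by (intro divide_left_mono mult_pos_pos) auto
    moreover have "0 \<le> s * t / Am m" using Am_ge[of m] AB st by simp
    ultimately have "\<bar>s * t / Am m\<bar> \<le> s * t / A0" by linarith
    then have "c * \<bar>s * t / Am m\<bar> \<le> c * (s * t / A0)" using c0 by (intro mult_left_mono) auto
    moreover have "\<bar>u m\<bar> = c * \<bar>s * t / Am m\<bar>" unfolding u_def abs_mult using c0 by simp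
    ultimately show ?thesis by simp
  qed
  have vb: "\<bar>v n\<bar> \<le> c * A0" for n
  proof -
    have "0 \<le> min s t - Bn n" "min s t - Bn n \<le> A0" using Bn_le[of n] s t by auto
    then show ?thesis unfolding v_def using c0 by (simp add: abs_mult)
  qed
  have d: "\<bar>y m n - \<beta> ^ m * \<beta> ^ n\<bar> \<le> e" for m n
  proof -
    define a b where "a = Am m" and "b = Bn n"
    have a: "A0 \<le> a" "0 < a" "A0 - B0 \<le> a - b" "0 < a - b" "0 < b" "b \<le> B0" "0 < A0 - B0"
      using Am_ge[of m] AB ABd(1)[of m n] ABd(2) ABd(3)[of m n] Bn_le[of n] by (auto simp: a_def b_def)
    have bm: "\<beta> ^ m = A0 / a" unfolding a_def Am_def using AB bn[of m] by simp
    define z where "z = A0 / (a - b) * (1 - s * t / ((s + t) * a) - b / (s + t)) - A0 / a"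
    have z: "z = A0 / a * (b / (a - b)) - (A0 / a * (s * t / (s + t) / (a - b)) + A0 / (a - b) * (b / (s + t)))"
      unfolding z_def using a st by (simp add: divide_simps) (simp add: algebra_simps)
    have A1: "0 \<le> A0 / a" "A0 / a \<le> 1" using a AB by auto
    have 1: "0 \<le> A0 / a * (b / (a - b))" "A0 / a * (b / (a - b)) \<le> 1 * (B0 / (A0 - B0))"
      using a AB by simp (rule mult_mono[OF A1(2) frac_le], use a AB in auto)
    have sts: "s * t / (s + t) \<le> s" using st by (simp add: divide_le_eq algebra_simps)
    have 2: "0 \<le> A0 / a * (s * t / (s + t) / (a - b))" "A0 / a * (s * t / (s + t) / (a - b)) \<le> 1 * (s / (A0 - B0))"
      using a st AB by simp (rule mult_mono[OF A1(2) frac_le], use a st AB sts in auto)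
    have "b / (s + t) \<le> B0 / s" using a st by (intro frac_le) auto
    moreover have "A0 / (a - b) \<le> A0 / (A0 - B0)" using a AB by (intro divide_left_mono mult_pos_pos) auto
    ultimately have "A0 / (a - b) * (b / (s + t)) \<le> A0 / (A0 - B0) * (B0 / s)"
      by (intro mult_mono) (use a st AB in auto)
    then have 3: "0 \<le> A0 / (a - b) * (b / (s + t))" "A0 / (a - b) * (b / (s + t)) \<le> A0 / (A0 - B0) * (B0 / s)"
      using a st AB by auto
    have "\<bar>z\<bar> \<le> e" unfolding z e_def using 1 2 3 by (simp add: mult.commute abs_le_iff)
    moreover have "y m n - \<beta> ^ m * \<beta> ^ n = \<beta> ^ n * z" unfolding y_def bm z_def a_def[symmetric] b_def[symmetric]
      by (simp add: algebra_simps)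
    moreover have "\<bar>\<beta> ^ n * z\<bar> \<le> 1 * \<bar>z\<bar>" unfolding abs_mult using bn[of n] by (intro mult_right_mono) auto
    ultimately show ?thesis by linarith
  qed
  have pb: "\<bar>\<beta> ^ m * \<beta> ^ n\<bar> \<le> 1" for m n using bn[of m] bn[of n] mult_le_one[of "\<beta> ^ m" "\<beta> ^ n"] by (simp add: abs_mult)
  have yb: "\<bar>y m n\<bar> \<le> 1 + e" for m n using d[of m n] pb[of m n] by linarith
  have vub: "\<bar>v n + u m\<bar> \<le> c * A0 + c * (s * t / A0)" for m n using ub[of m] vb[of n] by linarith
  have "c * Wsum q r gg = Wsum q r (\<lambda>m n. c * gg m n)" using Wsum_cmult[OF q r] by simp
  also have "\<dots> = Wsum q r (\<lambda>m n. (v n + u m) + y m n)" using eq by simp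
  also have "\<dots> = Wsum q r (\<lambda>m n. v n + u m) + Wsum q r y" by (rule Wsum_add[OF q r vub yb])
  also have "Wsum q r (\<lambda>m n. v n + u m) = 0"
    using Wsum_add[OF q r vb ub] Wsum_fst[OF q r ub] Wsum_snd[OF q r vb] by simp
  finally have cy: "c * Wsum q r gg = Wsum q r y" by simp
  have bb: "\<bar>\<beta> ^ n\<bar> \<le> 1" for n using bn[of n] by simp
  have "Wsum q r (\<lambda>m n. \<beta> ^ m * \<beta> ^ n) = (- q * (1 - \<beta>) / (q - \<beta>)) * (- r * (1 - \<beta>) / (r - \<beta>))"
    using \<beta> by (intro Wsum_prod[OF q r bb bb] Fc_sums q r) auto
  then have W: "Wsum q r (\<lambda>m n. \<beta> ^ m * \<beta> ^ n) = q * (1 - \<beta>) / (q - \<beta>) * (r * (1 - \<beta>) / (r - \<beta>))" by simp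
  have "A0 * Wsum q r gg / (B0 * (s + t)) = Wsum q r y" using cy by (simp add: c_def)
  then show ?thesis unfolding W[symmetric] e_def[symmetric] using Wsum_diff_bound[OF q r yb pb d] by simp
qed

end

section \<open>The Green function of the walk on the Diestel-Leader graph\<close>

context htree
begin

text \<open>The index counts down from \<open>cl x y + 1\<close>, the largest one at which
  \<open>fk y\<close> does not vanish at \<open>x\<close>. There only the subtracted indicator is
  present, which accounts for the extra term of \<open>Fc\<close> at 0.\<close>

lemma fk_Fc: "fk y (cl x y + 1 - int m) x = real p powi (cl x y - lv y) * Fc (real p) m"
proof -
  note nz = real_p(1)
  have 1: "real p powi (cl x y + 1 - int m - lv y) = real p powi (cl x y - lv y) * (real p / real p ^ m)"
  proof -
    have "cl x y + 1 - int m - lv y = (cl x y - lv y) + (1 - int m)" by simp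
    then show ?thesis using nz by (simp only: power_int_add power_int_diff simp_thms) simp
  qed
  have 2: "real p powi (cl x y + 1 - int m - 1 - lv y) = real p powi (cl x y - lv y) * (1 / real p ^ m)"
  proof -
    have "cl x y + 1 - int m - 1 - lv y = (cl x y - lv y) + (0 - int m)" by simp
    then show ?thesis using nz by (simp only: power_int_add power_int_diff simp_thms) simp
  qed
  have c: "cl x y + 1 - int m \<le> cl x y \<longleftrightarrow> m \<noteq> 0" "cl x y + 1 - int m - 1 \<le> cl x y" by auto
  show ?thesis unfolding fk_def 1 2 c using nz by (cases "m = 0") (simp_all add: Fc_def diff_divide_distrib right_diff_distrib)
qed

end

lemma has_sum_sum_finite:
  fixes f :: "'i \<Rightarrow> 'j \<Rightarrow> real"
  assumes "finite I" "\<And>i. i \<in> I \<Longrightarrow> (f i has_sum S i) B"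
  shows "((\<lambda>x. \<Sum>i\<in>I. f i x) has_sum (\<Sum>i\<in>I. S i)) B"
  using assms by (induction I) (auto intro: has_sum_add)

locale dl = T1: homtree T1 q + T2: homtree T2 r
  for T1 :: "'a tree" and T2 :: "'b tree" and q r :: nat +
  fixes \<alpha> :: real
  assumes \<alpha>: "0 < \<alpha>" "\<alpha> < 1" "\<alpha> \<noteq> 1 / 2"
begin

abbreviation X where "X \<equiv> DL T1 T2"
abbreviation P where "P \<equiv> DL_walk \<alpha> q r T1 T2"

lemma X_iff: "(x1, x2) \<in> X \<longleftrightarrow> T1.lv x1 + T2.lv x2 = 0"
  by (simp add: DL_def T1.hor_eq T2.hor_eq)

lemma P_eq: "P (x1, x2) (z1, z2) = (if T1.par z1 = x1 \<and> z2 = T2.par x2 then \<alpha> / real q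
    else if z1 = T1.par x1 \<and> T2.par z2 = x2 then (1 - \<alpha>) / real r else 0)"
  by (simp only: DL_walk_def T1.pred_vertex_eq T2.pred_vertex_eq fst_conv snd_conv)

lemma P_up: "T1.par z1 = x1 \<Longrightarrow> P (x1, x2) (z1, T2.par x2) = \<alpha> / real q"
  by (simp add: P_eq)

lemma P_down: "T2.par z2 = x2 \<Longrightarrow> P (x1, x2) (T1.par x1, z2) = (1 - \<alpha>) / real r"
proof -
  assume z: "T2.par z2 = x2"
  have "T1.par (T1.par x1) \<noteq> x1" using T1.lv_par[of x1] T1.lv_par[of "T1.par x1"] by force
  then show ?thesis using z by (simp add: P_eq)
qed

lemma qr: "real q > 0" "real r > 0" using T1.real_p T2.real_p by auto

definition ups where "ups x = (\<lambda>z1. (z1, T2.par (snd x))) ` {z1. T1.par z1 = fst x}"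
definition downs where "downs x = (\<lambda>z2. (T1.par (fst x), z2)) ` {z2. T2.par z2 = snd x}"

lemma supp: assumes "x \<in> X" shows "{z \<in> X. P x z \<noteq> 0} = ups x \<union> downs x"
proof -
  obtain x1 x2 where x: "x = (x1, x2)" by (cases x)
  have l: "T1.lv x1 + T2.lv x2 = 0" using assms x X_iff by simp
  show ?thesis
  proof (intro set_eqI iffI)
    fix z assume "z \<in> {z \<in> X. P x z \<noteq> 0}"
    then show "z \<in> ups x \<union> downs x"
      by (cases z) (auto simp: x P_eq ups_def downs_def split: if_splits)
  next
    fix z assume z: "z \<in> ups x \<union> downs x"
    then consider z1 where "z = (z1, T2.par x2)" "T1.par z1 = x1" | z2 where "z = (T1.par x1, z2)" "T2.par z2 = x2"
      by (auto simp: ups_def downs_def x)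
    then show "z \<in> {z \<in> X. P x z \<noteq> 0}"
    proof cases
      case 1
      then show ?thesis using l T1.lv_child[of z1 x1] P_up[of z1 x1 x2] \<alpha> qr by (simp add: X_iff x)
    next
      case 2
      then show ?thesis using l T2.lv_child[of z2 x2] P_down[of z2 x2 x1] \<alpha> qr by (simp add: X_iff x)
    qed
  qed
qed

sublocale C: finite_range_chain X P
proof
  show "0 \<le> P x z" for x z using \<alpha> by (cases x; cases z) (simp add: P_eq)
  show "finite {z \<in> X. P x z \<noteq> 0}" if "x \<in> X" for x
    unfolding supp[OF that] using T1.finite_children T2.finite_children by (simp add: ups_def downs_def)
qed

lemma sum_nb:
  assumes "(x1, x2) \<in> X"
  shows "(\<Sum>z\<in>C.nb (x1, x2). P (x1, x2) z * f z) =
    \<alpha> / real q * (\<Sum>z1 | T1.par z1 = x1. f (z1, T2.par x2)) + (1 - \<alpha>) / real r * (\<Sum>z2 | T2.par z2 = x2. f (T1.par x1, z2))"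
proof -
  have disj: "ups (x1, x2) \<inter> downs (x1, x2) = {}"
  proof -
    have "T1.par (T1.par x1) \<noteq> x1" using T1.lv_par[of x1] T1.lv_par[of "T1.par x1"] by force
    then show ?thesis by (auto simp: ups_def downs_def)
  qed
  have "(\<Sum>z\<in>C.nb (x1, x2). P (x1, x2) z * f z) =
     (\<Sum>z\<in>ups (x1, x2). P (x1, x2) z * f z) + (\<Sum>z\<in>downs (x1, x2). P (x1, x2) z * f z)"
    unfolding C.nb_def supp[OF assms]
    by (rule sum.union_disjoint) (use disj T1.finite_children T2.finite_children in \<open>auto simp: ups_def downs_def\<close>)
  also have "(\<Sum>z\<in>ups (x1, x2). P (x1, x2) z * f z) = (\<Sum>z1 | T1.par z1 = x1. \<alpha> / real q * f (z1, T2.par x2))"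
    unfolding ups_def by (subst sum.reindex) (auto simp: inj_on_def P_up intro!: sum.cong)
  also have "(\<Sum>z\<in>downs (x1, x2). P (x1, x2) z * f z) = (\<Sum>z2 | T2.par z2 = x2. (1 - \<alpha>) / real r * f (T1.par x1, z2))"
    unfolding downs_def by (subst sum.reindex) (auto simp: inj_on_def P_down intro!: sum.cong)
  finally show ?thesis by (simp add: sum_distrib_left)
qed

definition \<beta> where "\<beta> = (1 - \<alpha>) / \<alpha>"
text \<open>The scale function of the level process:
  \<open>\<alpha> * sc (k + 1) + (1 - \<alpha>) * sc (k - 1) = sc k\<close>.\<close>

definition sc where "sc k = \<beta> powi k"
definition w :: "'a \<times> 'b \<Rightarrow> real" where "w x = sqrt \<beta> powi T1.lv (fst x)"

lemma \<beta>_pos: "\<beta> > 0" using \<alpha> by (simp add: \<beta>_def)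
lemma \<alpha>\<beta>: "\<alpha> * \<beta> = 1 - \<alpha>" using \<alpha> by (simp add: \<beta>_def)
lemma sc_pos: "sc k > 0" using \<beta>_pos by (simp add: sc_def)
lemma sc_add: "sc (k + n) = sc k * sc n" using \<beta>_pos by (simp add: sc_def power_int_add)
lemma sc_Suc: "sc (k + 1) = \<beta> * sc k" using \<beta>_pos by (simp add: sc_def power_int_add)
lemma sc_pred: "sc (k - 1) = sc k / \<beta>" using \<beta>_pos by (simp add: sc_def power_int_diff)
lemma sc_0 [simp]: "sc 0 = 1" by (simp add: sc_def)

abbreviation \<rho> where "\<rho> \<equiv> 2 * sqrt (\<alpha> * (1 - \<alpha>))"

lemma rho: "0 \<le> \<rho>" "\<rho> < 1" using \<alpha> sqrt_drift_less[OF \<alpha>] by auto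

lemma w_sum: assumes "x \<in> X" shows "(\<Sum>z\<in>C.nb x. P x z * w z) \<le> \<rho> * w x"
proof -
  obtain x1 x2 where x: "x = (x1, x2)" by (cases x)
  have t: "sqrt \<beta> > 0" using \<beta>_pos by simp
  have "w (z1, T2.par x2) = sqrt \<beta> * w x" if "T1.par z1 = x1" for z1
    using T1.lv_child[OF that] t by (simp add: w_def x power_int_add)
  then have 1: "(\<Sum>z1 | T1.par z1 = x1. w (z1, T2.par x2)) = real q * (sqrt \<beta> * w x)"
    using T1.card_children[of x1] by simp
  have "w (T1.par x1, z2) = w x / sqrt \<beta>" for z2 using t by (simp add: w_def x power_int_diff)
  then have 2: "(\<Sum>z2 | T2.par z2 = x2. w (T1.par x1, z2)) = real r * (w x / sqrt \<beta>)"
    using T2.card_children[of x2] by simp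
  have "(\<Sum>z\<in>C.nb x. P x z * w z) = \<alpha> / real q * (real q * (sqrt \<beta> * w x)) + (1 - \<alpha>) / real r * (real r * (w x / sqrt \<beta>))"
    using sum_nb[of x1 x2 w] assms unfolding x 1[unfolded x] 2[unfolded x] by simp
  also have "\<dots> = (\<alpha> * sqrt \<beta> + (1 - \<alpha>) / sqrt \<beta>) * w x" using qr by (simp add: distrib_right)
  finally have "(\<Sum>z\<in>C.nb x. P x z * w z) = (\<alpha> * sqrt \<beta> + (1 - \<alpha>) / sqrt \<beta>) * w x" .
  then show ?thesis using drift_sqrt(1)[OF \<alpha>(1,2)] by (simp add: \<beta>_def)
qed

text \<open>For fixed \<open>i\<close>, \<open>j\<close> this is a multiple of the Green function, with pole \<open>l\<close>, of the level process
  killed outside \<open>[i, j]\<close>.\<close>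

definition gz where
  "gz l i j k = (sc (i - 1) - max (sc k) (sc l)) * (min (sc k) (sc l) - sc (j + 1)) / (sc (i - 1) - sc (j + 1))"

context
  assumes half: "\<alpha> > 1 / 2"
begin

lemma \<beta>_less: "\<beta> < 1" using half \<alpha> by (simp add: \<beta>_def)

lemma sc_mono: "k \<le> n \<Longrightarrow> sc n \<le> sc k"
proof -
  assume "k \<le> n"
  then obtain m where n: "n = k + int m" by (metis zle_iff_zadd)
  have "sc (int m) \<le> 1" using \<beta>_pos \<beta>_less by (simp add: sc_def power_le_one)
  then show ?thesis unfolding n sc_add using sc_pos[of k] by simp
qed

lemma sc_strict: "k < n \<Longrightarrow> sc n < sc k"
  using sc_mono[of "k + 1" n] sc_Suc[of k] \<beta>_less sc_pos[of k] by (smt (verit) mult_less_cancel_right2)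

lemma gz_left: "gz l i j (i - 1) = 0" if "i \<le> l" using sc_mono[of "i - 1" l] that by (simp add: gz_def max_def)

lemma gz_right: "gz l i j (j + 1) = 0" if "l \<le> j" using sc_mono[of l "j + 1"] that by (simp add: gz_def min_def)

text \<open>On either side of the pole \<open>gz\<close> is affine in the scale function, hence
  harmonic for the level process; the jump of the slope at \<open>l\<close> gives the source. The
  identity holds for all \<open>k\<close>: outside the interval the formula simply continues, and
  the killing is left to the factors \<open>fk\<close>.\<close>

lemma gz_rec:
  assumes "i \<le> l" "l \<le> j"
  shows "gz l i j k = \<alpha> * gz l i j (k + 1) + (1 - \<alpha>) * gz l i j (k - 1) + (if k = l then (2 * \<alpha> - 1) * sc l else 0)"
proof -
  define A B where "A = sc (i - 1)" and "B = sc (j + 1)"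
  have AB: "A - B \<noteq> 0" using sc_strict[of "i - 1" "j + 1"] assms by (simp add: A_def B_def)
  define e where "e = sc k"
  have e: "sc (k + 1) = \<beta> * e" "sc (k - 1) = e / \<beta>" using sc_Suc sc_pred by (simp_all add: e_def)
  have av: "\<alpha> * (\<beta> * e) + (1 - \<alpha>) * (e / \<beta>) = e"
  proof -
    have "\<alpha> * (\<beta> * e) = (1 - \<alpha>) * e" using \<alpha>\<beta> by (metis mult.assoc)
    moreover have "(1 - \<alpha>) * (e / \<beta>) = \<alpha> * e" unfolding \<alpha>\<beta>[symmetric] using \<beta>_pos by simp
    ultimately show ?thesis by (simp add: algebra_simps)
  qed
  have lin: "\<alpha> * ((c - d * (\<beta> * e)) * E / F) + (1 - \<alpha>) * ((c - d * (e / \<beta>)) * E / F) = (c - d * e) * E / F" for c d E F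
  proof -
    have "\<alpha> * (c - d * (\<beta> * e)) + (1 - \<alpha>) * (c - d * (e / \<beta>)) = c - d * (\<alpha> * (\<beta> * e) + (1 - \<alpha>) * (e / \<beta>))"
      by (simp add: algebra_simps)
    also have "\<dots> = c - d * e" unfolding av ..
    finally have "(\<alpha> * (c - d * (\<beta> * e)) + (1 - \<alpha>) * (c - d * (e / \<beta>))) * E / F = (c - d * e) * E / F" by simp
    then show ?thesis by (simp add: add_divide_distrib distrib_right mult.assoc)
  qed
  have lo: "gz l i j n = (A - 1 * sc n) * (sc l - B) / (A - B)" if "n \<le> l" for n
    using sc_mono[OF that] by (simp add: gz_def A_def B_def max_def min_def)
  have hi: "gz l i j n = (B - 1 * sc n) * (sc l - A) / (A - B)" if "l \<le> n" for n
  proof -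
    have "(A - sc l) * (sc n - B) = (B - 1 * sc n) * (sc l - A)" by (simp add: algebra_simps)
    then show ?thesis using sc_mono[OF that] by (simp add: gz_def A_def B_def max_def min_def)
  qed
  consider "k < l" | "k > l" | "k = l" by linarith
  then show ?thesis
  proof cases
    case 1
    then show ?thesis using lo[of k] lo[of "k + 1"] lo[of "k - 1"] lin[of A 1 "sc l - B" "A - B"] unfolding e e_def[symmetric] by simp
  next
    case 2
    then show ?thesis using hi[of k] hi[of "k + 1"] hi[of "k - 1"] lin[of B 1 "sc l - A" "A - B"] unfolding e e_def[symmetric] by simp
  next
    case 3
    have s: "sc l = e" using 3 by (simp add: e_def)
    have "gz l i j (k + 1) = (A - 1 * sc (k + 1)) * (sc l - B) / (A - B) - (sc l - sc (k + 1))"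
    proof -
      have "(B - 1 * sc (k + 1)) * (sc l - A) = (A - 1 * sc (k + 1)) * (sc l - B) - (sc l - sc (k + 1)) * (A - B)"
        by (simp add: algebra_simps)
      then show ?thesis using hi[of "k + 1"] 3 AB by (simp add: diff_divide_distrib)
    qed
    then have "\<alpha> * gz l i j (k + 1) + (1 - \<alpha>) * gz l i j (k - 1) = gz l i j k - \<alpha> * (sc l - sc (k + 1))"
      using lo[of k] lo[of "k - 1"] 3 lin[of A 1 "sc l - B" "A - B"] unfolding e e_def[symmetric] s by (simp add: right_diff_distrib)
    moreover have "\<alpha> * (sc l - sc (k + 1)) = (2 * \<alpha> - 1) * sc l"
    proof -
      have "\<alpha> * (e - \<beta> * e) = (\<alpha> - \<alpha> * \<beta>) * e" by (simp add: algebra_simps)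
      then show ?thesis unfolding e s \<alpha>\<beta> by simp
    qed
    ultimately show ?thesis using 3 by simp
  qed
qed

text \<open>Products of functions \<open>fk\<close> on the two trees behave under \<open>P\<close> like functions of the level, killed where
  one of the factors sums to zero. Their sum over \<open>m\<close> and \<open>n\<close> is a point mass on the level of \<open>y\<close>, so summing
  \<open>psi\<close> yields the Green function.\<close>

definition psi where
  "psi y m n x = T1.fk (fst y) (T1.lv (fst y) - int m) (fst x) * T2.fk (snd y) (T2.lv (snd y) - int n) (snd x)
     * gz (T1.lv (fst y)) (T1.lv (fst y) - int m) (T1.lv (fst y) + int n) (T1.lv (fst x))"

lemma psi_rec:
  assumes x: "x \<in> X" and y: "y \<in> X"
  shows "psi y m n x = (if T1.lv (fst x) = T1.lv (fst y) then
      T1.fk (fst y) (T1.lv (fst y) - int m) (fst x) * T2.fk (snd y) (T2.lv (snd y) - int n) (snd x) * ((2 * \<alpha> - 1) * sc (T1.lv (fst y))) else 0)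
      + (\<Sum>z\<in>C.nb x. P x z * psi y m n z)"
proof -
  obtain x1 x2 y1 y2 where xy: "x = (x1, x2)" "y = (y1, y2)" by (cases x; cases y)
  define l k where "l = T1.lv y1" and "k = T1.lv x1"
  have l2: "T2.lv y2 = - l" and k2: "T2.lv x2 = - k" using x y unfolding xy X_iff by (simp_all add: l_def k_def)
  define i j where "i = l - int m" and "j = l + int n"
  have ij: "i \<le> l" "l \<le> j" by (simp_all add: i_def j_def)
  define f where "f = T1.fk y1 i"
  define e where "e = T2.fk y2 (- j)"
  have psi: "psi (y1, y2) m n (z1, z2) = f z1 * e z2 * gz l i j (T1.lv z1)" for z1 z2
    by (simp add: psi_def l_def f_def e_def i_def j_def l2[unfolded l_def])
  have S: "(\<Sum>z\<in>C.nb x. P x z * psi y m n z) =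
     \<alpha> / real q * ((\<Sum>z1 | T1.par z1 = x1. f z1) * (e (T2.par x2) * gz l i j (k + 1)))
     + (1 - \<alpha>) / real r * ((\<Sum>z2 | T2.par z2 = x2. e z2) * (f (T1.par x1) * gz l i j (k - 1)))"
  proof -
    have "(\<Sum>z1 | T1.par z1 = x1. f z1 * e (T2.par x2) * gz l i j (T1.lv z1)) = (\<Sum>z1 | T1.par z1 = x1. f z1 * (e (T2.par x2) * gz l i j (k + 1)))"
    proof (rule sum.cong)
      fix z1 assume "z1 \<in> {z1. T1.par z1 = x1}"
      then have "T1.lv z1 = k + 1" using T1.lv_child[of z1 x1] by (simp add: k_def)
      then show "f z1 * e (T2.par x2) * gz l i j (T1.lv z1) = f z1 * (e (T2.par x2) * gz l i j (k + 1))" by simp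
    qed simp
    moreover have "(\<Sum>z2 | T2.par z2 = x2. f (T1.par x1) * e z2 * gz l i j (T1.lv (T1.par x1))) = (\<Sum>z2 | T2.par z2 = x2. e z2 * (f (T1.par x1) * gz l i j (k - 1)))"
      by (rule sum.cong) (auto simp: k_def mult_ac)
    ultimately show ?thesis using sum_nb[of x1 x2 "psi (y1, y2) m n"] x unfolding xy psi by (simp add: sum_distrib_right)
  qed
  have goal: "f x1 * e x2 * gz l i j k = (if k = l then f x1 * e x2 * ((2 * \<alpha> - 1) * sc l) else 0) + (\<Sum>z\<in>C.nb x. P x z * psi y m n z)"
  proof -
    \<comment> \<open>At level \<open>i - 1\<close> the product vanishes through \<open>gz\<close>,
      and so do the contributions of the neighbours, because \<open>f\<close> has zero sum over the
      children and is zero at the parent; level \<open>j + 1\<close> is symmetric. Farther out the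
      \<open>fk\<close> vanish. In between \<open>f\<close> and \<open>e\<close> do not change along
      the steps that count, and only the level process remains.\<close>
    consider "k < i - 1" | "k = i - 1" | "i \<le> k" "k \<le> j" | "k = j + 1" | "j + 1 < k" by linarith
    then show ?thesis
    proof cases
      case 1
      have "f x1 = 0" "f (T1.par x1) = 0" using 1 by (auto simp: f_def k_def intro!: T1.fk_zero_lv)
      moreover have "(\<Sum>z1 | T1.par z1 = x1. f z1) * (e (T2.par x2) * gz l i j (k + 1)) = 0"
      proof (cases "k + 1 = i - 1")
        case True
        then show ?thesis by (simp only: True gz_left[OF ij(1)] mult_zero_right)
      next
        case False
        have "f z1 = 0" if "T1.par z1 = x1" for z1
          using False 1 T1.lv_child[OF that] by (auto simp: f_def k_def intro!: T1.fk_zero_lv)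
        then show ?thesis by simp
      qed
      ultimately show ?thesis unfolding S using 1 ij by simp
    next
      case 2
      have "(\<Sum>z1 | T1.par z1 = x1. f z1) = 0" unfolding f_def
        by (rule T1.fk_sum) (use 2 ij in \<open>auto simp: k_def l_def\<close>)
      moreover have "f (T1.par x1) = 0" using 2 by (auto simp: f_def k_def intro!: T1.fk_zero_lv)
      moreover have "gz l i j k = 0" using gz_left[OF ij(1), of j] 2 by simp
      ultimately show ?thesis unfolding S using 2 ij by simp
    next
      case 3
      have "(\<Sum>z1 | T1.par z1 = x1. f z1) = (\<Sum>z1 | T1.par z1 = x1. f x1)"
        unfolding f_def by (rule sum.cong) (use 3 in \<open>auto simp: k_def intro!: T1.fk_child\<close>)
      then have s1: "(\<Sum>z1 | T1.par z1 = x1. f z1) = real q * f x1" using T1.card_children[of x1] by simp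
      have "(\<Sum>z2 | T2.par z2 = x2. e z2) = (\<Sum>z2 | T2.par z2 = x2. e x2)"
        unfolding e_def by (rule sum.cong) (use 3 k2 in \<open>auto intro!: T2.fk_child\<close>)
      then have s2: "(\<Sum>z2 | T2.par z2 = x2. e z2) = real r * e x2" using T2.card_children[of x2] by simp
      have e1: "e (T2.par x2) * gz l i j (k + 1) = e x2 * gz l i j (k + 1)"
      proof (cases "k = j")
        case True then show ?thesis using gz_right[OF ij(2), of i] by simp
      next
        case False
        then have "e x2 = e (T2.par x2)" unfolding e_def using 3 k2 by (intro T2.fk_child) auto
        then show ?thesis by simp
      qed
      have f1: "f (T1.par x1) * gz l i j (k - 1) = f x1 * gz l i j (k - 1)"
      proof (cases "k = i")
        case True then show ?thesis using gz_left[OF ij(1), of j] by simp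
      next
        case False
        then have "f x1 = f (T1.par x1)" unfolding f_def using 3 by (intro T1.fk_child) (auto simp: k_def)
        then show ?thesis by simp
      qed
      have cq: "\<alpha> / real q * (real q * f x1 * u) = \<alpha> * (f x1 * u)" for u using qr by simp
      have cr: "(1 - \<alpha>) / real r * (real r * e x2 * u) = (1 - \<alpha>) * (e x2 * u)" for u using qr by simp
      show ?thesis unfolding S s1 s2 e1 f1 gz_rec[OF ij, of k] cq cr by (simp add: algebra_simps)
    next
      case 4
      have "(\<Sum>z2 | T2.par z2 = x2. e z2) = 0" unfolding e_def
        by (rule T2.fk_sum) (use 4 ij k2 l2 in auto)
      moreover have "e (T2.par x2) = 0" using 4 k2 by (auto simp: e_def intro!: T2.fk_zero_lv)
      moreover have "gz l i j k = 0" using gz_right[OF ij(2), of i] 4 by simp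
      ultimately show ?thesis unfolding S using 4 ij by simp
    next
      case 5
      have "e x2 = 0" "e (T2.par x2) = 0" using 5 k2 by (auto simp: e_def intro!: T2.fk_zero_lv)
      moreover have "(\<Sum>z2 | T2.par z2 = x2. e z2) * (f (T1.par x1) * gz l i j (k - 1)) = 0"
      proof (cases "k - 1 = j + 1")
        case True
        then show ?thesis by (simp only: True gz_right[OF ij(2)] mult_zero_right)
      next
        case False
        have "e z2 = 0" if "T2.par z2 = x2" for z2
          using False 5 k2 T2.lv_child[OF that] by (auto simp: e_def intro!: T2.fk_zero_lv)
        then show ?thesis by simp
      qed
      ultimately show ?thesis unfolding S using 5 ij by simp
    qed
  qed
  show ?thesis using goal psi[of x1 x2] unfolding xy by (simp add: k_def l_def f_def e_def i_def j_def l2[unfolded l_def])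
qed

text \<open>Chosen such that \<open>Cw y * w x\<close> equals
  \<open>sc l * sqrt \<beta> powi (k - l)\<close> for the levels \<open>k\<close> of
  \<open>x\<close> and \<open>l\<close> of \<open>y\<close>, which dominates
  \<open>min (sc k) (sc l)\<close>.\<close>

definition Cw where "Cw y = sc (T1.lv (fst y)) * sqrt \<beta> powi (- T1.lv (fst y))"

text \<open>Where the product of the \<open>fk\<close> is nonzero, the level of \<open>x\<close>
  lies between the two barriers, and there \<open>gz\<close> is between 0 and
  \<open>min (sc k) (sc l)\<close>. The decay in \<open>m\<close> and \<open>n\<close> comes from
  \<open>fk_bound\<close>.\<close>

lemma psi_bound:
  assumes x: "x \<in> X" and y: "y \<in> X"
  shows "\<bar>psi y m n x\<bar> \<le> (4 * Cw y * w x) * ((1 / real q) ^ m * (1 / real r) ^ n)"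
proof -
  obtain x1 x2 y1 y2 where xy: "x = (x1, x2)" "y = (y1, y2)" by (cases x; cases y)
  define l k where "l = T1.lv y1" and "k = T1.lv x1"
  have l2: "T2.lv y2 = - l" and k2: "T2.lv x2 = - k" using x y unfolding xy X_iff by (simp_all add: l_def k_def)
  define f where "f = T1.fk y1 (l - int m) x1"
  define e where "e = T2.fk y2 (- l - int n) x2"
  define g where "g = gz l (l - int m) (l + int n) k"
  have psi: "psi y m n x = f * e * g"
    by (simp add: psi_def xy l_def k_def f_def e_def g_def l2[unfolded l_def])
  have fb: "\<bar>f\<bar> \<le> 2 * (1 / real q) ^ m" and eb: "\<bar>e\<bar> \<le> 2 * (1 / real r) ^ n"
    using T1.fk_bound[of y1 m x1] T2.fk_bound[of y2 n x2] by (simp_all add: f_def e_def l_def l2[unfolded l_def] power_one_over)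
  have Cw: "0 \<le> Cw y * w x" using sc_pos[of l] \<beta>_pos by (simp add: Cw_def w_def xy l_def less_imp_le)
  show ?thesis
  proof (cases "f = 0 \<or> e = 0")
    case True
    then show ?thesis unfolding psi using Cw by auto
  next
    case False
    have "\<not> k < l - int m - 1" using False T1.fk_zero_lv[of x1 "l - int m" y1] by (auto simp: f_def k_def)
    then have k1: "sc k \<le> sc (l - int m - 1)" by (intro sc_mono) simp
    have "\<not> - k < - l - int n - 1" using False T2.fk_zero_lv[of x2 "- l - int n" y2] k2 by (auto simp: e_def)
    then have k3: "sc (l + int n + 1) \<le> sc k" by (intro sc_mono) simp
    have A: "sc l \<le> sc (l - int m - 1)" "sc (l + int n + 1) \<le> sc l" by (auto intro: sc_mono)
    have AB: "sc (l + int n + 1) < sc (l - int m - 1)" by (rule sc_strict) simp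
    have g0: "0 \<le> g" unfolding g_def gz_def using k1 k3 A AB by (intro divide_nonneg_pos mult_nonneg_nonneg) auto
    have "g \<le> min (sc k) (sc l)"
    proof -
      have "(sc (l - int m - 1) - max (sc k) (sc l)) * (min (sc k) (sc l) - sc (l + int n + 1)) \<le>
         (sc (l - int m - 1) - sc (l + int n + 1)) * min (sc k) (sc l)"
        using k1 k3 A AB sc_pos[of "l + int n + 1"] by (intro mult_mono) auto
      moreover have D: "0 < sc (l - int m - 1) - sc (l + int n + 1)" using AB by simp
      ultimately show ?thesis unfolding g_def gz_def pos_divide_le_eq[OF D] by (simp only: mult.commute)
    qed
    also have "\<dots> \<le> Cw y * w x"
    proof -
      have t: "0 < sqrt \<beta>" "sqrt \<beta> < 1" using \<beta>_pos \<beta>_less by auto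
      have c: "Cw y * w x = sc l * sqrt \<beta> powi (k - l)"
        using t(1) unfolding Cw_def w_def by (simp add: xy l_def k_def power_int_diff power_int_minus field_simps)
      show ?thesis
      proof (cases "k \<le> l")
        case True
        then obtain d where d: "k - l = - int d" by (metis diff_le_0_iff_le nonpos_int_cases)
        have "1 \<le> sqrt \<beta> powi (k - l)" unfolding d using t by (simp add: power_int_minus one_le_inverse_iff power_le_one)
        then have "sc l * 1 \<le> sc l * sqrt \<beta> powi (k - l)" using sc_pos[of l] by (intro mult_left_mono) auto
        then show ?thesis unfolding c by (simp add: min_le_iff_disj)
      next
        case False
        then obtain d where d: "k - l = int d" by (metis diff_ge_0_iff_ge nle_le zero_le_imp_eq_int)
        then have "sc k = sc l * \<beta> ^ d" using sc_add[of l "int d"] by (simp add: sc_def algebra_simps)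
        moreover have "\<beta> ^ d \<le> sqrt \<beta> ^ d"
        proof (rule power_mono)
          have "sqrt \<beta> * sqrt \<beta> \<le> sqrt \<beta> * 1" using t by (intro mult_left_mono) auto
          moreover have "sqrt \<beta> * sqrt \<beta> = \<beta>" using \<beta>_pos by simp
          ultimately show "\<beta> \<le> sqrt \<beta>" by linarith
        qed (use \<beta>_pos in simp)
        ultimately have "sc k \<le> sc l * sqrt \<beta> powi (k - l)" unfolding d using sc_pos[of l] by (simp add: mult_left_mono)
        then show ?thesis unfolding c by (simp add: min_le_iff_disj)
      qed
    qed
    finally have gb: "\<bar>g\<bar> \<le> Cw y * w x" using g0 by simp
    have "\<bar>f\<bar> * \<bar>e\<bar> * \<bar>g\<bar> \<le> (2 * (1 / real q) ^ m) * (2 * (1 / real r) ^ n) * (Cw y * w x)"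
      using fb eb gb qr by (intro mult_mono) auto
    then show ?thesis unfolding psi abs_mult by (simp add: mult_ac)
  qed
qed

definition geoc where "geoc = 1 / (1 - 1 / real q) * (1 / (1 - 1 / real r))"

lemma geo2: "((\<lambda>(m, n). (1 / real q) ^ m * (1 / real r) ^ n) has_sum geoc) UNIV"
  unfolding geoc_def using T1.real_p T2.real_p by (intro geometric_has_sum2) auto

lemma psi_has_sum:
  assumes x: "x \<in> X" and y: "y \<in> X"
  shows "((\<lambda>(m, n). psi y m n x) has_sum infsum (\<lambda>(m, n). psi y m n x) UNIV) UNIV"
    "\<bar>infsum (\<lambda>(m, n). psi y m n x) UNIV\<bar> \<le> 4 * Cw y * geoc * w x"
proof -
  have hs: "((\<lambda>mn. (4 * Cw y * w x) * (case mn of (m, n) \<Rightarrow> (1 / real q) ^ m * (1 / real r) ^ n)) has_sum (4 * Cw y * w x * geoc)) UNIV"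
    by (rule has_sum_cmult_right[OF geo2])
  have b: "norm (case mn of (m, n) \<Rightarrow> psi y m n x) \<le> (4 * Cw y * w x) * (case mn of (m, n) \<Rightarrow> (1 / real q) ^ m * (1 / real r) ^ n)" for mn
    using psi_bound[OF x y] by (cases mn) auto
  have "(\<lambda>mn. norm (case mn of (m, n) \<Rightarrow> psi y m n x)) summable_on UNIV"
    by (rule summable_on_comparison_test[OF has_sum_imp_summable[OF hs]]) (use b in auto)
  then show 1: "((\<lambda>(m, n). psi y m n x) has_sum infsum (\<lambda>(m, n). psi y m n x) UNIV) UNIV"
    using abs_summable_summable has_sum_infsum by blast
  show "\<bar>infsum (\<lambda>(m, n). psi y m n x) UNIV\<bar> \<le> 4 * Cw y * geoc * w x"
    using norm_infsum_le[OF 1 hs] b by (simp add: mult_ac)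
qed

lemma fk2_has_sum:
  assumes x: "x \<in> X" and y: "y \<in> X" and l: "T1.lv (fst x) = T1.lv (fst y)"
  shows "((\<lambda>(m, n). T1.fk (fst y) (T1.lv (fst y) - int m) (fst x) * T2.fk (snd y) (T2.lv (snd y) - int n) (snd x))
     has_sum (if x = y then 1 else 0)) UNIV"
proof -
  obtain x1 x2 y1 y2 where xy: "x = (x1, x2)" "y = (y1, y2)" by (cases x; cases y)
  have l2: "T2.lv x2 = T2.lv y2" using x y l unfolding xy X_iff by simp
  define u where "u = (\<lambda>m :: nat. T1.fk y1 (T1.lv y1 - int m) x1)"
  define v where "v = (\<lambda>n :: nat. T2.fk y2 (T2.lv y2 - int n) x2)"
  have ub: "\<bar>u m\<bar> \<le> 2 * (1 / real q) ^ m" and vb: "\<bar>v m\<bar> \<le> 2 * (1 / real r) ^ m" for m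
    using T1.fk_bound[of y1 m x1] T2.fk_bound[of y2 m x2] by (simp_all add: u_def v_def power_one_over)
  have su: "summable (\<lambda>m. norm (u m))"
    by (rule summable_comparison_test[of _ "\<lambda>m. 2 * (1 / real q) ^ m"])
      (use ub T1.real_p in \<open>auto intro!: summable_mult summable_geometric\<close>)
  have sv: "summable (\<lambda>m. norm (v m))"
    by (rule summable_comparison_test[of _ "\<lambda>m. 2 * (1 / real r) ^ m"])
      (use vb T2.real_p in \<open>auto intro!: summable_mult summable_geometric\<close>)
  have hu: "(u has_sum (if x1 = y1 then 1 else 0)) UNIV"
    using norm_summable_imp_has_sum[OF su] T1.fk_sums[of x1 y1] l by (simp add: u_def xy)
  have hv: "(v has_sum (if x2 = y2 then 1 else 0)) UNIV"
    using norm_summable_imp_has_sum[OF sv] T2.fk_sums[of x2 y2] l2 by (simp add: v_def xy)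
  have "(\<lambda>mn. norm (case mn of (m, n) \<Rightarrow> u m * v n)) summable_on UNIV"
  proof (rule summable_on_comparison_test)
    show "(\<lambda>mn. 4 * (case mn of (m, n) \<Rightarrow> (1 / real q) ^ m * (1 / real r) ^ n)) summable_on UNIV"
      by (rule has_sum_imp_summable[OF has_sum_cmult_right[OF geo2]])
    fix mn :: "nat \<times> nat"
    obtain m n where mn: "mn = (m, n)" by (cases mn)
    have "\<bar>u m\<bar> * \<bar>v n\<bar> \<le> (2 * (1 / real q) ^ m) * (2 * (1 / real r) ^ n)" using ub vb qr by (intro mult_mono) auto
    then show "norm (case mn of (m, n) \<Rightarrow> u m * v n) \<le> 4 * (case mn of (m, n) \<Rightarrow> (1 / real q) ^ m * (1 / real r) ^ n)"
      by (simp add: mn abs_mult)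
  qed auto
  then have "(\<lambda>(m, n). u m * v n) summable_on UNIV" by (rule abs_summable_summable)
  then have s: "(\<lambda>(m, n). u m * v n) summable_on Sigma UNIV (\<lambda>_. UNIV)" by simp
  have "((\<lambda>(m, n). u m * v n) has_sum ((if x1 = y1 then 1 else 0) * (if x2 = y2 then 1 else 0))) (Sigma UNIV (\<lambda>_. UNIV))"
    by (rule has_sum_SigmaI[OF _ has_sum_cmult_left[OF hu] s]) (use has_sum_cmult_right[OF hv] in auto)
  then show ?thesis by (auto simp: u_def v_def xy)
qed

text \<open>The divisor is the source in \<open>gz_rec\<close>, so that the point mass resolved by
  \<open>fk2_has_sum\<close> appears with factor 1.\<close>

definition Gf where "Gf x y = infsum (\<lambda>(m, n). psi y m n x) UNIV / ((2 * \<alpha> - 1) * sc (T1.lv (fst y)))"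

lemma Gf_rec:
  assumes x: "x \<in> X" and y: "y \<in> X"
  shows "Gf x y = (if x = y then 1 else 0) + (\<Sum>z\<in>C.nb x. P x z * Gf z y)"
proof -
  define c where "c = (2 * \<alpha> - 1) * sc (T1.lv (fst y))"
  define I where "I z = infsum (\<lambda>(m, n). psi y m n z) UNIV" for z
  have c: "c \<noteq> 0" using half sc_pos[of "T1.lv (fst y)"] by (simp add: c_def)
  have hI: "((\<lambda>mn. case mn of (m, n) \<Rightarrow> psi y m n z) has_sum I z) UNIV" if "z \<in> X" for z
    unfolding I_def using psi_has_sum(1)[OF that y] by simp
  define d where "d mn = (if T1.lv (fst x) = T1.lv (fst y) then c * (case mn of (m, n) \<Rightarrow>
      T1.fk (fst y) (T1.lv (fst y) - int m) (fst x) * T2.fk (snd y) (T2.lv (snd y) - int n) (snd x)) else 0)" for mn :: "nat \<times> nat"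
  have hd: "(d has_sum (c * (if x = y then 1 else 0))) UNIV"
  proof (cases "T1.lv (fst x) = T1.lv (fst y)")
    case True
    then show ?thesis using has_sum_cmult_right[OF fk2_has_sum[OF x y True], of c] unfolding d_def by simp
  next
    case False
    then have "x \<noteq> y" "d = (\<lambda>_. 0)" by (auto simp: d_def)
    then show ?thesis by simp
  qed
  have "((\<lambda>mn. d mn + (\<Sum>z\<in>C.nb x. P x z * (case mn of (m, n) \<Rightarrow> psi y m n z))) has_sum
     (c * (if x = y then 1 else 0) + (\<Sum>z\<in>C.nb x. P x z * I z))) UNIV"
    by (intro has_sum_add hd has_sum_sum_finite has_sum_cmult_right hI) (use C.nb_X C.finite_nb x in auto)
  moreover have "d mn + (\<Sum>z\<in>C.nb x. P x z * (case mn of (m, n) \<Rightarrow> psi y m n z)) = (case mn of (m, n) \<Rightarrow> psi y m n x)" for mn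
    using psi_rec[OF x y] by (cases mn) (simp add: d_def c_def mult_ac)
  ultimately have "I x = c * (if x = y then 1 else 0) + (\<Sum>z\<in>C.nb x. P x z * I z)"
    using has_sum_unique[OF hI[OF x]] by simp
  then have "I x / c = (if x = y then 1 else 0) + (\<Sum>z\<in>C.nb x. P x z * (I z / c))"
    using c by (simp add: add_divide_distrib sum_divide_distrib)
  then show ?thesis by (simp add: Gf_def I_def c_def)
qed

lemma Gf_bound:
  assumes x: "x \<in> X" and y: "y \<in> X"
  shows "\<bar>Gf x y\<bar> \<le> 4 * Cw y * geoc / ((2 * \<alpha> - 1) * sc (T1.lv (fst y))) * w x"
proof -
  have c: "(2 * \<alpha> - 1) * sc (T1.lv (fst y)) > 0" using half sc_pos by simp
  show ?thesis unfolding Gf_def abs_divide using psi_has_sum(2)[OF x y] c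
    by (simp add: divide_right_mono)
qed

lemma nstep_sums: assumes x: "x \<in> X" and y: "y \<in> X" shows "(\<lambda>n. nstep X P n x y) sums Gf x y"
proof (rule C.nstep_sums_green[where w = w and \<rho> = \<rho> and C = "4 * Cw y * geoc / ((2 * \<alpha> - 1) * sc (T1.lv (fst y)))"])
  have "0 \<le> Cw y" using sc_pos[of "T1.lv (fst y)"] \<beta>_pos by (simp add: Cw_def less_imp_le)
  moreover have "0 \<le> geoc" using T1.real_p T2.real_p by (simp add: geoc_def)
  moreover have "0 < (2 * \<alpha> - 1) * sc (T1.lv (fst y))" using half sc_pos by simp
  ultimately show "0 \<le> 4 * Cw y * geoc / ((2 * \<alpha> - 1) * sc (T1.lv (fst y)))" by simp
  show "\<bar>Gf x y\<bar> \<le> 4 * Cw y * geoc / ((2 * \<alpha> - 1) * sc (T1.lv (fst y))) * w x" if "x \<in> X" for x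
    by (rule Gf_bound[OF that y])
qed (rule w_sum rho Gf_rec x y | assumption)+

lemma green_Gf: "x \<in> X \<Longrightarrow> y \<in> X \<Longrightarrow> green X P x y = Gf x y"
  unfolding green_def using nstep_sums sums_unique by metis

lemma transient_half: "transient_chain X P"
  unfolding transient_chain_def using nstep_sums sums_summable by blast

section \<open>The Green function in terms of the two confluents\<close>

lemma gparam_DL:
  assumes x: "(x1, x2) \<in> X" and y: "(y1, y2) \<in> X" and ab: "T1.cl x1 y1 < - T2.cl x2 y2"
  shows "gparam (real q) (real r) \<beta> (sc (T1.cl x1 y1)) (sc (- T2.cl x2 y2)) (sc (T1.lv x1)) (sc (T1.lv y1))"
proof
  have 2: "T1.lv x1 \<le> - T2.cl x2 y2" "T1.lv y1 \<le> - T2.cl x2 y2"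
    using T2.cl_le1[of x2 y2] T2.cl_le2[of x2 y2] x y by (auto simp: X_iff)
  show "2 \<le> real q" "2 \<le> real r" using T1.real_p T2.real_p by auto
  show "0 < \<beta>" "\<beta> < 1" by (rule \<beta>_pos \<beta>_less)+
  show "0 < sc (- T2.cl x2 y2)" by (rule sc_pos)
  show "sc (- T2.cl x2 y2) < sc (T1.cl x1 y1)" by (rule sc_strict[OF ab])
  show "sc (- T2.cl x2 y2) \<le> sc (T1.lv x1)" "sc (- T2.cl x2 y2) \<le> sc (T1.lv y1)" using 2 by (auto intro: sc_mono)
  show "sc (T1.lv x1) \<le> sc (T1.cl x1 y1)" "sc (T1.lv y1) \<le> sc (T1.cl x1 y1)"
    using T1.cl_le1 T1.cl_le2 by (auto intro: sc_mono)
qed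

text \<open>In the series of \<open>psi\<close> the indices \<open>i = l - m\<close> and
  \<open>j = l + n\<close> are counted from the level of \<open>y\<close>. Here they are counted
  from the confluents, so that the values of \<open>fk\<close> become the coefficients
  \<open>Fc\<close>.\<close>

lemma green_Wsum:
  assumes x: "(x1, x2) \<in> X" and y: "(y1, y2) \<in> X" and ab: "T1.cl x1 y1 < - T2.cl x2 y2"
  shows "green X P (x1, x2) (y1, y2) = real q powi (T1.cl x1 y1 - T1.lv y1) * real r powi (T2.cl x2 y2 - T2.lv y2)
     * Wsum (real q) (real r) (gparam.gg \<beta> (sc (T1.cl x1 y1)) (sc (- T2.cl x2 y2)) (sc (T1.lv x1)) (sc (T1.lv y1)))
     / ((2 * \<alpha> - 1) * sc (T1.lv y1))"
proof -
  define a b l k where "a = T1.cl x1 y1" and "b = - T2.cl x2 y2" and "l = T1.lv y1" and "k = T1.lv x1"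
  interpret gparam "real q" "real r" \<beta> "sc a" "sc b" "sc k" "sc l"
    unfolding a_def b_def l_def k_def by (rule gparam_DL[OF x y ab])
  have l2: "T2.lv y2 = - l" and k2: "T2.lv x2 = - k" using x y unfolding X_iff by (simp_all add: l_def k_def)
  have le: "a \<le> k" "a \<le> l" "k \<le> b" "l \<le> b"
    using T1.cl_le1[of x1 y1] T1.cl_le2[of x1 y1] T2.cl_le1[of x2 y2] T2.cl_le2[of x2 y2] l2 k2
    by (auto simp: a_def b_def l_def k_def)
  define h where "h = (\<lambda>(i, j). T1.fk y1 i x1 * T2.fk y2 (- j) x2 * gz l i j k)"
  define c where "c = real q powi (a - l) * real r powi (- b + l)"
  have gb: "\<bar>gg m n\<bar> \<le> sc l" for m n
  proof -
    have p: "0 \<le> Am m - max (sc k) (sc l)" "0 \<le> min (sc k) (sc l) - Bn n"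
      using Am_ge[of m] Bn_le[of n] s t by auto
    have "(Am m - max (sc k) (sc l)) * (min (sc k) (sc l) - Bn n) \<le> (Am m - Bn n) * sc l"
      using p Bn_le[of n] s t by (intro mult_mono) auto
    then have "gg m n \<le> sc l" unfolding gg_def using ABd(3)[of m n] by (simp add: divide_le_eq mult.commute)
    moreover have "0 \<le> gg m n" unfolding gg_def using p ABd(3)[of m n] by simp
    ultimately show ?thesis by simp
  qed
  have hW: "((\<lambda>mn. c * (case mn of (m, n) \<Rightarrow> Fc (real q) m * Fc (real r) n * gg m n)) has_sum (c * Wsum (real q) (real r) gg)) UNIV"
    by (intro has_sum_cmult_right Wsum_has_sum(1)[OF q r gb])
  have hi: "h (a + 1 - int m, b - 1 + int n) = c * (Fc (real q) m * Fc (real r) n * gg m n)" for m n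
  proof -
    have "T1.fk y1 (a + 1 - int m) x1 = real q powi (a - l) * Fc (real q) m"
      using T1.fk_Fc[of y1 x1 m] by (simp add: a_def l_def)
    moreover have "T2.fk y2 (- (b - 1 + int n)) x2 = real r powi (- b + l) * Fc (real r) n"
      using T2.fk_Fc[of y2 x2 n] l2 by (simp add: b_def algebra_simps)
    moreover have "gz l (a + 1 - int m) (b - 1 + int n) k = gg m n"
    proof -
      have "sc (a - int m) = Am m" unfolding Am_def using \<beta>_pos by (simp add: sc_def power_int_diff)
      moreover have "sc (b + int n) = Bn n" unfolding Bn_def using \<beta>_pos by (simp add: sc_def power_int_add)
      ultimately show ?thesis by (simp add: gz_def gg_def)
    qed
    ultimately show ?thesis by (simp add: h_def c_def)
  qed
  have "(h has_sum (c * Wsum (real q) (real r) gg)) ({..a + 1} \<times> {b - 1..})"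
  proof (subst has_sum_reindex_bij_witness[where T = UNIV and s' = "c * Wsum (real q) (real r) gg"
      and i = "\<lambda>(m, n). (a + 1 - int m, b - 1 + int n)" and j = "\<lambda>(i, j). (nat (a + 1 - i), nat (j - (b - 1)))"
      and h = "\<lambda>mn. c * (case mn of (m, n) \<Rightarrow> Fc (real q) m * Fc (real r) n * gg m n)"])
    fix ij assume "ij \<in> {..a + 1} \<times> {b - 1..}"
    then obtain i j where ij: "ij = (i, j)" "i \<le> a + 1" "b - 1 \<le> j" by auto
    show "c * (case case ij of (i, j) \<Rightarrow> (nat (a + 1 - i), nat (j - (b - 1))) of (m, n) \<Rightarrow> Fc (real q) m * Fc (real r) n * gg m n) = h ij"
      using hi[of "nat (a + 1 - i)" "nat (j - (b - 1))"] ij by simp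
  qed (use hW in auto)
  \<comment> \<open>The index ranges differ only where \<open>h\<close> vanishes: beyond the
    confluents one of the \<open>fk\<close> is zero, and the range starting at the confluents
    exceeds the other one only for \<open>i - 1 = l\<close> or \<open>j + 1 = l\<close>, where
    \<open>gz\<close> is zero.\<close>
  also have "?this \<longleftrightarrow> (h has_sum (c * Wsum (real q) (real r) gg)) ({..l} \<times> {l..})"
  proof (rule has_sum_cong_neutral)
    fix ij assume "ij \<in> {..l} \<times> {l..} - {..a + 1} \<times> {b - 1..}"
    then obtain i j where ij': "ij = (i, j)" "\<not> (i \<le> a + 1 \<and> b - 1 \<le> j)" by auto
    then have ij: "ij = (i, j)" "a < i - 1 \<or> - b < - j - 1" by auto
    then have "T1.fk y1 i x1 = 0 \<or> T2.fk y2 (- j) x2 = 0"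
      using T1.fk_zero[of x1 y1 i] T2.fk_zero[of x2 y2 "- j"] by (auto simp: a_def b_def)
    then show "h ij = 0" by (auto simp: h_def ij)
  next
    fix ij assume "ij \<in> {..a + 1} \<times> {b - 1..} - {..l} \<times> {l..}"
    then obtain i j where ij': "ij = (i, j)" "i \<le> a + 1" "b - 1 \<le> j" "\<not> (i \<le> l \<and> l \<le> j)" by auto
    then have ij: "ij = (i, j)" "i \<le> a + 1" "b - 1 \<le> j" "l < i \<or> j < l" by auto
    have "gz l i j k = 0"
    proof (cases "l < i")
      case True
      then have "a = l" "i - 1 = l" using ij le by auto
      then show ?thesis using sc_mono[of l k] le by (simp add: gz_def max_def)
    next
      case False
      then have "b = l" "j + 1 = l" using ij le by auto
      then show ?thesis using sc_mono[of k l] le by (simp add: gz_def min_def)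
    qed
    then show "h ij = 0" by (simp add: h_def ij)
  qed simp
  also have "\<dots> \<longleftrightarrow> ((\<lambda>(m, n). psi (y1, y2) m n (x1, x2)) has_sum (c * Wsum (real q) (real r) gg)) UNIV"
  proof (rule has_sum_reindex_bij_witness[where i = "\<lambda>(m, n). (l - int m, l + int n)" and j = "\<lambda>(i, j). (nat (l - i), nat (j - l))"])
    fix ij assume "ij \<in> {..l} \<times> {l..}"
    then obtain i j where ij: "ij = (i, j)" "i \<le> l" "l \<le> j" by auto
    show "(case case ij of (i, j) \<Rightarrow> (nat (l - i), nat (j - l)) of (m, n) \<Rightarrow> psi (y1, y2) m n (x1, x2)) = h ij"
      using ij l2 by (simp add: psi_def h_def l_def[symmetric] k_def[symmetric])
  qed auto
  finally have "infsum (\<lambda>(m, n). psi (y1, y2) m n (x1, x2)) UNIV = c * Wsum (real q) (real r) gg"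
    by (rule infsumI)
  then have "green X P (x1, x2) (y1, y2) = c * Wsum (real q) (real r) gg / ((2 * \<alpha> - 1) * sc l)"
    unfolding green_Gf[OF x y] Gf_def by (simp add: l_def)
  then show ?thesis unfolding c_def by (simp add: a_def b_def l_def k_def l2[unfolded l_def])
qed

end
end

section \<open>Limits of Martin kernels\<close>

context finite_range_chain
begin

text \<open>Since \<open>P K(\<sqdot>, y) = K(\<sqdot>, y) - \<delta>\<^sub>y / G(o, y)\<close>, limits of Martin kernels along sequences leaving
  every finite set are harmonic.\<close>

lemma green_rec:
  assumes "transient_chain X P" "x \<in> X" "y \<in> X"
  shows "green X P x y = (if x = y then 1 else 0) + (\<Sum>z\<in>nb x. P x z * green X P z y)"
proof -
  have s: "summable (\<lambda>n. nstep X P n z y)" if "z \<in> X" for z using assms that by (simp add: transient_chain_def)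
  have "(\<lambda>N. \<Sum>n<Suc N. nstep X P n x y) \<longlonglongrightarrow> green X P x y"
    unfolding green_def using summable_LIMSEQ[OF s[OF assms(2)]] by (rule LIMSEQ_Suc)
  moreover have "(\<lambda>N. (if x = y then 1 else 0) + (\<Sum>z\<in>nb x. P x z * (\<Sum>n<N. nstep X P n z y)))
     \<longlonglongrightarrow> (if x = y then 1 else 0) + (\<Sum>z\<in>nb x. P x z * green X P z y)"
    unfolding green_def by (intro tendsto_intros summable_LIMSEQ s) (rule nb_X)
  ultimately show ?thesis unfolding sum_nstep_Suc[OF assms(2)] using LIMSEQ_unique by blast
qed

lemma nstep_green_le:
  assumes "transient_chain X P" "x \<in> X" "z \<in> X" "y \<in> X"
  shows "nstep X P m x z * green X P z y \<le> green X P x y"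
proof -
  have s: "summable (\<lambda>n. nstep X P n z y)" "summable (\<lambda>n. nstep X P n x y)"
    using assms by (auto simp: transient_chain_def)
  have s': "summable (\<lambda>n. nstep X P (n + m) x y)" using s(2) summable_iff_shift[of "\<lambda>n. nstep X P n x y" m] by simp
  have "nstep X P m x z * green X P z y = (\<Sum>n. nstep X P m x z * nstep X P n z y)"
    unfolding green_def by (rule suminf_mult[OF s(1), symmetric])
  also have "\<dots> \<le> (\<Sum>n. nstep X P (n + m) x y)"
  proof (rule suminf_le)
    show "nstep X P m x z * nstep X P n z y \<le> nstep X P (n + m) x y" for n
      using nstep_add_ge[OF assms(2,3), of m n y] by (simp add: add.commute)
  qed (use s s' in \<open>auto intro: summable_mult\<close>)
  also have "\<dots> \<le> (\<Sum>n. nstep X P n x y)"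
    unfolding suminf_minus_initial_segment[OF s(2), of m] using nstep_nonneg[OF assms(2)] by (simp add: sum_nonneg)
  finally show ?thesis by (simp add: green_def)
qed

lemma kernel_limit_harmonic:
  assumes tr: "transient_chain X P" and irr: "irreducible_chain X P" and o: "o\<^sub>0 \<in> X"
    and F: "F \<noteq> bot" and yX: "\<forall>\<^sub>F i in F. y i \<in> X" and esc: "\<And>x. x \<in> X \<Longrightarrow> \<forall>\<^sub>F i in F. y i \<noteq> x"
    and lim: "\<And>x. x \<in> X \<Longrightarrow> ((\<lambda>i. martin_kernel X P o\<^sub>0 x (y i)) \<longlongrightarrow> h x) F"
  shows "positive_harmonic X P h" "h o\<^sub>0 = 1"
proof -
  have "(\<Sum>z\<in>nb x. P x z * h z) = h x" if x: "x \<in> X" for x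
  proof -
    have "((\<lambda>i. \<Sum>z\<in>nb x. P x z * martin_kernel X P o\<^sub>0 z (y i)) \<longlongrightarrow> (\<Sum>z\<in>nb x. P x z * h z)) F"
      by (intro tendsto_intros lim) (rule nb_X)
    moreover have "\<forall>\<^sub>F i in F. (\<Sum>z\<in>nb x. P x z * martin_kernel X P o\<^sub>0 z (y i)) = martin_kernel X P o\<^sub>0 x (y i)"
      using yX esc[OF x]
    proof eventually_elim
      case (elim i)
      then show ?case using green_rec[OF tr x elim(1)] by (simp add: martin_kernel_def sum_divide_distrib)
    qed
    ultimately have "((\<lambda>i. martin_kernel X P o\<^sub>0 x (y i)) \<longlongrightarrow> (\<Sum>z\<in>nb x. P x z * h z)) F"
      by (rule Lim_transform_eventually)
    then show ?thesis using tendsto_unique[OF F] lim[OF x] by blast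
  qed
  moreover have "h x > 0" if x: "x \<in> X" for x
  proof -
    obtain m where m: "nstep X P m x o\<^sub>0 > 0" using irr x o by (auto simp: irreducible_chain_def)
    have "\<forall>\<^sub>F i in F. nstep X P m x o\<^sub>0 \<le> martin_kernel X P o\<^sub>0 x (y i)"
      using yX
    proof eventually_elim
      case (elim i)
      then show ?case unfolding martin_kernel_def using nstep_green_le[OF tr x o elim, of m] green_pos[OF tr irr o elim]
        by (simp add: le_divide_eq)
    qed
    then show ?thesis using tendsto_lowerbound[OF lim[OF x] _ F] m by force
  qed
  ultimately show "positive_harmonic X P h" by (simp add: positive_harmonic_def harmonic_iff)
  have "\<forall>\<^sub>F i in F. martin_kernel X P o\<^sub>0 o\<^sub>0 (y i) = 1"
    using yX by eventually_elim (use green_pos[OF tr irr o] in \<open>simp add: martin_kernel_def less_imp_neq[symmetric]\<close>)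
  then have "((\<lambda>i. martin_kernel X P o\<^sub>0 o\<^sub>0 (y i)) \<longlongrightarrow> 1) F" by (rule tendsto_eventually)
  then show "h o\<^sub>0 = 1" using tendsto_unique[OF F] lim[OF o] by blast
qed

text \<open>The step between \<open>y i\<close> and \<open>y' i\<close> costs at most a factor
  \<open>c\<close> in the numerator of the Martin kernel and another one in the denominator.\<close>

lemma kernel_limit_compare:
  assumes tr: "transient_chain X P" and irr: "irreducible_chain X P" and o: "o\<^sub>0 \<in> X" and x: "x \<in> X"
    and F: "F \<noteq> bot" and yX: "\<forall>\<^sub>F i in F. y i \<in> X \<and> y' i \<in> X \<and> c \<le> P (y i) (y' i) \<and> c \<le> P (y' i) (y i)" and c: "c > 0"
    and lim: "((\<lambda>i. martin_kernel X P o\<^sub>0 x (y i)) \<longlongrightarrow> h) F" "((\<lambda>i. martin_kernel X P o\<^sub>0 x (y' i)) \<longlongrightarrow> h') F"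
  shows "c\<^sup>2 * h' \<le> h"
proof (rule tendsto_le[OF F lim(1)])
  show "((\<lambda>i. c\<^sup>2 * martin_kernel X P o\<^sub>0 x (y' i)) \<longlongrightarrow> c\<^sup>2 * h') F" by (intro tendsto_intros lim)
  show "\<forall>\<^sub>F i in F. c\<^sup>2 * martin_kernel X P o\<^sub>0 x (y' i) \<le> martin_kernel X P o\<^sub>0 x (y i)"
    using yX
  proof eventually_elim
    case (elim i)
    have g: "green X P o\<^sub>0 (y i) > 0" "green X P o\<^sub>0 (y' i) > 0" "green X P x (y' i) > 0"
      using green_pos[OF tr irr] o x elim by auto
    have 1: "green X P x (y' i) * c \<le> green X P x (y i)"
    proof -
      have "green X P x (y' i) * c \<le> green X P x (y' i) * P (y' i) (y i)" using elim g by (intro mult_left_mono) auto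
      also have "\<dots> \<le> green X P x (y i)" using green_mult_le[OF tr x] elim by blast
      finally show ?thesis .
    qed
    have 2: "green X P o\<^sub>0 (y i) * c \<le> green X P o\<^sub>0 (y' i)"
    proof -
      have "green X P o\<^sub>0 (y i) * c \<le> green X P o\<^sub>0 (y i) * P (y i) (y' i)" using elim g by (intro mult_left_mono) auto
      also have "\<dots> \<le> green X P o\<^sub>0 (y' i)" using green_mult_le[OF tr o] elim by blast
      finally show ?thesis .
    qed
    have "c\<^sup>2 * green X P x (y' i) * green X P o\<^sub>0 (y i) = (green X P x (y' i) * c) * (green X P o\<^sub>0 (y i) * c)"
      by (simp add: power2_eq_square mult_ac)
    also have "\<dots> \<le> green X P x (y i) * green X P o\<^sub>0 (y' i)"
      using 1 2 g c green_nonneg[OF tr x] elim by (intro mult_mono) auto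
    finally show ?case unfolding martin_kernel_def using g by (simp add: divide_le_eq le_divide_eq mult_ac)
  qed
qed

text \<open>Minimality would make \<open>c * h'\<close> a multiple of \<open>h\<close>, and the
  common value 1 at the reference point would force \<open>h = h'\<close> on
  \<open>X\<close>.\<close>

lemma not_minimalI:
  assumes h: "h o\<^sub>0 = 1" and h': "positive_harmonic X P h'" "h' o\<^sub>0 = 1" and o: "o\<^sub>0 \<in> X"
    and le: "c > 0" "\<And>x. x \<in> X \<Longrightarrow> c * h' x \<le> h x" and x: "x \<in> X" "h x \<noteq> h' x"
  shows "\<not> minimal_harmonic X P o\<^sub>0 h"
proof
  assume m: "minimal_harmonic X P o\<^sub>0 h"
  have "positive_harmonic X P (\<lambda>x. c * h' x)"
    using h'(1) le(1) by (simp add: positive_harmonic_def harmonic_iff sum_distrib_left[symmetric] mult.left_commute)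
  then obtain d where d: "\<And>x. x \<in> X \<Longrightarrow> c * h' x = d * h x"
    using m le(2) unfolding minimal_harmonic_def by blast
  have "c = d" using d[OF o] h h'(2) by simp
  then show False using d[OF x(1)] le(1) x(2) by simp
qed

end

lemma spherical_swap:
  fixes b :: real assumes "b > 0"
  shows "1 / (p * b\<^sup>2) ^ d * z = (1 / b) ^ (u + d) / p ^ d * z * b powi (int u - int d)"
proof -
  have e: "b powi (int u - int d) = b ^ u / b ^ d" using assms by (simp add: power_int_diff)
  show ?thesis unfolding e using assms by (simp add: power_mult_distrib power_add power_one_over power2_eq_square field_simps)
qed

context homtree
begin

text \<open>The factor between \<open>spherical\<close> and \<open>Hh\<close> in
  \<open>spherical_gt\<close>; it depends on neither vertex and cancels in the kernels.\<close>

definition kap :: "real \<Rightarrow> real" where "kap b = b * (real p - b) / (real p * (1 - b)\<^sup>2)"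

lemma spherical_gt:
  assumes a: "1 / 2 < a" "a < 1"
  shows "spherical a p T x y = kap ((1 - a) / a) * Hh (real p) ((1 - a) / a) (((1 - a) / a) ^ up T x y) (((1 - a) / a) ^ down T x y) / real p ^ down T x y"
proof -
  define b where "b = (1 - a) / a"
  define u d where "u = up T x y" and "d = down T x y"
  have b: "0 < b" "b < 1" using a by (auto simp: b_def)
  define U V where "U = b ^ u" and "V = b ^ d"
  have UV: "U > 0" "V > 0" using b by (auto simp: U_def V_def)
  define Z where "Z = (real p * (1 / b) + 1) / (real p * (1 / b)\<^sup>2 - 1) + ((1 / b) ^ u - 1) / (1 / b - 1) + ((1 / b) ^ d - 1) / (1 / b - 1)"
  have sp: "spherical a p T x y = b ^ (u + d) / real p ^ d * Z"
    using a unfolding spherical_def Let_def Z_def u_def d_def b_def by simp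
  define th where "th = (1 + b) * (real p - b) / (real p - b\<^sup>2)"
  have b2: "b\<^sup>2 < 1" using b by (simp add: power_less_one_iff)
  have pb: "real p - b\<^sup>2 > 0" "real p - b > 0" using b2 b real_p by linarith+
  have z1: "(real p * (1 / b) + 1) / (real p * (1 / b)\<^sup>2 - 1) = b * (real p + b) / (real p - b\<^sup>2)"
    using b pb by (simp add: field_simps power2_eq_square)
  have z2: "((1 / b) ^ n - 1) / (1 / b - 1) = b / (1 - b) * (1 / b ^ n - 1)" for n
    using b by (simp add: field_simps power_one_over)
  have "U * V * Z = b / (1 - b) * (V + U - U * V * th)"
  proof -
    have "Z = b / (1 - b) * (1 / U - 1 + (1 / V - 1) + (1 - b) * (real p + b) / (real p - b\<^sup>2))"
    proof -
      have c: "b * (real p + b) / (real p - b\<^sup>2) = b / (1 - b) * ((1 - b) * (real p + b) / (real p - b\<^sup>2))" using b by simp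
      have d: "c * x3 + c * x1 + c * x2 = c * (x1 + x2 + x3)" for c x1 x2 x3 :: real by (simp add: algebra_simps)
      show ?thesis unfolding Z_def z1 z2 U_def V_def c by (rule d)
    qed
    also have "(1 - b) * (real p + b) / (real p - b\<^sup>2) = 2 - th"
      unfolding th_def using pb by (simp add: field_simps power2_eq_square)
    finally have "U * V * Z = b / (1 - b) * (U * V * (1 / U - 1 + (1 / V - 1) + (2 - th)))" by simp
    also have "U * V * (1 / U - 1 + (1 / V - 1) + (2 - th)) = V + U - U * V * th" using UV by (simp add: field_simps)
    finally show ?thesis .
  qed
  moreover have "kap b * Hh (real p) b U V = b / (1 - b) * (V + U - U * V * th)"
  proof -
    have k: "kap b * (real p * (1 - b) / (real p - b)) = b / (1 - b)"
      unfolding kap_def using b pb real_p by (simp add: power2_eq_square)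
    have m: "kap b * (real p * (1 - b) / (real p - b) * z) = b / (1 - b) * z" for z
      unfolding k[symmetric] by (rule mult.assoc[symmetric])
    show ?thesis unfolding Hh_factor[OF b real_p(3)] th_def[symmetric] m add.commute[of V U] ..
  qed
  ultimately have "b ^ (u + d) * Z = kap b * Hh (real p) b (b ^ u) (b ^ d)" by (simp add: power_add U_def V_def)
  then show ?thesis unfolding sp using b_def u_def d_def by (metis times_divide_eq_left)
qed

text \<open>Replacing \<open>a\<close> by \<open>1 - a\<close> inverts \<open>b\<close>, so the
  bracket is the same in both branches of the definition; the remaining power of \<open>b\<close> is
  the h-transform on levels.\<close>

lemma spherical_lt:
  assumes a: "0 < a" "a < 1 / 2"
  shows "spherical a p T x y = spherical (1 - a) p T x y * ((1 - a) / a) powi (lv x - lv y)"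
proof -
  define b where "b = (1 - a) / a"
  define u d where "u = up T x y" and "d = down T x y"
  have b: "0 < b" using a by (auto simp: b_def)
  have b': "(1 - (1 - a)) / (1 - a) = 1 / b" using a by (simp add: b_def)
  have e: "lv x - lv y = int u - int d" using up_eq[of x y] down_eq[of x y] by (simp add: u_def d_def)
  define Z where "Z = (real p * b + 1) / (real p * b\<^sup>2 - 1) + (b ^ u - 1) / (b - 1) + (b ^ d - 1) / (b - 1)"
  have 1: "spherical a p T x y = 1 / (real p * b\<^sup>2) ^ d * Z"
    using a unfolding spherical_def Let_def Z_def u_def d_def b_def by simp
  have n: "\<not> 1 - a < 1 / 2" using a by simp
  have 2: "spherical (1 - a) p T x y = (1 / b) ^ (u + d) / real p ^ d * Z"
    unfolding spherical_def Let_def b' if_not_P[OF n] Z_def u_def d_def by simp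
  show ?thesis unfolding 1 2 e b_def[symmetric] by (rule spherical_swap[OF b])
qed

lemma kap_pos: "0 < b \<Longrightarrow> b < 1 \<Longrightarrow> 0 < kap b"
  unfolding kap_def using real_p by (intro divide_pos_pos mult_pos_pos zero_less_power) auto

lemma spherical_pos: assumes "0 < a" "a < 1" "a \<noteq> 1 / 2" shows "0 < spherical a p T x y"
proof -
  have gt: "0 < spherical a p T x y" if a: "1 / 2 < a" "a < 1" for a
  proof -
    have b: "0 < (1 - a) / a" "(1 - a) / a < 1" using a by auto
    have "0 < Hh (real p) ((1 - a) / a) (((1 - a) / a) ^ up T x y) (((1 - a) / a) ^ down T x y)"
      using b real_p by (intro Hh_pos) (auto intro: power_le_one less_imp_le)
    moreover have "kap ((1 - a) / a) > 0" using b by (rule kap_pos)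
    ultimately show ?thesis unfolding spherical_gt[OF a] using real_p by simp
  qed
  show ?thesis
  proof (cases "a < 1 / 2")
    case True
    then show ?thesis unfolding spherical_lt[OF assms(1) True] using gt[of "1 - a"] assms by simp
  qed (use gt assms in auto)
qed

lemma spherical_cong: "lv x = lv x' \<Longrightarrow> cl x y = cl x' y \<Longrightarrow> spherical a p T x y = spherical a p T x' y"
proof -
  assume "lv x = lv x'" "cl x y = cl x' y"
  then have "up T x y = up T x' y" "down T x y = down T x' y"
    using up_eq[of x y] down_eq[of x y] up_eq[of x' y] down_eq[of x' y] by linarith+
  then show ?thesis by (simp add: spherical_def)
qed

lemma spherical_strict:
  assumes "0 < a" "a < 1" "a \<noteq> 1 / 2" "lv x = lv x'" "cl x' y = cl x y - 1"
  shows "spherical a p T x' y < spherical a p T x y"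
proof -
  have ud: "up T x' y = Suc (up T x y)" "down T x' y = Suc (down T x y)"
    using up_eq[of x y] down_eq[of x y] up_eq[of x' y] down_eq[of x' y] assms(4,5) by linarith+
  have gt: "spherical a p T x' y < spherical a p T x y" if a: "1 / 2 < a" "a < 1" for a
  proof -
    define b where "b = (1 - a) / a"
    have b: "0 < b" "b < 1" using a by (auto simp: b_def)
    have "Hh (real p) b (b * b ^ up T x y) (b * b ^ down T x y) < real p * Hh (real p) b (b ^ up T x y) (b ^ down T x y)"
      using b real_p by (intro Hh_strict) (auto intro: power_le_one less_imp_le)
    then have "Hh (real p) b (b ^ up T x' y) (b ^ down T x' y) / real p ^ down T x' y < Hh (real p) b (b ^ up T x y) (b ^ down T x y) / real p ^ down T x y"
      unfolding ud using real_p by (simp add: divide_less_eq field_simps)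
    moreover have "kap b > 0" using b by (rule kap_pos)
    ultimately show ?thesis unfolding spherical_gt[OF a] b_def[symmetric] times_divide_eq_right[symmetric] by (rule mult_strict_left_mono)
  qed
  show ?thesis
  proof (cases "a < 1 / 2")
    case True
    then show ?thesis unfolding spherical_lt[OF assms(1) True] assms(4) using gt[of "1 - a"] assms
      by (intro mult_strict_right_mono) auto
  qed (use gt assms in auto)
qed

lemma spherical_bounded:
  assumes "1 / 2 < a" "a < 1" shows "spherical a p T x y \<le> kap ((1 - a) / a) * (2 * real p)"
proof -
  define b where "b = (1 - a) / a"
  have b: "0 < b" "b < 1" using assms by (auto simp: b_def)
  have bn: "0 < b ^ n" "b ^ n \<le> 1" for n using b by (auto intro: power_le_one)
  have H: "0 < Hh (real p) b (b ^ up T x y) (b ^ down T x y)" "Hh (real p) b (b ^ up T x y) (b ^ down T x y) \<le> 2 * real p"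
    using Hh_pos[OF b real_p(3)] Hh_le[OF b real_p(3)] bn less_imp_le[OF bn(1)] by blast+
  have k: "kap b > 0" using b by (rule kap_pos)
  have "1 \<le> real p ^ down T x y" using real_p by (intro one_le_power) auto
  then have "kap b * Hh (real p) b (b ^ up T x y) (b ^ down T x y) / real p ^ down T x y \<le> kap b * Hh (real p) b (b ^ up T x y) (b ^ down T x y) / 1"
    using H k by (intro divide_left_mono) auto
  also have "\<dots> \<le> kap b * (2 * real p)" using H k by simp
  finally show ?thesis unfolding spherical_gt[OF assms] b_def .
qed

end

context dl
begin

abbreviation orig where "orig \<equiv> DL_origin T1 T2"
abbreviation mk where "mk \<equiv> martin_kernel X P orig"

lemma orig_X: "orig \<in> X" by (simp add: DL_origin_def X_iff)

lemma sc_tendsto_0: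
  assumes half: "\<alpha> > 1 / 2" and "\<And>c. \<forall>\<^sub>F i in F. c \<le> f i"
  shows "((\<lambda>i. sc (f i)) \<longlongrightarrow> 0) F"
proof (rule order_tendstoI)
  fix e :: real assume "e < 0"
  then show "\<forall>\<^sub>F i in F. e < sc (f i)" using sc_pos by (auto intro: always_eventually order_less_trans)
next
  fix e :: real assume e: "0 < e"
  obtain n where n: "\<beta> ^ n < e" using real_arch_pow_inv[OF e \<beta>_less[OF half]] by blast
  have "\<forall>\<^sub>F i in F. int n \<le> f i" by (rule assms)
  then show "\<forall>\<^sub>F i in F. sc (f i) < e"
  proof eventually_elim
    case (elim i)
    have "sc (f i) \<le> sc (int n)" by (rule sc_mono[OF half elim])
    then show ?case using n by (simp add: sc_def)
  qed
qed

lemma cl2_eventually: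
  assumes "\<And>c. \<forall>\<^sub>F i in F. T2.cl (root T2) (y i) \<le> c"
  shows "\<forall>\<^sub>F i in F. T2.cl x (y i) = T2.cl (root T2) (y i)"
proof -
  have "\<forall>\<^sub>F i in F. T2.cl (root T2) (y i) \<le> T2.cl x (root T2) - 1" by (rule assms)
  then show ?thesis by eventually_elim (rule T2.cl_strict, simp)
qed

lemma cl1_eventually:
  assumes "\<And>c. \<forall>\<^sub>F i in F. T1.cl (root T1) (y i) \<le> c"
  shows "\<forall>\<^sub>F i in F. T1.cl x (y i) = T1.cl (root T1) (y i)"
proof -
  have "\<forall>\<^sub>F i in F. T1.cl (root T1) (y i) \<le> T1.cl x (root T1) - 1" by (rule assms)
  then show ?thesis by eventually_elim (rule T1.cl_strict, simp)
qed

context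
  assumes half: "\<alpha> > 1 / 2"
begin

definition WW where "WW x y = Wsum (real q) (real r) (gparam.gg \<beta> (sc (T1.cl (fst x) (fst y))) (sc (- T2.cl (snd x) (snd y))) (sc (T1.lv (fst x))) (sc (T1.lv (fst y))))"

text \<open>As soon as the second confluents of \<open>x\<close> and of the origin with
  \<open>y\<close> coincide, the powers of \<open>r\<close> and the normalization by the level of
  \<open>y\<close> cancel.\<close>

lemma mk_WW:
  assumes x: "x \<in> X" and y: "y \<in> X" and ab: "T1.cl (fst x) (fst y) < - T2.cl (snd x) (snd y)"
    "T1.cl (root T1) (fst y) < - T2.cl (root T2) (snd y)" and b: "T2.cl (snd x) (snd y) = T2.cl (root T2) (snd y)"
  shows "mk x y = real q powi (T1.cl (fst x) (fst y) - T1.cl (root T1) (fst y)) * (WW x y / WW orig y)"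
proof -
  obtain x1 x2 y1 y2 where xy: "x = (x1, x2)" "y = (y1, y2)" by (cases x; cases y)
  have g: "green X P x y = real q powi (T1.cl x1 y1 - T1.lv y1) * real r powi (T2.cl (root T2) y2 - T2.lv y2) * WW x y / ((2 * \<alpha> - 1) * sc (T1.lv y1))"
    using green_Wsum[OF half, of x1 x2 y1 y2] x y ab(1) b unfolding xy WW_def by simp
  have g0: "green X P orig y = real q powi (T1.cl (root T1) y1 - T1.lv y1) * real r powi (T2.cl (root T2) y2 - T2.lv y2) * WW orig y / ((2 * \<alpha> - 1) * sc (T1.lv y1))"
    using green_Wsum[OF half, of "root T1" "root T2" y1 y2] orig_X y ab(2) unfolding xy WW_def DL_origin_def by simp
  have r0: "real r powi (T2.cl (root T2) y2 - T2.lv y2) \<noteq> 0" using qr by simp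
  have s0: "(2 * \<alpha> - 1) * sc (T1.lv y1) \<noteq> 0" using half sc_pos[of "T1.lv y1"] by simp
  have q0: "real q powi (T1.cl x1 y1 - T1.lv y1) = real q powi (T1.cl x1 y1 - T1.cl (root T1) y1) * real q powi (T1.cl (root T1) y1 - T1.lv y1)"
    using qr by (simp add: power_int_add[symmetric])
  have q1: "real q powi (T1.cl (root T1) y1 - T1.lv y1) \<noteq> 0" using qr by simp
  have cancel: "(Q * B * R * W / S) / (B * R * W0 / S) = Q * (W / W0)" if "B \<noteq> 0" "R \<noteq> 0" "S \<noteq> 0" for Q B R S W W0 :: real
    using that by simp
  show ?thesis unfolding martin_kernel_def g g0 q0 using cancel[OF q1 r0 s0] by (simp add: xy mult.assoc)
qed

lemma WW_first_limit:
  assumes yX: "\<forall>\<^sub>F i in F. y i \<in> X" and x: "x \<in> X"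
    and a: "\<forall>\<^sub>F i in F. T1.cl (fst x) (fst (y i)) = a"
    and b: "\<And>c. \<forall>\<^sub>F i in F. T2.cl (root T2) (snd (y i)) \<le> c"
    and t: "((\<lambda>i. sc (T1.lv (fst (y i)))) \<longlongrightarrow> \<tau>) F"
  shows "((\<lambda>i. WW x (y i) / sc (- T2.cl (root T2) (snd (y i)))) \<longlongrightarrow>
      real r * (1 - \<beta>) / (real r - \<beta>) * Hh (real q) \<beta> (sc (T1.lv (fst x)) / sc a) (\<tau> / sc a)) F"
proof -
  define B where "B i = sc (- T2.cl (root T2) (snd (y i)))" for i
  define H where "H i = real r * (1 - \<beta>) / (real r - \<beta>) * Hh (real q) \<beta> (sc (T1.lv (fst x)) / sc a) (sc (T1.lv (fst (y i))) / sc a)" for i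
  have B0: "(B \<longlongrightarrow> 0) F" unfolding B_def
  proof (rule sc_tendsto_0[OF half])
    fix c show "\<forall>\<^sub>F i in F. c \<le> - T2.cl (root T2) (snd (y i))" using b[of "- c"] by eventually_elim simp
  qed
  have H: "(H \<longlongrightarrow> real r * (1 - \<beta>) / (real r - \<beta>) * Hh (real q) \<beta> (sc (T1.lv (fst x)) / sc a) (\<tau> / sc a)) F"
    unfolding H_def Hh_def by (intro tendsto_intros t) (use sc_pos[of a] in auto)
  have boundary: "\<forall>\<^sub>F i in F. norm (WW x (y i) / B i - H i) \<le> Kc (real q) (real r) * (B i / (sc a - B i))"
    using yX a cl2_eventually[OF b, of "snd x"] b[of "- a - 1"]
  proof eventually_elim
    case (elim i)
    obtain x1 x2 y1 y2 where xy: "x = (x1, x2)" "y i = (y1, y2)" by (cases x; cases "y i")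
    interpret gparam "real q" "real r" \<beta> "sc (T1.cl x1 y1)" "sc (- T2.cl x2 y2)" "sc (T1.lv x1)" "sc (T1.lv y1)"
      by (rule gparam_DL[OF half]) (use elim x xy in auto)
    show ?case using first_kind_bound elim unfolding WW_def B_def H_def xy by simp
  qed
  have "((\<lambda>i. Kc (real q) (real r) * (B i / (sc a - B i))) \<longlongrightarrow> Kc (real q) (real r) * (0 / (sc a - 0))) F"
    by (intro tendsto_intros B0) (use sc_pos[of a] in auto)
  then have "((\<lambda>i. WW x (y i) / B i - H i) \<longlongrightarrow> 0) F" by (intro Lim_null_comparison[OF boundary]) simp
  from tendsto_add[OF this H] show ?thesis unfolding B_def by simp
qed

text \<open>Covers two kinds of limits at once: \<open>\<tau> = sc (T1.lv y1)\<close> for a fixed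
  first coordinate \<open>y1\<close>, and \<open>\<tau> = 0\<close> when the first coordinate tends
  to a proper end, its level growing to infinity.\<close>

lemma first_limit_half:
  assumes yX: "\<forall>\<^sub>F i in F. y i \<in> X" and x: "x \<in> X"
    and a: "\<forall>\<^sub>F i in F. T1.cl (fst x) (fst (y i)) = a" and a0: "\<forall>\<^sub>F i in F. T1.cl (root T1) (fst (y i)) = a0"
    and b: "\<And>c. \<forall>\<^sub>F i in F. T2.cl (root T2) (snd (y i)) \<le> c"
    and t: "((\<lambda>i. sc (T1.lv (fst (y i)))) \<longlongrightarrow> \<tau>) F"
  shows "((\<lambda>i. mk x (y i)) \<longlongrightarrow> real q powi (a - a0) *
     (Hh (real q) \<beta> (sc (T1.lv (fst x)) / sc a) (\<tau> / sc a) / Hh (real q) \<beta> (1 / sc a0) (\<tau> / sc a0))) F"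
proof (cases "F = bot")
  case False
  define c where "c = real r * (1 - \<beta>) / (real r - \<beta>)"
  have c: "c > 0" using T2.real_p \<beta>_less[OF half] by (simp add: c_def)
  have l1: "((\<lambda>i. WW x (y i) / sc (- T2.cl (root T2) (snd (y i)))) \<longlongrightarrow> c * Hh (real q) \<beta> (sc (T1.lv (fst x)) / sc a) (\<tau> / sc a)) F"
    unfolding c_def by (rule WW_first_limit[OF yX x a b t])
  have l2: "((\<lambda>i. WW orig (y i) / sc (- T2.cl (root T2) (snd (y i)))) \<longlongrightarrow> c * Hh (real q) \<beta> (1 / sc a0) (\<tau> / sc a0)) F"
    using WW_first_limit[OF yX orig_X _ b t, of a0] a0 unfolding c_def by (simp add: DL_origin_def)
  have lt: "\<forall>\<^sub>F i in F. sc (T1.lv (fst (y i))) \<le> sc a0 \<and> a0 \<le> 0"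
    using a0 by eventually_elim (use T1.cl_le2 T1.cl_le1[of "root T1"] sc_mono[OF half] in auto)
  have "\<tau> \<le> sc a0" by (rule tendsto_upperbound[OF t _ False]) (use lt in \<open>auto elim: eventually_mono\<close>)
  moreover have "0 \<le> \<tau>" by (rule tendsto_lowerbound[OF t _ False]) (simp add: less_imp_le[OF sc_pos])
  moreover have "a0 \<le> 0" using lt False eventually_happens' by fastforce
  then have "1 \<le> sc a0" using sc_mono[OF half, of a0 0] by simp
  ultimately have h0: "0 < Hh (real q) \<beta> (1 / sc a0) (\<tau> / sc a0)"
    using \<beta>_pos \<beta>_less[OF half] T1.real_p by (intro Hh_pos) auto
  have "((\<lambda>i. real q powi (a - a0) * ((WW x (y i) / sc (- T2.cl (root T2) (snd (y i)))) / (WW orig (y i) / sc (- T2.cl (root T2) (snd (y i)))))) \<longlongrightarrow>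
     real q powi (a - a0) * (c * Hh (real q) \<beta> (sc (T1.lv (fst x)) / sc a) (\<tau> / sc a) / (c * Hh (real q) \<beta> (1 / sc a0) (\<tau> / sc a0)))) F"
    by (intro tendsto_intros l1 l2) (use h0 c in auto)
  moreover have "\<forall>\<^sub>F i in F. real q powi (a - a0) * ((WW x (y i) / sc (- T2.cl (root T2) (snd (y i)))) / (WW orig (y i) / sc (- T2.cl (root T2) (snd (y i))))) = mk x (y i)"
    using yX a a0 cl2_eventually[OF b, of "snd x"] b[of "- a - 1"] b[of "- a0 - 1"]
  proof eventually_elim
    case (elim i)
    have "sc (- T2.cl (root T2) (snd (y i))) \<noteq> 0" using sc_pos[of "- T2.cl (root T2) (snd (y i))"] by simp
    then show ?case using mk_WW[OF x elim(1)] elim by simp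
  qed
  ultimately show ?thesis using c by (simp add: tendsto_cong)
qed simp

text \<open>Stated as a difference, so that the levels of \<open>y i\<close> need not converge;
  finite and infinite \<open>k\<close> are inserted afterwards in \<open>lim_kom\<close>.\<close>

lemma omega_limit_half:
  assumes yX: "\<forall>\<^sub>F i in F. y i \<in> X" and x: "x \<in> X"
    and a: "\<And>c. \<forall>\<^sub>F i in F. T1.cl (root T1) (fst (y i)) \<le> c"
    and b: "\<And>c. \<forall>\<^sub>F i in F. T2.cl (root T2) (snd (y i)) \<le> c"
  shows "((\<lambda>i. mk x (y i) - (sc (T1.lv (fst (y i))) + sc (T1.lv (fst x))) / (sc (T1.lv (fst (y i))) + 1)) \<longlongrightarrow> 0) F"
proof -
  define B where "B i = sc (- T2.cl (root T2) (snd (y i)))" for i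
  define u where "u i = sc (- T1.cl (root T1) (fst (y i)))" for i
  define t where "t i = sc (T1.lv (fst (y i)))" for i
  \<comment> \<open>The quotient estimated in \<open>omega_bound\<close>, with
    \<open>A0 = 1 / u i\<close> and \<open>B0 = B i\<close>. It has the same limit for
    \<open>x\<close> and for the origin, so only the factors \<open>s + t i\<close> and
    \<open>1 + t i\<close> remain in the kernel.\<close>
  define N where "N x i = WW x (y i) / (u i * B i * (sc (T1.lv (fst x)) + t i))" for x i
  define cc where "cc = real q * (1 - \<beta>) / (real q - \<beta>) * (real r * (1 - \<beta>) / (real r - \<beta>))"
  have cc: "cc > 0" using T1.real_p T2.real_p \<beta>_less[OF half] by (simp add: cc_def)
  have B0: "(B \<longlongrightarrow> 0) F" unfolding B_def
  proof (rule sc_tendsto_0[OF half])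
    fix c show "\<forall>\<^sub>F i in F. c \<le> - T2.cl (root T2) (snd (y i))" using b[of "- c"] by eventually_elim simp
  qed
  have u0: "(u \<longlongrightarrow> 0) F" unfolding u_def
  proof (rule sc_tendsto_0[OF half])
    fix c show "\<forall>\<^sub>F i in F. c \<le> - T1.cl (root T1) (fst (y i))" using a[of "- c"] by eventually_elim simp
  qed
  have pos: "B i > 0" "u i > 0" "t i > 0" for i using sc_pos by (simp_all add: B_def u_def t_def)
  have lim: "(N x \<longlongrightarrow> cc) F" if x: "x \<in> X" for x
  proof -
    define s where "s = sc (T1.lv (fst x))"
    have s: "s > 0" using sc_pos by (simp add: s_def)
    define e where "e i = Kc (real q) (real r) * (u i * B i / (1 - u i * B i) + s * u i / (1 - u i * B i) + B i / s * (1 / (1 - u i * B i)))" for i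
    have ev: "\<forall>\<^sub>F i in F. norm (N x i - cc) \<le> e i"
      using yX cl1_eventually[OF a, of "fst x"] cl2_eventually[OF b, of "snd x"] a[of "-1"] b[of "-1"]
    proof eventually_elim
      case (elim i)
      obtain x1 x2 y1 y2 where xy: "x = (x1, x2)" "y i = (y1, y2)" by (cases x; cases "y i")
      interpret gparam "real q" "real r" \<beta> "sc (T1.cl x1 y1)" "sc (- T2.cl x2 y2)" "sc (T1.lv x1)" "sc (T1.lv y1)"
        by (rule gparam_DL[OF half]) (use elim x xy in auto)
      define A where "A = sc (T1.cl (root T1) y1)"
      have A: "A > 0" using sc_pos by (simp add: A_def)
      have uA: "u i = 1 / A"
        using sc_add[of "T1.cl (root T1) y1" "- T1.cl (root T1) y1"] A by (simp add: u_def xy A_def field_simps)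
      have AB: "A - B i > 0" using AB elim by (simp add: xy A_def B_def)
      have A1: "1 - u i * B i = (A - B i) / A" unfolding uA using A by (simp add: field_simps)
      have e: "e i = Kc (real q) (real r) * (B i / (A - B i) + s / (A - B i) + B i / s * (A / (A - B i)))"
        unfolding e_def A1 unfolding uA using A by simp
      have "N x i = A * WW x (y i) / (B i * (s + t i))" unfolding N_def uA s_def using A by simp
      then show ?case unfolding e cc_def using omega_bound elim
        by (simp add: xy A_def B_def s_def t_def WW_def)
    qed
    have "(e \<longlongrightarrow> Kc (real q) (real r) * (0 * 0 / (1 - 0 * 0) + s * 0 / (1 - 0 * 0) + 0 / s * (1 / (1 - 0 * 0)))) F"
      unfolding e_def by (intro tendsto_intros B0 u0) (use s in auto)
    then have "(e \<longlongrightarrow> 0) F" by simp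
    from tendsto_add[OF Lim_null_comparison[OF ev this] tendsto_const[of cc]] show ?thesis by simp
  qed
  define s where "s = sc (T1.lv (fst x))"
  have s: "s > 0" using sc_pos by (simp add: s_def)
  have "((\<lambda>i. (N x i / N orig i - 1) * (s + 1)) \<longlongrightarrow> (cc / cc - 1) * (s + 1)) F"
    by (intro tendsto_intros lim x orig_X) (use cc in auto)
  then have z: "((\<lambda>i. \<bar>(N x i / N orig i - 1) * (s + 1)\<bar>) \<longlongrightarrow> 0) F" using cc by (intro tendsto_rabs_zero) simp
  show ?thesis
  proof (rule Lim_null_comparison[OF _ z])
    show "\<forall>\<^sub>F i in F. norm (mk x (y i) - (sc (T1.lv (fst (y i))) + sc (T1.lv (fst x))) / (sc (T1.lv (fst (y i))) + 1)) \<le> \<bar>(N x i / N orig i - 1) * (s + 1)\<bar>"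
      using yX cl1_eventually[OF a, of "fst x"] cl2_eventually[OF b, of "snd x"] a[of "-1"] b[of "-1"]
    proof eventually_elim
      case (elim i)
      have m: "mk x (y i) = WW x (y i) / WW orig (y i)"
        using mk_WW[OF x elim(1)] elim by simp
      have ub: "u i * B i \<noteq> 0" using pos[of i] by simp
      have W: "WW x (y i) = N x i * (u i * B i * (s + t i))" unfolding N_def s_def using pos[of i] s s_def by simp
      have W0: "WW orig (y i) = N orig i * (u i * B i * (1 + t i))" unfolding N_def using pos[of i] by (simp add: DL_origin_def)
      have st: "(s + t i) / (1 + t i) \<le> s + 1" "0 \<le> (s + t i) / (1 + t i)"
      proof -
        have "s + t i \<le> (s + 1) * (1 + t i)" using s pos[of i] by (simp add: algebra_simps)
        then show "(s + t i) / (1 + t i) \<le> s + 1" using pos[of i] by (simp add: divide_le_eq)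
        show "0 \<le> (s + t i) / (1 + t i)" using s pos[of i] by simp
      qed
      have "mk x (y i) = N x i / N orig i * ((s + t i) / (1 + t i))" unfolding m W W0 using ub by simp
      then have "mk x (y i) - (t i + s) / (t i + 1) = (N x i / N orig i - 1) * ((s + t i) / (1 + t i))"
        by (simp add: algebra_simps)
      then have "\<bar>mk x (y i) - (t i + s) / (t i + 1)\<bar> = \<bar>N x i / N orig i - 1\<bar> * ((s + t i) / (1 + t i))"
        by (simp only: abs_mult abs_of_nonneg[OF st(2)])
      also have "\<dots> \<le> \<bar>N x i / N orig i - 1\<bar> * (s + 1)" using st(1) by (intro mult_left_mono) auto
      finally show ?case using s by (simp add: t_def s_def abs_mult)
    qed
  qed
qed

end

end

section \<open>Symmetries of the Diestel-Leader walk\<close>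

context dl
begin

text \<open>The function \<open>x \<mapsto> sc (lv (fst x))\<close> is harmonic, and it transforms the walk with parameter \<open>\<alpha>\<close>
  into the one with parameter \<open>1 - \<alpha>\<close>; this reduces \<open>\<alpha> < 1/2\<close> to \<open>\<alpha> > 1/2\<close>.\<close>

abbreviation Ph where "Ph \<equiv> DL_walk (1 - \<alpha>) q r T1 T2"

lemma nstep_htransform:
  "x \<in> X \<Longrightarrow> nstep X P n x y = nstep X Ph n x y * sc (T1.lv (fst x) - T1.lv (fst y))"
proof (induction n arbitrary: x)
  case (Suc n)
  interpret H: dl T1 T2 q r "1 - \<alpha>" by unfold_locales (use \<alpha> in auto)
  have *: "P x z * nstep X P n z y = Ph x z * nstep X Ph n z y * sc (T1.lv (fst x) - T1.lv (fst y))" if z: "z \<in> X" for z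
  proof -
    obtain x1 x2 z1 z2 where xz: "x = (x1, x2)" "z = (z1, z2)" by (cases x; cases z)
    have "P x z = Ph x z * sc (T1.lv x1 - T1.lv z1)"
    proof -
      have s: "sc (-1) = \<alpha> / (1 - \<alpha>)" "sc 1 = (1 - \<alpha>) / \<alpha>" using \<alpha> by (simp_all add: sc_def \<beta>_def power_int_minus)
      have 1: "T1.lv x1 - T1.lv z1 = -1" if "T1.par z1 = x1" using T1.lv_child[OF that] by simp
      have 2: "T1.lv x1 - T1.lv z1 = 1" if "z1 = T1.par x1" using that by simp
      show ?thesis unfolding xz P_eq H.P_eq using 1 2 s \<alpha> by auto
    qed
    moreover have "sc (T1.lv x1 - T1.lv z1) * sc (T1.lv z1 - T1.lv (fst y)) = sc (T1.lv x1 - T1.lv (fst y))"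
      unfolding sc_add[symmetric] by simp
    ultimately show ?thesis using Suc.IH[OF z] by (simp add: xz mult_ac)
  qed
  have "nstep X P (Suc n) x y = infsum (\<lambda>z. Ph x z * nstep X Ph n z y * sc (T1.lv (fst x) - T1.lv (fst y))) X"
    unfolding nstep.simps(2) by (rule infsum_cong[OF *])
  then show ?case unfolding nstep.simps(2) infsum_cmult_left' .
qed simp

lemma half_or: "\<alpha> > 1 / 2 \<or> 1 - \<alpha> > 1 / 2" using \<alpha> by linarith

lemma transient: "transient_chain X P"
proof (cases "\<alpha> > 1 / 2")
  case True then show ?thesis by (rule transient_half)
next
  case False
  interpret H: dl T1 T2 q r "1 - \<alpha>" by unfold_locales (use \<alpha> in auto)
  have "transient_chain X Ph" by (rule H.transient_half) (use False half_or in blast)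
  then show ?thesis unfolding transient_chain_def using nstep_htransform by (simp add: summable_mult2)
qed

lemma mk_htransform:
  assumes nh: "\<not> \<alpha> > 1 / 2" and x: "x \<in> X" and y: "y \<in> X"
  shows "mk x y = martin_kernel X Ph orig x y * sc (T1.lv (fst x))"
proof -
  interpret H: dl T1 T2 q r "1 - \<alpha>" by unfold_locales (use \<alpha> in auto)
  have "green X P x y = green X Ph x y * sc (T1.lv (fst x) - T1.lv (fst y))" if x: "x \<in> X" for x
    unfolding green_def nstep_htransform[OF x]
    by (rule suminf_mult2[symmetric]) (use H.transient x y in \<open>simp add: transient_chain_def\<close>)
  moreover have "sc (T1.lv (fst x) - T1.lv (fst y)) = sc (T1.lv (fst x)) * sc (T1.lv (fst orig) - T1.lv (fst y))"
    unfolding sc_add[symmetric] by (simp add: DL_origin_def)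
  moreover have "sc (T1.lv (fst orig) - T1.lv (fst y)) \<noteq> 0" using sc_pos by (metis less_irrefl)
  ultimately show ?thesis unfolding martin_kernel_def using x orig_X by simp
qed

lemma nstep_swap:
  "(x1, x2) \<in> X \<Longrightarrow> nstep X P n (x1, x2) (y1, y2) = nstep (DL T2 T1) (DL_walk (1 - \<alpha>) r q T2 T1) n (x2, x1) (y2, y1)"
proof (induction n arbitrary: x1 x2)
  case (Suc n)
  interpret S: dl T2 T1 r q "1 - \<alpha>" by unfold_locales (use \<alpha> in auto)
  have bij: "bij_betw prod.swap X S.X" by (rule bij_betwI[of _ _ _ prod.swap]) (auto simp: X_iff S.X_iff)
  have *: "P (x1, x2) z * nstep X P n z (y1, y2) = S.P (x2, x1) (prod.swap z) * nstep S.X S.P n (prod.swap z) (y2, y1)" if z: "z \<in> X" for z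
  proof -
    obtain z1 z2 where zz: "z = (z1, z2)" by (cases z)
    have ne: "T1.par (T1.par x1) \<noteq> x1" using T1.lv_par[of x1] T1.lv_par[of "T1.par x1"] by force
    have "P (x1, x2) (z1, z2) = S.P (x2, x1) (z2, z1)" unfolding P_eq S.P_eq using ne by auto
    then show ?thesis using Suc.IH[of z1 z2] z by (simp add: zz)
  qed
  have "nstep X P (Suc n) (x1, x2) (y1, y2) = infsum (\<lambda>z. S.P (x2, x1) (prod.swap z) * nstep S.X S.P n (prod.swap z) (y2, y1)) X"
    unfolding nstep.simps(2) by (rule infsum_cong[OF *])
  also have "\<dots> = infsum (\<lambda>z. S.P (x2, x1) z * nstep S.X S.P n z (y2, y1)) S.X"
    by (rule infsum_reindex_bij_betw[OF bij])
  finally show ?case unfolding nstep.simps(2) .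
qed auto

lemma mk_swap:
  "(x1, x2) \<in> X \<Longrightarrow> mk (x1, x2) (y1, y2) = martin_kernel (DL T2 T1) (DL_walk (1 - \<alpha>) r q T2 T1) (DL_origin T2 T1) (x2, x1) (y2, y1)"
  using orig_X by (simp add: martin_kernel_def green_def nstep_swap DL_origin_def)

section \<open>Irreducibility of the Diestel-Leader walk\<close>

definition step where "step u v \<longleftrightarrow> u \<in> X \<and> v \<in> X \<and> P u v > 0"

lemma step_up: assumes "T1.par z1 = x1" "(x1, x2) \<in> X" shows "step (x1, x2) (z1, T2.par x2)" "step (z1, T2.par x2) (x1, x2)"
proof -
  have "(z1, T2.par x2) \<in> X" using assms T1.lv_child[OF assms(1)] by (simp add: X_iff)
  then show "step (x1, x2) (z1, T2.par x2)" "step (z1, T2.par x2) (x1, x2)"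
    using assms P_up[OF assms(1), of x2] P_down[of x2 "T2.par x2" z1] \<alpha> qr by (auto simp: step_def)
qed

lemma step_down: assumes "T2.par z2 = x2" "(x1, x2) \<in> X" shows "step (x1, x2) (T1.par x1, z2)" "step (T1.par x1, z2) (x1, x2)"
proof -
  have "(T1.par x1, z2) \<in> X" using assms T2.lv_child[OF assms(1)] by (simp add: X_iff)
  then show "step (x1, x2) (T1.par x1, z2)" "step (T1.par x1, z2) (x1, x2)"
    using assms P_down[OF assms(1), of x1] P_up[of x1 "T1.par x1" z2] \<alpha> qr by (auto simp: step_def)
qed

lemma reach_anc1:
  "(x1, x2) \<in> X \<Longrightarrow> \<exists>w. (T1.anc x1 (T1.lv x1 - int n), w) \<in> X \<and> step\<^sup>*\<^sup>* (x1, x2) (T1.anc x1 (T1.lv x1 - int n), w)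
     \<and> step\<^sup>*\<^sup>* (T1.anc x1 (T1.lv x1 - int n), w) (x1, x2)"
proof (induction n)
  case (Suc n)
  let ?v = "T1.anc x1 (T1.lv x1 - int n)"
  obtain w where w: "(?v, w) \<in> X" "step\<^sup>*\<^sup>* (x1, x2) (?v, w)" "step\<^sup>*\<^sup>* (?v, w) (x1, x2)" using Suc by blast
  obtain z where z: "T2.par z = w" using T2.ex_child_not by blast
  have p: "T1.par ?v = T1.anc x1 (T1.lv x1 - int (Suc n))" using T1.par_anc[of "T1.lv x1 - int n" x1] by (simp add: algebra_simps)
  note s = step_down[OF z w(1), unfolded p]
  have "(T1.anc x1 (T1.lv x1 - int (Suc n)), z) \<in> X" using s(1) by (simp add: step_def)
  then show ?case using rtranclp.rtrancl_into_rtrancl[OF w(2) s(1)] converse_rtranclp_into_rtranclp[OF s(2) w(3)] by blast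
qed auto

lemma reach_desc1:
  fixes w :: 'b
  shows "(v, w) \<in> X \<Longrightarrow> T1.lv z = T1.lv v + int n \<Longrightarrow> T1.anc z (T1.lv v) = v \<Longrightarrow>
    step\<^sup>*\<^sup>* (v, w) (z, T2.anc w (T2.lv w - int n)) \<and> step\<^sup>*\<^sup>* (z, T2.anc w (T2.lv w - int n)) (v, w)"
proof (induction n arbitrary: z)
  case 0
  then show ?case using T1.anc_self[of z] by simp
next
  case (Suc n)
  let ?u = "T2.anc w (T2.lv w - int n)"
  have l: "T1.lv (T1.par z) = T1.lv v + int n" using Suc.prems by simp
  then have IH: "step\<^sup>*\<^sup>* (v, w) (T1.par z, ?u)" "step\<^sup>*\<^sup>* (T1.par z, ?u) (v, w)"
    using Suc.IH[OF Suc.prems(1), of "T1.par z"] T1.anc_par[of "T1.lv v" z] Suc.prems by auto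
  have "(T1.par z, ?u) \<in> X" using l Suc.prems(1) T2.lv_anc[of "T2.lv w - int n" w] by (simp add: X_iff)
  note s = step_up[OF refl this]
  have "T2.par ?u = T2.anc w (T2.lv w - int (Suc n))" using T2.par_anc[of "T2.lv w - int n" w] by (simp add: algebra_simps)
  then show ?case using s IH by (auto intro: rtranclp.rtrancl_into_rtrancl converse_rtranclp_into_rtranclp)
qed

text \<open>Both points climb in the first tree to the common ancestor \<open>v\<close>, with
  unrelated second coordinates \<open>w\<close> and \<open>w'\<close>. A descent in the first tree
  from \<open>v\<close> to the same \<open>z\<close> lifts \<open>w\<close> and \<open>w'\<close> to
  their own common ancestor, where the two paths meet; all steps used can be reversed.\<close>

lemma irreducible: "irreducible_chain X P"
proof (rule C.irreducibleI)
  fix x y assume xy: "x \<in> X" "y \<in> X"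
  obtain x1 x2 y1 y2 where e: "x = (x1, x2)" "y = (y1, y2)" by (cases x; cases y)
  define c where "c = T1.cl x1 y1"
  define v where "v = T1.anc x1 c"
  have cle: "c \<le> T1.lv x1" "c \<le> T1.lv y1" using T1.cl_le1 T1.cl_le2 by (auto simp: c_def)
  have v2: "v = T1.anc y1 c" unfolding v_def c_def by (rule T1.anc_cl)
  have lv: "T1.lv v = c" using cle by (simp add: v_def T1.lv_anc)
  obtain w where w: "(v, w) \<in> X" "step\<^sup>*\<^sup>* (x1, x2) (v, w)"
    using reach_anc1[of x1 x2 "nat (T1.lv x1 - c)"] xy cle by (auto simp: e v_def)
  obtain w' where w': "(v, w') \<in> X" "step\<^sup>*\<^sup>* (v, w') (y1, y2)"
    using reach_anc1[of y1 y2 "nat (T1.lv y1 - c)"] xy cle by (auto simp: e v2)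
  have lw: "T2.lv w = - c" "T2.lv w' = - c" using w(1) w'(1) lv by (auto simp: X_iff)
  define n where "n = nat (- c - T2.cl w w')"
  have n: "T2.cl w w' = - c - int n" using T2.cl_le1[of w w'] lw by (simp add: n_def)
  obtain z where z: "T1.lv z = c + int n" "T1.anc z c = v" using T1.ex_desc[of v "c + int n"] lv by auto
  have "step\<^sup>*\<^sup>* (v, w) (z, T2.anc w (T2.lv w - int n))" using reach_desc1[OF w(1), of z n] z lv by simp
  moreover have "step\<^sup>*\<^sup>* (z, T2.anc w' (T2.lv w' - int n)) (v, w')" using reach_desc1[OF w'(1), of z n] z lv by simp
  moreover have "T2.anc w (T2.lv w - int n) = T2.anc w' (T2.lv w' - int n)"
    using T2.anc_cl[of w w'] unfolding n lw .
  ultimately have "step\<^sup>*\<^sup>* x y" using w(2) w'(2) unfolding e by (metis rtranclp_trans)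
  then show "(\<lambda>u v. u \<in> X \<and> v \<in> X \<and> P u v > 0)\<^sup>*\<^sup>* x y" unfolding step_def[abs_def] .
qed

lemma sph_ratio_half:
  assumes half: "\<alpha> > 1 / 2"
  shows "real q powi (T1.cl x y - T1.cl (root T1) y) *
     (Hh (real q) \<beta> (sc (T1.lv x) / sc (T1.cl x y)) (sc (T1.lv y) / sc (T1.cl x y)) /
      Hh (real q) \<beta> (1 / sc (T1.cl (root T1) y)) (sc (T1.lv y) / sc (T1.cl (root T1) y)))
     = spherical \<alpha> q T1 x y / spherical \<alpha> q T1 (root T1) y"
proof -
  have dv: "sc (T1.lv x) / sc (T1.cl x y) = \<beta> ^ up T1 x y" "sc (T1.lv y) / sc (T1.cl x y) = \<beta> ^ down T1 x y" for x
  proof -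
    have n: "sc (int n) = \<beta> ^ n" for n by (simp add: sc_def)
    have "sc (T1.lv x) = sc (int (up T1 x y) + T1.cl x y)" using T1.up_eq[of x y] by simp
    then show "sc (T1.lv x) / sc (T1.cl x y) = \<beta> ^ up T1 x y" unfolding sc_add n using sc_pos[of "T1.cl x y"] by simp
    have "sc (T1.lv y) = sc (int (down T1 x y) + T1.cl x y)" using T1.down_eq[of x y] by simp
    then show "sc (T1.lv y) / sc (T1.cl x y) = \<beta> ^ down T1 x y" unfolding sc_add n using sc_pos[of "T1.cl x y"] by simp
  qed
  have r: "1 / sc (T1.cl (root T1) y) = \<beta> ^ up T1 (root T1) y" using dv(1)[of "root T1"] by simp
  have qq: "real q powi (T1.cl x y - T1.cl (root T1) y) = real q ^ down T1 (root T1) y / real q ^ down T1 x y"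
  proof -
    have "T1.cl x y - T1.cl (root T1) y = int (down T1 (root T1) y) - int (down T1 x y)"
      using T1.down_eq[of x y] T1.down_eq[of "root T1" y] by simp
    then show ?thesis using qr by (simp add: power_int_diff)
  qed
  have k: "T1.kap \<beta> \<noteq> 0" using T1.kap_pos[OF \<beta>_pos \<beta>_less[OF half]] by simp
  have "(Q0 / Q) * (H / H0) = (kk * H / Q) / (kk * H0 / Q0)" if "kk \<noteq> 0" for Q Q0 H H0 kk :: real using that by simp
  from this[OF k] show ?thesis unfolding dv r qq T1.spherical_gt[OF half \<alpha>(2)] \<beta>_def[symmetric] .
qed

lemma lim_vertex1:
  assumes yX: "\<forall>\<^sub>F i in F. y i \<in> X" and x: "x \<in> X" and y1: "\<forall>\<^sub>F i in F. fst (y i) = y1"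
    and b: "\<And>c. \<forall>\<^sub>F i in F. T2.cl (root T2) (snd (y i)) \<le> c"
  shows "((\<lambda>i. mk x (y i)) \<longlongrightarrow> spherical \<alpha> q T1 (fst x) y1 / spherical \<alpha> q T1 (root T1) y1) F"
proof -
  \<comment> \<open>Proved for an arbitrary parameter above 1/2, since it is applied to
    \<open>\<alpha>\<close> or to \<open>1 - \<alpha>\<close>.\<close>
  have h: "((\<lambda>i. mm x (y i)) \<longlongrightarrow> spherical a q T1 (fst x) y1 / spherical a q T1 (root T1) y1) F"
    if D: "dl T1 T2 q r a" and half: "a > 1 / 2" and mk: "mm = martin_kernel X (DL_walk a q r T1 T2) orig" for a mm
  proof -
    interpret D: dl T1 T2 q r a by (rule D)
    show ?thesis unfolding mk D.sph_ratio_half[OF half, symmetric]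
      by (rule D.first_limit_half[OF half yX x _ _ b])
        (use y1 in \<open>auto elim: eventually_mono intro: tendsto_eventually\<close>)
  qed
  show ?thesis
  proof (cases "\<alpha> > 1 / 2")
    case True
    show ?thesis by (rule h[OF _ True refl]) unfold_locales
  next
    case False
    then have nh: "1 - \<alpha> > 1 / 2" using half_or by blast
    have L1: "((\<lambda>i. martin_kernel X Ph orig x (y i) * sc (T1.lv (fst x))) \<longlongrightarrow> spherical (1 - \<alpha>) q T1 (fst x) y1 / spherical (1 - \<alpha>) q T1 (root T1) y1 * sc (T1.lv (fst x))) F"
      by (intro tendsto_intros h[OF _ nh refl]) (unfold_locales, use \<alpha> in auto)
    have L2: "\<forall>\<^sub>F i in F. martin_kernel X Ph orig x (y i) * sc (T1.lv (fst x)) = mk x (y i)"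
      using yX by eventually_elim (use mk_htransform[OF False x] in simp)
    have L3: "spherical \<alpha> q T1 (fst x) y1 / spherical \<alpha> q T1 (root T1) y1 =
       spherical (1 - \<alpha>) q T1 (fst x) y1 / spherical (1 - \<alpha>) q T1 (root T1) y1 * sc (T1.lv (fst x))"
    proof -
      have a: "\<alpha> < 1 / 2" using False \<alpha> by linarith
      have "((1 - \<alpha>) / \<alpha>) powi (T1.lv (fst x) - T1.lv y1) = sc (T1.lv (fst x)) * sc (T1.lv (root T1) - T1.lv y1)"
        unfolding sc_add[symmetric] by (simp add: sc_def \<beta>_def)
      moreover have "((1 - \<alpha>) / \<alpha>) powi (T1.lv (root T1) - T1.lv y1) = sc (T1.lv (root T1) - T1.lv y1)"
        by (simp add: sc_def \<beta>_def)
      moreover have "sc (T1.lv (root T1) - T1.lv y1) \<noteq> 0" using sc_pos by (metis less_irrefl)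
      ultimately show ?thesis unfolding T1.spherical_lt[OF \<alpha>(1) a] by (simp add: mult.assoc[symmetric])
    qed
    show ?thesis unfolding L3 by (rule Lim_transform_eventually[OF L1 L2])
  qed
qed

text \<open>The right-hand side of \<open>hit_ratio_end\<close>, with \<open>\<delta>\<close> in
  place of the difference of confluent levels.\<close>

definition end_kernel :: "'a \<Rightarrow> int \<Rightarrow> real" where
  "end_kernel x \<delta> = tree_rw.Fm \<alpha> powi T1.lv x * (tree_rw.Fm \<alpha> * tree_rw.Fp q \<alpha>) powi \<delta>"

lemma lim_end1:
  assumes yX: "\<forall>\<^sub>F i in F. y i \<in> X" and x: "x \<in> X"
    and a: "\<forall>\<^sub>F i in F. T1.cl (fst x) (fst (y i)) = a" and a0: "\<forall>\<^sub>F i in F. T1.cl (root T1) (fst (y i)) = a0"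
    and b: "\<And>c. \<forall>\<^sub>F i in F. T2.cl (root T2) (snd (y i)) \<le> c"
    and l: "\<And>c. \<forall>\<^sub>F i in F. c \<le> T1.lv (fst (y i))"
  shows "((\<lambda>i. mk x (y i)) \<longlongrightarrow> end_kernel (fst x) (a0 - a)) F"
proof -
  interpret R: tree_rw T1 q \<alpha> by unfold_locales (use \<alpha> in auto)
  have h: "((\<lambda>i. martin_kernel X (DL_walk c q r T1 T2) orig x (y i)) \<longlongrightarrow> ((1 - c) / c) powi T1.lv (fst x) * ((1 - c) / c / real q) powi (a0 - a)) F"
    if D: "dl T1 T2 q r c" and half: "c > 1 / 2" for c
  proof -
    interpret D: dl T1 T2 q r c by (rule D)
    \<comment> \<open>Here \<open>\<tau> = 0\<close>; with a zero argument \<open>Hh\<close> is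
      linear in the other one, so its constant factor cancels in the quotient.\<close>
    have "((\<lambda>i. D.mk x (y i)) \<longlongrightarrow> real q powi (a - a0) *
       (Hh (real q) D.\<beta> (D.sc (T1.lv (fst x)) / D.sc a) (0 / D.sc a) / Hh (real q) D.\<beta> (1 / D.sc a0) (0 / D.sc a0))) F"
      by (rule D.first_limit_half[OF half yX x a a0 b D.sc_tendsto_0[OF half l]])
    moreover have "real q powi (a - a0) *
       (Hh (real q) D.\<beta> (D.sc (T1.lv (fst x)) / D.sc a) (0 / D.sc a) / Hh (real q) D.\<beta> (1 / D.sc a0) (0 / D.sc a0))
       = D.\<beta> powi T1.lv (fst x) * (D.\<beta> / real q) powi (a0 - a)"
    proof -
      have cc: "real q * (1 - D.\<beta>) / (real q - D.\<beta>) \<noteq> 0" using D.\<beta>_less[OF half] T1.real_p by simp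
      have "(s / A * k - 0) / (1 / A0 * k - 0) = s * (A0 / A)" if "k \<noteq> 0" for s A A0 k :: real using that by simp
      from this[OF cc] have "Hh (real q) D.\<beta> (D.sc (T1.lv (fst x)) / D.sc a) (0 / D.sc a) / Hh (real q) D.\<beta> (1 / D.sc a0) (0 / D.sc a0)
         = D.sc (T1.lv (fst x)) * (D.sc a0 / D.sc a)" unfolding Hh_def by simp
      also have "D.sc a0 / D.sc a = D.\<beta> powi (a0 - a)" using D.\<beta>_pos by (simp add: D.sc_def power_int_diff)
      finally have "real q powi (a - a0) * (Hh (real q) D.\<beta> (D.sc (T1.lv (fst x)) / D.sc a) (0 / D.sc a) / Hh (real q) D.\<beta> (1 / D.sc a0) (0 / D.sc a0))
        = D.\<beta> powi T1.lv (fst x) * (D.\<beta> powi (a0 - a) * real q powi (a - a0))" by (simp add: D.sc_def mult_ac)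
      also have "D.\<beta> powi (a0 - a) * real q powi (a - a0) = (D.\<beta> / real q) powi (a0 - a)"
        unfolding power_int_divide_distrib using qr power_int_minus[of "real q" "a0 - a"] by (simp add: divide_inverse)
      finally show ?thesis .
    qed
    ultimately show ?thesis unfolding D.\<beta>_def by simp
  qed
  show ?thesis
  proof (cases "\<alpha> > 1 / 2")
    case True
    have "R.Fm = (1 - \<alpha>) / \<alpha>" "R.Fp = 1 / real q" using True \<alpha> unfolding R.Fm_def R.Fp_def R.b_def by (simp_all add: min_def max_def field_simps)
    then show ?thesis unfolding end_kernel_def using h[of \<alpha>, OF _ True] by (simp add: dl_axioms)
  next
    case False
    then have nh: "1 - \<alpha> > 1 / 2" using half_or by blast
    have D: "dl T1 T2 q r (1 - \<alpha>)" by unfold_locales (use \<alpha> in auto)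
    have L1: "((\<lambda>i. martin_kernel X Ph orig x (y i) * sc (T1.lv (fst x))) \<longlongrightarrow>
       (((1 - (1 - \<alpha>)) / (1 - \<alpha>)) powi T1.lv (fst x) * ((1 - (1 - \<alpha>)) / (1 - \<alpha>) / real q) powi (a0 - a)) * sc (T1.lv (fst x))) F"
      by (intro tendsto_intros h[OF D nh])
    have L2: "\<forall>\<^sub>F i in F. martin_kernel X Ph orig x (y i) * sc (T1.lv (fst x)) = mk x (y i)"
      using yX by eventually_elim (use mk_htransform[OF False x] in simp)
    have L3: "(((1 - (1 - \<alpha>)) / (1 - \<alpha>)) powi T1.lv (fst x) * ((1 - (1 - \<alpha>)) / (1 - \<alpha>) / real q) powi (a0 - a)) * sc (T1.lv (fst x))
       = end_kernel (fst x) (a0 - a)"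
    proof -
      have b1: "b > 1" if "b = (1 - \<alpha>) / \<alpha>" for b using that nh \<alpha> by (simp add: less_divide_eq)
      have F: "R.Fm = 1" "R.Fp = 1 / (real q * ((1 - \<alpha>) / \<alpha>))" using b1[OF refl]
        unfolding R.Fm_def R.Fp_def R.b_def by (simp_all add: min_def max_def)
      have inv: "(\<alpha> / (1 - \<alpha>)) powi k * sc k = 1" for k
        unfolding sc_def \<beta>_def power_int_mult_distrib[symmetric] using \<alpha> by simp
      have e: "(1 - (1 - \<alpha>)) / (1 - \<alpha>) = \<alpha> / (1 - \<alpha>)" "\<alpha> / (1 - \<alpha>) / real q = 1 / (real q * ((1 - \<alpha>) / \<alpha>))"
        using \<alpha> by simp_all
      have e2: "(\<alpha> / (1 - \<alpha>)) powi k * Z * sc k = Z" for k Z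
        using inv[of k] by (simp add: mult_ac)
      show ?thesis unfolding end_kernel_def F e e2 by simp
    qed
    show ?thesis unfolding L3[symmetric] by (rule Lim_transform_eventually[OF L1 L2])
  qed
qed

lemma lim_omega:
  assumes yX: "\<forall>\<^sub>F i in F. y i \<in> X" and x: "x \<in> X"
    and a: "\<And>c. \<forall>\<^sub>F i in F. T1.cl (root T1) (fst (y i)) \<le> c"
    and b: "\<And>c. \<forall>\<^sub>F i in F. T2.cl (root T2) (snd (y i)) \<le> c"
  shows "((\<lambda>i. mk x (y i) - (sc (T1.lv (fst (y i))) + sc (T1.lv (fst x))) / (sc (T1.lv (fst (y i))) + 1)) \<longlongrightarrow> 0) F"
proof (cases "\<alpha> > 1 / 2")
  case True
  then show ?thesis by (rule omega_limit_half[OF _ yX x a b])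
next
  case False
  then have nh: "1 - \<alpha> > 1 / 2" using half_or by blast
  interpret H: dl T1 T2 q r "1 - \<alpha>" by unfold_locales (use \<alpha> in auto)
  have s: "H.sc k = 1 / sc k" for k
  proof -
    have "H.\<beta> = inverse \<beta>" using \<alpha> by (simp add: \<beta>_def H.\<beta>_def)
    then show ?thesis unfolding H.sc_def sc_def by (simp only: power_int_inverse inverse_eq_divide[of "\<beta> powi k"])
  qed
  have "((\<lambda>i. (H.mk x (y i) - (H.sc (T1.lv (fst (y i))) + H.sc (T1.lv (fst x))) / (H.sc (T1.lv (fst (y i))) + 1)) * sc (T1.lv (fst x))) \<longlongrightarrow> 0 * sc (T1.lv (fst x))) F"
    by (intro tendsto_intros H.omega_limit_half[OF nh yX x a b])
  moreover have "\<forall>\<^sub>F i in F. (H.mk x (y i) - (H.sc (T1.lv (fst (y i))) + H.sc (T1.lv (fst x))) / (H.sc (T1.lv (fst (y i))) + 1)) * sc (T1.lv (fst x))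
     = mk x (y i) - (sc (T1.lv (fst (y i))) + sc (T1.lv (fst x))) / (sc (T1.lv (fst (y i))) + 1)"
    using yX
  proof eventually_elim
    case (elim i)
    define t u where "t = sc (T1.lv (fst (y i)))" and "u = sc (T1.lv (fst x))"
    have tu: "t > 0" "u > 0" using sc_pos by (auto simp: t_def u_def)
    have f: "1 / t + 1 / u = (t + u) / (t * u)" "1 / t + 1 = (t + 1) / t" using tu by (simp_all add: field_simps)
    have "(1 / t + 1 / u) / (1 / t + 1) * u = (t + u) / (t + 1)" unfolding f using tu by simp
    then show ?case unfolding s mk_htransform[OF False x elim] t_def[symmetric] u_def[symmetric] by (simp add: left_diff_distrib)
  qed
  ultimately show ?thesis by (simp add: tendsto_cong)
qed

end

section \<open>A criterion for Martin compactifications\<close>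

text \<open>Discreteness gives an open set meeting the image only in the point. Removing the point,
  which is closed, leaves an open set that misses the dense image and is therefore empty.\<close>

lemma open_singleton_compactification:
  assumes "metrizable_compactification X C \<iota>" "x \<in> X"
  shows "openin C {\<iota> x}"
proof -
  have t1: "t1_space C" and i: "\<iota> ` X \<subseteq> topspace C" and d: "subtopology C (\<iota> ` X) = discrete_topology (\<iota> ` X)"
    and dense: "C closure_of (\<iota> ` X) = topspace C"
    using assms metrizable_imp_t1_space by (auto simp: metrizable_compactification_def)
  have "openin (subtopology C (\<iota> ` X)) {\<iota> x}" unfolding d using assms(2) by simp
  then obtain U where U: "openin C U" "U \<inter> \<iota> ` X = {\<iota> x}" by (auto simp: openin_subtopology)
  have "closedin C {\<iota> x}" using t1 i assms(2) by (simp add: t1_space_closedin_singleton image_subset_iff)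
  then have V: "openin C (U - {\<iota> x})" using U(1) by (rule openin_diff[rotated])
  have "U - {\<iota> x} = {}"
  proof (rule ccontr)
    assume "U - {\<iota> x} \<noteq> {}"
    then obtain z where z: "z \<in> U - {\<iota> x}" by blast
    then have "z \<in> C closure_of (\<iota> ` X)" using openin_subset[OF U(1)] dense by auto
    then have "\<exists>y. y \<in> \<iota> ` X \<and> y \<in> U - {\<iota> x}" using V z unfolding in_closure_of by metis
    then show False using U(2) by auto
  qed
  moreover have "\<iota> x \<in> U" using U(2) by auto
  ultimately have "U = {\<iota> x}" by auto
  then show ?thesis using U(1) by simp
qed

text \<open>Points of \<open>X\<close> are isolated in \<open>D\<close>, so over
  \<open>\<kappa> x\<close> the closure of the graph adds nothing. In \<open>graph_snd_point\<close>
  the roles are exchanged: no boundary point of \<open>D\<close> is related to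
  \<open>\<iota> x\<close>.\<close>

lemma graph_fst_point:
  assumes D: "metrizable_compactification X D \<kappa>" and C: "metrizable_compactification X C \<iota>"
    and G: "(\<kappa> x, c) \<in> prod_topology D C closure_of ((\<lambda>x. (\<kappa> x, \<iota> x)) ` X)" and x: "x \<in> X"
  shows "c = \<iota> x"
proof (rule ccontr)
  assume "c \<noteq> \<iota> x"
  have i: "\<iota> ` X \<subseteq> topspace C" and t1: "t1_space C" and inj: "inj_on \<kappa> X"
    using C D metrizable_imp_t1_space by (auto simp: metrizable_compactification_def)
  have "closedin C {\<iota> x}" using t1 i x by (simp add: t1_space_closedin_singleton image_subset_iff)
  then have "openin C (topspace C - {\<iota> x})" by blast
  then have op: "openin (prod_topology D C) ({\<kappa> x} \<times> (topspace C - {\<iota> x}))"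
    using open_singleton_compactification[OF D x] by (simp add: openin_prod_Times_iff)
  have mem: "(\<kappa> x, c) \<in> {\<kappa> x} \<times> (topspace C - {\<iota> x})"
    using G \<open>c \<noteq> \<iota> x\<close> by (auto simp: in_closure_of)
  from conjunct2[OF G[unfolded in_closure_of], rule_format, OF conjI[OF mem op]] obtain x' where "x' \<in> X" "(\<kappa> x', \<iota> x') \<in> {\<kappa> x} \<times> (topspace C - {\<iota> x})" by blast
  then show False using inj x by (auto simp: inj_on_def)
qed

lemma graph_snd_point:
  assumes D: "metrizable_compactification X D \<kappa>" and C: "metrizable_compactification X C \<iota>"
    and G: "(d, \<iota> x) \<in> prod_topology D C closure_of ((\<lambda>x. (\<kappa> x, \<iota> x)) ` X)" and x: "x \<in> X"
  shows "d = \<kappa> x"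
proof (rule ccontr)
  assume "d \<noteq> \<kappa> x"
  have i: "\<kappa> ` X \<subseteq> topspace D" and t1: "t1_space D" and inj: "inj_on \<iota> X"
    using C D metrizable_imp_t1_space by (auto simp: metrizable_compactification_def)
  have "closedin D {\<kappa> x}" using t1 i x by (simp add: t1_space_closedin_singleton image_subset_iff)
  then have "openin D (topspace D - {\<kappa> x})" by blast
  then have op: "openin (prod_topology D C) ((topspace D - {\<kappa> x}) \<times> {\<iota> x})"
    using open_singleton_compactification[OF C x] by (simp add: openin_prod_Times_iff)
  have mem: "(d, \<iota> x) \<in> (topspace D - {\<kappa> x}) \<times> {\<iota> x}"
    using G \<open>d \<noteq> \<kappa> x\<close> by (auto simp: in_closure_of)
  from conjunct2[OF G[unfolded in_closure_of], rule_format, OF conjI[OF mem op]] obtain x' where "x' \<in> X" "(\<kappa> x', \<iota> x') \<in> (topspace D - {\<kappa> x}) \<times> {\<iota> x}" by blast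
  then show False using inj x by (auto simp: inj_on_def)
qed

text \<open>The comparison map is the closure of the graph of \<open>\<kappa> x \<mapsto> \<iota> x\<close>: it projects onto \<open>D\<close> by
  compactness, and it is single-valued because the kernels separate boundary points.\<close>

lemma martin_compactificationI:
  fixes C :: "'c topology" and X :: "'s set"
  assumes irr: "irreducible_chain X P" and tr: "transient_chain X P"
    and C: "metrizable_compactification X C \<iota>" and K: "kernel_extension X P o\<^sub>0 C \<iota> K"
    and sep: "\<And>c c'. c \<in> topspace C - \<iota> ` X \<Longrightarrow> c' \<in> topspace C - \<iota> ` X \<Longrightarrow> (\<And>x. x \<in> X \<Longrightarrow> K x c = K x c') \<Longrightarrow> c = c'"
  shows "martin_compactification TYPE('d) X P o\<^sub>0 C \<iota>"
  unfolding martin_compactification_def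
proof (intro conjI allI impI)
  show "\<exists>K. kernel_extension X P o\<^sub>0 C \<iota> K" using K by blast
  fix D :: "'d topology" and \<kappa>
  assume "metrizable_compactification X D \<kappa> \<and> (\<exists>K. kernel_extension X P o\<^sub>0 D \<kappa> K)"
  then obtain L where D: "metrizable_compactification X D \<kappa>" and L: "kernel_extension X P o\<^sub>0 D \<kappa> L" by blast
  define G where "G = prod_topology D C closure_of ((\<lambda>x. (\<kappa> x, \<iota> x)) ` X)"
  have tD: "\<kappa> ` X \<subseteq> topspace D" and tC: "\<iota> ` X \<subseteq> topspace C" using C D by (auto simp: metrizable_compactification_def)
  have GS: "G \<subseteq> topspace D \<times> topspace C" unfolding G_def using closure_of_subset_topspace[of "prod_topology D C"] by simp
  have gr: "(\<kappa> x, \<iota> x) \<in> G" if "x \<in> X" for x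
    unfolding G_def using closure_of_subset[of "(\<lambda>x. (\<kappa> x, \<iota> x)) ` X" "prod_topology D C"] tD tC that by auto
  \<comment> \<open>Two continuous functions that agree on the graph agree on its closure: related
    points carry the same kernels.\<close>
  have LK: "L x d = K x c" if dc: "(d, c) \<in> G" and x: "x \<in> X" for x d c
  proof -
    have cf: "continuous_map (prod_topology D C) euclideanreal (\<lambda>z. L x (fst z))" "continuous_map (prod_topology D C) euclideanreal (\<lambda>z. K x (snd z))"
      using continuous_map_compose[OF continuous_map_fst, of D euclideanreal "L x" C]
        continuous_map_compose[OF continuous_map_snd, of C euclideanreal "K x" D] K L x
      by (auto simp: kernel_extension_def o_def)
    have "closedin (prod_topology D C) {z \<in> topspace (prod_topology D C). L x (fst z) = K x (snd z)}"
      by (rule closedin_continuous_maps_eq[OF _ cf]) simp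
    moreover have "(\<lambda>x. (\<kappa> x, \<iota> x)) ` X \<subseteq> {z \<in> topspace (prod_topology D C). L x (fst z) = K x (snd z)}"
      using K L x tD tC by (auto simp: kernel_extension_def)
    ultimately have "G \<subseteq> {z \<in> topspace (prod_topology D C). L x (fst z) = K x (snd z)}"
      unfolding G_def by (rule closure_of_minimal[rotated])
    then show ?thesis using dc by auto
  qed
  \<comment> \<open>Over boundary points of \<open>D\<close> only boundary points of
    \<open>C\<close> occur, and there the kernels separate.\<close>
  have uniq: "c = c'" if cc: "(d, c) \<in> G" "(d, c') \<in> G" for d c c'
  proof (cases "d \<in> \<kappa> ` X")
    case True
    then show ?thesis using graph_fst_point[OF D C] cc unfolding G_def by blast
  next
    case False
    have "c \<notin> \<iota> ` X" "c' \<notin> \<iota> ` X" using graph_snd_point[OF D C] cc False unfolding G_def by blast+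
    then show ?thesis using sep[of c c'] LK cc GS by (metis DiffI SigmaE2 subsetD)
  qed
  \<comment> \<open>Projection along the compact factor \<open>C\<close> is closed; this yields both
    that the graph covers \<open>D\<close> and that \<open>g\<close> is continuous.\<close>
  have proj: "closedin D (fst ` (G \<inter> (topspace D \<times> Z)))" if Z: "closedin C Z" for Z
  proof -
    have "closed_map (prod_topology D C) D fst" using C by (intro closed_map_fst) (simp add: metrizable_compactification_def)
    moreover have "closedin (prod_topology D C) (G \<inter> (topspace D \<times> Z))"
      using Z by (intro closedin_Int) (auto simp: G_def closedin_prod_Times_iff)
    ultimately show ?thesis by (simp add: closed_map_def)
  qed
  have ex: "\<exists>c. (d, c) \<in> G" if "d \<in> topspace D" for d
  proof -
    have "closedin D (fst ` G)" using proj[OF closedin_topspace] GS by (simp add: inf.absorb1)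
    moreover have "\<kappa> ` X \<subseteq> fst ` G" using gr by force
    ultimately have "D closure_of (\<kappa> ` X) \<subseteq> fst ` G" by (rule closure_of_minimal[rotated])
    then show ?thesis using D that by (force simp: metrizable_compactification_def)
  qed
  define g where "g d = (THE c. (d, c) \<in> G)" for d
  have gG: "(d, g d) \<in> G" if d: "d \<in> topspace D" for d
  proof -
    obtain c where "(d, c) \<in> G" using ex[OF d] by blast
    moreover from this have "g d = c" unfolding g_def using uniq by (intro the_equality)
    ultimately show ?thesis by simp
  qed
  show "\<exists>g. continuous_map D C g \<and> (\<forall>x\<in>X. g (\<kappa> x) = \<iota> x)"
  proof (intro exI[of _ g] conjI ballI)
    show "g (\<kappa> x) = \<iota> x" if "x \<in> X" for x
      using gG[of "\<kappa> x"] gr[OF that] uniq tD that by blast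
    show "continuous_map D C g"
      unfolding continuous_map_closedin
    proof (intro conjI allI impI)
      show "g \<in> topspace D \<rightarrow> topspace C" using gG GS by blast
      fix Z assume Z: "closedin C Z"
      have "{d \<in> topspace D. g d \<in> Z} = fst ` (G \<inter> (topspace D \<times> Z))"
      proof (intro set_eqI iffI)
        fix d assume "d \<in> {d \<in> topspace D. g d \<in> Z}"
        then have "(d, g d) \<in> G \<inter> (topspace D \<times> Z)" using gG by auto
        then show "d \<in> fst ` (G \<inter> (topspace D \<times> Z))" by (metis fst_conv image_eqI)
      next
        fix d assume "d \<in> fst ` (G \<inter> (topspace D \<times> Z))"
        then obtain c where c: "(d, c) \<in> G" "d \<in> topspace D" "c \<in> Z" by auto
        then have "g d = c" using gG uniq by blast
        then show "d \<in> {d \<in> topspace D. g d \<in> Z}" using c by simp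
      qed
      then show "closedin D {d \<in> topspace D. g d \<in> Z}" using proj[OF Z] by simp
    qed
  qed
qed (use irr tr C in auto)

context homtree
begin

lemma continuous_squash_hor: "continuous_map (hor_topology p T) euclideanreal (\<lambda>z. squash (hor_ext T z))"
  unfolding continuous_map_atin
proof
  fix z assume z: "z \<in> topspace (hor_topology p T)"
  have "limitin (hor_topology p T) (\<lambda>z. z) z (atin (hor_topology p T) z)"
    using continuous_map_id[of "hor_topology p T"] z unfolding continuous_map_atin by (simp add: id_def)
  then show "limitin euclideanreal (\<lambda>z. squash (hor_ext T z)) (squash (hor_ext T z)) (atin (hor_topology p T) z)"
    unfolding hor_limit_iff by simp
qed

lemma lim_Omega_child:
  assumes "limitin (hor_topology p T) (\<lambda>i. HVertex (v i)) (Omega (Fin k)) F" "\<And>x. par (c x) = x"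
  shows "limitin (hor_topology p T) (\<lambda>i. HVertex (c (v i))) (Omega (Fin (k + 1))) F"
proof -
  have a: "\<And>c. \<forall>\<^sub>F i in F. cl (root T) (v i) \<le> c" and k: "\<forall>\<^sub>F i in F. lv (v i) = k"
    using assms(1) unfolding lim_Omega_iff squash_tendsto_Fin by auto
  have "\<forall>\<^sub>F i in F. cl (root T) (c (v i)) \<le> b" for b
    using a[of "min b (k - 1)"] k
  proof eventually_elim
    case (elim i)
    have "cl (v i) (root T) = min (cl (c (v i)) (root T)) (lv (v i))"
      using cl_par[of "c (v i)" "root T"] lv_child[OF assms(2)] assms(2) by simp
    then show ?case using elim by (simp add: cl_commute min_def split: if_splits)
  qed
  moreover have "\<forall>\<^sub>F i in F. lv (c (v i)) = k + 1"
    using k by eventually_elim (use lv_child[OF assms(2)] in simp)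
  ultimately show ?thesis unfolding lim_Omega_iff squash_tendsto_Fin by blast
qed

lemma lim_Omega_par:
  assumes "limitin (hor_topology p T) (\<lambda>i. HVertex (v i)) (Omega (Fin k)) F"
  shows "limitin (hor_topology p T) (\<lambda>i. HVertex (par (v i))) (Omega (Fin (k - 1))) F"
proof -
  have a: "\<And>c. \<forall>\<^sub>F i in F. cl (root T) (v i) \<le> c" and k: "\<forall>\<^sub>F i in F. lv (v i) = k"
    using assms(1) unfolding lim_Omega_iff squash_tendsto_Fin by auto
  have "\<forall>\<^sub>F i in F. cl (root T) (par (v i)) \<le> b" for b
    using a[of b]
  proof eventually_elim
    case (elim i)
    then show ?case using cl_par[of "v i" "root T"] by (simp add: cl_commute)
  qed
  moreover have "\<forall>\<^sub>F i in F. lv (par (v i)) = k - 1"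
    using k by eventually_elim simp
  ultimately show ?thesis unfolding lim_Omega_iff squash_tendsto_Fin by blast
qed

section \<open>Lines from the reference end to vertices and proper ends\<close>

definition is_target :: "'v hor_pt \<Rightarrow> bool" where
  "is_target z \<longleftrightarrow> (\<exists>y. z = HVertex y) \<or> (\<exists>\<xi>\<in>proper_ends T. z = HEnd \<xi>)"

text \<open>The value 0 at \<open>Omega k\<close> is a dummy, since only targets are of
  interest.\<close>

definition target_cl :: "'v hor_pt \<Rightarrow> 'v \<Rightarrow> int" where
  "target_cl z x = (case z of HVertex y \<Rightarrow> cl x y | HEnd \<xi> \<Rightarrow> clE x \<xi> | Omega k \<Rightarrow> 0)"

lemma target_cl_simps [simp]: "target_cl (HVertex y) x = cl x y" "target_cl (HEnd \<xi>) x = clE x \<xi>"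
  by (simp_all add: target_cl_def)

lemma target_cl_seq: assumes "is_target z" shows "\<exists>t. \<forall>x. \<forall>\<^sub>F n in sequentially. cl x (t n) = target_cl z x"
proof -
  from assms consider y where "z = HVertex y" | \<xi> where "\<xi> \<in> proper_ends T" "z = HEnd \<xi>" by (auto simp: is_target_def)
  then show ?thesis
  proof cases
    case 1
    then show ?thesis by (intro exI[of _ "\<lambda>_. y"]) simp
  next
    case 2
    then show ?thesis using cl_ray_eventually by (intro exI[of _ "ray (root T) \<xi>"]) simp
  qed
qed

lemma target_cl_le: "is_target z \<Longrightarrow> target_cl z x \<le> lv x"
proof -
  assume "is_target z"
  then obtain t where "\<And>x. \<forall>\<^sub>F n in sequentially. cl x (t n) = target_cl z x" using target_cl_seq by metis
  then obtain n where "cl x (t n) = target_cl z x" using eventually_happens' sequentially_bot by blast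
  then show ?thesis using cl_le1[of x "t n"] by simp
qed

lemma target_cl_par: "is_target z \<Longrightarrow> target_cl z (par x) = min (target_cl z x) (lv x - 1)"
proof -
  assume "is_target z"
  then obtain t where t: "\<And>x. \<forall>\<^sub>F n in sequentially. cl x (t n) = target_cl z x" using target_cl_seq by metis
  have "\<forall>\<^sub>F n in sequentially. cl x (t n) = target_cl z x \<and> cl (par x) (t n) = target_cl z (par x)" using t by (intro eventually_conj)
  then obtain n where "cl x (t n) = target_cl z x" "cl (par x) (t n) = target_cl z (par x)" using eventually_happens' sequentially_bot by blast
  then show ?thesis using cl_par[of x "t n"] by simp
qed

lemma target_cl_sibling:
  assumes "is_target z" "target_cl z v = lv v" "par v' = par v" "v' \<noteq> v"
  shows "target_cl z v' = lv v - 1"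
proof -
  obtain t where t: "\<And>x. \<forall>\<^sub>F n in sequentially. cl x (t n) = target_cl z x" using target_cl_seq[OF assms(1)] by metis
  have "\<forall>\<^sub>F n in sequentially. cl v (t n) = target_cl z v \<and> cl v' (t n) = target_cl z v'" using t by (intro eventually_conj)
  then obtain n where n: "cl v (t n) = target_cl z v" "cl v' (t n) = target_cl z v'" using eventually_happens' sequentially_bot by blast
  have l: "lv v' = lv v" using lv_par[of v] lv_par[of v'] assms(3) by simp
  have "target_cl z v' \<noteq> lv v"
  proof
    assume "target_cl z v' = lv v"
    then have "anc (t n) (lv v) = v" "anc (t n) (lv v') = v'" using n assms(2) l cl_eq_lv_iff by metis+
    then show False using l assms(4) by simp
  qed
  moreover have "target_cl z v' \<le> lv v" using target_cl_le[OF assms(1), of v'] l by simp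
  moreover have "min (target_cl z v') (lv v - 1) = lv v - 1"
    using target_cl_par[OF assms(1), of v] target_cl_par[OF assms(1), of v'] assms(2,3) l by simp
  ultimately show ?thesis by linarith
qed

lemma target_cl_off:
  assumes "is_target z" "target_cl z (par v) = lv (par v)" "target_cl z v \<noteq> lv v" shows "target_cl z v = lv v - 1"
  using target_cl_par[OF assms(1), of v] target_cl_le[OF assms(1), of v] assms(2,3) by (simp add: min_def split: if_splits)

lemma target_cl_line_up: "is_target z \<Longrightarrow> target_cl z v = lv v \<Longrightarrow> target_cl z (par v) = lv (par v)"
  using target_cl_par[of z v] by simp

lemma target_cl_reach: "is_target z \<Longrightarrow> \<exists>n. target_cl z ((par ^^ n) v) = lv ((par ^^ n) v)"
proof -
  assume z: "is_target z"
  have "target_cl z ((par ^^ n) v) = min (target_cl z v) (lv v - int n)" for n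
  proof (induction n)
    case (Suc n)
    then show ?case using target_cl_par[OF z, of "(par ^^ n) v"] by (simp add: lv_funpow)
  qed (use target_cl_le[OF z, of v] in simp)
  then have "target_cl z ((par ^^ nat (lv v - target_cl z v)) v) = lv v - int (nat (lv v - target_cl z v))" using target_cl_le[OF z, of v] by simp
  then show ?thesis using lv_funpow by metis
qed

lemma clE_on_ray: assumes "\<xi> \<in> proper_ends T" "dstart \<xi> \<le> n" shows "clE (ray (root T) \<xi> n) \<xi> = lv (ray (root T) \<xi> n)"
proof -
  have "\<forall>\<^sub>F m in sequentially. cl (ray (root T) \<xi> n) (ray (root T) \<xi> m) = clE (ray (root T) \<xi> n) \<xi> \<and> n \<le> m"
    using cl_ray_eventually[OF assms(1)] eventually_ge_at_top by (rule eventually_conj)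
  then obtain m where m: "cl (ray (root T) \<xi> n) (ray (root T) \<xi> m) = clE (ray (root T) \<xi> n) \<xi>" "n \<le> m"
    using eventually_happens' sequentially_bot by blast
  then show ?thesis using ray_anc[OF assms m(2)] cl_eq_lv_iff by metis
qed

text \<open>\<open>target_cl z v = lv v\<close> says that \<open>v\<close> lies on the line from the
  reference end to \<open>z\<close>. The line stops at \<open>z\<close> if \<open>z\<close> is a
  vertex, and contains a tail of the ray to \<open>z\<close> if \<open>z\<close> is an end, so it
  determines \<open>z\<close>.\<close>

lemma line_inj:
  assumes z: "is_target z" "is_target z'" and eq: "\<And>v. target_cl z v = lv v \<longleftrightarrow> target_cl z' v = lv v"
  shows "z = z'"
proof -
  have ve: False if "\<xi> \<in> proper_ends T" "\<And>v. cl v y = lv v \<longleftrightarrow> clE v \<xi> = lv v" for y \<xi>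
  proof -
    have "\<forall>\<^sub>F n in sequentially. lv y + 1 \<le> lv (ray (root T) \<xi> n) \<and> dstart \<xi> \<le> n"
      using ray_lv_large[OF that(1)] eventually_ge_at_top by (rule eventually_conj)
    then obtain n where n: "lv y + 1 \<le> lv (ray (root T) \<xi> n)" "dstart \<xi> \<le> n" using eventually_happens' sequentially_bot by blast
    then have "cl (ray (root T) \<xi> n) y = lv (ray (root T) \<xi> n)" using clE_on_ray[OF that(1)] that(2) by blast
    then show False using cl_le2[of "ray (root T) \<xi> n" y] n by simp
  qed
  from z(1) consider y where "z = HVertex y" | \<xi> where "\<xi> \<in> proper_ends T" "z = HEnd \<xi>" by (auto simp: is_target_def)
  then show ?thesis
  proof cases
    case 1
    from z(2) consider y' where "z' = HVertex y'" | \<xi> where "\<xi> \<in> proper_ends T" "z' = HEnd \<xi>" by (auto simp: is_target_def)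
    then show ?thesis
    proof cases
      case y': 1
      have "cl y y' = lv y" "cl y' y = lv y'" using eq[of y] eq[of y'] 1 y' by auto
      then have "lv y \<le> lv y'" "lv y' \<le> lv y" "anc y' (lv y) = y" using cl_eq_lv_iff by metis+
      then have "y = y'" by (metis anc_self order_antisym)
      then show ?thesis using 1 y' by simp
    next
      case 2
      then show ?thesis using ve[of \<xi> y] eq 1 by auto
    qed
  next
    case 2
    from z(2) consider y' where "z' = HVertex y'" | \<eta> where "\<eta> \<in> proper_ends T" "z' = HEnd \<eta>" by (auto simp: is_target_def)
    then show ?thesis
    proof cases
      case y': 1
      then show ?thesis using ve[of \<xi> y'] eq 2 by auto
    next
      case e: 2
      let ?r = "ray (root T) \<xi>" and ?s = "ray (root T) \<eta>"
      have eE: "clE v \<xi> = lv v \<longleftrightarrow> clE v \<eta> = lv v" for v using eq[of v] 2 e by simp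
      have "\<forall>\<^sub>F m in sequentially. lv (?r (dstart \<xi>)) \<le> lv (?s m) \<and> dstart \<eta> \<le> m"
        using ray_lv_large[OF e(1)] eventually_ge_at_top by (rule eventually_conj)
      then obtain m where m: "lv (?r (dstart \<xi>)) \<le> lv (?s m)" "dstart \<eta> \<le> m" using eventually_happens' sequentially_bot by blast
      define k where "k = nat (lv (?s m) - lv (?r (dstart \<xi>)))"
      have "?r (n + (dstart \<xi> + k)) = ?s (n + m)" for n
      proof -
        have l1: "lv (?r (n + (dstart \<xi> + k))) = lv (?s m) + int n"
          using lv_ray[OF 2(1), of "n + k"] m by (simp add: k_def algebra_simps)
        have l2: "lv (?s (n + m)) = lv (?s m) + int n"
          using lv_ray[OF e(1), of "n + m - dstart \<eta>"] lv_ray[OF e(1), of "m - dstart \<eta>"] m by simp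
        have "clE (?r (n + (dstart \<xi> + k))) \<eta> = lv (?r (n + (dstart \<xi> + k)))"
          using clE_on_ray[OF 2(1), of "n + (dstart \<xi> + k)"] eE by simp
        moreover have "clE (?s (n + m)) \<eta> = lv (?s (n + m))" using clE_on_ray[OF e(1), of "n + m"] m by simp
        moreover have "\<forall>\<^sub>F i in sequentially. cl (?r (n + (dstart \<xi> + k))) (?s i) = clE (?r (n + (dstart \<xi> + k))) \<eta> \<and> cl (?s (n + m)) (?s i) = clE (?s (n + m)) \<eta>"
          using cl_ray_eventually[OF e(1)] by (intro eventually_conj)
        then obtain i where "cl (?r (n + (dstart \<xi> + k))) (?s i) = clE (?r (n + (dstart \<xi> + k))) \<eta>" "cl (?s (n + m)) (?s i) = clE (?s (n + m)) \<eta>"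
          using eventually_happens' sequentially_bot by blast
        ultimately show ?thesis using l1 l2 cl_eq_lv_iff by metis
      qed
      then have "tail_eq ?r ?s" unfolding tail_eq_def by blast
      then have ev: "eqv ?r ?s" by (rule tail_eq_imp_eqv)
      have ends: "\<xi> \<in> ends T" "\<eta> \<in> ends T" using proper_end_ends 2 e by auto
      have "?s \<in> \<xi>" using end_closed[OF ends(1) ray_in[OF ends(1)] ray_nb[OF ends(2)]] ev by blast
      then have "\<xi> = \<eta>" using end_eqI[OF ends] ray_in[OF ends(2)] by blast
      then show ?thesis using 2 e by simp
    qed
  qed
qed

text \<open>Where the lines from the reference end to two targets part, a vertex on one line and a sibling
  of it tell the targets apart.\<close>

lemma target_sep:
  assumes z: "is_target z" "is_target z'" "z \<noteq> z'"
  shows "\<exists>v v'. lv v' = lv v \<and> ((target_cl z v = lv v \<and> target_cl z v' = lv v - 1 \<and> target_cl z' v = lv v - 1 \<and> target_cl z' v' \<in> {lv v - 1, lv v}) \<or>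
     (target_cl z' v = lv v \<and> target_cl z' v' = lv v - 1 \<and> target_cl z v = lv v - 1 \<and> target_cl z v' \<in> {lv v - 1, lv v}))"
proof -
  have main: "\<exists>v v'. lv v' = lv v \<and> target_cl z v = lv v \<and> target_cl z v' = lv v - 1 \<and> target_cl z' v = lv v - 1 \<and> target_cl z' v' \<in> {lv v - 1, lv v}"
    if t: "is_target z" "is_target z'" and u: "target_cl z u = lv u" "target_cl z' u \<noteq> lv u" for z z' u
  proof -
    \<comment> \<open>Going up from \<open>u\<close>, which is on the line to \<open>z\<close> only,
      the \<open>n\<close>-th ancestor is the first one on the line to \<open>z'\<close>;
      \<open>v\<close> below is the last vertex before it.\<close>
    define n where "n = (LEAST n. target_cl z' ((par ^^ n) u) = lv ((par ^^ n) u))"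
    have n: "target_cl z' ((par ^^ n) u) = lv ((par ^^ n) u)" unfolding n_def by (rule LeastI_ex[OF target_cl_reach[OF t(2)]])
    obtain m where m: "n = Suc m" using n u(2) by (cases n) auto
    define v where "v = (par ^^ m) u"
    have "m < n" using m by simp
    then have v1: "target_cl z' v \<noteq> lv v" unfolding n_def v_def by (rule not_less_Least)
    have pv: "target_cl z' (par v) = lv (par v)" using n m by (simp add: v_def)
    have "target_cl z ((par ^^ m) u) = lv ((par ^^ m) u)"
    proof (induction m)
      case (Suc m)
      then show ?case using target_cl_line_up[OF t(1)] by simp
    qed (use u in simp)
    then have v2: "target_cl z v = lv v" by (simp add: v_def)
    obtain v' where v': "par v' = par v" "v' \<noteq> v" using ex_child_not by blast
    have l: "lv v' = lv v" using lv_par[of v] lv_par[of v'] v' by simp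
    have "lv v - 1 \<le> target_cl z' v'" using target_cl_par[OF t(2), of v'] pv v' l by (simp add: min_def split: if_splits)
    then have "target_cl z' v' \<in> {lv v - 1, lv v}" using target_cl_le[OF t(2), of v'] l by auto
    then show ?thesis using l v2 target_cl_sibling[OF t(1) v2 v'] target_cl_off[OF t(2) pv v1] by blast
  qed
  obtain u where "target_cl z u = lv u \<longleftrightarrow> target_cl z' u \<noteq> lv u" using line_inj[OF z(1,2)] z(3) by blast
  then consider "target_cl z u = lv u" "target_cl z' u \<noteq> lv u" | "target_cl z' u = lv u" "target_cl z u \<noteq> lv u" by blast
  then show ?thesis
  proof cases
    case 1 then show ?thesis using main[OF z(1,2), of u] by blast
  next
    case 2 then show ?thesis using main[OF z(2,1), of u] by blast
  qed
qed

lemma target_sibling: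
  assumes z: "is_target z" shows "\<exists>v v'. lv v' = lv v \<and> target_cl z v = lv v \<and> target_cl z v' = lv v - 1"
proof -
  obtain v where v: "target_cl z v = lv v" using target_cl_reach[OF z] by blast
  obtain v' where v': "par v' = par v" "v' \<noteq> v" using ex_child_not by blast
  then show ?thesis using v target_cl_sibling[OF z v v'] lv_par[of v] lv_par[of v'] by (intro exI[of _ v] exI[of _ v']) simp
qed

end

section \<open>The boundary of the Diestel-Leader graph\<close>

context homtree
begin

lemma is_target_HM: "is_target z \<Longrightarrow> z \<in> HM"
  by (auto simp: is_target_def)

lemma HM_cases: "z \<in> HM \<Longrightarrow> is_target z \<or> (\<exists>k. z = Omega k)"
  by (auto simp: is_target_def hor_compactification_def)

lemma not_target_Omega [simp]: "\<not> is_target (Omega k)"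
  by (auto simp: is_target_def)

lemma lim_target_cl:
  assumes "is_target z" "limitin (hor_topology p T) (\<lambda>i. HVertex (v i)) z F"
  shows "\<forall>\<^sub>F i in F. cl x (v i) = target_cl z x"
proof -
  from assms(1) consider y where "z = HVertex y" | \<xi> where "\<xi> \<in> proper_ends T" "z = HEnd \<xi>" by (auto simp: is_target_def)
  then show ?thesis
  proof cases
    case 1
    show ?thesis using lim_HVertex[of "\<lambda>i. HVertex (v i)" y F] assms(2) unfolding 1 by (auto elim: eventually_mono)
  next
    case 2
    show ?thesis using lim_HEnd(1)[of v \<xi> F x] assms(2) unfolding 2 by simp
  qed
qed

lemma lim_hor_ext:
  "limitin (hor_topology p T) (\<lambda>i. HVertex (v i)) z F \<Longrightarrow> ((\<lambda>i. squash (Fin (lv (v i)))) \<longlongrightarrow> squash (hor_ext T z)) F"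
  unfolding hor_limit_iff by (simp add: hor_eq)

lemma far_seq: "\<exists>v. \<forall>n. lv (v n) = l n \<and> cl x (v n) \<le> - int n"
  using ex_far by (intro choice allI)

lemma lim_Omega_far:
  assumes "\<And>n. cl (root T) (v n) \<le> - int n" "(\<lambda>n. squash (Fin (lv (v n)))) \<longlonglongrightarrow> squash k"
  shows "limitin (hor_topology p T) (\<lambda>n. HVertex (v n)) (Omega k) sequentially"
  unfolding lim_Omega_iff
proof (intro conjI allI assms(2))
  fix c show "\<forall>\<^sub>F n in sequentially. cl (root T) (v n) \<le> c"
  proof (rule eventually_sequentiallyI)
    fix n assume "nat (- c) \<le> n"
    then show "cl (root T) (v n) \<le> c" using assms(1)[of n] by simp
  qed
qed

lemma vertex_seq: assumes "z \<in> HM" shows "\<exists>t. limitin (hor_topology p T) (\<lambda>n. HVertex (t n)) z sequentially"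
proof (cases z)
  case (HVertex y)
  then show ?thesis using assms by (intro exI[of _ "\<lambda>_. y"]) (simp add: limitin_const topspace_hor)
next
  case (HEnd \<xi>)
  then show ?thesis using assms ray_tendsto_HEnd by auto
next
  case (Omega k)
  have "\<exists>l. (\<lambda>n. squash (Fin (l n))) \<longlonglongrightarrow> squash k"
  proof (cases k)
    case (Fin j)
    then show ?thesis by (intro exI[of _ "\<lambda>_. j"]) simp
  next
    case Pinf
    have "\<forall>\<^sub>F n in sequentially. l \<le> int n" for l by (rule eventually_sequentiallyI[of "nat l"]) simp
    then have "(\<lambda>n. squash (Fin (int n))) \<longlonglongrightarrow> squash Pinf" unfolding squash.simps(2) squash_tendsto_Pinf by blast
    then show ?thesis unfolding Pinf by blast
  next
    case Minf
    have "\<forall>\<^sub>F n in sequentially. - int n \<le> l" for l by (rule eventually_sequentiallyI[of "nat (- l)"]) simp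
    then have "(\<lambda>n. squash (Fin (- int n))) \<longlonglongrightarrow> squash Minf" unfolding squash.simps(3) squash_tendsto_Minf by blast
    then show ?thesis unfolding Minf by (rule exI[of _ "\<lambda>n. - int n"])
  qed
  then obtain l where l: "(\<lambda>n. squash (Fin (l n))) \<longlonglongrightarrow> squash k" by blast
  obtain v where v: "\<And>n. lv (v n) = l n \<and> cl (root T) (v n) \<le> - int n" using far_seq by metis
  then show ?thesis unfolding Omega using lim_Omega_far[of v k] l by auto
qed

end

context dl
begin

abbreviation W where "W \<equiv> prod_topology (hor_topology q T1) (hor_topology r T2)"
abbreviation CC where "CC \<equiv> DL_hor_topology q r T1 T2"

lemma embed_lim: "limitin W (\<lambda>i. DL_embed (y i)) \<eta> F \<longleftrightarrow>
    limitin (hor_topology q T1) (\<lambda>i. HVertex (fst (y i))) (fst \<eta>) F \<and> limitin (hor_topology r T2) (\<lambda>i. HVertex (snd (y i))) (snd \<eta>) F"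
  by (simp add: limitin_pairwise DL_embed_def o_def)

lemma X_lv: "y \<in> X \<Longrightarrow> T2.lv (snd y) = - T1.lv (fst y)"
  using X_iff[of "fst y" "snd y"] by simp

text \<open>Grouped by which coordinate is a target. Writing the other level as
  \<open>- hor_ext\<close> treats vertices and proper ends together, the latter having level
  \<open>Pinf\<close>; \<open>boundary_eq\<close> recovers the explicit list.\<close>

definition boundary :: "('a hor_pt \<times> 'b hor_pt) set" where
  "boundary = {(z, Omega (- hor_ext T1 z)) | z. T1.is_target z} \<union> {(Omega (- hor_ext T2 z), z) | z. T2.is_target z}
    \<union> {(Omega k, Omega (- k)) | k. True}"

lemma boundary_eq: "boundary = {(HEnd \<xi>1, Omega Minf) | \<xi>1. \<xi>1 \<in> proper_ends T1}
        \<union> {(Omega Minf, HEnd \<xi>2) | \<xi>2. \<xi>2 \<in> proper_ends T2}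
        \<union> {(Omega k, Omega (- k)) | k. True}
        \<union> {(HVertex y1, Omega (Fin (- hor T1 y1))) | y1. True}
        \<union> {(Omega (Fin (- hor T2 y2)), HVertex y2) | y2. True}"
proof -
  have 1: "{(z, Omega (- hor_ext T1 z)) | z. T1.is_target z} =
      {(HEnd \<xi>1, Omega Minf) | \<xi>1. \<xi>1 \<in> proper_ends T1} \<union> {(HVertex y1, Omega (Fin (- hor T1 y1))) | y1. True}" (is "?A = ?B \<union> ?C")
  proof (intro equalityI subsetI)
    fix z assume "z \<in> ?A" then show "z \<in> ?B \<union> ?C" by (auto simp: T1.is_target_def)
  next
    fix z assume "z \<in> ?B \<union> ?C"
    then show "z \<in> ?A"
    proof
      assume "z \<in> ?B"
      then obtain \<xi> where "z = (HEnd \<xi>, Omega Minf)" "\<xi> \<in> proper_ends T1" by blast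
      then show "z \<in> ?A" by (auto simp: T1.is_target_def intro!: exI[of _ "HEnd \<xi>"])
    next
      assume "z \<in> ?C"
      then obtain y where "z = (HVertex y, Omega (Fin (- hor T1 y)))" by blast
      then show "z \<in> ?A" by (auto simp: T1.is_target_def intro!: exI[of _ "HVertex y"])
    qed
  qed
  have 2: "{(Omega (- hor_ext T2 z), z) | z. T2.is_target z} =
      {(Omega Minf, HEnd \<xi>2) | \<xi>2. \<xi>2 \<in> proper_ends T2} \<union> {(Omega (Fin (- hor T2 y2)), HVertex y2) | y2. True}" (is "?A = ?B \<union> ?C")
  proof (intro equalityI subsetI)
    fix z assume "z \<in> ?A" then show "z \<in> ?B \<union> ?C" by (auto simp: T2.is_target_def)
  next
    fix z assume "z \<in> ?B \<union> ?C"
    then show "z \<in> ?A"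
    proof
      assume "z \<in> ?B"
      then obtain \<xi> where "z = (Omega Minf, HEnd \<xi>)" "\<xi> \<in> proper_ends T2" by blast
      then show "z \<in> ?A" by (auto simp: T2.is_target_def intro!: exI[of _ "HEnd \<xi>"])
    next
      assume "z \<in> ?C"
      then obtain y where "z = (Omega (Fin (- hor T2 y)), HVertex y)" by blast
      then show "z \<in> ?A" by (auto simp: T2.is_target_def intro!: exI[of _ "HVertex y"])
    qed
  qed
  show ?thesis unfolding boundary_def 1 2 by blast
qed

lemma boundary_cases:
  assumes "\<eta> \<in> boundary"
  obtains z where "T1.is_target z" "\<eta> = (z, Omega (- hor_ext T1 z))"
  | z where "T2.is_target z" "\<eta> = (Omega (- hor_ext T2 z), z)"
  | k where "\<eta> = (Omega k, Omega (- k))"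
  using assms unfolding boundary_def by blast

lemma boundary_disjoint: "boundary \<inter> DL_embed ` X = {}"
  by (auto simp: boundary_def DL_embed_def)

lemma approach1:
  assumes "z \<in> T1.HM"
  shows "\<exists>y. (\<forall>n. y n \<in> X) \<and> limitin W (\<lambda>n. DL_embed (y n)) (z, Omega (- hor_ext T1 z)) sequentially"
proof -
  obtain t where t: "limitin (hor_topology q T1) (\<lambda>n. HVertex (t n)) z sequentially" using T1.vertex_seq[OF assms] by blast
  obtain v where v: "\<And>n. T2.lv (v n) = - T1.lv (t n) \<and> T2.cl (root T2) (v n) \<le> - int n" using T2.far_seq[of "\<lambda>n. - T1.lv (t n)" "root T2"] by blast
  have "(\<lambda>n. - squash (Fin (T1.lv (t n)))) \<longlonglongrightarrow> - squash (hor_ext T1 z)"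
    using T1.lim_hor_ext[OF t] by (rule tendsto_minus)
  then have "(\<lambda>n. squash (Fin (T2.lv (v n)))) \<longlonglongrightarrow> squash (- hor_ext T1 z)"
    unfolding squash_uminus[symmetric] using v by simp
  then have "limitin (hor_topology r T2) (\<lambda>n. HVertex (v n)) (Omega (- hor_ext T1 z)) sequentially"
    using v by (intro T2.lim_Omega_far) auto
  then show ?thesis using t v by (intro exI[of _ "\<lambda>n. (t n, v n)"]) (simp add: embed_lim X_iff)
qed

lemma ext_uminus_uminus: "- (- k) = (k :: int extended)"
  by (cases k) auto

lemma approach:
  assumes "\<eta> \<in> boundary" shows "\<exists>y. (\<forall>n. y n \<in> X) \<and> limitin W (\<lambda>n. DL_embed (y n)) \<eta> sequentially"
  using assms
proof (cases rule: boundary_cases)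
  case (1 z)
  then show ?thesis using approach1[OF T1.is_target_HM] by simp
next
  case (2 z)
  interpret S: dl T2 T1 r q "1 - \<alpha>" by unfold_locales (use \<alpha> in auto)
  obtain y where y: "\<And>n. y n \<in> S.X" "limitin S.W (\<lambda>n. DL_embed (y n)) (z, Omega (- hor_ext T2 z)) sequentially"
    using S.approach1[OF T2.is_target_HM[OF 2(1)]] by blast
  show ?thesis
  proof (intro exI[of _ "\<lambda>n. prod.swap (y n)"] conjI allI)
    show "prod.swap (y n) \<in> X" for n using y(1)[of n] by (cases "y n") (simp add: X_iff S.X_iff)
    show "limitin W (\<lambda>n. DL_embed (prod.swap (y n))) \<eta> sequentially"
      using y(2) unfolding embed_lim S.embed_lim 2(2) by simp
  qed
next
  case (3 k)
  then show ?thesis using approach1[of "Omega k"] by simp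
qed

lemma topspace_W: "topspace W = T1.HM \<times> T2.HM"
  by (simp add: T1.topspace_hor T2.topspace_hor)

text \<open>Opposite levels are a closed condition, which bounds the closure from above. Two proper
  ends, or a vertex and a proper end, are ruled out because \<open>Pinf\<close> is not the negative
  of \<open>Pinf\<close> or of a finite level. The reverse inclusion is
  \<open>approach\<close>.\<close>

lemma closure_W: "W closure_of (DL_embed ` X) = boundary \<union> DL_embed ` X"
proof (intro equalityI subsetI)
  let ?Z = "{z \<in> topspace W. squash (hor_ext T1 (fst z)) = - squash (hor_ext T2 (snd z))}"
  have c: "continuous_map W euclideanreal (\<lambda>z. squash (hor_ext T1 (fst z)))" "continuous_map W euclideanreal (\<lambda>z. squash (hor_ext T2 (snd z)))"
    using continuous_map_compose[OF continuous_map_fst T1.continuous_squash_hor, of "hor_topology r T2"]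
      continuous_map_compose[OF continuous_map_snd T2.continuous_squash_hor, of "hor_topology q T1"] by (simp_all add: o_def)
  have "closedin W ?Z"
    by (rule closedin_continuous_maps_eq[OF _ c(1) continuous_map_minus[OF c(2)]]) simp
  moreover have "DL_embed ` X \<subseteq> ?Z"
  proof
    fix z assume "z \<in> DL_embed ` X"
    then obtain x1 x2 where x: "(x1, x2) \<in> X" "z = (HVertex x1, HVertex x2)" by (auto simp: DL_embed_def)
    have "hor T1 x1 = - hor T2 x2" using x(1) by (simp add: X_iff T1.hor_eq T2.hor_eq)
    then show "z \<in> ?Z" using x squash_uminus[of "Fin (hor T2 x2)"] by (simp add: T1.topspace_hor T2.topspace_hor del: squash.simps(1))
  qed
  ultimately have sub: "W closure_of (DL_embed ` X) \<subseteq> ?Z" by (rule closure_of_minimal[rotated])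
  fix z assume "z \<in> W closure_of (DL_embed ` X)"
  then have z: "z \<in> ?Z" using sub by blast
  obtain z1 z2 where zz: "z = (z1, z2)" by (cases z)
  have h: "hor_ext T1 z1 = - hor_ext T2 z2"
    using z squash_uminus[of "hor_ext T2 z2"] squash_inj[of "hor_ext T1 z1" "- hor_ext T2 z2"] unfolding zz by simp
  have HM: "z1 \<in> T1.HM" "z2 \<in> T2.HM" using z unfolding zz topspace_W by simp_all
  have h': "hor_ext T2 z2 = - hor_ext T1 z1" unfolding h by (simp add: ext_uminus_uminus)
  consider k where "z2 = Omega k" "T1.is_target z1" | k where "z1 = Omega k" "T2.is_target z2"
    | k l where "z1 = Omega k" "z2 = Omega l" | "T1.is_target z1" "T2.is_target z2"
    using T1.HM_cases[OF HM(1)] T2.HM_cases[OF HM(2)] by blast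
  then show "z \<in> boundary \<union> DL_embed ` X"
  proof cases
    case 1
    then have "z2 = Omega (- hor_ext T1 z1)" using h' by simp
    then show ?thesis using 1 unfolding zz boundary_def by blast
  next
    case 2
    then have "z1 = Omega (- hor_ext T2 z2)" using h by simp
    then show ?thesis using 2 unfolding zz boundary_def by blast
  next
    case 3
    then have "z2 = Omega (- k)" using h' by simp
    then show ?thesis using 3 unfolding zz boundary_def by blast
  next
    case 4
    then obtain x1 x2 where x: "z1 = HVertex x1" "z2 = HVertex x2"
      using h by (auto simp: T1.is_target_def T2.is_target_def)
    then have "(x1, x2) \<in> X" using h by (simp add: X_iff T1.hor_eq T2.hor_eq)
    then show ?thesis unfolding zz x by (auto simp: DL_embed_def image_iff intro!: bexI[of _ "(x1, x2)"])
  qed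
next
  fix z assume "z \<in> boundary \<union> DL_embed ` X"
  then show "z \<in> W closure_of (DL_embed ` X)"
  proof
    assume "z \<in> boundary"
    then obtain y where y: "\<And>n. y n \<in> X" "limitin W (\<lambda>n. DL_embed (y n)) z sequentially" using approach by blast
    show ?thesis unfolding in_closure_of
    proof (intro conjI allI impI)
      show "z \<in> topspace W" by (rule limitin_topspace[OF y(2)])
      fix U assume "z \<in> U \<and> openin W U"
      then have "\<forall>\<^sub>F n in sequentially. DL_embed (y n) \<in> U" using y(2) unfolding limitin_def by blast
      then obtain n where "DL_embed (y n) \<in> U" using eventually_happens' sequentially_bot by blast
      then show "\<exists>u. u \<in> DL_embed ` X \<and> u \<in> U" using y(1) by blast
    qed
  next
    assume "z \<in> DL_embed ` X"
    moreover have "DL_embed ` X \<subseteq> W closure_of (DL_embed ` X)"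
      by (rule closure_of_subset) (auto simp: T1.topspace_hor T2.topspace_hor DL_embed_def)
    ultimately show ?thesis by blast
  qed
qed

lemma CC_eq: "CC = subtopology W (boundary \<union> DL_embed ` X)"
  by (simp add: DL_hor_topology_def Let_def closure_W)

lemma boundary_W: "boundary \<union> DL_embed ` X \<subseteq> topspace W"
  unfolding closure_W[symmetric] by (rule closure_of_subset_topspace)

lemma topspace_CC: "topspace CC = boundary \<union> DL_embed ` X"
  unfolding CC_eq topspace_subtopology using boundary_W by blast

lemma CC_compactification: "metrizable_compactification X CC DL_embed"
  unfolding metrizable_compactification_def
proof (intro conjI)
  have "compact_space W" using T1.hor_compact T2.hor_compact by (simp add: compact_space_prod_topology)
  moreover have "closedin W (boundary \<union> DL_embed ` X)" unfolding closure_W[symmetric] by (rule closedin_closure_of)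
  ultimately show "compact_space CC" unfolding CC_eq by (intro compact_space_subtopology closedin_compact_space)
  have "metrizable_space W" using T1.hor_metrizable T2.hor_metrizable by (simp add: metrizable_space_prod_topology)
  then show "metrizable_space CC" unfolding CC_eq by (rule metrizable_space_subtopology)
  show "inj_on DL_embed X" by (auto simp: inj_on_def DL_embed_def)
  show "DL_embed ` X \<subseteq> topspace CC" by (simp add: topspace_CC)
  have op: "openin W {DL_embed x}" for x
  proof -
    have "{DL_embed x} = {HVertex (fst x)} \<times> {HVertex (snd x)}" by (cases x) (simp add: DL_embed_def)
    moreover have "openin W ({HVertex (fst x)} \<times> {HVertex (snd x)})"
      unfolding openin_prod_Times_iff using T1.open_HVertex T2.open_HVertex by blast
    ultimately show ?thesis by simp
  qed
  have "subtopology W (DL_embed ` X) = discrete_topology (DL_embed ` X)"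
    unfolding discrete_topology_unique[symmetric]
    by (rule sym, unfold discrete_topology_unique) (use boundary_W op in \<open>auto simp: openin_subtopology intro!: exI[of _ "{_}"]\<close>)
  then show "subtopology CC (DL_embed ` X) = discrete_topology (DL_embed ` X)"
    unfolding CC_eq subtopology_subtopology by (simp add: Int_absorb1)
  have "CC closure_of (DL_embed ` X) = (boundary \<union> DL_embed ` X) \<inter> W closure_of ((boundary \<union> DL_embed ` X) \<inter> DL_embed ` X)"
    unfolding CC_eq by (rule closure_of_subtopology)
  also have "(boundary \<union> DL_embed ` X) \<inter> DL_embed ` X = DL_embed ` X" by blast
  finally show "CC closure_of (DL_embed ` X) = topspace CC" unfolding closure_W topspace_CC by simp
qed

section \<open>The candidate kernels on the boundary and convergence to them\<close>

definition target_kernel :: "'a hor_pt \<Rightarrow> 'a \<Rightarrow> real" where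
  "target_kernel z x = (case z of HVertex y \<Rightarrow> spherical \<alpha> q T1 x y / spherical \<alpha> q T1 (root T1) y
     | HEnd \<xi> \<Rightarrow> end_kernel x (T1.clE (root T1) \<xi> - T1.clE x \<xi>) | Omega k \<Rightarrow> 0)"

text \<open>The infinite levels carry the limits of the finite formula:
  \<open>\<beta> powi k\<close> tends to 0 at plus infinity if \<open>\<alpha> > 1/2\<close>, and at
  minus infinity otherwise; at the opposite end it dominates and the quotient tends to 1.\<close>

definition omega_kernel :: "int extended \<Rightarrow> 'a \<Rightarrow> real" where
  "omega_kernel k x = (case k of Fin j \<Rightarrow> (sc j + sc (T1.lv x)) / (sc j + 1)
     | Pinf \<Rightarrow> if \<alpha> > 1 / 2 then sc (T1.lv x) else 1 | Minf \<Rightarrow> if \<alpha> > 1 / 2 then 1 else sc (T1.lv x))"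

abbreviation target_kernel2 where "target_kernel2 \<equiv> dl.target_kernel T2 r (1 - \<alpha>)"

text \<open>On \<open>boundary\<close> at most one coordinate is a target, so the order of the tests
  is immaterial and the last default is never reached.\<close>

definition boundary_kernel :: "'a \<times> 'b \<Rightarrow> 'a hor_pt \<times> 'b hor_pt \<Rightarrow> real" where
  "boundary_kernel x \<eta> = (if T1.is_target (fst \<eta>) then target_kernel (fst \<eta>) (fst x)
     else if T2.is_target (snd \<eta>) then target_kernel2 (snd \<eta>) (snd x)
     else case fst \<eta> of Omega k \<Rightarrow> omega_kernel k (fst x) | _ \<Rightarrow> 0)"

lemma boundary_kernel_simps:
  "T1.is_target z \<Longrightarrow> boundary_kernel x (z, u) = target_kernel z (fst x)"
  "T2.is_target z' \<Longrightarrow> boundary_kernel x (Omega k, z') = target_kernel2 z' (snd x)"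
  "boundary_kernel x (Omega k, Omega l) = omega_kernel k (fst x)"
  by (simp_all add: boundary_kernel_def)

lemma lim_target:
  assumes z: "T1.is_target z" and yX: "\<forall>\<^sub>F i in F. y i \<in> X" and x: "x \<in> X"
    and l: "limitin (hor_topology q T1) (\<lambda>i. HVertex (fst (y i))) z F"
    and b: "\<And>c. \<forall>\<^sub>F i in F. T2.cl (root T2) (snd (y i)) \<le> c"
  shows "((\<lambda>i. mk x (y i)) \<longlongrightarrow> target_kernel z (fst x)) F"
proof -
  from z consider v where "z = HVertex v" | \<xi> where "\<xi> \<in> proper_ends T1" "z = HEnd \<xi>" by (auto simp: T1.is_target_def)
  then show ?thesis
  proof cases
    case 1
    have "\<forall>\<^sub>F i in F. fst (y i) = v"
      using T1.lim_HVertex[of "\<lambda>i. HVertex (fst (y i))" v F] l unfolding 1 by (auto elim: eventually_mono)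
    then show ?thesis using lim_vertex1[OF yX x _ b] by (simp add: target_kernel_def 1)
  next
    case 2
    have "T1.target_cl z = (\<lambda>x. T1.clE x \<xi>)" unfolding 2 by auto
    then have c: "\<forall>\<^sub>F i in F. T1.cl v (fst (y i)) = T1.clE v \<xi>" for v using T1.lim_target_cl[OF z l] by simp
    have "\<forall>\<^sub>F i in F. c \<le> T1.lv (fst (y i))" for c using T1.lim_HEnd(2)[of "\<lambda>i. fst (y i)" \<xi> F c] l unfolding 2 by simp
    then show ?thesis using lim_end1[OF yX x c c b] by (simp add: target_kernel_def 2)
  qed
qed

lemma sc_tendsto_0':
  assumes half: "\<not> \<alpha> > 1 / 2" and b: "\<And>c. \<forall>\<^sub>F i in F. f i \<le> c"
  shows "((\<lambda>i. sc (f i)) \<longlongrightarrow> 0) F"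
proof -
  interpret H: dl T1 T2 q r "1 - \<alpha>" by unfold_locales (use \<alpha> in auto)
  have "((\<lambda>i. H.sc (- f i)) \<longlongrightarrow> 0) F"
  proof (rule H.sc_tendsto_0)
    show "1 - \<alpha> > 1 / 2" using half half_or by blast
    show "\<forall>\<^sub>F i in F. c \<le> - f i" for c using b[of "- c"] by eventually_elim simp
  qed
  moreover have "H.sc (- k) = sc k" for k
  proof -
    have "H.\<beta> = inverse \<beta>" using \<alpha> by (simp add: \<beta>_def H.\<beta>_def)
    then show ?thesis unfolding H.sc_def sc_def by (simp add: power_int_minus power_int_inverse)
  qed
  ultimately show ?thesis by simp
qed

lemma sc_minus: "sc (- k) = 1 / sc k"
  using \<beta>_pos by (simp add: sc_def power_int_minus divide_inverse)

lemma omega_kernel_limit0: "((\<lambda>i. sc (f i)) \<longlongrightarrow> 0) F \<Longrightarrow> ((\<lambda>i. (sc (f i) + t) / (sc (f i) + 1)) \<longlongrightarrow> t) F"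
proof -
  assume s: "((\<lambda>i. sc (f i)) \<longlongrightarrow> 0) F"
  have "((\<lambda>i. (sc (f i) + t) / (sc (f i) + 1)) \<longlongrightarrow> (0 + t) / (0 + 1)) F" by (intro tendsto_intros s) simp
  then show ?thesis by simp
qed

lemma omega_kernel_limit1: "((\<lambda>i. sc (- f i)) \<longlongrightarrow> 0) F \<Longrightarrow> ((\<lambda>i. (sc (f i) + t) / (sc (f i) + 1)) \<longlongrightarrow> 1) F"
proof -
  assume s: "((\<lambda>i. sc (- f i)) \<longlongrightarrow> 0) F"
  have "((\<lambda>i. (1 + t * sc (- f i)) / (1 + sc (- f i))) \<longlongrightarrow> (1 + t * 0) / (1 + 0)) F" by (intro tendsto_intros s) simp
  moreover have "(1 + t * sc (- f i)) / (1 + sc (- f i)) = (sc (f i) + t) / (sc (f i) + 1)" for i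
  proof -
    define s where "s = sc (f i)"
    have s: "s > 0" using sc_pos by (simp add: s_def)
    have "(1 + t * (1 / s)) / (1 + 1 / s) = ((1 + t * (1 / s)) * s) / ((1 + 1 / s) * s)" using s by simp
    also have "\<dots> = (s + t) / (s + 1)" using s by (simp add: distrib_right)
    finally show ?thesis unfolding sc_minus s_def .
  qed
  ultimately show ?thesis by simp
qed

lemma omega_kernel_limit_Pinf:
  assumes "\<And>c. \<forall>\<^sub>F i in F. c \<le> f i"
  shows "((\<lambda>i. (sc (f i) + sc (T1.lv x)) / (sc (f i) + 1)) \<longlongrightarrow> omega_kernel Pinf x) F"
proof (cases "\<alpha> > 1 / 2")
  case True
  then show ?thesis using omega_kernel_limit0[OF sc_tendsto_0[OF True assms]] by (simp add: omega_kernel_def)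
next
  case False
  have "\<forall>\<^sub>F i in F. - f i \<le> c" for c using assms[of "- c"] by eventually_elim simp
  then show ?thesis using omega_kernel_limit1[OF sc_tendsto_0'[OF False, where f = "\<lambda>i. - f i"]] False by (simp add: omega_kernel_def)
qed

lemma omega_kernel_limit_Minf:
  assumes "\<And>c. \<forall>\<^sub>F i in F. f i \<le> c"
  shows "((\<lambda>i. (sc (f i) + sc (T1.lv x)) / (sc (f i) + 1)) \<longlongrightarrow> omega_kernel Minf x) F"
proof (cases "\<alpha> > 1 / 2")
  case False
  then show ?thesis using omega_kernel_limit0[OF sc_tendsto_0'[OF False assms]] by (simp add: omega_kernel_def)
next
  case True
  have "\<forall>\<^sub>F i in F. c \<le> - f i" for c using assms[of "- c"] by eventually_elim simp
  then show ?thesis using omega_kernel_limit1[OF sc_tendsto_0[OF True, where f = "\<lambda>i. - f i"]] True by (simp add: omega_kernel_def)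
qed

lemma lim_kom:
  assumes yX: "\<forall>\<^sub>F i in F. y i \<in> X" and x: "x \<in> X"
    and l1: "limitin (hor_topology q T1) (\<lambda>i. HVertex (fst (y i))) (Omega k) F"
    and l2: "limitin (hor_topology r T2) (\<lambda>i. HVertex (snd (y i))) (Omega l) F"
  shows "((\<lambda>i. mk x (y i)) \<longlongrightarrow> omega_kernel k (fst x)) F"
proof -
  have a: "\<And>c. \<forall>\<^sub>F i in F. T1.cl (root T1) (fst (y i)) \<le> c" and sq: "((\<lambda>i. squash (Fin (T1.lv (fst (y i))))) \<longlongrightarrow> squash k) F"
    using l1 unfolding T1.lim_Omega_iff by auto
  have b: "\<And>c. \<forall>\<^sub>F i in F. T2.cl (root T2) (snd (y i)) \<le> c"
    using l2 unfolding T2.lim_Omega_iff by auto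
  let ?g = "\<lambda>i. (sc (T1.lv (fst (y i))) + sc (T1.lv (fst x))) / (sc (T1.lv (fst (y i))) + 1)"
  have "(?g \<longlongrightarrow> omega_kernel k (fst x)) F"
  proof (cases k)
    case (Fin j)
    have "\<forall>\<^sub>F i in F. T1.lv (fst (y i)) = j" using sq unfolding Fin squash_tendsto_Fin .
    then have "\<forall>\<^sub>F i in F. ?g i = omega_kernel k (fst x)" by eventually_elim (simp add: omega_kernel_def Fin)
    then show ?thesis by (rule tendsto_eventually)
  next
    case Pinf
    show ?thesis using sq unfolding Pinf squash.simps(2) squash_tendsto_Pinf by (intro omega_kernel_limit_Pinf) blast
  next
    case Minf
    show ?thesis using sq unfolding Minf squash.simps(3) squash_tendsto_Minf by (intro omega_kernel_limit_Minf) blast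
  qed
  from tendsto_add[OF lim_omega[OF yX x a b] this] show ?thesis by simp
qed

lemma martin_kernel_limit:
  assumes \<eta>: "\<eta> \<in> boundary" and yX: "\<forall>\<^sub>F i in F. y i \<in> X" and x: "x \<in> X" and l: "limitin W (\<lambda>i. DL_embed (y i)) \<eta> F"
  shows "((\<lambda>i. mk x (y i)) \<longlongrightarrow> boundary_kernel x \<eta>) F"
  using \<eta>
proof (cases rule: boundary_cases)
  case (1 z)
  have "\<And>c. \<forall>\<^sub>F i in F. T2.cl (root T2) (snd (y i)) \<le> c"
    using l unfolding embed_lim 1 fst_conv snd_conv T2.lim_Omega_iff by blast
  then show ?thesis using l unfolding embed_lim 1 fst_conv snd_conv boundary_kernel_simps(1)[OF 1(1)] by (intro lim_target[OF 1(1) yX x]) auto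
next
  case (2 z)
  interpret S: dl T2 T1 r q "1 - \<alpha>" by unfold_locales (use \<alpha> in auto)
  obtain x1 x2 where xx: "x = (x1, x2)" by (cases x)
  have "\<And>c. \<forall>\<^sub>F i in F. T1.cl (root T1) (fst (y i)) \<le> c"
    using l unfolding embed_lim 2 fst_conv snd_conv T1.lim_Omega_iff by blast
  moreover have "\<forall>\<^sub>F i in F. prod.swap (y i) \<in> S.X" using yX
  proof eventually_elim
    case (elim i)
    then show ?case by (cases "y i") (simp add: X_iff S.X_iff)
  qed
  moreover have "(x2, x1) \<in> S.X" using x by (simp add: xx X_iff S.X_iff)
  ultimately have L: "((\<lambda>i. S.mk (x2, x1) (prod.swap (y i))) \<longlongrightarrow> target_kernel2 z x2) F"
    using S.lim_target[OF 2(1), where F = F and y = "\<lambda>i. prod.swap (y i)" and x = "(x2, x1)"] l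
    unfolding embed_lim 2 fst_conv snd_conv by simp
  have "S.mk (x2, x1) (prod.swap (y i)) = mk x (y i)" for i
    using mk_swap[of x1 x2 "fst (y i)" "snd (y i)"] x by (simp add: xx prod.swap_def)
  then show ?thesis using L unfolding 2 boundary_kernel_simps(2)[OF 2(1)] by (simp add: xx)
next
  case (3 k)
  then show ?thesis using l unfolding embed_lim 3 fst_conv snd_conv boundary_kernel_simps(3) by (intro lim_kom[OF yX x]) auto
qed

lemma kernel_exists: "\<exists>K. kernel_extension X P orig CC DL_embed K \<and> (\<forall>x\<in>X. \<forall>\<eta>\<in>boundary. K x \<eta> = boundary_kernel x \<eta>)"
proof -
  let ?E = "DL_embed ` X"
  have MC: "metrizable_compactification X CC DL_embed" by (rule CC_compactification)
  have "\<exists>g. continuous_map CC euclideanreal g \<and> (\<forall>y\<in>X. g (DL_embed y) = mk x y) \<and> (\<forall>\<eta>\<in>boundary. g \<eta> = boundary_kernel x \<eta>)" if x: "x \<in> X" for x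
  proof -
    define f where "f z = mk x (inv_into X DL_embed z)" for z
    have inj: "inj_on DL_embed X" using MC by (simp add: metrizable_compactification_def)
    have fX: "f (DL_embed y) = mk x y" if "y \<in> X" for y unfolding f_def using inv_into_f_f[OF inj that] by simp
    have lim: "(f \<longlongrightarrow> boundary_kernel x \<eta>) (atin_within CC \<eta> ?E)" if \<eta>: "\<eta> \<in> boundary" for \<eta>
    proof -
      let ?F = "atin_within CC \<eta> ?E"
      have E: "\<forall>\<^sub>F z in ?F. z \<in> ?E" unfolding eventually_atin_within
        by (intro disjI2 exI[of _ "topspace CC"]) (use \<eta> openin_topspace[of CC] in \<open>auto simp: topspace_CC\<close>)
      have "\<forall>\<^sub>F z in ?F. inv_into X DL_embed z \<in> X" using E by eventually_elim (rule inv_into_into)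
      moreover have "limitin W (\<lambda>z. DL_embed (inv_into X DL_embed z)) \<eta> ?F"
      proof -
        have "limitin CC (\<lambda>z. z) \<eta> ?F"
          unfolding limitin_def topspace_CC using \<eta> by (auto simp: eventually_atin_within)
        then have "limitin W (\<lambda>z. z) \<eta> ?F" unfolding CC_eq limitin_subtopology by simp
        moreover have "\<forall>\<^sub>F z in ?F. z = DL_embed (inv_into X DL_embed z)"
          using E by eventually_elim (simp add: f_inv_into_f)
        ultimately show ?thesis by (rule limitin_transform_eventually[rotated])
      qed
      ultimately show ?thesis unfolding f_def by (rule martin_kernel_limit[OF \<eta> _ x])
    qed
    have cf: "continuous_map (subtopology CC ?E) euclideanreal f"
    proof -
      have "subtopology CC ?E = discrete_topology ?E" using MC by (simp add: metrizable_compactification_def)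
      then show ?thesis by simp
    qed
    \<comment> \<open>The kernel has a limit at every boundary point along the dense set of
      vertices, so it extends continuously with values in the regular space of reals; the values of
      the extension are then read off along sequences.\<close>
    obtain g where g: "continuous_map (subtopology CC (topspace CC)) euclideanreal g" "\<And>z. z \<in> ?E \<Longrightarrow> g z = f z"
    proof (rule continuous_map_extension_pointwise_alt[of euclideanreal ?E "topspace CC" CC f])
      show "?E \<subseteq> topspace CC" "topspace CC \<subseteq> CC closure_of ?E" using MC by (auto simp: metrizable_compactification_def)
      show "\<exists>l. limitin euclideanreal f l (atin_within CC t ?E)" if "t \<in> topspace CC - ?E" for t
        using lim[of t] that unfolding topspace_CC by auto
    qed (use cf metrizable_imp_regular_space[OF metrizable_space_euclidean] in auto)
    have g1: "continuous_map CC euclideanreal g" using g(1) by simp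
    have "g \<eta> = boundary_kernel x \<eta>" if \<eta>: "\<eta> \<in> boundary" for \<eta>
    proof -
      obtain y where y: "\<And>n. y n \<in> X" "limitin W (\<lambda>n. DL_embed (y n)) \<eta> sequentially" using approach[OF \<eta>] by blast
      have "limitin CC (\<lambda>n. DL_embed (y n)) \<eta> sequentially"
        unfolding CC_eq limitin_subtopology using y \<eta> by simp
      then have "limitin euclideanreal (g \<circ> (\<lambda>n. DL_embed (y n))) (g \<eta>) sequentially"
        by (rule continuous_map_limit[OF g1])
      then have "(\<lambda>n. mk x (y n)) \<longlonglongrightarrow> g \<eta>" using g(2) fX y(1) by (simp add: o_def)
      moreover have "(\<lambda>n. mk x (y n)) \<longlonglongrightarrow> boundary_kernel x \<eta>" by (rule martin_kernel_limit[OF \<eta> _ x y(2)]) (simp add: y(1))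
      ultimately show ?thesis by (rule LIMSEQ_unique)
    qed
    moreover have "g (DL_embed y) = mk x y" if "y \<in> X" for y using g(2)[OF imageI[OF that]] fX[OF that] by simp
    ultimately show ?thesis using g1 by (intro exI[of _ g]) blast
  qed
  then obtain K where "\<And>x. x \<in> X \<Longrightarrow> continuous_map CC euclideanreal (K x) \<and> (\<forall>y\<in>X. K x (DL_embed y) = mk x y) \<and> (\<forall>\<eta>\<in>boundary. K x \<eta> = boundary_kernel x \<eta>)"
    by metis
  then show ?thesis unfolding kernel_extension_def by (intro exI[of _ K]) blast
qed

end

section \<open>Separation, minimality and non-minimality\<close>

context homtree
begin

text \<open>The bounding function depends on the level only; it serves the comparison with the
  kernels at infinite \<open>k\<close> in \<open>omega_inf_not_minimal\<close>.\<close>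

lemma spherical_le:
  assumes a: "0 < a" "a < 1" "a \<noteq> 1 / 2"
  shows "\<exists>C>0. \<forall>x. spherical a p T x y \<le> C * (if 1 / 2 < a then 1 else ((1 - a) / a) powi lv x)"
proof (cases "1 / 2 < a")
  case True
  have "0 < kap ((1 - a) / a)" using True a by (intro kap_pos) auto
  then show ?thesis using True spherical_bounded[OF True a(2)] real_p by (intro exI[of _ "kap ((1 - a) / a) * (2 * real p)"]) simp
next
  case False
  then have f: "a < 1 / 2" "1 / 2 < 1 - a" using a by auto
  define b where "b = (1 - a) / a"
  have b: "0 < b" using a by (simp add: b_def)
  define C where "C = kap ((1 - (1 - a)) / (1 - a)) * (2 * real p)"
  have C: "C > 0" unfolding C_def using real_p f a by (intro mult_pos_pos kap_pos) auto
  have "spherical a p T x y \<le> C * b powi (- lv y) * b powi lv x" for x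
  proof -
    have "spherical a p T x y \<le> C * b powi (lv x - lv y)"
      unfolding spherical_lt[OF a(1) f(1)] b_def[symmetric]
      using spherical_bounded[OF f(2), of x y] a b unfolding C_def by (intro mult_right_mono) auto
    also have "b powi (lv x - lv y) = b powi (- lv y) * b powi lv x" using b by (simp add: power_int_add[symmetric])
    finally show ?thesis by (simp add: mult.assoc)
  qed
  then show ?thesis using False b C by (intro exI[of _ "C * b powi (- lv y)"]) (simp add: b_def)
qed

lemma ray_confluent:
  assumes "\<xi> \<in> proper_ends T" "clE x \<xi> < clE y \<xi>" shows "cl x y = clE x \<xi>"
proof -
  have "\<forall>\<^sub>F n in sequentially. cl x (ray (root T) \<xi> n) = clE x \<xi> \<and> cl y (ray (root T) \<xi> n) = clE y \<xi>"
    using cl_ray_eventually[OF assms(1)] by (intro eventually_conj)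
  then obtain n where n: "cl x (ray (root T) \<xi> n) = clE x \<xi>" "cl y (ray (root T) \<xi> n) = clE y \<xi>"
    using eventually_happens' sequentially_bot by blast
  then show ?thesis using cl_strict[of "ray (root T) \<xi> n" x y] assms(2) cl_commute by metis
qed

lemma cl_ray_min:
  assumes "\<xi> \<in> proper_ends T" "dstart \<xi> \<le> n"
  shows "cl x (ray (root T) \<xi> n) = min (clE x \<xi>) (lv (ray (root T) \<xi> n))"
proof -
  have "\<forall>\<^sub>F m in sequentially. cl x (ray (root T) \<xi> m) = clE x \<xi> \<and> n \<le> m"
    using cl_ray_eventually[OF assms(1)] eventually_ge_at_top by (rule eventually_conj)
  then obtain m where m: "cl x (ray (root T) \<xi> m) = clE x \<xi>" "n \<le> m"
    using eventually_happens' sequentially_bot by blast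
  have a: "anc (ray (root T) \<xi> m) (lv (ray (root T) \<xi> n)) = ray (root T) \<xi> n" "lv (ray (root T) \<xi> n) \<le> lv (ray (root T) \<xi> m)"
    using ray_anc[OF assms m(2)] by auto
  then show ?thesis using cl_anc[OF a(2), of x] m(1) cl_commute by metis
qed

end

context dl
begin

lemma embed_escapes:
  assumes "\<eta> \<in> boundary" "limitin W (\<lambda>i. DL_embed (y i)) \<eta> F" shows "\<forall>\<^sub>F i in F. y i \<noteq> x"
proof -
  have "metrizable_space W" using T1.hor_metrizable T2.hor_metrizable by (simp add: metrizable_space_prod_topology)
  then have "t1_space W" by (rule metrizable_imp_t1_space)
  moreover have "DL_embed x \<in> topspace W" by (cases x) (simp add: T1.topspace_hor T2.topspace_hor DL_embed_def)
  ultimately have "closedin W {DL_embed x}" unfolding t1_space_closedin_singleton by blast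
  then have op: "openin W (topspace W - {DL_embed x})" by (intro openin_diff openin_topspace)
  have "\<eta> \<noteq> DL_embed x" using assms(1) by (cases x) (auto simp: boundary_def DL_embed_def)
  then have "\<eta> \<in> topspace W - {DL_embed x}" using assms(1) boundary_W by blast
  then have "\<forall>\<^sub>F i in F. DL_embed (y i) \<in> topspace W - {DL_embed x}" using assms(2) op unfolding limitin_def by blast
  then show ?thesis by eventually_elim auto
qed

lemma boundary_kernel_harmonic:
  assumes "\<eta> \<in> boundary" shows "positive_harmonic X P (\<lambda>x. boundary_kernel x \<eta>)" "boundary_kernel orig \<eta> = 1"
proof -
  obtain y where y: "\<And>n. y n \<in> X" "limitin W (\<lambda>n. DL_embed (y n)) \<eta> sequentially" using approach[OF assms] by blast
  have yX: "\<forall>\<^sub>F n in sequentially. y n \<in> X" using y(1) by simp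
  note * = C.kernel_limit_harmonic[OF transient irreducible orig_X sequentially_bot yX embed_escapes[OF assms y(2)] martin_kernel_limit[OF assms yX _ y(2)]]
  show "positive_harmonic X P (\<lambda>x. boundary_kernel x \<eta>)" "boundary_kernel orig \<eta> = 1" using *(1) *(2) by blast+
qed

lemma X_fst: "\<exists>u. (v, u) \<in> X"
proof -
  obtain u where "T2.lv u = - T1.lv v" using T2.ex_far by blast
  then show ?thesis by (intro exI[of _ u]) (simp add: X_iff)
qed

lemma X_snd: "\<exists>v. (v, u) \<in> X"
proof -
  obtain v where "T1.lv v = - T2.lv u" using T1.ex_far by blast
  then show ?thesis by (intro exI[of _ v]) (simp add: X_iff)
qed

lemma end_kernel_pos: "end_kernel x \<delta> > 0"
proof -
  interpret R: tree_rw T1 q \<alpha> by unfold_locales (use \<alpha> in auto)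
  show ?thesis unfolding end_kernel_def using R.F_pos by simp
qed

lemma FmFp: "0 < tree_rw.Fm \<alpha> * tree_rw.Fp q \<alpha>" "tree_rw.Fm \<alpha> * tree_rw.Fp q \<alpha> < 1"
proof -
  interpret R: tree_rw T1 q \<alpha> by unfold_locales (use \<alpha> in auto)
  show "0 < R.Fm * R.Fp" using R.F_pos by simp
  have "real q * 1 \<le> real q * max 1 R.b" using T1.real_p by (intro mult_left_mono) auto
  then have "1 < real q * max 1 R.b" using T1.real_p by linarith
  then have "R.Fp < 1" by (simp add: R.Fp_def)
  moreover have "R.Fm \<le> 1" by (simp add: R.Fm_def)
  ultimately show "R.Fm * R.Fp < 1" using R.F_pos mult_left_le_one_le[of R.Fp R.Fm] by linarith
qed

lemma end_kernel_strict: "end_kernel x (\<delta> + 1) < end_kernel x \<delta>"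
proof -
  have "end_kernel x (\<delta> + 1) = end_kernel x \<delta> * (tree_rw.Fm \<alpha> * tree_rw.Fp q \<alpha>)"
    unfolding end_kernel_def using FmFp(1) by (simp only: power_int_add[OF disjI1[OF less_imp_neq[OF FmFp(1), symmetric]]] power_int_1_right mult.assoc)
  then show ?thesis using end_kernel_pos[of x \<delta>] FmFp by (simp add: mult_less_cancel_left2)
qed

lemma target_kernel_cong:
  assumes "T1.is_target z" "T1.lv v' = T1.lv v" "T1.target_cl z v' = T1.target_cl z v" shows "target_kernel z v' = target_kernel z v"
proof -
  from assms(1) consider y where "z = HVertex y" | \<xi> where "z = HEnd \<xi>" by (auto simp: T1.is_target_def)
  then show ?thesis
  proof cases
    case 1
    then show ?thesis using T1.spherical_cong[of v' v y] assms by (simp add: target_kernel_def)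
  next
    case 2
    then show ?thesis using assms by (simp add: target_kernel_def end_kernel_def)
  qed
qed

lemma target_kernel_strict:
  assumes "T1.is_target z" "T1.lv v' = T1.lv v" "T1.target_cl z v' = T1.target_cl z v - 1" shows "target_kernel z v' < target_kernel z v"
proof -
  from assms(1) consider y where "z = HVertex y" | \<xi> where "z = HEnd \<xi>" by (auto simp: T1.is_target_def)
  then show ?thesis
  proof cases
    case 1
    have "spherical \<alpha> q T1 v' y < spherical \<alpha> q T1 v y"
      by (rule T1.spherical_strict[OF \<alpha>]) (use assms 1 in auto)
    then show ?thesis using T1.spherical_pos[OF \<alpha>, of "root T1" y] by (simp add: target_kernel_def 1 divide_strict_right_mono)
  next
    case 2
    have c: "T1.clE (root T1) \<xi> - T1.clE v' \<xi> = (T1.clE (root T1) \<xi> - T1.clE v \<xi>) + 1" using assms(3) 2 by simp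
    have "target_kernel z v' = end_kernel v ((T1.clE (root T1) \<xi> - T1.clE v \<xi>) + 1)" unfolding 2 target_kernel_def hor_pt.case c end_kernel_def assms(2) ..
    then show ?thesis using end_kernel_strict by (simp add: target_kernel_def 2)
  qed
qed

lemma target_kernel_separates:
  assumes z: "T1.is_target z" "T1.is_target z'" "z \<noteq> z'" shows "\<exists>v. target_kernel z v \<noteq> target_kernel z' v"
proof -
  \<comment> \<open>From \<open>v\<close> to \<open>v'\<close> the kernel of \<open>z\<close> drops
    strictly while that of \<open>z'\<close> does not, so the two cannot agree at both
    vertices.\<close>
  have main: "target_kernel z v' < target_kernel z v \<and> target_kernel z' v \<le> target_kernel z' v'"
    if t: "T1.is_target z" "T1.is_target z'" and l: "T1.lv v' = T1.lv v" and c: "T1.target_cl z v = T1.lv v" "T1.target_cl z v' = T1.lv v - 1"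
      "T1.target_cl z' v = T1.lv v - 1" "T1.target_cl z' v' \<in> {T1.lv v - 1, T1.lv v}" for z z' v v'
  proof
    show "target_kernel z v' < target_kernel z v" using target_kernel_strict[OF t(1) l] c by simp
    from c(4) consider "T1.target_cl z' v' = T1.target_cl z' v" | "T1.target_cl z' v = T1.target_cl z' v' - 1" using c(3) by auto
    then show "target_kernel z' v \<le> target_kernel z' v'"
    proof cases
      case 1 then show ?thesis using target_kernel_cong[OF t(2) l] by simp
    next
      case 2 then show ?thesis using target_kernel_strict[OF t(2) l[symmetric]] by (simp add: less_imp_le)
    qed
  qed
  obtain v v' where l: "T1.lv v' = T1.lv v" and c: "(T1.target_cl z v = T1.lv v \<and> T1.target_cl z v' = T1.lv v - 1 \<and> T1.target_cl z' v = T1.lv v - 1 \<and> T1.target_cl z' v' \<in> {T1.lv v - 1, T1.lv v}) \<or>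
     (T1.target_cl z' v = T1.lv v \<and> T1.target_cl z' v' = T1.lv v - 1 \<and> T1.target_cl z v = T1.lv v - 1 \<and> T1.target_cl z v' \<in> {T1.lv v - 1, T1.lv v})"
    using T1.target_sep[OF z] by blast
  from c have "target_kernel z v \<noteq> target_kernel z' v \<or> target_kernel z v' \<noteq> target_kernel z' v'"
  proof
    assume "T1.target_cl z v = T1.lv v \<and> T1.target_cl z v' = T1.lv v - 1 \<and> T1.target_cl z' v = T1.lv v - 1 \<and> T1.target_cl z' v' \<in> {T1.lv v - 1, T1.lv v}"
    then show ?thesis using main[OF z(1,2) l] by fastforce
  next
    assume "T1.target_cl z' v = T1.lv v \<and> T1.target_cl z' v' = T1.lv v - 1 \<and> T1.target_cl z v = T1.lv v - 1 \<and> T1.target_cl z v' \<in> {T1.lv v - 1, T1.lv v}"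
    then show ?thesis using main[OF z(2,1) l] by fastforce
  qed
  then show ?thesis by blast
qed

text \<open>Kernels at \<open>Omega k\<close> depend on the level only, and kernels of the other
  tree do not see the first coordinate; neither can match a kernel that varies within a
  level.\<close>

lemma target_kernel_not_radial: assumes "T1.is_target z" shows "\<exists>v v'. T1.lv v' = T1.lv v \<and> target_kernel z v' \<noteq> target_kernel z v"
proof -
  obtain v v' where "T1.lv v' = T1.lv v" "T1.target_cl z v = T1.lv v" "T1.target_cl z v' = T1.lv v - 1" using T1.target_sibling[OF assms] by blast
  then show ?thesis using target_kernel_strict[OF assms, of v' v] by force
qed

lemma \<beta>_ne_1: "\<beta> \<noteq> 1" using \<alpha> by (simp add: \<beta>_def field_simps)

lemma sc_inj: "sc j = sc k \<Longrightarrow> j = k"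
proof -
  assume s: "sc j = sc k"
  have "real_of_int n * ln \<beta> = ln (sc n)" for n
    using \<beta>_pos by (simp add: sc_def ln_powr[symmetric] powr_real_of_int')
  then have "real_of_int j * ln \<beta> = real_of_int k * ln \<beta>" using s by metis
  moreover have "ln \<beta> \<noteq> 0" using \<beta>_pos \<beta>_ne_1 by simp
  ultimately show ?thesis by simp
qed

text \<open>One vertex at level 1 suffices: with \<open>s = \<beta> powi k\<close> the value is
  \<open>(s + \<beta>) / (s + 1)\<close>, which is injective in \<open>s\<close> and never equal to
  its limits 1 and \<open>\<beta>\<close>, since \<open>\<beta> \<noteq> 1\<close>.\<close>

lemma omega_kernel_separates: assumes "k \<noteq> l" shows "\<exists>v. omega_kernel k v \<noteq> omega_kernel l v"
proof -
  obtain v where v: "T1.lv v = 1" using T1.ex_far by blast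
  have sv: "sc (T1.lv v) = \<beta>" by (simp add: v sc_def)
  have f: "(s + \<beta>) / (s + 1) = 1 + (\<beta> - 1) / (s + 1)" "(s + \<beta>) / (s + 1) = \<beta> + s * (1 - \<beta>) / (s + 1)" if "s > 0" for s :: real
    using that by (simp_all add: field_simps)
  have F1: "omega_kernel (Fin j) v \<noteq> 1" for j
    using f(1)[OF sc_pos[of j]] sc_pos[of j] \<beta>_ne_1 by (simp add: omega_kernel_def sv)
  have F2: "omega_kernel (Fin j) v \<noteq> \<beta>" for j
    using f(2)[OF sc_pos[of j]] sc_pos[of j] \<beta>_ne_1 by (simp add: omega_kernel_def sv)
  have F3: "omega_kernel (Fin i) v \<noteq> omega_kernel (Fin j) v" if "i \<noteq> j" for i j
  proof
    assume "omega_kernel (Fin i) v = omega_kernel (Fin j) v"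
    then have "(\<beta> - 1) / (sc i + 1) = (\<beta> - 1) / (sc j + 1)" using f(1)[OF sc_pos[of i]] f(1)[OF sc_pos[of j]] by (simp add: omega_kernel_def sv)
    then have "sc i + 1 = sc j + 1" using \<beta>_ne_1 by simp
    then show False using sc_inj[of i j] that by simp
  qed
  have PM: "omega_kernel Pinf v \<in> {1, \<beta>}" "omega_kernel Minf v \<in> {1, \<beta>}" "omega_kernel Pinf v \<noteq> omega_kernel Minf v" using \<beta>_ne_1 by (auto simp: omega_kernel_def sv)
  have "omega_kernel k v \<noteq> omega_kernel l v"
    using assms F1 F2 F3 PM by (cases k; cases l) (auto, metis+)
  then show ?thesis by blast
qed

lemma boundary_kernel_separates:
  assumes e: "\<eta> \<in> boundary" "\<eta>' \<in> boundary" "\<eta> \<noteq> \<eta>'" shows "\<exists>x\<in>X. boundary_kernel x \<eta> \<noteq> boundary_kernel x \<eta>'"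
proof -
  interpret S: dl T2 T1 r q "1 - \<alpha>" by unfold_locales (use \<alpha> in auto)
  have A: "\<exists>x\<in>X. f (fst x) \<noteq> g (fst x)" if "f v \<noteq> g v" for f g :: "'a \<Rightarrow> real" and v using X_fst[of v] that by force
  have B: "\<exists>x\<in>X. f (snd x) \<noteq> g (snd x)" if "f v \<noteq> g v" for f g :: "'b \<Rightarrow> real" and v using X_snd[of v] that by force
  have 12: "\<exists>x\<in>X. target_kernel z (fst x) \<noteq> target_kernel2 z' (snd x)" if "T1.is_target z" for z z'
  proof -
    obtain v v' where v: "T1.lv v' = T1.lv v" "target_kernel z v' \<noteq> target_kernel z v" using target_kernel_not_radial[OF \<open>T1.is_target z\<close>] by blast
    obtain u where "(v, u) \<in> X" using X_fst by blast
    moreover from this have "(v', u) \<in> X" using v by (simp add: X_iff)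
    ultimately show ?thesis using v(2) by (metis fst_conv snd_conv)
  qed
  have 13: "\<exists>x\<in>X. target_kernel z (fst x) \<noteq> omega_kernel k (fst x)" if "T1.is_target z" for z k
  proof -
    obtain v v' where v: "T1.lv v' = T1.lv v" "target_kernel z v' \<noteq> target_kernel z v" using target_kernel_not_radial[OF \<open>T1.is_target z\<close>] by blast
    have "omega_kernel k v' = omega_kernel k v" unfolding omega_kernel_def v(1) ..
    then show ?thesis using A[of "target_kernel z" v "omega_kernel k"] A[of "target_kernel z" v' "omega_kernel k"] v(2) by metis
  qed
  have 23: "\<exists>x\<in>X. target_kernel2 z (snd x) \<noteq> omega_kernel k (fst x)" if "T2.is_target z" for z k
  proof -
    obtain v v' where v: "T2.lv v' = T2.lv v" "target_kernel2 z v' \<noteq> target_kernel2 z v" using S.target_kernel_not_radial[OF \<open>T2.is_target z\<close>] by blast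
    obtain u where "(u, v) \<in> X" using X_snd by blast
    moreover from this have "(u, v') \<in> X" using v by (simp add: X_iff)
    ultimately show ?thesis using v(2) by (metis fst_conv snd_conv)
  qed
  have O: "\<exists>x\<in>X. omega_kernel k (fst x) \<noteq> omega_kernel l (fst x)" if "k \<noteq> l" for k l using omega_kernel_separates[OF that] A by metis
  show ?thesis
    using e(1)
  proof (cases rule: boundary_cases)
    case z: (1 z)
    show ?thesis using e(2)
    proof (cases rule: boundary_cases)
      case (1 z')
      then have "z \<noteq> z'" using e(3) z by auto
      then show ?thesis using target_kernel_separates[OF z(1) 1(1)] A unfolding z(2) 1(2) boundary_kernel_simps(1)[OF z(1)] boundary_kernel_simps(1)[OF 1(1)] by metis
    next
      case (2 z')
      show ?thesis unfolding z(2) 2(2) boundary_kernel_simps(1)[OF z(1)] boundary_kernel_simps(2)[OF 2(1)] by (rule 12[OF z(1)])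
    next
      case (3 k)
      show ?thesis unfolding z(2) 3 boundary_kernel_simps(1)[OF z(1)] boundary_kernel_simps(3) by (rule 13[OF z(1)])
    qed
  next
    case z: (2 z)
    show ?thesis using e(2)
    proof (cases rule: boundary_cases)
      case (1 z')
      show ?thesis unfolding z(2) 1(2) boundary_kernel_simps(1)[OF 1(1)] boundary_kernel_simps(2)[OF z(1)] using 12[OF 1(1), of z] by metis
    next
      case (2 z')
      then have "z \<noteq> z'" using e(3) z by auto
      then show ?thesis using S.target_kernel_separates[OF z(1) 2(1)] B unfolding z(2) 2(2) boundary_kernel_simps(2)[OF z(1)] boundary_kernel_simps(2)[OF 2(1)] by metis
    next
      case (3 k)
      show ?thesis unfolding z(2) 3 boundary_kernel_simps(2)[OF z(1)] boundary_kernel_simps(3) by (rule 23[OF z(1)])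
    qed
  next
    case z: (3 k)
    show ?thesis using e(2)
    proof (cases rule: boundary_cases)
      case (1 z')
      show ?thesis unfolding z 1(2) boundary_kernel_simps(1)[OF 1(1)] boundary_kernel_simps(3) using 13[OF 1(1), of k] by metis
    next
      case (2 z')
      show ?thesis unfolding z 2(2) boundary_kernel_simps(2)[OF 2(1)] boundary_kernel_simps(3) using 23[OF 2(1), of k] by metis
    next
      case (3 l)
      then have "k \<noteq> l" using e(3) z by auto
      then show ?thesis unfolding z 3 boundary_kernel_simps(3) by (rule O)
    qed
  qed
qed

section \<open>Non-minimal kernels\<close>

lemma boundary_kernel_not_minimalI:
  assumes e: "\<eta> \<in> boundary" "\<eta>' \<in> boundary" "\<eta> \<noteq> \<eta>'" and c: "c > 0" "\<And>x. x \<in> X \<Longrightarrow> c * boundary_kernel x \<eta>' \<le> boundary_kernel x \<eta>"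
  shows "\<not> minimal_harmonic X P orig (\<lambda>x. boundary_kernel x \<eta>)"
proof -
  obtain x where x: "x \<in> X" "boundary_kernel x \<eta> \<noteq> boundary_kernel x \<eta>'" using boundary_kernel_separates[OF e] by blast
  show ?thesis by (rule C.not_minimalI[OF boundary_kernel_harmonic(2)[OF e(1)] boundary_kernel_harmonic[OF e(2)] orig_X c x])
qed

text \<open>Boundary points approached by sequences at bounded distance have comparable kernels.\<close>

lemma boundary_kernel_not_minimal_near:
  assumes e: "\<eta> \<in> boundary" "\<eta>' \<in> boundary" "\<eta> \<noteq> \<eta>'" and y: "\<And>n. y n \<in> X" "limitin W (\<lambda>n. DL_embed (y n)) \<eta> sequentially"
    and y': "\<And>n. step (y n) (y' n) \<and> step (y' n) (y n)" "limitin W (\<lambda>n. DL_embed (y' n)) \<eta>' sequentially"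
  shows "\<not> minimal_harmonic X P orig (\<lambda>x. boundary_kernel x \<eta>)"
proof -
  define c where "c = min (\<alpha> / real q) ((1 - \<alpha>) / real r)"
  have c: "c > 0" using \<alpha> qr by (simp add: c_def)
  have Pc: "c \<le> P u v" if "P u v > 0" for u v
    using that by (cases u; cases v) (auto simp: P_eq c_def split: if_splits)
  have near: "y n \<in> X \<and> y' n \<in> X \<and> c \<le> P (y n) (y' n) \<and> c \<le> P (y' n) (y n)" for n
    using y'(1)[of n] Pc unfolding step_def by blast
  show ?thesis
  proof (rule boundary_kernel_not_minimalI[OF e])
    show "c\<^sup>2 > 0" using c by simp
    fix x assume x: "x \<in> X"
    show "c\<^sup>2 * boundary_kernel x \<eta>' \<le> boundary_kernel x \<eta>"
      by (rule C.kernel_limit_compare[OF transient irreducible orig_X x sequentially_bot _ c martin_kernel_limit[OF e(1) _ x y(2)] martin_kernel_limit[OF e(2) _ x y'(2)]])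
        (use near in auto)
  qed
qed

lemma lim_par_vertex1:
  "limitin (hor_topology q T1) (\<lambda>i. HVertex (t i)) (HVertex v) F \<Longrightarrow> limitin (hor_topology q T1) (\<lambda>i. HVertex (T1.par (t i))) (HVertex (T1.par v)) F"
  using T1.lim_HVertex[of "\<lambda>i. HVertex (t i)" v F]
  by (intro limitin_eventually) (auto simp: T1.topspace_hor elim: eventually_mono)

lemma lim_par_vertex2:
  "limitin (hor_topology r T2) (\<lambda>i. HVertex (t i)) (HVertex v) F \<Longrightarrow> limitin (hor_topology r T2) (\<lambda>i. HVertex (T2.par (t i))) (HVertex (T2.par v)) F"
  using T2.lim_HVertex[of "\<lambda>i. HVertex (t i)" v F]
  by (intro limitin_eventually) (auto simp: T2.topspace_hor elim: eventually_mono)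

lemma child_choice1: "\<exists>c. \<forall>x. T1.par (c x) = x" using T1.ex_child_not by (intro choice allI) blast
lemma child_choice2: "\<exists>c. \<forall>x. T2.par (c x) = x" using T2.ex_child_not by (intro choice allI) blast

lemma boundary_HVertex1: "(HVertex y, Omega (Fin (- T1.lv y))) \<in> boundary"
  unfolding boundary_eq by (auto simp: T1.hor_eq)

lemma boundary_HVertex2: "(Omega (Fin (- T2.lv y)), HVertex y) \<in> boundary"
  unfolding boundary_eq by (auto simp: T2.hor_eq)

lemma boundary_Omega: "(Omega k, Omega (- k)) \<in> boundary"
  unfolding boundary_def by blast

lemma boundary_Omega_Fin: "(Omega (Fin k), Omega (Fin (- k))) \<in> boundary"
  using boundary_Omega[of "Fin k"] by simp

lemma vertex1_not_minimal: "\<not> minimal_harmonic X P orig (\<lambda>x. boundary_kernel x (HVertex v, Omega (Fin (- T1.lv v))))"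
proof -
  obtain y where y: "\<And>n. y n \<in> X" "limitin W (\<lambda>n. DL_embed (y n)) (HVertex v, Omega (Fin (- T1.lv v))) sequentially"
    using approach[OF boundary_HVertex1] by blast
  obtain c where c: "\<And>x. T2.par (c x) = x" using child_choice2 by blast
  \<comment> \<open>The neighbours step to the parent in the first tree and to a child in the
    second, so the limit point moves from \<open>v\<close> to \<open>T1.par v\<close>.\<close>
  define y' where "y' n = (T1.par (fst (y n)), c (snd (y n)))" for n
  have "limitin W (\<lambda>n. DL_embed (y' n)) (HVertex (T1.par v), Omega (Fin (- T1.lv (T1.par v)))) sequentially"
    unfolding embed_lim y'_def fst_conv snd_conv
  proof
    show "limitin (hor_topology q T1) (\<lambda>n. HVertex (T1.par (fst (y n)))) (HVertex (T1.par v)) sequentially"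
      using y(2) unfolding embed_lim by (intro lim_par_vertex1) simp
    have "limitin (hor_topology r T2) (\<lambda>n. HVertex (c (snd (y n)))) (Omega (Fin (- T1.lv v + 1))) sequentially"
      using y(2) unfolding embed_lim by (intro T2.lim_Omega_child c) simp
    then show "limitin (hor_topology r T2) (\<lambda>n. HVertex (c (snd (y n)))) (Omega (Fin (- T1.lv (T1.par v)))) sequentially"
      by (simp add: add.commute)
  qed
  moreover have "step (y n) (y' n) \<and> step (y' n) (y n)" for n
    using step_down[OF c, of "fst (y n)" "snd (y n)"] y(1)[of n] by (simp add: y'_def)
  moreover have "T1.par v \<noteq> v" using T1.lv_par[of v] by force
  ultimately show ?thesis using y by (intro boundary_kernel_not_minimal_near[OF boundary_HVertex1 boundary_HVertex1[of "T1.par v"]]) auto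
qed

lemma vertex2_not_minimal: "\<not> minimal_harmonic X P orig (\<lambda>x. boundary_kernel x (Omega (Fin (- T2.lv v)), HVertex v))"
proof -
  obtain y where y: "\<And>n. y n \<in> X" "limitin W (\<lambda>n. DL_embed (y n)) (Omega (Fin (- T2.lv v)), HVertex v) sequentially"
    using approach[OF boundary_HVertex2] by blast
  obtain c where c: "\<And>x. T1.par (c x) = x" using child_choice1 by blast
  define y' where "y' n = (c (fst (y n)), T2.par (snd (y n)))" for n
  have "limitin W (\<lambda>n. DL_embed (y' n)) (Omega (Fin (- T2.lv (T2.par v))), HVertex (T2.par v)) sequentially"
    unfolding embed_lim y'_def fst_conv snd_conv
  proof
    show "limitin (hor_topology r T2) (\<lambda>n. HVertex (T2.par (snd (y n)))) (HVertex (T2.par v)) sequentially"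
      using y(2) unfolding embed_lim by (intro lim_par_vertex2) simp
    have "limitin (hor_topology q T1) (\<lambda>n. HVertex (c (fst (y n)))) (Omega (Fin (- T2.lv v + 1))) sequentially"
      using y(2) unfolding embed_lim by (intro T1.lim_Omega_child c) simp
    then show "limitin (hor_topology q T1) (\<lambda>n. HVertex (c (fst (y n)))) (Omega (Fin (- T2.lv (T2.par v)))) sequentially"
      by (simp add: add.commute)
  qed
  moreover have "step (y n) (y' n) \<and> step (y' n) (y n)" for n
    using step_up[OF c, of "fst (y n)" "snd (y n)"] y(1)[of n] by (simp add: y'_def)
  moreover have "T2.par v \<noteq> v" using T2.lv_par[of v] by force
  ultimately show ?thesis using y by (intro boundary_kernel_not_minimal_near[OF boundary_HVertex2 boundary_HVertex2[of "T2.par v"]]) auto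
qed

lemma omega_fin_not_minimal: "\<not> minimal_harmonic X P orig (\<lambda>x. boundary_kernel x (Omega (Fin k), Omega (Fin (- k))))"
proof -
  obtain y where y: "\<And>n. y n \<in> X" "limitin W (\<lambda>n. DL_embed (y n)) (Omega (Fin k), Omega (Fin (- k))) sequentially"
    using approach[OF boundary_Omega_Fin] by blast
  obtain c where c: "\<And>x. T1.par (c x) = x" using child_choice1 by blast
  define y' where "y' n = (c (fst (y n)), T2.par (snd (y n)))" for n
  have "limitin W (\<lambda>n. DL_embed (y' n)) (Omega (Fin (k + 1)), Omega (Fin (- (k + 1)))) sequentially"
    unfolding embed_lim y'_def fst_conv snd_conv
  proof
    have "limitin (hor_topology r T2) (\<lambda>n. HVertex (T2.par (snd (y n)))) (Omega (Fin (- k - 1))) sequentially"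
      using y(2) unfolding embed_lim by (intro T2.lim_Omega_par) simp
    then show "limitin (hor_topology r T2) (\<lambda>n. HVertex (T2.par (snd (y n)))) (Omega (Fin (- (k + 1)))) sequentially" by simp
    show "limitin (hor_topology q T1) (\<lambda>n. HVertex (c (fst (y n)))) (Omega (Fin (k + 1))) sequentially"
      using y(2) unfolding embed_lim by (intro T1.lim_Omega_child c) simp
  qed
  moreover have "step (y n) (y' n) \<and> step (y' n) (y n)" for n
    using step_up[OF c, of "fst (y n)" "snd (y n)"] y(1)[of n] by (simp add: y'_def)
  ultimately show ?thesis using y by (intro boundary_kernel_not_minimal_near[OF boundary_Omega_Fin boundary_Omega_Fin[of "k + 1"]]) auto
qed

text \<open>At infinite \<open>k\<close> a bounded shift of the level does not change the limit
  point, so neighbouring sequences would compare the kernel only with itself. Instead a multiple of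
  the spherical kernel at the root of one of the trees is placed below it.\<close>

lemma omega_inf_not_minimal:
  assumes k: "k = Pinf \<or> k = Minf" shows "\<not> minimal_harmonic X P orig (\<lambda>x. boundary_kernel x (Omega k, Omega (- k)))"
proof -
  interpret S: dl T2 T1 r q "1 - \<alpha>" by unfold_locales (use \<alpha> in auto)
  let ?g1 = "\<lambda>x. if 1 / 2 < \<alpha> then 1 else ((1 - \<alpha>) / \<alpha>) powi T1.lv x"
  let ?g2 = "\<lambda>x. if 1 / 2 < 1 - \<alpha> then 1 else ((1 - (1 - \<alpha>)) / (1 - \<alpha>)) powi T2.lv x"
  define v1 v2 where "v1 = root T1" and "v2 = root T2"
  obtain C1 where C1: "C1 > 0" "\<And>x. spherical \<alpha> q T1 x v1 \<le> C1 * ?g1 x" using T1.spherical_le[OF \<alpha>] by blast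
  obtain C2 where C2: "C2 > 0" "\<And>x. spherical (1 - \<alpha>) r T2 x v2 \<le> C2 * ?g2 x" using T2.spherical_le[OF S.\<alpha>] by blast
  define s1 s2 where "s1 = spherical \<alpha> q T1 (root T1) v1" and "s2 = spherical (1 - \<alpha>) r T2 (root T2) v2"
  have s: "s1 > 0" "s2 > 0" using T1.spherical_pos[OF \<alpha>] T2.spherical_pos[OF S.\<alpha>] by (simp_all add: s1_def s2_def)
  have t: "T1.is_target (HVertex v1)" "T2.is_target (HVertex v2)" by (simp_all add: T1.is_target_def T2.is_target_def)
  have K1: "(s1 / C1) * boundary_kernel x (HVertex v1, Omega (Fin (- T1.lv v1))) \<le> ?g1 (fst x)" for x
    unfolding boundary_kernel_simps(1)[OF t(1)] target_kernel_def hor_pt.case s1_def[symmetric] using C1(2)[of "fst x"] C1(1) s(1)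
    by (simp add: divide_le_eq mult.commute)
  have K2: "(s2 / C2) * boundary_kernel x (Omega (Fin (- T2.lv v2)), HVertex v2) \<le> ?g2 (snd x)" for x
    unfolding boundary_kernel_simps(2)[OF t(2)] S.target_kernel_def hor_pt.case s2_def[symmetric] using C2(2)[of "snd x"] C2(1) s(2)
    by (simp add: divide_le_eq mult.commute)
  have g1: "?g1 (fst x) = (if 1 / 2 < \<alpha> then 1 else sc (T1.lv (fst x)))" for x by (simp add: sc_def \<beta>_def)
  have g2: "?g2 (snd x) = (if 1 / 2 < \<alpha> then sc (T1.lv (fst x)) else 1)" if "x \<in> X" for x
  proof (cases "1 / 2 < \<alpha>")
    case True
    have "(\<alpha> / (1 - \<alpha>)) powi (- n) = sc n" for n
    proof -
      have "\<alpha> / (1 - \<alpha>) = inverse \<beta>" by (simp add: \<beta>_def)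
      then show ?thesis unfolding sc_def by (simp add: power_int_minus power_int_inverse)
    qed
    then show ?thesis using True X_lv[OF that] by simp
  qed (use \<alpha> in auto)
  \<comment> \<open>Which of the two bounds is the kernel in question depends on the sign of
    \<open>k\<close> and on the side of 1/2 on which \<open>\<alpha>\<close> lies.\<close>
  have "(\<forall>x\<in>X. omega_kernel k (fst x) = (if 1 / 2 < \<alpha> then 1 else sc (T1.lv (fst x)))) \<or> (\<forall>x\<in>X. omega_kernel k (fst x) = (if 1 / 2 < \<alpha> then sc (T1.lv (fst x)) else 1))"
    using k by (cases "1 / 2 < \<alpha>") (auto simp: omega_kernel_def)
  then have "(\<forall>x\<in>X. omega_kernel k (fst x) = ?g1 (fst x)) \<or> (\<forall>x\<in>X. omega_kernel k (fst x) = ?g2 (snd x))"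
    using g1 g2 by metis
  then show ?thesis
  proof
    assume kk: "\<forall>x\<in>X. omega_kernel k (fst x) = ?g1 (fst x)"
    have le: "(s1 / C1) * boundary_kernel x (HVertex v1, Omega (Fin (- T1.lv v1))) \<le> boundary_kernel x (Omega k, Omega (- k))" if "x \<in> X" for x
      unfolding boundary_kernel_simps(3) bspec[OF kk that] by (rule K1)
    show ?thesis
    proof (rule boundary_kernel_not_minimalI[OF boundary_Omega boundary_HVertex1[of v1] _ _ le])
      show "s1 / C1 > 0" using s C1(1) by simp
    qed auto
  next
    assume kk: "\<forall>x\<in>X. omega_kernel k (fst x) = ?g2 (snd x)"
    have le: "(s2 / C2) * boundary_kernel x (Omega (Fin (- T2.lv v2)), HVertex v2) \<le> boundary_kernel x (Omega k, Omega (- k))" if "x \<in> X" for x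
      unfolding boundary_kernel_simps(3) bspec[OF kk that] by (rule K2)
    show ?thesis
    proof (rule boundary_kernel_not_minimalI[OF boundary_Omega boundary_HVertex2[of v2] _ _ le])
      show "s2 / C2 > 0" using s C2(1) by simp
    qed auto
  qed
qed

section \<open>Minimality of the kernels at proper ends\<close>

lemma proj_sum:
  assumes "x \<in> X"
  shows "(\<Sum>z\<in>C.nb x. P x z * f (fst z)) = \<alpha> / real q * (\<Sum>z | T1.par z = fst x. f z) + (1 - \<alpha>) * f (T1.par (fst x))"
proof -
  obtain x1 x2 where x: "x = (x1, x2)" by (cases x)
  have "(x1, x2) \<in> X" using assms x by simp
  then show ?thesis using T2.card_children[of x2] qr unfolding x by (simp add: sum_nb)
qed

text \<open>For \<open>h \<le> \<kappa>\<close> consider \<open>min h \<psi>\<close>, where \<open>\<psi>\<close> is the tree Martin kernel of the \<open>n\<close>-th vertex \<open>v n\<close> on the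
  ray to \<open>\<xi>\<close>. It is a potential whose charge lies on points below \<open>v n\<close>, where \<open>mk x\<close> is close to \<open>\<kappa> x\<close>.\<close>

lemma end_minimal:
  assumes \<xi>: "\<xi> \<in> proper_ends T1"
  shows "minimal_harmonic X P orig (\<lambda>x. boundary_kernel x (HEnd \<xi>, Omega Minf))"
proof -
  interpret R: tree_rw T1 q \<alpha> by unfold_locales (use \<alpha> in auto)
  define \<kappa> where "\<kappa> x = end_kernel (fst x) (T1.clE (root T1) \<xi> - T1.clE (fst x) \<xi>)" for x :: "'a \<times> 'b"
  have tgt: "T1.is_target (HEnd \<xi>)" using \<xi> by (simp add: T1.is_target_def)
  have boundary_kernel: "boundary_kernel x (HEnd \<xi>, Omega Minf) = \<kappa> x" for x by (simp add: boundary_kernel_simps(1)[OF tgt] target_kernel_def \<kappa>_def)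
  have boundary: "(HEnd \<xi>, Omega Minf) \<in> boundary" using \<xi> unfolding boundary_eq by blast
  have "\<exists>c. \<forall>x\<in>X. h x = c * \<kappa> x" if h: "positive_harmonic X P h" and le: "\<And>x. x \<in> X \<Longrightarrow> h x \<le> \<kappa> x" for h
  proof -
    define v where "v n = T1.ray (root T1) \<xi> n" for n
    have hh: "(\<Sum>z\<in>C.nb x. P x z * h z) = h x" "h x > 0" if "x \<in> X" for x
      using h that by (auto simp: positive_harmonic_def C.harmonic_iff)
    have lvv: "\<forall>\<^sub>F n in sequentially. l \<le> T1.lv (v n)" for l unfolding v_def by (rule T1.ray_lv_large[OF \<xi>])
    have vmono: "T1.lv (v m) \<le> T1.lv (v n)" if "T1.dstart \<xi> \<le> m" "m \<le> n" for m n
      using T1.ray_anc[OF \<xi> that] by (simp add: v_def)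
    \<comment> \<open>For \<open>n\<close> beyond \<open>T1.dstart \<xi>\<close> these are the
      points whose first coordinate is \<open>v n\<close> or a descendant of it.\<close>
    define S where "S n = {y \<in> X. T1.lv (v n) \<le> T1.clE (fst y) \<xi>}" for n
    \<comment> \<open>A sequence of counterexamples would tend to \<open>\<xi>\<close> in the sense
      required by \<open>lim_end1\<close>. The uniformity in \<open>y\<close> is what the estimate
      of ratios of potentials needs.\<close>
    have near: "\<exists>N. \<forall>n\<ge>N. \<forall>y\<in>S n. \<bar>mk x y - \<kappa> x\<bar> \<le> \<epsilon>" if x: "x \<in> X" and e: "\<epsilon> > 0" for x \<epsilon>
    proof (rule ccontr)
      assume "\<not> ?thesis"
      then have "\<forall>N. \<exists>y. \<exists>n\<ge>N. y \<in> S n \<and> \<bar>mk x y - \<kappa> x\<bar> > \<epsilon>" by (meson not_le)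
      then obtain y where y: "\<And>N. \<exists>n\<ge>N. y N \<in> S n \<and> \<bar>mk x (y N) - \<kappa> x\<bar> > \<epsilon>" by metis
      have yX: "y N \<in> X" for N using y[of N] by (auto simp: S_def)
      have yc: "\<forall>\<^sub>F N in sequentially. l \<le> T1.clE (fst (y N)) \<xi>" for l
        using lvv[of l] eventually_ge_at_top[of "T1.dstart \<xi>"]
      proof eventually_elim
        case (elim N)
        obtain n where "n \<ge> N" "y N \<in> S n" using y by blast
        then show ?case using vmono[of N n] elim by (auto simp: S_def)
      qed
      have c: "\<forall>\<^sub>F N in sequentially. T1.cl u (fst (y N)) = T1.clE u \<xi>" for u
        using yc[of "T1.clE u \<xi> + 1"]
      proof eventually_elim
        case (elim N)
        then show ?case using T1.ray_confluent[OF \<xi>, of u "fst (y N)"] by simp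
      qed
      have l: "\<forall>\<^sub>F N in sequentially. c \<le> T1.lv (fst (y N))" for c
        using yc[of c]
      proof eventually_elim
        case (elim N)
        then show ?case using T1.target_cl_le[OF tgt, of "fst (y N)"] by simp
      qed
      have b: "\<forall>\<^sub>F N in sequentially. T2.cl (root T2) (snd (y N)) \<le> c" for c
        using l[of "- c"]
      proof eventually_elim
        case (elim N)
        then show ?case using T2.cl_le2[of "root T2" "snd (y N)"] X_lv[OF yX[of N]] by simp
      qed
      have "(\<lambda>N. mk x (y N)) \<longlonglongrightarrow> \<kappa> x"
        unfolding \<kappa>_def by (rule lim_end1[OF _ x c c b l]) (simp add: yX)
      then have "\<forall>\<^sub>F N in sequentially. dist (mk x (y N)) (\<kappa> x) < \<epsilon>" using e by (rule tendstoD)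
      from eventually_happens'[OF sequentially_bot this] obtain N where "dist (mk x (y N)) (\<kappa> x) < \<epsilon>" by blast
      then show False using y[of N] by (auto simp: dist_real_def)
    qed
    have est: "\<bar>h x - \<kappa> x * h orig\<bar> \<le> \<epsilon> * h orig" if x: "x \<in> X" and e: "\<epsilon> > 0" for x \<epsilon>
    proof -
      obtain N where N: "\<And>n y. n \<ge> N \<Longrightarrow> y \<in> S n \<Longrightarrow> \<bar>mk x y - \<kappa> x\<bar> \<le> \<epsilon>" using near[OF x e] by blast
      have "\<forall>\<^sub>F n in sequentially. (N \<le> n \<and> T1.dstart \<xi> \<le> n) \<and> T1.clE (fst x) \<xi> \<le> T1.lv (v n) \<and> T1.clE (root T1) \<xi> \<le> T1.lv (v n)"
        using lvv eventually_ge_at_top by (intro eventually_conj)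
      then obtain n where n: "N \<le> n" "T1.dstart \<xi> \<le> n" "T1.clE (fst x) \<xi> \<le> T1.lv (v n)" "T1.clE (root T1) \<xi> \<le> T1.lv (v n)"
        using eventually_happens' sequentially_bot by blast
      have cm: "T1.cl u (v n) = min (T1.clE u \<xi>) (T1.lv (v n))" for u unfolding v_def by (rule T1.cl_ray_min[OF \<xi> n(2)])
      define \<psi> where "\<psi> z = R.\<phi> (fst z) (v n) / R.\<phi> (root T1) (v n)" for z :: "'a \<times> 'b"
      have \<psi>: "\<psi> z = end_kernel (fst z) (T1.clE (root T1) \<xi> - min (T1.clE (fst z) \<xi>) (T1.lv (v n)))" for z
        unfolding \<psi>_def R.\<phi>_ratio end_kernel_def cm using n(4) by simp
      \<comment> \<open>As long as the confluent with \<open>\<xi>\<close> is not beyond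
        \<open>v n\<close>, the tree kernel at \<open>v n\<close> already has the value of the end
        kernel.\<close>
      have \<psi>_eq: "\<psi> z = \<kappa> z" if "T1.clE (fst z) \<xi> \<le> T1.lv (v n)" for z using that by (simp add: \<psi> \<kappa>_def)
      have \<phi>0: "R.\<phi> (root T1) (v n) > 0" unfolding R.\<phi>_def using R.F_pos by simp
      have \<psi>_super: "(\<Sum>z\<in>C.nb y. P y z * \<psi> z) \<le> \<psi> y" if y: "y \<in> X" for y
      proof -
        define f where "f z = R.\<phi> z (v n) / R.\<phi> (root T1) (v n)" for z
        have "(\<Sum>z\<in>R.C.nb (fst y). R.P (fst y) z * (R.cG * R.\<phi> z (v n))) \<le> R.cG * R.\<phi> (fst y) (v n)"
          using R.\<phi>_rec[of "fst y" "v n"] by (auto split: if_splits)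
        then have "R.cG * (\<Sum>z\<in>R.C.nb (fst y). R.P (fst y) z * R.\<phi> z (v n)) \<le> R.cG * R.\<phi> (fst y) (v n)"
          by (simp add: sum_distrib_left mult.left_commute)
        then have "(\<Sum>z\<in>R.C.nb (fst y). R.P (fst y) z * R.\<phi> z (v n)) \<le> R.\<phi> (fst y) (v n)"
          using R.cG_pos by simp
        then have "(\<Sum>z\<in>R.C.nb (fst y). R.P (fst y) z * R.\<phi> z (v n)) / R.\<phi> (root T1) (v n) \<le> f (fst y)"
          unfolding f_def using \<phi>0 by (intro divide_right_mono) auto
        then have "(\<Sum>z\<in>R.C.nb (fst y). R.P (fst y) z * f z) \<le> f (fst y)"
          unfolding sum_divide_distrib f_def by simp
        moreover have "(\<Sum>z\<in>C.nb y. P y z * \<psi> z) = (\<Sum>z\<in>R.C.nb (fst y). R.P (fst y) z * f z)"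
          unfolding \<psi>_def f_def[symmetric] proj_sum[OF y] R.sum_nb ..
        ultimately show ?thesis by (simp add: \<psi>_def f_def)
      qed
      \<comment> \<open>The minimum with \<open>\<psi>\<close> is bounded by a multiple of
        \<open>w\<close>, which no positive harmonic function is; only this makes the Riesz
        decomposition applicable.\<close>
      define u where "u z = min (h z) (\<psi> z)" for z
      have \<psi>_pos: "\<psi> z > 0" for z unfolding \<psi> by (rule end_kernel_pos)
      have u_h: "u z = h z" if "z \<in> X" "T1.clE (fst z) \<xi> \<le> T1.lv (v n)" for z
        using le[OF that(1)] \<psi>_eq[OF that(2)] by (simp add: u_def)
      define Cn where "Cn = sqrt \<beta> powi (- T1.lv (v n)) / R.\<phi> (root T1) (v n)"
      have b: "\<bar>u x - \<kappa> x * u orig\<bar> \<le> \<epsilon> * u orig"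
      proof (rule C.potential_ratio[OF transient w_sum rho])
        show "0 \<le> Cn" unfolding Cn_def using \<phi>0 \<beta>_pos by simp
        show "0 \<le> u z" if "z \<in> X" for z using hh(2)[OF that] \<psi>_pos[of z] by (simp add: u_def)
        show "u z \<le> Cn * w z" if "z \<in> X" for z
        proof -
          have "R.\<phi> (fst z) (v n) \<le> sqrt R.b powi (- T1.lv (v n)) * R.w (fst z)" using R.\<phi>_bound[of "fst z" "v n"] by simp
          then have "\<psi> z \<le> sqrt R.b powi (- T1.lv (v n)) * R.w (fst z) / R.\<phi> (root T1) (v n)"
            unfolding \<psi>_def using \<phi>0 by (intro divide_right_mono) auto
          also have "\<dots> = Cn * w z" by (simp add: Cn_def w_def R.w_def R.b_def \<beta>_def)
          finally show ?thesis by (simp add: u_def)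
        qed
        have Pn: "0 \<le> P y z" if "y \<in> X" "z \<in> C.nb y" for y z using C.P_nb_pos[OF that] by simp
        show "(\<Sum>z\<in>C.nb y. P y z * u z) \<le> u y" if y: "y \<in> X" for y
        proof -
          have "(\<Sum>z\<in>C.nb y. P y z * u z) \<le> (\<Sum>z\<in>C.nb y. P y z * h z)" "(\<Sum>z\<in>C.nb y. P y z * u z) \<le> (\<Sum>z\<in>C.nb y. P y z * \<psi> z)"
            using Pn[OF y] by (auto intro!: sum_mono mult_left_mono simp: u_def)
          then show ?thesis using hh(1)[OF y] \<psi>_super[OF y] by (simp add: u_def)
        qed
        show "x \<in> X" "orig \<in> X" using x orig_X by auto
        fix y assume y: "y \<in> X" and ne: "(\<Sum>z\<in>C.nb y. P y z * u z) \<noteq> u y"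
        \<comment> \<open>At all other points \<open>u = h\<close> holds at \<open>y\<close> and at
          its neighbours, as one step raises the confluent level by at most 1; there
          \<open>u\<close> is harmonic and carries no charge.\<close>
        have "T1.lv (v n) \<le> T1.clE (fst y) \<xi>"
        proof (rule ccontr)
          assume "\<not> ?thesis"
          then have lt: "T1.clE (fst y) \<xi> < T1.lv (v n)" by simp
          have "u z = h z" if z: "z \<in> C.nb y" for z
          proof (rule u_h)
            show zX: "z \<in> X" using C.nb_X[OF z] .
            have "P y z > 0" using C.P_nb_pos[OF y z] .
            then have "T1.par (fst z) = fst y \<or> fst z = T1.par (fst y)"
              by (cases y; cases z) (auto simp: P_eq split: if_splits)
            then show "T1.clE (fst z) \<xi> \<le> T1.lv (v n)"
            proof
              assume p: "T1.par (fst z) = fst y"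
              then show ?thesis using T1.target_cl_par[OF tgt, of "fst z"] T1.target_cl_le[OF tgt, of "fst z"] lt by (simp add: min_def split: if_splits)
            next
              assume p: "fst z = T1.par (fst y)"
              then show ?thesis using T1.target_cl_par[OF tgt, of "fst y"] lt by simp
            qed
          qed
          then have "(\<Sum>z\<in>C.nb y. P y z * u z) = (\<Sum>z\<in>C.nb y. P y z * h z)" by (intro sum.cong) auto
          then show False using ne hh(1)[OF y] u_h[OF y] lt by simp
        qed
        then have "\<bar>mk x y - \<kappa> x\<bar> \<le> \<epsilon>" using N[OF n(1)] y by (simp add: S_def)
        moreover have g: "green X P orig y > 0" by (rule C.green_pos[OF transient irreducible orig_X y])
        ultimately have "\<bar>mk x y - \<kappa> x\<bar> * green X P orig y \<le> \<epsilon> * green X P orig y" by (intro mult_right_mono) auto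
        moreover have "\<bar>mk x y - \<kappa> x\<bar> * green X P orig y = \<bar>(mk x y - \<kappa> x) * green X P orig y\<bar>" using g by (simp add: abs_mult)
        moreover have "(mk x y - \<kappa> x) * green X P orig y = green X P x y - \<kappa> x * green X P orig y"
          using g by (simp add: martin_kernel_def left_diff_distrib)
        ultimately show "\<bar>green X P x y - \<kappa> x * green X P orig y\<bar> \<le> \<epsilon> * green X P orig y" by simp
      qed
      have "u x = h x" "u orig = h orig" using u_h x orig_X n by (auto simp: DL_origin_def)
      then show ?thesis using b by simp
    qed
    have "h x = h orig * \<kappa> x" if x: "x \<in> X" for x
    proof -
      have "\<bar>h x - \<kappa> x * h orig\<bar> \<le> 0 + d" if d: "d > 0" for d
      proof -
        have ho: "h orig > 0" using hh(2)[OF orig_X] .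
        then have "\<bar>h x - \<kappa> x * h orig\<bar> \<le> d / h orig * h orig" using est[OF x, of "d / h orig"] d by simp
        then show ?thesis using ho by simp
      qed
      then have "\<bar>h x - \<kappa> x * h orig\<bar> \<le> 0" by (rule field_le_epsilon)
      then show ?thesis by (simp add: mult.commute)
    qed
    then show ?thesis by blast
  qed
  then show ?thesis using boundary_kernel_harmonic[OF boundary] unfolding minimal_harmonic_def boundary_kernel by blast
qed

end

lemma positive_harmonic_cong:
  assumes "\<And>x. x \<in> X \<Longrightarrow> f x = g x" shows "positive_harmonic X P f \<longleftrightarrow> positive_harmonic X P g"
proof -
  have "(\<lambda>y. P x y * f y) summable_on X \<longleftrightarrow> (\<lambda>y. P x y * g y) summable_on X" "infsum (\<lambda>y. P x y * f y) X = infsum (\<lambda>y. P x y * g y) X" for x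
    using assms by (auto intro!: summable_on_cong infsum_cong)
  then show ?thesis using assms unfolding positive_harmonic_def harmonic_def by auto
qed

lemma minimal_harmonic_cong:
  assumes "\<And>x. x \<in> X \<Longrightarrow> f x = g x" "o\<^sub>0 \<in> X" shows "minimal_harmonic X P o\<^sub>0 f \<longleftrightarrow> minimal_harmonic X P o\<^sub>0 g"
  unfolding minimal_harmonic_def using positive_harmonic_cong[of X f g P] assms by simp

context dl
begin

lemma positive_harmonic_swap:
  assumes "positive_harmonic X P h"
  shows "positive_harmonic (DL T2 T1) (DL_walk (1 - \<alpha>) r q T2 T1) (\<lambda>x. h (prod.swap x))"
proof -
  interpret S: dl T2 T1 r q "1 - \<alpha>" by unfold_locales (use \<alpha> in auto)
  have "(\<Sum>z\<in>S.C.nb x. S.P x z * h (prod.swap z)) = h (prod.swap x) \<and> h (prod.swap x) > 0" if x: "x \<in> S.X" for x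
  proof -
    obtain x1 x2 where xx: "x = (x2, x1)" by (cases x)
    have x': "(x1, x2) \<in> X" "(x2, x1) \<in> S.X" using x by (simp_all add: xx X_iff S.X_iff)
    have "(\<Sum>z\<in>C.nb (x1, x2). P (x1, x2) z * h z) = h (x1, x2)" "h (x1, x2) > 0"
      using assms x'(1) by (auto simp: positive_harmonic_def C.harmonic_iff)
    then show ?thesis unfolding xx S.sum_nb[OF x'(2)] sum_nb[OF x'(1)] by simp
  qed
  then show ?thesis by (simp add: positive_harmonic_def S.C.harmonic_iff)
qed

lemma end_minimal2:
  assumes \<xi>: "\<xi> \<in> proper_ends T2"
  shows "minimal_harmonic X P orig (\<lambda>x. boundary_kernel x (Omega Minf, HEnd \<xi>))"
proof -
  interpret S: dl T2 T1 r q "1 - \<alpha>" by unfold_locales (use \<alpha> in auto)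
  have tgt: "T2.is_target (HEnd \<xi>)" using \<xi> by (simp add: T2.is_target_def)
  have boundary: "(Omega Minf, HEnd \<xi>) \<in> boundary" using \<xi> unfolding boundary_eq by blast
  have "\<exists>c. \<forall>x\<in>X. h x = c * boundary_kernel x (Omega Minf, HEnd \<xi>)"
    if h: "positive_harmonic X P h" and le: "\<forall>x\<in>X. h x \<le> boundary_kernel x (Omega Minf, HEnd \<xi>)" for h
  proof -
    have "h (prod.swap x) \<le> S.boundary_kernel x (HEnd \<xi>, Omega Minf)" if "x \<in> S.X" for x
    proof -
      have "prod.swap x \<in> X" using that by (cases x) (simp add: X_iff S.X_iff)
      then have "h (prod.swap x) \<le> boundary_kernel (prod.swap x) (Omega Minf, HEnd \<xi>)" using le by blast
      then show ?thesis unfolding boundary_kernel_simps(2)[OF tgt] S.boundary_kernel_simps(1)[OF tgt] by simp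
    qed
    then obtain c where c: "\<And>x. x \<in> S.X \<Longrightarrow> h (prod.swap x) = c * S.boundary_kernel x (HEnd \<xi>, Omega Minf)"
      using S.end_minimal[OF \<xi>] positive_harmonic_swap[OF h] unfolding minimal_harmonic_def by blast
    have "h x = c * boundary_kernel x (Omega Minf, HEnd \<xi>)" if "x \<in> X" for x
    proof -
      have "prod.swap x \<in> S.X" using that by (cases x) (simp add: X_iff S.X_iff)
      then show ?thesis using c[of "prod.swap x"] unfolding boundary_kernel_simps(2)[OF tgt] S.boundary_kernel_simps(1)[OF tgt] by simp
    qed
    then show ?thesis by blast
  qed
  then show ?thesis using boundary_kernel_harmonic[OF boundary] unfolding minimal_harmonic_def by blast
qed

lemma martin: "martin_compactification TYPE('d) X P orig CC DL_embed"
proof -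
  obtain K where K: "kernel_extension X P orig CC DL_embed K" "\<And>x \<eta>. x \<in> X \<Longrightarrow> \<eta> \<in> boundary \<Longrightarrow> K x \<eta> = boundary_kernel x \<eta>"
    using kernel_exists by blast
  show ?thesis
  proof (rule martin_compactificationI[OF irreducible transient CC_compactification K(1)])
    fix c c' assume c: "c \<in> topspace CC - DL_embed ` X" "c' \<in> topspace CC - DL_embed ` X" and eq: "\<And>x. x \<in> X \<Longrightarrow> K x c = K x c'"
    then have "c \<in> boundary" "c' \<in> boundary" unfolding topspace_CC by blast+
    then show "c = c'" using boundary_kernel_separates[of c c'] eq K(2) by metis
  qed
qed

section \<open>Kernel values as hitting ratios, spherical quotients and limits\<close>

lemma boundary_kernel_end1: assumes "\<xi> \<in> proper_ends T1"
  shows "boundary_kernel (x1, x2) (HEnd \<xi>, Omega k) =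
    (let c = confluent T1 (Vertex x1) (End \<xi>) in hit_prob UNIV (tree_walk \<alpha> q T1) x1 c / hit_prob UNIV (tree_walk \<alpha> q T1) (root T1) c)"
proof -
  interpret R: tree_rw T1 q \<alpha> by unfold_locales (use \<alpha> in auto)
  have "T1.is_target (HEnd \<xi>)" using assms by (simp add: T1.is_target_def)
  then show ?thesis unfolding Let_def R.hit_ratio_end[OF assms] by (simp add: boundary_kernel_simps(1) target_kernel_def end_kernel_def)
qed

lemma boundary_kernel_end2: assumes "\<xi> \<in> proper_ends T2"
  shows "boundary_kernel (x1, x2) (Omega k, HEnd \<xi>) =
    (let c = confluent T2 (Vertex x2) (End \<xi>) in hit_prob UNIV (tree_walk (1 - \<alpha>) r T2) x2 c / hit_prob UNIV (tree_walk (1 - \<alpha>) r T2) (root T2) c)"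
proof -
  interpret S: dl T2 T1 r q "1 - \<alpha>" by unfold_locales (use \<alpha> in auto)
  have "T2.is_target (HEnd \<xi>)" using assms by (simp add: T2.is_target_def)
  then show ?thesis unfolding S.boundary_kernel_end1[OF assms, of x2 x1 k, symmetric] by (simp add: boundary_kernel_simps(2) S.boundary_kernel_simps(1))
qed

lemma boundary_kernel_vertex1: "boundary_kernel (x1, x2) (HVertex y, u) = spherical \<alpha> q T1 x1 y / spherical \<alpha> q T1 (root T1) y"
  by (simp add: boundary_kernel_simps(1) T1.is_target_def target_kernel_def)

lemma boundary_kernel_vertex2: "boundary_kernel (x1, x2) (Omega k, HVertex y) = spherical (1 - \<alpha>) r T2 x2 y / spherical (1 - \<alpha>) r T2 (root T2) y"
proof -
  interpret S: dl T2 T1 r q "1 - \<alpha>" by unfold_locales (use \<alpha> in auto)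
  show ?thesis by (simp add: boundary_kernel_simps(2) T2.is_target_def S.target_kernel_def)
qed

lemma boundary_kernel_omega:
  "boundary_kernel (x1, x2) (Omega (Fin k), Omega l) = (\<beta> powi k + \<beta> powi hor T1 x1) / (\<beta> powi k + 1)"
  "((\<lambda>k. (\<beta> powi k + \<beta> powi hor T1 x1) / (\<beta> powi k + 1)) \<longlongrightarrow> boundary_kernel (x1, x2) (Omega Pinf, Omega l)) at_top"
  "((\<lambda>k. (\<beta> powi k + \<beta> powi hor T1 x1) / (\<beta> powi k + 1)) \<longlongrightarrow> boundary_kernel (x1, x2) (Omega Minf, Omega l)) at_bot"
proof -
  have t: "\<forall>\<^sub>F i in at_top. c \<le> i" and b: "\<forall>\<^sub>F i in at_bot. i \<le> c" for c :: int
    by (rule eventually_ge_at_top, rule eventually_le_at_bot)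
  show "boundary_kernel (x1, x2) (Omega (Fin k), Omega l) = (\<beta> powi k + \<beta> powi hor T1 x1) / (\<beta> powi k + 1)"
    by (simp add: boundary_kernel_simps(3) omega_kernel_def sc_def T1.hor_eq)
  show "((\<lambda>k. (\<beta> powi k + \<beta> powi hor T1 x1) / (\<beta> powi k + 1)) \<longlongrightarrow> boundary_kernel (x1, x2) (Omega Pinf, Omega l)) at_top"
    using omega_kernel_limit_Pinf[of "\<lambda>k. k" at_top x1, OF t] by (simp add: boundary_kernel_simps(3) sc_def T1.hor_eq)
  show "((\<lambda>k. (\<beta> powi k + \<beta> powi hor T1 x1) / (\<beta> powi k + 1)) \<longlongrightarrow> boundary_kernel (x1, x2) (Omega Minf, Omega l)) at_bot"
    using omega_kernel_limit_Minf[of "\<lambda>k. k" at_bot x1, OF b] by (simp add: boundary_kernel_simps(3) sc_def T1.hor_eq)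
qed

lemma boundary_kernel_nonminimal:
  assumes "\<eta> \<in> {(Omega k, Omega (- k)) | k. True} \<union> {(HVertex y1, Omega (Fin (- hor T1 y1))) | y1. True}
     \<union> {(Omega (Fin (- hor T2 y2)), HVertex y2) | y2. True}"
  shows "\<eta> \<in> boundary" "\<not> minimal_harmonic X P orig (\<lambda>x. boundary_kernel x \<eta>)"
proof -
  show "\<eta> \<in> boundary" using assms unfolding boundary_eq by blast
  consider k where "\<eta> = (Omega k, Omega (- k))" | y1 where "\<eta> = (HVertex y1, Omega (Fin (- T1.lv y1)))"
    | y2 where "\<eta> = (Omega (Fin (- T2.lv y2)), HVertex y2)"
    using assms unfolding T1.hor_eq T2.hor_eq by blast
  then show "\<not> minimal_harmonic X P orig (\<lambda>x. boundary_kernel x \<eta>)"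
  proof cases
    case 1
    then show ?thesis using omega_fin_not_minimal omega_inf_not_minimal[of k] by (cases k) auto
  next
    case 2
    then show ?thesis using vertex1_not_minimal by simp
  next
    case 3
    then show ?thesis using vertex2_not_minimal by simp
  qed
qed

end

theorem theorem5p7:
  fixes T1 :: "'a tree" and T2 :: "'b tree" and q r :: nat and \<alpha> \<beta> :: real
  assumes "q \<ge> 2" and "r \<ge> 2"
    and "homogeneous_tree q T1" and "ref_end T1 \<in> ends T1"
    and "homogeneous_tree r T2" and "ref_end T2 \<in> ends T2"
    and "0 < \<alpha>" and "\<alpha> < 1" and "\<alpha> \<noteq> 1/2"
    and "\<beta> = (1 - \<alpha>) / \<alpha>"
  defines "X \<equiv> DL T1 T2"
    and "P \<equiv> DL_walk \<alpha> q r T1 T2"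
    and "P1 \<equiv> tree_walk \<alpha> q T1"
    and "P2 \<equiv> tree_walk (1 - \<alpha>) r T2"
    and "C \<equiv> DL_hor_topology q r T1 T2"
  shows "martin_compactification TYPE('d) X P (DL_origin T1 T2) C DL_embed
    \<and> topspace C - DL_embed ` X =
        {(HEnd \<xi>1, Omega Minf) | \<xi>1. \<xi>1 \<in> proper_ends T1}
        \<union> {(Omega Minf, HEnd \<xi>2) | \<xi>2. \<xi>2 \<in> proper_ends T2}
        \<union> {(Omega k, Omega (- k)) | k. True}
        \<union> {(HVertex y1, Omega (Fin (- hor T1 y1))) | y1. True}
        \<union> {(Omega (Fin (- hor T2 y2)), HVertex y2) | y2. True}
    \<and> (\<exists>K K1 K2.
        kernel_extension X P (DL_origin T1 T2) C DL_embed K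
        \<and> kernel_extension UNIV P1 (root T1) (end_topology q T1) Vertex K1
        \<and> kernel_extension UNIV P2 (root T2) (end_topology r T2) Vertex K2
        \<and> (\<forall>\<xi>1 \<in> ends T1. \<forall>x1. K1 x1 (End \<xi>1) =
              (let c1 = confluent T1 (Vertex x1) (End \<xi>1)
               in hit_prob UNIV P1 x1 c1 / hit_prob UNIV P1 (root T1) c1))
        \<and> (\<forall>\<xi>2 \<in> ends T2. \<forall>x2. K2 x2 (End \<xi>2) =
              (let c2 = confluent T2 (Vertex x2) (End \<xi>2)
               in hit_prob UNIV P2 x2 c2 / hit_prob UNIV P2 (root T2) c2))
        \<and> (\<forall>(x1, x2) \<in> X.
            (\<forall>\<xi>1 \<in> proper_ends T1. K (x1, x2) (HEnd \<xi>1, Omega Minf) = K1 x1 (End \<xi>1))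
            \<and> (\<forall>\<xi>2 \<in> proper_ends T2. K (x1, x2) (Omega Minf, HEnd \<xi>2) = K2 x2 (End \<xi>2))
            \<and> (\<forall>k :: int. K (x1, x2) (Omega (Fin k), Omega (- Fin k)) =
                  (\<beta> powi k + \<beta> powi hor T1 x1) / (\<beta> powi k + 1))
            \<and> ((\<lambda>k :: int. (\<beta> powi k + \<beta> powi hor T1 x1) / (\<beta> powi k + 1))
                  \<longlongrightarrow> K (x1, x2) (Omega Pinf, Omega (- Pinf))) at_top
            \<and> ((\<lambda>k :: int. (\<beta> powi k + \<beta> powi hor T1 x1) / (\<beta> powi k + 1))
                  \<longlongrightarrow> K (x1, x2) (Omega Minf, Omega (- Minf))) at_bot
            \<and> (\<forall>y1. K (x1, x2) (HVertex y1, Omega (Fin (- hor T1 y1))) =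
                  spherical \<alpha> q T1 x1 y1 / spherical \<alpha> q T1 (root T1) y1)
            \<and> (\<forall>y2. K (x1, x2) (Omega (Fin (- hor T2 y2)), HVertex y2) =
                  spherical (1 - \<alpha>) r T2 x2 y2 / spherical (1 - \<alpha>) r T2 (root T2) y2))
        \<and> (\<forall>\<xi>1 \<in> proper_ends T1.
              minimal_harmonic X P (DL_origin T1 T2) (\<lambda>x. K x (HEnd \<xi>1, Omega Minf)))
        \<and> (\<forall>\<xi>2 \<in> proper_ends T2.
              minimal_harmonic X P (DL_origin T1 T2) (\<lambda>x. K x (Omega Minf, HEnd \<xi>2)))
        \<and> (\<forall>\<eta> \<in> {(Omega k, Omega (- k)) | k. True}
                \<union> {(HVertex y1, Omega (Fin (- hor T1 y1))) | y1. True}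
                \<union> {(Omega (Fin (- hor T2 y2)), HVertex y2) | y2. True}.
              positive_harmonic X P (\<lambda>x. K x \<eta>)
              \<and> \<not> minimal_harmonic X P (DL_origin T1 T2) (\<lambda>x. K x \<eta>)))"
proof -
  interpret L: dl T1 T2 q r \<alpha> by unfold_locales (use assms(1-9) in auto)
  interpret R1: tree_rw T1 q \<alpha> by unfold_locales (use L.\<alpha> in auto)
  interpret R2: tree_rw T2 r "1 - \<alpha>" by unfold_locales (use L.\<alpha> in auto)
  have b: "\<beta> = L.\<beta>" using assms(10) by (simp add: L.\<beta>_def)
  obtain K where K: "kernel_extension X P (DL_origin T1 T2) C DL_embed K"
    and KX: "\<And>x \<eta>. x \<in> X \<Longrightarrow> \<eta> \<in> L.boundary \<Longrightarrow> K x \<eta> = L.boundary_kernel x \<eta>"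
    using L.kernel_exists unfolding X_def P_def C_def by blast
  obtain K1 where K1: "kernel_extension UNIV P1 (root T1) (end_topology q T1) Vertex K1"
    "\<And>\<xi> x. \<xi> \<in> ends T1 \<Longrightarrow> K1 x (End \<xi>) = (let c = confluent T1 (Vertex x) (End \<xi>) in hit_prob UNIV P1 x c / hit_prob UNIV P1 (root T1) c)"
    using R1.kernel_extension_tree unfolding P1_def Let_def by blast
  obtain K2 where K2: "kernel_extension UNIV P2 (root T2) (end_topology r T2) Vertex K2"
    "\<And>\<xi> x. \<xi> \<in> ends T2 \<Longrightarrow> K2 x (End \<xi>) = (let c = confluent T2 (Vertex x) (End \<xi>) in hit_prob UNIV P2 x c / hit_prob UNIV P2 (root T2) c)"
    using R2.kernel_extension_tree unfolding P2_def Let_def by blast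
  have o: "DL_origin T1 T2 \<in> X" unfolding X_def by (rule L.orig_X)
  \<comment> \<open>\<open>K x\<close> is known only for \<open>x\<close> in \<open>X\<close>, where
    it agrees with \<open>boundary_kernel x\<close>; minimality does not depend on values
    elsewhere.\<close>
  have min: "minimal_harmonic X P (DL_origin T1 T2) (\<lambda>x. K x \<eta>) \<longleftrightarrow> minimal_harmonic X P (DL_origin T1 T2) (\<lambda>x. L.boundary_kernel x \<eta>)"
    if "\<eta> \<in> L.boundary" for \<eta> by (rule minimal_harmonic_cong[OF KX[OF _ that] o])
  have pos: "positive_harmonic X P (\<lambda>x. K x \<eta>)" if "\<eta> \<in> L.boundary" for \<eta>
    using positive_harmonic_cong[OF KX[OF _ that], where P = P] L.boundary_kernel_harmonic(1)[OF that] unfolding X_def P_def by simp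
  have e1: "(HEnd \<xi>, Omega Minf) \<in> L.boundary" if "\<xi> \<in> proper_ends T1" for \<xi> using that unfolding L.boundary_eq by blast
  have e2: "(Omega Minf, HEnd \<xi>) \<in> L.boundary" if "\<xi> \<in> proper_ends T2" for \<xi> using that unfolding L.boundary_eq by blast
  have top: "topspace C - DL_embed ` X = L.boundary" unfolding C_def X_def L.topspace_CC using L.boundary_disjoint by blast
  have vals: "(\<forall>\<xi>1 \<in> proper_ends T1. K (x1, x2) (HEnd \<xi>1, Omega Minf) = K1 x1 (End \<xi>1))
            \<and> (\<forall>\<xi>2 \<in> proper_ends T2. K (x1, x2) (Omega Minf, HEnd \<xi>2) = K2 x2 (End \<xi>2))
            \<and> (\<forall>k :: int. K (x1, x2) (Omega (Fin k), Omega (- Fin k)) =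
                  (\<beta> powi k + \<beta> powi hor T1 x1) / (\<beta> powi k + 1))
            \<and> ((\<lambda>k :: int. (\<beta> powi k + \<beta> powi hor T1 x1) / (\<beta> powi k + 1))
                  \<longlongrightarrow> K (x1, x2) (Omega Pinf, Omega (- Pinf))) at_top
            \<and> ((\<lambda>k :: int. (\<beta> powi k + \<beta> powi hor T1 x1) / (\<beta> powi k + 1))
                  \<longlongrightarrow> K (x1, x2) (Omega Minf, Omega (- Minf))) at_bot
            \<and> (\<forall>y1. K (x1, x2) (HVertex y1, Omega (Fin (- hor T1 y1))) =
                  spherical \<alpha> q T1 x1 y1 / spherical \<alpha> q T1 (root T1) y1)
            \<and> (\<forall>y2. K (x1, x2) (Omega (Fin (- hor T2 y2)), HVertex y2) =
                  spherical (1 - \<alpha>) r T2 x2 y2 / spherical (1 - \<alpha>) r T2 (root T2) y2)" (is "?V x1 x2") if x: "(x1, x2) \<in> X" for x1 x2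
  proof (intro conjI ballI allI)
    show "K (x1, x2) (HEnd \<xi>, Omega Minf) = K1 x1 (End \<xi>)" if "\<xi> \<in> proper_ends T1" for \<xi>
      unfolding KX[OF x e1[OF that]] L.boundary_kernel_end1[OF that] K1(2)[OF L.T1.proper_end_ends[OF that]] P1_def ..
    show "K (x1, x2) (Omega Minf, HEnd \<xi>) = K2 x2 (End \<xi>)" if "\<xi> \<in> proper_ends T2" for \<xi>
      unfolding KX[OF x e2[OF that]] L.boundary_kernel_end2[OF that] K2(2)[OF L.T2.proper_end_ends[OF that]] P2_def ..
    show "K (x1, x2) (Omega (Fin k), Omega (- Fin k)) = (\<beta> powi k + \<beta> powi hor T1 x1) / (\<beta> powi k + 1)" for k
      unfolding KX[OF x L.boundary_Omega] b by (rule L.boundary_kernel_omega(1))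
    show "((\<lambda>k :: int. (\<beta> powi k + \<beta> powi hor T1 x1) / (\<beta> powi k + 1)) \<longlongrightarrow> K (x1, x2) (Omega Pinf, Omega (- Pinf))) at_top"
      unfolding KX[OF x L.boundary_Omega] b by (rule L.boundary_kernel_omega(2))
    show "((\<lambda>k :: int. (\<beta> powi k + \<beta> powi hor T1 x1) / (\<beta> powi k + 1)) \<longlongrightarrow> K (x1, x2) (Omega Minf, Omega (- Minf))) at_bot"
      unfolding KX[OF x L.boundary_Omega] b by (rule L.boundary_kernel_omega(3))
    show "K (x1, x2) (HVertex y, Omega (Fin (- hor T1 y))) = spherical \<alpha> q T1 x1 y / spherical \<alpha> q T1 (root T1) y" for y
      using KX[OF x L.boundary_HVertex1[of y]] unfolding L.T1.hor_eq L.boundary_kernel_vertex1 .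
    show "K (x1, x2) (Omega (Fin (- hor T2 y)), HVertex y) = spherical (1 - \<alpha>) r T2 x2 y / spherical (1 - \<alpha>) r T2 (root T2) y" for y
      using KX[OF x L.boundary_HVertex2[of y]] unfolding L.T2.hor_eq L.boundary_kernel_vertex2 .
  qed
  show ?thesis
  proof (intro conjI exI[of _ K] exI[of _ K1] exI[of _ K2])
    show "martin_compactification TYPE('d) X P (DL_origin T1 T2) C DL_embed" unfolding X_def P_def C_def by (rule L.martin)
    show "kernel_extension X P (DL_origin T1 T2) C DL_embed K" by (rule K)
    show "kernel_extension UNIV P1 (root T1) (end_topology q T1) Vertex K1" by (rule K1(1))
    show "kernel_extension UNIV P2 (root T2) (end_topology r T2) Vertex K2" by (rule K2(1))
      show "topspace C - DL_embed ` X =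
        {(HEnd \<xi>1, Omega Minf) | \<xi>1. \<xi>1 \<in> proper_ends T1}
        \<union> {(Omega Minf, HEnd \<xi>2) | \<xi>2. \<xi>2 \<in> proper_ends T2}
        \<union> {(Omega k, Omega (- k)) | k. True}
        \<union> {(HVertex y1, Omega (Fin (- hor T1 y1))) | y1. True}
        \<union> {(Omega (Fin (- hor T2 y2)), HVertex y2) | y2. True}"
      unfolding top by (rule L.boundary_eq)
    show "\<forall>\<xi>1 \<in> proper_ends T1. minimal_harmonic X P (DL_origin T1 T2) (\<lambda>x. K x (HEnd \<xi>1, Omega Minf))"
      using min[OF e1] L.end_minimal unfolding X_def P_def by blast
    show "\<forall>\<xi>2 \<in> proper_ends T2. minimal_harmonic X P (DL_origin T1 T2) (\<lambda>x. K x (Omega Minf, HEnd \<xi>2))"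
      using min[OF e2] L.end_minimal2 unfolding X_def P_def by blast
  next
    show "\<forall>\<eta> \<in> {(Omega k, Omega (- k)) | k. True} \<union> {(HVertex y1, Omega (Fin (- hor T1 y1))) | y1. True}
        \<union> {(Omega (Fin (- hor T2 y2)), HVertex y2) | y2. True}.
      positive_harmonic X P (\<lambda>x. K x \<eta>) \<and> \<not> minimal_harmonic X P (DL_origin T1 T2) (\<lambda>x. K x \<eta>)"
    proof
      fix \<eta> assume "\<eta> \<in> {(Omega k, Omega (- k)) | k. True} \<union> {(HVertex y1, Omega (Fin (- hor T1 y1))) | y1. True}
        \<union> {(Omega (Fin (- hor T2 y2)), HVertex y2) | y2. True}"
      note n = L.boundary_kernel_nonminimal[OF this]
      show "positive_harmonic X P (\<lambda>x. K x \<eta>) \<and> \<not> minimal_harmonic X P (DL_origin T1 T2) (\<lambda>x. K x \<eta>)"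
        using pos[OF n(1)] min[OF n(1)] n(2) unfolding X_def P_def by blast
    qed
    show "\<forall>(x1, x2) \<in> X. ?V x1 x2"
    proof
      fix x assume "x \<in> X"
      then show "case x of (x1, x2) \<Rightarrow> ?V x1 x2" using vals by (cases x) simp
    qed
  qed (use K1(2) K2(2) in blast)+
qed

end
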